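(* $\mathrm{IBL}_\infty$-algebras, together with $\mathrm{IBL}_\infty$-morphisms, form a subcategory of the category $\mathrm{MV}_{\Bbbk[[\hbar]]}$ of MV-algebras over $\Bbbk[[\hbar]]$. Here an $\mathrm{IBL}_\infty$-morphism from $(S(U'),\Delta')$ to $(S(U''),\Delta'')$ is a (degree-$0$) $\Bbbk[[\hbar]]$-linear map $f:S(U')[[\hbar]]\to S(U'')[[\hbar]]$ of the form $f=f^{(1)}+\hbar f^{(2)}+\hbar^2f^{(3)}+\cdots$, with each $f^{(k)}:S(U')\to S(U'')$ $\Bbbk$-linear, such that $$f^{(1)}(1)=0,\qquad \Delta''\circ\exp(f)=\exp(f)\circ\Delta',\qquad \bigoplus_{n>k}S^n(U')\subset\ker(f^{(k)})\ \text{ for all } k\ge1.$$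
   Context: $\Bbbk$ is a field of characteristic zero, $\otimes=\otimes_\Bbbk$, Koszul signs are used throughout, and $\hbar$ has degree $0$. Let $R=\Bbbk[[\hbar]]$ with maximal ideal $\mathfrak m=(\hbar)$. For a graded vector space $V$, $V[[\hbar]]=V\widehat\otimes R:=\varprojlim_n V\otimes R/V\otimes\mathfrak m^n$, and $V\widehat\otimes\mathfrak m=\hbar V[[\hbar]]$; convergence is $\mathfrak m$-adic. Maps and their $R$-linear extensions are denoted by the same symbol. An MV-algebra over $R$ is $V=(V,\mu,\delta,\Delta)$ where (i) $(V,\mu)$ is a unital graded commutative associative $\Bbbk$-algebra; (ii) $(V,\delta)$ is a conilpotent counital graded cocommutative coassociative $\Bbbk$-coalgebra; (iii) $\Delta:V\widehat\otimes R\to V\widehat\otimes R$ is a continuous degree $+1$ $R$-linear map with $\Delta^2=0$, $\Delta(1)=0$. The unit $\eta:\Bbbk\to V$ of $\mu$ is required to be a coaugmentation for $(V,\delta)$ and the counit $\epsilon:V\to\Bbbk$ of $\delta$ an augmentation for $(V,\mu)$. Conilpotent means: with $\bar\delta(v)=\delta(v)-v\otimes1-1\otimes v$ for $v\in\ker\epsilon$ and $\bar\delta(1)=0$, for every $v$ the iterates $\bar\delta^{[k]}(v)$ vanish for $k$ large, where $\bar\delta^{[0]}(v)=v$, $\bar\delta^{[k]}=(\bar\delta\otimes \mathrm{id}^{\otimes k-1})\bar\delta^{[k-1]}$. For MV-algebras $V',V''$, $\mathrm{Lin}_R(V',V'')$ denotes the continuous degree-$0$ $R$-linear maps $V'\widehat\otimes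 R\to V''\widehat\otimes R$, a commutative algebra under convolution $f\star g=\mu''(f\otimes g)\delta'$ (extended $R$-linearly) with unit $\mathsf e=\eta''\circ\epsilon'$. $\mathrm{Lin}^0_R(V',V'')$ is the ideal of those $f$ with $\mathrm{Im}(f\circ\eta')\subset V''\widehat\otimes\mathfrak m$. For $f,g\in\mathrm{Lin}_R^0(V',V'')$ the (pointwise $\mathfrak m$-adically convergent) series, with powers with respect to $\star$, $\exp(f)=\mathsf e+f+f^2/2!+\cdots$ and $\log(\mathsf e+g)=g-g^2/2+g^3/3-\cdots$ define mutually inverse bijections between $\mathrm{Lin}_R^0$ and $\mathsf e+\mathrm{Lin}_R^0$. The category $\mathrm{MV}_R$ has MV-algebras over $R$ as objects, morphisms $\mathrm{MV}_R(V',V'')=\{f\in\mathrm{Lin}_R^0(V',V'')\mid \Delta''\circ\exp(f)=\exp(f)\circ\Delta'\}$, composition $f\diamond g=\log(\exp(f)\circ\exp(g))$, and identities $\mathbf 1_V=\log(\mathrm{id}_{V\widehat\otimes R})$. An $\mathrm{IBL}_\infty$-algebra structure on a graded vector space $U$ is a degree $1$ $\Bbbk[[\hbar]]$-linear map $\Delta:S(U)[[\hbar]]\to S(U)[[\hbar]]$, $S(U)=\bigoplus_{n\ge0}S^n(U)$ the graded symmetric algebra, with $\Delta^2=0$, $\Delta(1)=0$, which decomposes as $\Delta=\Delta_1+\hbar\Delta_2+\hbar^2\Delta_3+\cdots$ where $\Delta_k:S(U)\to S(U)$ is a $\Bbbk$-linear differential operator of order $\le k$, i.e. all iterated graded commutators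 $[[\dots[\Delta_k,L_{a_1}],\dots],L_{a_{k+1}}]$ with left multiplication operators $L_a$ vanish. It is regarded as an MV-algebra over $\Bbbk[[\hbar]]$ via the standard bialgebra structure on $S(U)$ (elements of $U$ primitive). *)

theory Defs
  imports
    "HOL-Computational_Algebra.Formal_Power_Series"
    "HOL-Library.Function_Algebras"
    "HOL-Library.FuncSet"
begin

section \<open>Graded vector spaces\<close>

text \<open>
  A graded vector space is an internal direct sum of subspaces \<open>gr V n\<close>, \<open>n \<in> \<int>\<close>, of an ambient
  \<open>\<bbbk>\<close>-vector space carried by a whole type; its underlying space is \<open>carr V\<close>.  Only the scalar
  multiplication is part of the record, addition comes from the type.
\<close>

record ('k, 'v) gvs =
  scl :: "'k \<Rightarrow> 'v \<Rightarrow> 'v"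
  gr :: "int \<Rightarrow> 'v set"

definition carr :: "('k::field, 'v::ab_group_add, 'z) gvs_scheme \<Rightarrow> 'v set" where
  "carr V = module.span (scl V) (\<Union>n. gr V n)"

definition graded_vs :: "('k::field, 'v::ab_group_add, 'z) gvs_scheme \<Rightarrow> bool" where
  "graded_vs V \<longleftrightarrow>
     vector_space (scl V) \<and>
     (\<forall>n. module.subspace (scl V) (gr V n)) \<and>
     (\<forall>N x. finite N \<and> (\<forall>n\<in>N. x n \<in> gr V n) \<and> (\<Sum>n\<in>N. x n) = 0 \<longrightarrow> (\<forall>n\<in>N. x n = 0))"

definition linear_map_on ::
  "('k \<Rightarrow> 'v::ab_group_add \<Rightarrow> 'v) \<Rightarrow> ('k \<Rightarrow> 'w::ab_group_add \<Rightarrow> 'w) \<Rightarrow> 'v set \<Rightarrow> ('v \<Rightarrow> 'w) \<Rightarrow> bool" where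
  "linear_map_on s s' A f \<longleftrightarrow>
     (\<forall>x\<in>A. \<forall>y\<in>A. f (x + y) = f x + f y) \<and> (\<forall>c. \<forall>x\<in>A. f (s c x) = s' c (f x))"

text \<open>The Koszul sign \<open>(-1)\<^bsup>ij\<^esup>\<close> applied to an element.\<close>

definition ksign :: "int \<Rightarrow> int \<Rightarrow> 'a::ab_group_add \<Rightarrow> 'a" where
  "ksign i j x = (if odd i \<and> odd j then - x else x)"

definition homogeneous_list :: "('k::field, 'v::ab_group_add, 'z) gvs_scheme \<Rightarrow> 'v list \<Rightarrow> int list \<Rightarrow> bool" where
  "homogeneous_list V xs ds \<longleftrightarrow> list_all2 (\<lambda>x i. x \<in> gr V i) xs ds"


section \<open>Tensor powers\<close>

text \<open>
  Over a field the canonical map from \<open>V\<^sup>\<otimes>\<^sup>n\<close> to the dual of the space of \<open>n\<close>-linear forms is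
  injective.  So \<open>v\<^sub>1 \<otimes> \<dots> \<otimes> v\<^sub>n\<close> is realised as evaluation of multilinear forms at \<open>[v\<^sub>1, \<dots>, v\<^sub>n]\<close>, and
  tensor powers are spans of such evaluations; all of them live in one type.  A multilinear
  form here is a function on lists whose restriction to the lists of each length is multilinear.
  Forms on the ambient space serve for all its subspaces, because forms on a subspace extend.
  The lemmas \<open>multilinear_tens\<close> and \<open>tensor_universal\<close> below give the universal property.
\<close>

type_synonym ('k, 'v) tensor = "('v list \<Rightarrow> 'k) \<Rightarrow> 'k"

definition dscl :: "'k::field \<Rightarrow> ('a \<Rightarrow> 'k) \<Rightarrow> ('a \<Rightarrow> 'k)" where
  "dscl c t = (\<lambda>a. c * t a)"

definition multilinear_form :: "('k::field \<Rightarrow> 'v::ab_group_add \<Rightarrow> 'v) \<Rightarrow> ('v list \<Rightarrow> 'k) \<Rightarrow> bool" where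
  "multilinear_form s \<phi> \<longleftrightarrow> (\<forall>xs ys. Vector_Spaces.linear s (*) (\<lambda>x. \<phi> (xs @ x # ys)))"

definition tens :: "('k::field \<Rightarrow> 'v::ab_group_add \<Rightarrow> 'v) \<Rightarrow> 'v list \<Rightarrow> ('k, 'v) tensor" where
  "tens s xs = (\<lambda>\<phi>. if multilinear_form s \<phi> then \<phi> xs else 0)"

text \<open>Concatenation product \<open>V\<^sup>\<otimes>\<^sup>m \<times> V\<^sup>\<otimes>\<^sup>n \<rightarrow> V\<^sup>\<otimes>\<^sup>m\<^sup>+\<^sup>n\<close>; see \<open>tens_app_tens\<close>.\<close>

definition tens_app ::
  "('k::field \<Rightarrow> 'v::ab_group_add \<Rightarrow> 'v) \<Rightarrow> ('k, 'v) tensor \<Rightarrow> ('k, 'v) tensor \<Rightarrow> ('k, 'v) tensor" where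
  "tens_app s a b = (\<lambda>\<phi>. if multilinear_form s \<phi> then a (\<lambda>xs. b (\<lambda>ys. \<phi> (xs @ ys))) else 0)"

text \<open>
  The linear map \<open>V\<^sup>\<otimes>\<^sup>n \<rightarrow> X\<close> induced by an \<open>n\<close>-linear map \<open>b\<close> on the subspace \<open>A\<close> underlying \<open>V\<close>.
  Its values on \<open>V\<^sup>\<otimes>\<^sup>n\<close> are uniquely determined.
\<close>

definition tens_lift ::
  "('k::field \<Rightarrow> 'v::ab_group_add \<Rightarrow> 'v) \<Rightarrow> ('k \<Rightarrow> 'x::ab_group_add \<Rightarrow> 'x) \<Rightarrow> 'v set \<Rightarrow> nat \<Rightarrow>
     ('v list \<Rightarrow> 'x) \<Rightarrow> ('k, 'v) tensor \<Rightarrow> 'x" where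
  "tens_lift s s' A n b =
     (SOME L. Vector_Spaces.linear dscl s' L \<and> (\<forall>xs\<in>lists A. length xs = n \<longrightarrow> L (tens s xs) = b xs))"

definition tens_pow :: "('k::field, 'v::ab_group_add, 'z) gvs_scheme \<Rightarrow> nat \<Rightarrow> ('k, 'v) tensor set" where
  "tens_pow V n = module.span dscl {tens (scl V) xs | xs. xs \<in> lists (carr V) \<and> length xs = n}"

definition tens2_gr :: "('k::field, 'v::ab_group_add, 'z) gvs_scheme \<Rightarrow> int \<Rightarrow> ('k, 'v) tensor set" where
  "tens2_gr V n = module.span dscl {tens (scl V) [x, y] | x y i j. x \<in> gr V i \<and> y \<in> gr V j \<and> i + j = n}"

text \<open>The symmetry \<open>x \<otimes> y \<mapsto> (-1)\<^bsup>|x||y|\<^esup> y \<otimes> x\<close> of \<open>V \<otimes> V\<close>.\<close>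

definition tens_swap :: "('k::field, 'v::ab_group_add, 'z) gvs_scheme \<Rightarrow> ('k, 'v) tensor \<Rightarrow> ('k, 'v) tensor" where
  "tens_swap V =
     (SOME L. Vector_Spaces.linear dscl dscl L \<and>
        (\<forall>i j. \<forall>x\<in>gr V i. \<forall>y\<in>gr V j. L (tens (scl V) [x, y]) = ksign i j (tens (scl V) [y, x])))"


section \<open>Power series with coefficients in a vector space\<close>

text \<open>
  \<open>V \<otimes> R/\<mm>\<^sup>n\<close> with \<open>R = \<bbbk>[[\<hbar>]]\<close> consists of the truncated power series with coefficients in \<open>V\<close>, so
  the completed tensor product \<open>V[[\<hbar>]]\<close> of \<open>V\<close> with \<open>R\<close> is the set \<open>ser (carr V)\<close>.  The metric topology of the type of formal power series
  is the \<open>\<mm>\<close>-adic one.  Since \<open>\<hbar>\<close> has degree \<open>0\<close>, the degree \<open>n\<close> part of \<open>V[[\<hbar>]]\<close> is \<open>ser (gr V n)\<close>.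
\<close>

definition ser :: "'v::zero set \<Rightarrow> 'v fps set" where
  "ser A = {v. \<forall>n. fps_nth v n \<in> A}"

definition R_act :: "('k::field \<Rightarrow> 'v::ab_group_add \<Rightarrow> 'v) \<Rightarrow> 'k fps \<Rightarrow> 'v fps \<Rightarrow> 'v fps" where
  "R_act s a v = Abs_fps (\<lambda>n. \<Sum>i\<le>n. s (fps_nth a i) (fps_nth v (n - i)))"

definition k_act :: "('k::field \<Rightarrow> 'v::ab_group_add \<Rightarrow> 'v) \<Rightarrow> 'k \<Rightarrow> 'v fps \<Rightarrow> 'v fps" where
  "k_act s c = R_act s (fps_const c)"

text \<open>\<open>R\<close>-bilinear extension of a bilinear operation and continuous \<open>R\<close>-linear extension of a
  \<open>\<bbbk>\<close>-linear map \<open>A \<rightarrow> W[[\<hbar>]]\<close>.\<close>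

definition ser_mult :: "('v::ab_group_add \<Rightarrow> 'v \<Rightarrow> 'v) \<Rightarrow> 'v fps \<Rightarrow> 'v fps \<Rightarrow> 'v fps" where
  "ser_mult m v w = Abs_fps (\<lambda>n. \<Sum>i\<le>n. m (fps_nth v i) (fps_nth w (n - i)))"

definition ser_ext :: "'v::ab_group_add set \<Rightarrow> ('v \<Rightarrow> 'w::ab_group_add fps) \<Rightarrow> 'v fps \<Rightarrow> 'w fps" where
  "ser_ext A \<phi> = (\<lambda>v\<in>ser A. Abs_fps (\<lambda>n. \<Sum>i\<le>n. fps_nth (\<phi> (fps_nth v i)) (n - i)))"

definition R_linear ::
  "('k::field, 'v::ab_group_add, 'y) gvs_scheme \<Rightarrow> ('k, 'w::ab_group_add, 'z) gvs_scheme \<Rightarrow>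
     ('v fps \<Rightarrow> 'w fps) \<Rightarrow> bool" where
  "R_linear V W F \<longleftrightarrow>
     F \<in> ser (carr V) \<rightarrow>\<^sub>E ser (carr W) \<and>
     (\<forall>v\<in>ser (carr V). \<forall>w\<in>ser (carr V). F (v + w) = F v + F w) \<and>
     (\<forall>a. \<forall>v\<in>ser (carr V). F (R_act (scl V) a v) = R_act (scl W) a (F v))"

definition has_degree ::
  "('k::field, 'v::ab_group_add, 'y) gvs_scheme \<Rightarrow> ('k, 'w::ab_group_add, 'z) gvs_scheme \<Rightarrow>
     int \<Rightarrow> ('v fps \<Rightarrow> 'w fps) \<Rightarrow> bool" where
  "has_degree V W d F \<longleftrightarrow> (\<forall>n. F ` ser (gr V n) \<subseteq> ser (gr W (n + d)))"

text \<open>\<open>F = c\<^sub>1 + \<hbar> c\<^sub>2 + \<hbar>\<^sup>2 c\<^sub>3 + \<dots>\<close> with \<open>\<bbbk>\<close>-linear maps \<open>c\<^sub>k\<close> between \<open>V\<close> and \<open>W\<close>; \<open>c 0\<close> is not used.\<close>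

definition hbar_expansion ::
  "('k::field, 'v::ab_group_add, 'y) gvs_scheme \<Rightarrow> ('k, 'w::ab_group_add, 'z) gvs_scheme \<Rightarrow>
     ('v fps \<Rightarrow> 'w fps) \<Rightarrow> (nat \<Rightarrow> 'v \<Rightarrow> 'w) \<Rightarrow> bool" where
  "hbar_expansion V W F c \<longleftrightarrow>
     (\<forall>k\<ge>1. c k \<in> carr V \<rightarrow> carr W \<and> linear_map_on (scl V) (scl W) (carr V) (c k)) \<and>
     (\<forall>v\<in>ser (carr V). \<forall>n. fps_nth (F v) n = (\<Sum>i\<le>n. c (Suc i) (fps_nth v (n - i))))"


section \<open>MV-algebras over \<open>\<bbbk>[[\<hbar>]]\<close>\<close>

record ('k, 'v) mv = "('k, 'v) gvs" +
  mult :: "'v \<Rightarrow> 'v \<Rightarrow> 'v"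
  unit :: 'v
  coprod :: "'v \<Rightarrow> ('k, 'v) tensor"
  counit :: "'v \<Rightarrow> 'k"
  BV :: "'v fps \<Rightarrow> 'v fps"

definition graded_comm_algebra :: "('k::field, 'v::ab_group_add, 'z) mv_scheme \<Rightarrow> bool" where
  "graded_comm_algebra V \<longleftrightarrow>
     graded_vs V \<and>
     (\<forall>x\<in>carr V. linear_map_on (scl V) (scl V) (carr V) (\<lambda>y. mult V x y)) \<and>
     (\<forall>y\<in>carr V. linear_map_on (scl V) (scl V) (carr V) (\<lambda>x. mult V x y)) \<and>
     (\<forall>i j. \<forall>x\<in>gr V i. \<forall>y\<in>gr V j. mult V x y \<in> gr V (i + j) \<and> mult V x y = ksign i j (mult V y x)) \<and>
     (\<forall>x\<in>carr V. \<forall>y\<in>carr V. \<forall>z\<in>carr V. mult V (mult V x y) z = mult V x (mult V y z)) \<and>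
     unit V \<in> gr V 0 \<and>
     (\<forall>x\<in>carr V. mult V (unit V) x = x \<and> mult V x (unit V) = x)"

definition graded_cocomm_coalgebra :: "('k::field, 'v::ab_group_add, 'z) mv_scheme \<Rightarrow> bool" where
  "graded_cocomm_coalgebra V \<longleftrightarrow>
     graded_vs V \<and>
     coprod V \<in> carr V \<rightarrow> tens_pow V 2 \<and>
     linear_map_on (scl V) dscl (carr V) (coprod V) \<and>
     (\<forall>n. coprod V ` gr V n \<subseteq> tens2_gr V n) \<and>
     linear_map_on (scl V) (*) (carr V) (counit V) \<and>
     (\<forall>n. n \<noteq> 0 \<longrightarrow> (\<forall>x\<in>gr V n. counit V x = 0)) \<and>
     \<comment> \<open>coassociativity: \<open>(\<delta> \<otimes> id) \<circ> \<delta> = (id \<otimes> \<delta>) \<circ> \<delta>\<close>\<close>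
     (\<forall>v\<in>carr V.
        tens_lift (scl V) dscl (carr V) 2
          (\<lambda>xs. tens_app (scl V) (coprod V (xs ! 0)) (tens (scl V) [xs ! 1])) (coprod V v) =
        tens_lift (scl V) dscl (carr V) 2
          (\<lambda>xs. tens_app (scl V) (tens (scl V) [xs ! 0]) (coprod V (xs ! 1))) (coprod V v)) \<and>
     \<comment> \<open>counit: \<open>(\<epsilon> \<otimes> id) \<circ> \<delta> = id = (id \<otimes> \<epsilon>) \<circ> \<delta>\<close>\<close>
     (\<forall>v\<in>carr V.
        tens_lift (scl V) (scl V) (carr V) 2 (\<lambda>xs. scl V (counit V (xs ! 0)) (xs ! 1)) (coprod V v) = v \<and>
        tens_lift (scl V) (scl V) (carr V) 2 (\<lambda>xs. scl V (counit V (xs ! 1)) (xs ! 0)) (coprod V v) = v) \<and>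
     (\<forall>v\<in>carr V. tens_swap V (coprod V v) = coprod V v)"

text \<open>The reduced coproduct is \<open>\<delta>(v) - v \<otimes> 1 - 1 \<otimes> v\<close> on \<open>ker \<epsilon>\<close> and kills \<open>1\<close>, so in general the component of \<open>v\<close> in
  \<open>ker \<epsilon>\<close> along \<open>V = ker \<epsilon> \<oplus> \<bbbk>1\<close> has to be taken first.\<close>

definition red_coprod :: "('k::field, 'v::ab_group_add, 'z) mv_scheme \<Rightarrow> 'v \<Rightarrow> ('k, 'v) tensor" where
  "red_coprod V v =
     (let u = v - scl V (counit V v) (unit V)
      in coprod V u - tens (scl V) [u, unit V] - tens (scl V) [unit V, u])"

primrec red_coprod_iter :: "('k::field, 'v::ab_group_add, 'z) mv_scheme \<Rightarrow> nat \<Rightarrow> 'v \<Rightarrow> ('k, 'v) tensor" where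
  "red_coprod_iter V 0 v = tens (scl V) [v]"
| "red_coprod_iter V (Suc k) v =
     tens_lift (scl V) dscl (carr V) (Suc k)
       (\<lambda>xs. tens_app (scl V) (red_coprod V (hd xs)) (tens (scl V) (tl xs)))
       (red_coprod_iter V k v)"

definition conilpotent :: "('k::field, 'v::ab_group_add, 'z) mv_scheme \<Rightarrow> bool" where
  "conilpotent V \<longleftrightarrow> (\<forall>v\<in>carr V. \<exists>K. \<forall>k\<ge>K. red_coprod_iter V k v = 0)"

definition mv_algebra :: "('k::field_char_0, 'v::ab_group_add) mv \<Rightarrow> bool" where
  "mv_algebra V \<longleftrightarrow>
     graded_comm_algebra V \<and>
     graded_cocomm_coalgebra V \<and>
     \<comment> \<open>the unit is a coaugmentation and the counit is an augmentation\<close>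
     coprod V (unit V) = tens (scl V) [unit V, unit V] \<and>
     counit V (unit V) = 1 \<and>
     (\<forall>x\<in>carr V. \<forall>y\<in>carr V. counit V (mult V x y) = counit V x * counit V y) \<and>
     conilpotent V \<and>
     R_linear V V (BV V) \<and>
     continuous_on (ser (carr V)) (BV V) \<and>
     has_degree V V 1 (BV V) \<and>
     (\<forall>v\<in>ser (carr V). BV V (BV V v) = 0) \<and>
     BV V (fps_const (unit V)) = 0"


section \<open>Convolution, exponential and logarithm\<close>

definition Lin_R :: "('k::field, 'v::ab_group_add) mv \<Rightarrow> ('k, 'w::ab_group_add) mv \<Rightarrow> ('v fps \<Rightarrow> 'w fps) set" where
  "Lin_R V W = {f. R_linear V W f \<and> continuous_on (ser (carr V)) f \<and> has_degree V W 0 f}"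

text \<open>As \<open>f \<circ> \<eta>\<close> is \<open>R\<close>-linear, its image lies in \<open>\<hbar>W[[\<hbar>]]\<close> iff \<open>f(1)\<close> does.\<close>

definition Lin0_R :: "('k::field, 'v::ab_group_add) mv \<Rightarrow> ('k, 'w::ab_group_add) mv \<Rightarrow> ('v fps \<Rightarrow> 'w fps) set" where
  "Lin0_R V W = {f \<in> Lin_R V W. fps_nth (f (fps_const (unit V))) 0 = 0}"

text \<open>\<open>f \<star> g = \<mu> \<circ> (f \<otimes> g) \<circ> \<delta>\<close>; there are no signs because \<open>f\<close> and \<open>g\<close> have degree \<open>0\<close>.\<close>

definition conv ::
  "('k::field, 'v::ab_group_add) mv \<Rightarrow> ('k, 'w::ab_group_add) mv \<Rightarrow>
     ('v fps \<Rightarrow> 'w fps) \<Rightarrow> ('v fps \<Rightarrow> 'w fps) \<Rightarrow> ('v fps \<Rightarrow> 'w fps)" where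
  "conv V W f g =
     ser_ext (carr V) (\<lambda>v.
       tens_lift (scl V) (k_act (scl W)) (carr V) 2
         (\<lambda>xs. ser_mult (mult W) (f (fps_const (xs ! 0))) (g (fps_const (xs ! 1))))
         (coprod V v))"

definition conv_unit :: "('k::field, 'v::ab_group_add) mv \<Rightarrow> ('k, 'w::ab_group_add) mv \<Rightarrow> 'v fps \<Rightarrow> 'w fps" where
  "conv_unit V W = ser_ext (carr V) (\<lambda>v. fps_const (scl W (counit V v) (unit W)))"

primrec conv_pow ::
  "('k::field, 'v::ab_group_add) mv \<Rightarrow> ('k, 'w::ab_group_add) mv \<Rightarrow> ('v fps \<Rightarrow> 'w fps) \<Rightarrow> nat \<Rightarrow> ('v fps \<Rightarrow> 'w fps)" where
  "conv_pow V W f 0 = conv_unit V W"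
| "conv_pow V W f (Suc n) = conv V W f (conv_pow V W f n)"

definition mv_exp ::
  "('k::field_char_0, 'v::ab_group_add) mv \<Rightarrow> ('k, 'w::ab_group_add) mv \<Rightarrow> ('v fps \<Rightarrow> 'w fps) \<Rightarrow> ('v fps \<Rightarrow> 'w fps)" where
  "mv_exp V W f = (\<lambda>v\<in>ser (carr V). \<Sum>n. k_act (scl W) (1 / fact n) (conv_pow V W f n v))"

text \<open>\<open>mv_log V W h\<close> is \<open>log(e + g)\<close> for \<open>g = h - e\<close>.\<close>

definition mv_log ::
  "('k::field_char_0, 'v::ab_group_add) mv \<Rightarrow> ('k, 'w::ab_group_add) mv \<Rightarrow> ('v fps \<Rightarrow> 'w fps) \<Rightarrow> ('v fps \<Rightarrow> 'w fps)" where
  "mv_log V W h =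
     (let g = (\<lambda>v\<in>ser (carr V). h v - conv_unit V W v)
      in (\<lambda>v\<in>ser (carr V). \<Sum>n. k_act (scl W) ((- 1) ^ n / of_nat (Suc n)) (conv_pow V W g (Suc n) v)))"


section \<open>Categories\<close>

record ('o, 'm) category =
  Obj :: "'o set"
  Hom :: "'o \<Rightarrow> 'o \<Rightarrow> 'm set"
  Idn :: "'o \<Rightarrow> 'm"
  Cmp :: "'o \<Rightarrow> 'o \<Rightarrow> 'o \<Rightarrow> 'm \<Rightarrow> 'm \<Rightarrow> 'm" \<comment> \<open>\<open>Cmp X Y Z f g\<close> is \<open>f \<circ> g : X \<rightarrow> Y \<rightarrow> Z\<close>\<close>

definition is_category :: "('o, 'm) category \<Rightarrow> bool" where
  "is_category C \<longleftrightarrow>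
     (\<forall>X\<in>Obj C. Idn C X \<in> Hom C X X) \<and>
     (\<forall>X\<in>Obj C. \<forall>Y\<in>Obj C. \<forall>Z\<in>Obj C. \<forall>g\<in>Hom C X Y. \<forall>f\<in>Hom C Y Z. Cmp C X Y Z f g \<in> Hom C X Z) \<and>
     (\<forall>X\<in>Obj C. \<forall>Y\<in>Obj C. \<forall>f\<in>Hom C X Y. Cmp C X Y Y (Idn C Y) f = f \<and> Cmp C X X Y f (Idn C X) = f) \<and>
     (\<forall>W\<in>Obj C. \<forall>X\<in>Obj C. \<forall>Y\<in>Obj C. \<forall>Z\<in>Obj C. \<forall>h\<in>Hom C W X. \<forall>g\<in>Hom C X Y. \<forall>f\<in>Hom C Y Z.
        Cmp C W X Z (Cmp C X Y Z f g) h = Cmp C W Y Z f (Cmp C W X Y g h))"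

definition subcategory :: "('o, 'm) category \<Rightarrow> ('o, 'm) category \<Rightarrow> bool" where
  "subcategory S C \<longleftrightarrow>
     is_category C \<and>
     Obj S \<subseteq> Obj C \<and>
     (\<forall>X\<in>Obj S. \<forall>Y\<in>Obj S. Hom S X Y \<subseteq> Hom C X Y) \<and>
     (\<forall>X\<in>Obj S. Idn S X = Idn C X \<and> Idn S X \<in> Hom S X X) \<and>
     (\<forall>X\<in>Obj S. \<forall>Y\<in>Obj S. \<forall>Z\<in>Obj S. \<forall>g\<in>Hom S X Y. \<forall>f\<in>Hom S Y Z.
        Cmp S X Y Z f g = Cmp C X Y Z f g \<and> Cmp S X Y Z f g \<in> Hom S X Z)"

definition MV_mor :: "('k::field_char_0, 'v::ab_group_add) mv \<Rightarrow> ('k, 'v) mv \<Rightarrow> ('v fps \<Rightarrow> 'v fps) set" where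
  "MV_mor V W =
     {f \<in> Lin0_R V W. \<forall>v\<in>ser (carr V). BV W (mv_exp V W f v) = mv_exp V W f (BV V v)}"

definition MV_id :: "('k::field_char_0, 'v::ab_group_add) mv \<Rightarrow> 'v fps \<Rightarrow> 'v fps" where
  "MV_id V = mv_log V V (\<lambda>v\<in>ser (carr V). v)"

definition MV_comp ::
  "('k::field_char_0, 'v::ab_group_add) mv \<Rightarrow> ('k, 'v) mv \<Rightarrow> ('k, 'v) mv \<Rightarrow>
     ('v fps \<Rightarrow> 'v fps) \<Rightarrow> ('v fps \<Rightarrow> 'v fps) \<Rightarrow> 'v fps \<Rightarrow> 'v fps" where
  "MV_comp X Y Z f g = mv_log X Z (compose (ser (carr X)) (mv_exp Y Z f) (mv_exp X Y g))"

text \<open>The MV-algebras whose underlying spaces lie in the type \<open>'v\<close>.\<close>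

definition MV_cat :: "(('k::field_char_0, 'v::ab_group_add) mv, 'v fps \<Rightarrow> 'v fps) category" where
  "MV_cat = \<lparr>Obj = {V. mv_algebra V}, Hom = MV_mor, Idn = MV_id, Cmp = MV_comp\<rparr>"


section \<open>The graded symmetric bialgebra\<close>

text \<open>
  \<open>S(U)\<close> is the quotient of the tensor algebra by the relations \<open>x \<otimes> y = (-1)\<^bsup>|x||y|\<^esup> y \<otimes> x\<close>.  As for
  tensor powers, it is realised inside the dual of the space of forms compatible with these
  relations: \<open>mon U [u\<^sub>1, \<dots>, u\<^sub>n]\<close>, the monomial \<open>u\<^sub>1\<cdots>u\<^sub>n\<close>, is evaluation at \<open>[u\<^sub>1, \<dots>, u\<^sub>n]\<close>.  See the
  lemmas \<open>mon_swap\<close>, \<open>sym_universal\<close> and \<open>sym_mult_mon\<close> below.  Although \<open>xs\<close> and \<open>ys\<close> in \<open>gsym_form\<close> range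
  over the ambient space, every graded symmetric form on \<open>U\<close> is the restriction of such a form
  (compose with a projection onto \<open>U\<close>).
\<close>

definition gsym_form :: "('k::field, 'u::ab_group_add) gvs \<Rightarrow> ('u list \<Rightarrow> 'k) \<Rightarrow> bool" where
  "gsym_form U \<phi> \<longleftrightarrow>
     multilinear_form (scl U) \<phi> \<and>
     (\<forall>xs ys i j. \<forall>x\<in>gr U i. \<forall>y\<in>gr U j. \<phi> (xs @ x # y # ys) = ksign i j (\<phi> (xs @ y # x # ys)))"

definition mon :: "('k::field, 'u::ab_group_add) gvs \<Rightarrow> 'u list \<Rightarrow> ('k, 'u) tensor" where
  "mon U xs = (\<lambda>\<phi>. if gsym_form U \<phi> then \<phi> xs else 0)"

definition sym_pow :: "('k::field, 'u::ab_group_add) gvs \<Rightarrow> nat \<Rightarrow> ('k, 'u) tensor set" where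
  "sym_pow U n = module.span dscl {mon U xs | xs. xs \<in> lists (carr U) \<and> length xs = n}"

definition sym_gr :: "('k::field, 'u::ab_group_add) gvs \<Rightarrow> int \<Rightarrow> ('k, 'u) tensor set" where
  "sym_gr U n = module.span dscl {mon U xs | xs ds. homogeneous_list U xs ds \<and> sum_list ds = n}"

definition sym_mult :: "('k::field, 'u::ab_group_add) gvs \<Rightarrow> ('k, 'u) tensor \<Rightarrow> ('k, 'u) tensor \<Rightarrow> ('k, 'u) tensor" where
  "sym_mult U s t = (\<lambda>\<phi>. if gsym_form U \<phi> then s (\<lambda>xs. t (\<lambda>ys. \<phi> (xs @ ys))) else 0)"

text \<open>The Koszul sign of the unshuffle moving the positions in \<open>I\<close> to the front.\<close>

definition unshuffle_sign :: "int list \<Rightarrow> nat set \<Rightarrow> 'a::ab_group_add \<Rightarrow> 'a" where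
  "unshuffle_sign ds I x =
     (if odd (card {(i, j). i < j \<and> j < length ds \<and> i \<notin> I \<and> j \<in> I \<and> odd (ds ! i) \<and> odd (ds ! j)}) then - x else x)"

text \<open>The unshuffle coproduct
  \<open>\<delta>(u\<^sub>1\<cdots>u\<^sub>n) = \<Sum>\<^bsub>I\<^esub> \<plusminus> u\<^sub>I \<otimes> u\<^bsub>- I\<^esub>\<close>, that is, the morphism of graded algebras with \<open>\<delta>(u) = u \<otimes> 1 + 1 \<otimes> u\<close>.\<close>

definition sym_coprod :: "('k::field, 'u::ab_group_add) gvs \<Rightarrow> ('k, 'u) tensor \<Rightarrow> ('k, ('k, 'u) tensor) tensor" where
  "sym_coprod U =
     (SOME L. Vector_Spaces.linear dscl dscl L \<and>
        (\<forall>xs ds. homogeneous_list U xs ds \<longrightarrow>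
           L (mon U xs) =
             (\<Sum>I\<in>Pow {..<length xs}. unshuffle_sign ds I (tens dscl [mon U (nths xs I), mon U (nths xs (- I))]))))"

text \<open>The counit is the coefficient of \<open>1\<close>, which is evaluation at the form vanishing on nonempty lists.\<close>

definition sym_mv :: "('k::field, 'u::ab_group_add) gvs \<Rightarrow> (('k, 'u) tensor fps \<Rightarrow> ('k, 'u) tensor fps) \<Rightarrow> ('k, ('k, 'u) tensor) mv" where
  "sym_mv U D =
     \<lparr>scl = dscl, gr = sym_gr U, mult = sym_mult U, unit = mon U [],
      coprod = sym_coprod U, counit = (\<lambda>s. s (\<lambda>xs. if xs = [] then 1 else 0)), BV = D\<rparr>"


section \<open>\<open>IBL\<^sub>\<infinity>\<close>-algebras and their morphisms\<close>

text \<open>\<open>[[\<dots>[D, L\<^bsub>a\<^sub>1\<^esub>],\<dots>], L\<^bsub>a\<^sub>n\<^esub>]\<close> for a map \<open>D\<close> of degree \<open>d\<close> and a list of elements \<open>a\<^sub>i\<close> paired with their degrees.\<close>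

primrec iter_commutator ::
  "('v::ab_group_add \<Rightarrow> 'v \<Rightarrow> 'v) \<Rightarrow> int \<Rightarrow> ('v \<Rightarrow> 'v) \<Rightarrow> ('v \<times> int) list \<Rightarrow> 'v \<Rightarrow> 'v" where
  "iter_commutator m d D [] = D"
| "iter_commutator m d D (p # ps) =
     iter_commutator m (d + snd p) (\<lambda>v. D (m (fst p) v) - ksign d (snd p) (m (fst p) (D v))) ps"

definition diff_operator :: "('k::field, 'v::ab_group_add, 'z) mv_scheme \<Rightarrow> int \<Rightarrow> nat \<Rightarrow> ('v \<Rightarrow> 'v) \<Rightarrow> bool" where
  "diff_operator A d k D \<longleftrightarrow>
     D \<in> carr A \<rightarrow> carr A \<and>
     linear_map_on (scl A) (scl A) (carr A) D \<and>
     (\<forall>n. D ` gr A n \<subseteq> gr A (n + d)) \<and>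
     (\<forall>ps. length ps = Suc k \<and> (\<forall>(a, i)\<in>set ps. a \<in> gr A i) \<longrightarrow>
        (\<forall>v\<in>carr A. iter_commutator (mult A) d D ps v = 0))"

definition IBL_algebra ::
  "('k::field_char_0, 'u::ab_group_add) gvs \<Rightarrow> (('k, 'u) tensor fps \<Rightarrow> ('k, 'u) tensor fps) \<Rightarrow> bool" where
  "IBL_algebra U D \<longleftrightarrow>
     graded_vs U \<and>
     (let S = sym_mv U D in
       R_linear S S D \<and>
       has_degree S S 1 D \<and>
       (\<forall>v\<in>ser (carr S). D (D v) = 0) \<and>
       D (fps_const (unit S)) = 0 \<and>
       (\<exists>Dk. hbar_expansion S S D Dk \<and> (\<forall>k\<ge>1. diff_operator S 1 k (Dk k))))"

definition IBL_mor ::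
  "('k::field_char_0, 'u::ab_group_add) gvs \<Rightarrow> (('k, 'u) tensor fps \<Rightarrow> ('k, 'u) tensor fps) \<Rightarrow>
   ('k, 'w::ab_group_add) gvs \<Rightarrow> (('k, 'w) tensor fps \<Rightarrow> ('k, 'w) tensor fps) \<Rightarrow>
   (('k, 'u) tensor fps \<Rightarrow> ('k, 'w) tensor fps) set" where
  "IBL_mor U' D' U'' D'' =
     (let S' = sym_mv U' D'; S'' = sym_mv U'' D'' in
      {f. R_linear S' S'' f \<and> has_degree S' S'' 0 f \<and>
          (\<exists>fk. hbar_expansion S' S'' f fk \<and>
             fk 1 (unit S') = 0 \<and>
             (\<forall>v\<in>ser (carr S'). D'' (mv_exp S' S'' f v) = mv_exp S' S'' f (D' v)) \<and>
             (\<forall>k\<ge>1. module.span dscl (\<Union>n\<in>{k<..}. sym_pow U' n) \<subseteq> {s. fk k s = 0}))})"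

text \<open>The \<open>IBL\<^sub>\<infinity>\<close>-algebras on graded subspaces of the type \<open>'u\<close>, regarded as MV-algebras.
  The existential quantifiers only unpack an object into \<open>U\<close> and the operator, which are determined by
  \<open>sym_mv U D\<close>: the form-space of \<open>U\<close> can be read off from the unit, and \<open>U\<close> from the elements \<open>mon U [u]\<close>.\<close>

definition IBL_cat ::
  "(('k::field_char_0, ('k, 'u::ab_group_add) tensor) mv, ('k, 'u) tensor fps \<Rightarrow> ('k, 'u) tensor fps) category" where
  "IBL_cat =
     \<lparr>Obj = {sym_mv U D | U D. IBL_algebra U D},
      Hom = (\<lambda>X Y. {f. \<exists>U' D' U'' D''. IBL_algebra U' D' \<and> IBL_algebra U'' D'' \<and>
                       X = sym_mv U' D' \<and> Y = sym_mv U'' D'' \<and> f \<in> IBL_mor U' D' U'' D''}),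
      Idn = MV_id,
      Cmp = MV_comp\<rparr>"


section \<open>Universal properties\<close>

lemma vector_space_dscl: "vector_space (dscl :: 'k::field \<Rightarrow> ('a \<Rightarrow> 'k) \<Rightarrow> _)"
  by unfold_locales (auto simp: dscl_def fun_eq_iff algebra_simps)

lemma vector_space_field: "vector_space ((*) :: 'k::field \<Rightarrow> 'k \<Rightarrow> 'k)"
  by unfold_locales (auto simp: algebra_simps)

lemma separating_functional:
  assumes "vector_space (s :: 'k::field \<Rightarrow> 'x::ab_group_add \<Rightarrow> 'x)" and "d \<noteq> 0"
  shows "\<exists>l. Vector_Spaces.linear s (*) l \<and> l d = 1"
proof -
  interpret vector_space s by fact
  interpret k: vector_space "(*) :: 'k \<Rightarrow> 'k \<Rightarrow> 'k" by (rule vector_space_field)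
  interpret vector_space_pair s "(*) :: 'k \<Rightarrow> 'k \<Rightarrow> 'k" ..
  have "independent {d}" using assms(2) by simp
  from linear_independent_extend[OF this, of "\<lambda>_. 1"] show ?thesis by auto
qed

lemma evaluation_universal:
  fixes s' :: "'k::field \<Rightarrow> 'x::ab_group_add \<Rightarrow> 'x" and P :: "('a \<Rightarrow> 'k) \<Rightarrow> bool"
  defines "E \<equiv> (\<lambda>a \<phi>. if P \<phi> then \<phi> a else 0)"
  assumes vs: "vector_space s'"
    and ext: "\<And>l. Vector_Spaces.linear s' (*) l \<Longrightarrow> \<exists>\<phi>. P \<phi> \<and> (\<forall>a\<in>A. \<phi> a = l (b a))"
  shows "\<exists>L. Vector_Spaces.linear dscl s' L \<and> (\<forall>a\<in>A. L (E a) = b a)"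
proof -
  interpret X: vector_space s' by fact
  interpret T: vector_space "dscl :: 'k \<Rightarrow> (('a \<Rightarrow> 'k) \<Rightarrow> 'k) \<Rightarrow> _" by (rule vector_space_dscl)
  interpret vector_space_pair "dscl :: 'k \<Rightarrow> (('a \<Rightarrow> 'k) \<Rightarrow> 'k) \<Rightarrow> _" s' ..
  obtain B where B: "B \<subseteq> E ` A" "T.independent B" "E ` A \<subseteq> T.span B"
    using T.maximal_independent_subset[of "E ` A"] by blast
  from B(1) have "\<forall>e\<in>B. \<exists>a\<in>A. E a = e" by blast
  then obtain r where r: "\<And>e. e \<in> B \<Longrightarrow> r e \<in> A \<and> E (r e) = e" by metis
  obtain L where L: "Vector_Spaces.linear dscl s' L" "\<forall>e\<in>B. L e = b (r e)"
    using linear_independent_extend[OF B(2), of "\<lambda>e. b (r e)"] by blast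
  interpret L: Vector_Spaces.linear dscl s' L by (rule L(1))
  have "L (E a) = b a" if a: "a \<in> A" for a
  proof (rule ccontr)
    assume "L (E a) \<noteq> b a"
    then have "L (E a) - b a \<noteq> 0" by simp
    then obtain l where l: "Vector_Spaces.linear s' (*) l" "l (L (E a) - b a) = 1"
      using separating_functional[OF vs] by blast
    interpret l: Vector_Spaces.linear s' "(*)" l by (rule l(1))
    obtain \<phi> where \<phi>: "P \<phi>" "\<And>a. a \<in> A \<Longrightarrow> \<phi> a = l (b a)" using ext[OF l(1)] by blast
    have "t \<phi> = l (L t)" if "t \<in> T.span B" for t
      using that
    proof (induction rule: T.span_induct_alt)
      case base show ?case using arg_cong[OF L.zero, of l] l.zero by (simp add: zero_fun_def)
    next
      case (step c x y)
      have "x \<phi> = \<phi> (r x)" using r[OF step(1)] \<phi>(1) unfolding E_def by (metis (mono_tags, lifting))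
      then have "x \<phi> = l (L x)" using \<phi>(2) r[OF step(1)] L(2) step(1) by simp
      moreover have "l (L (dscl c x + y)) = c * l (L x) + l (L y)"
        by (simp only: L.add L.scale l.add l.scale)
      ultimately show ?case using step(2) by (simp add: dscl_def plus_fun_def)
    qed
    then have "E a \<phi> = l (L (E a))" using B(3) a by blast
    moreover have "E a \<phi> = l (b a)" using \<phi> a by (simp add: E_def)
    ultimately show False using l(2) by (simp add: l.diff)
  qed
  with L(1) show ?thesis by blast
qed

lemma subspace_projection:
  assumes "vector_space (s :: 'k::field \<Rightarrow> 'v::ab_group_add \<Rightarrow> 'v)" and "module.subspace s A"
  shows "\<exists>p. Vector_Spaces.linear s s p \<and> range p \<subseteq> A \<and> (\<forall>x\<in>A. p x = x)"
proof -
  interpret vector_space s by fact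
  interpret vector_space_pair s s ..
  obtain B where B: "B \<subseteq> A" "independent B" "A \<subseteq> span B"
    using maximal_independent_subset[of A] by blast
  have BA: "span B = A"
    using B assms(2) by (metis span_minimal subset_antisym)
  obtain p where p: "Vector_Spaces.linear s s p" "\<forall>x\<in>B. p x = x" "range p = span ((\<lambda>x. x) ` B)"
    using linear_independent_extend_subspace[OF B(2), of "\<lambda>x. x"] by blast
  interpret p: Vector_Spaces.linear s s p by (rule p(1))
  have "p x = x" if "x \<in> span B" for x
    using that p(2) by (induction rule: span_induct_alt) (auto simp: p.zero p.add p.scale)
  then show ?thesis using p(1,3) BA by auto
qed

lemma multilinear_tens:
  assumes "vector_space (s :: 'k::field \<Rightarrow> 'v::ab_group_add \<Rightarrow> 'v)"
  shows "Vector_Spaces.linear s dscl (\<lambda>x. tens s (xs @ x # ys))"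
proof -
  interpret V: vector_space s by fact
  interpret T: vector_space "dscl :: 'k \<Rightarrow> ('k, 'v) tensor \<Rightarrow> _" by (rule vector_space_dscl)
  show ?thesis
    by (auto intro!: Vector_Spaces.linear.intro module_hom.intro module_hom_axioms.intro V.module_axioms T.module_axioms assms vector_space_dscl
         simp: fun_eq_iff tens_def dscl_def multilinear_form_def Vector_Spaces.linear_iff)
qed

lemma tens_app_tens:
  fixes s :: "'k::field \<Rightarrow> 'v::ab_group_add \<Rightarrow> 'v"
  shows "tens_app s (tens s xs) (tens s ys) = tens s (xs @ ys)"
proof -
  have *: "multilinear_form s (\<lambda>zs. \<phi> (as @ zs))" "multilinear_form s (\<lambda>zs. \<phi> (zs @ as))"
    if \<phi>: "multilinear_form s \<phi>" for \<phi> :: "'v list \<Rightarrow> 'k" and as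
  proof -
    show "multilinear_form s (\<lambda>zs. \<phi> (as @ zs))"
      unfolding multilinear_form_def
    proof (intro allI)
      fix us vs
      from \<phi> have "Vector_Spaces.linear s (*) (\<lambda>x. \<phi> ((as @ us) @ x # vs))"
        unfolding multilinear_form_def by blast
      then show "Vector_Spaces.linear s (*) (\<lambda>x. \<phi> (as @ us @ x # vs))" by simp
    qed
    show "multilinear_form s (\<lambda>zs. \<phi> (zs @ as))"
      using \<phi> unfolding multilinear_form_def by simp
  qed
  then show ?thesis by (auto simp: tens_app_def tens_def fun_eq_iff)
qed

theorem tensor_universal:
  fixes s :: "'k::field \<Rightarrow> 'v::ab_group_add \<Rightarrow> 'v" and s' :: "'k \<Rightarrow> 'x::ab_group_add \<Rightarrow> 'x"
  assumes "vector_space s" "vector_space s'" "module.subspace s A"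
    and b: "\<And>xs ys. xs \<in> lists A \<Longrightarrow> ys \<in> lists A \<Longrightarrow> length xs + length ys + 1 = n \<Longrightarrow>
              linear_map_on s s' A (\<lambda>x. b (xs @ x # ys))"
  shows "\<exists>L. Vector_Spaces.linear dscl s' L \<and> (\<forall>xs\<in>lists A. length xs = n \<longrightarrow> L (tens s xs) = b xs)"
proof -
  obtain p where p: "Vector_Spaces.linear s s p" "range p \<subseteq> A" "\<And>x. x \<in> A \<Longrightarrow> p x = x"
    using subspace_projection[OF assms(1,3)] by blast
  have pl: "map p zs \<in> lists A" for zs using p(2) by (auto simp: image_subset_iff)
  have "\<exists>L. Vector_Spaces.linear dscl s' L \<and>
      (\<forall>xs\<in>{xs \<in> lists A. length xs = n}. L (\<lambda>\<phi>. if multilinear_form s \<phi> then \<phi> xs else 0) = b xs)"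
  proof (rule evaluation_universal[OF assms(2)])
    fix l assume l: "Vector_Spaces.linear s' (*) l"
    define \<phi> where "\<phi> = (\<lambda>xs. if length xs = n then l (b (map p xs)) else 0)"
    have "multilinear_form s \<phi>"
      unfolding multilinear_form_def Vector_Spaces.linear_iff \<phi>_def
      using l p(1,2) b[OF pl pl] assms(1) vector_space_field
      unfolding Vector_Spaces.linear_iff linear_map_on_def
      by (auto simp: image_subset_iff)
    moreover have "map p xs = xs" if "xs \<in> lists A" for xs
      using that p(3) by (auto intro!: map_idI)
    ultimately show "\<exists>\<phi>. multilinear_form s \<phi> \<and> (\<forall>a\<in>{xs \<in> lists A. length xs = n}. \<phi> a = l (b a))"
      by (intro exI[of _ \<phi>]) (auto simp: \<phi>_def)
  qed
  then show ?thesis unfolding tens_def by blast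
qed

lemma mon_swap:
  assumes "x \<in> gr U i" "y \<in> gr U j"
  shows "mon U (xs @ x # y # ys) = ksign i j (mon U (xs @ y # x # ys))"
proof
  fix \<phi>
  have "\<phi> (xs @ x # y # ys) = ksign i j (\<phi> (xs @ y # x # ys))" if "gsym_form U \<phi>"
    using that assms unfolding gsym_form_def by blast
  then show "mon U (xs @ x # y # ys) \<phi> = ksign i j (mon U (xs @ y # x # ys)) \<phi>"
    by (auto simp: mon_def ksign_def)
qed

theorem sym_universal:
  fixes U :: "('k::field, 'u::ab_group_add) gvs" and s' :: "'k \<Rightarrow> 'x::ab_group_add \<Rightarrow> 'x"
  assumes "graded_vs U" "vector_space s'"
    and b: "\<And>xs ys. xs \<in> lists (carr U) \<Longrightarrow> ys \<in> lists (carr U) \<Longrightarrow>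
              linear_map_on (scl U) s' (carr U) (\<lambda>x. b (xs @ x # ys))"
    and sym: "\<And>xs ys i j x y. xs \<in> lists (carr U) \<Longrightarrow> ys \<in> lists (carr U) \<Longrightarrow> x \<in> gr U i \<Longrightarrow> y \<in> gr U j \<Longrightarrow>
              b (xs @ x # y # ys) = ksign i j (b (xs @ y # x # ys))"
  shows "\<exists>L. Vector_Spaces.linear dscl s' L \<and> (\<forall>xs\<in>lists (carr U). L (mon U xs) = b xs)"
proof -
  have vU: "vector_space (scl U)" using assms(1) by (simp add: graded_vs_def)
  interpret U: vector_space "scl U" by (rule vU)
  have "module.subspace (scl U) (carr U)" unfolding carr_def by (rule U.subspace_span)
  from subspace_projection[OF vU this]
  obtain p where p: "Vector_Spaces.linear (scl U) (scl U) p" "range p \<subseteq> carr U" "\<And>x. x \<in> carr U \<Longrightarrow> p x = x"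
    by blast
  have pl: "map p zs \<in> lists (carr U)" for zs using p(2) by (auto simp: image_subset_iff)
  have gc: "x \<in> carr U" if "x \<in> gr U i" for x i
    using that unfolding carr_def by (auto intro: U.span_base)
  have "\<exists>L. Vector_Spaces.linear dscl s' L \<and>
      (\<forall>xs\<in>lists (carr U). L (\<lambda>\<phi>. if gsym_form U \<phi> then \<phi> xs else 0) = b xs)"
  proof (rule evaluation_universal[OF assms(2)])
    fix l assume l: "Vector_Spaces.linear s' (*) l"
    interpret l: Vector_Spaces.linear s' "(*)" l by (rule l)
    define \<phi> where "\<phi> = (\<lambda>xs. l (b (map p xs)))"
    have "multilinear_form (scl U) \<phi>"
      unfolding multilinear_form_def Vector_Spaces.linear_iff \<phi>_def
      using l p(1,2) b[OF pl pl] vU vector_space_field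
      unfolding Vector_Spaces.linear_iff linear_map_on_def
      by (auto simp: image_subset_iff)
    moreover have "\<phi> (xs @ x # y # ys) = ksign i j (\<phi> (xs @ y # x # ys))"
      if "x \<in> gr U i" "y \<in> gr U j" for xs ys x y i j
      using sym[OF pl pl that] that gc p(3) by (auto simp: \<phi>_def ksign_def l.neg)
    ultimately have "gsym_form U \<phi>" unfolding gsym_form_def by blast
    moreover have "map p xs = xs" if "xs \<in> lists (carr U)" for xs
      using that p(3) by (auto intro!: map_idI)
    ultimately show "\<exists>\<phi>. gsym_form U \<phi> \<and> (\<forall>a\<in>lists (carr U). \<phi> a = l (b a))"
      by (intro exI[of _ \<phi>]) (auto simp: \<phi>_def)
  qed
  then show ?thesis unfolding mon_def .
qed

lemma sym_mult_mon:
  fixes U :: "('k::field, 'u::ab_group_add) gvs"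
  shows "sym_mult U (mon U xs) (mon U ys) = mon U (xs @ ys)"
proof -
  have *: "gsym_form U (\<lambda>zs. \<phi> (as @ zs))" "gsym_form U (\<lambda>zs. \<phi> (zs @ as))"
    if \<phi>: "gsym_form U \<phi>" for \<phi> :: "'u list \<Rightarrow> 'k" and as
  proof -
    have 1: "Vector_Spaces.linear (scl U) (*) (\<lambda>x. \<phi> (us @ x # vs))" for us vs
      using \<phi> unfolding gsym_form_def multilinear_form_def by blast
    have 2: "\<phi> (us @ x # y # vs) = ksign i j (\<phi> (us @ y # x # vs))" if "x \<in> gr U i" "y \<in> gr U j" for us vs x y i j
      using \<phi> that unfolding gsym_form_def by blast
    show "gsym_form U (\<lambda>zs. \<phi> (as @ zs))"
      unfolding gsym_form_def multilinear_form_def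
    proof (intro conjI allI ballI)
      show "Vector_Spaces.linear (scl U) (*) (\<lambda>x. \<phi> (as @ us @ x # vs))" for us vs
        using 1[of "as @ us" vs] by simp
      show "\<phi> (as @ us @ x # y # vs) = ksign i j (\<phi> (as @ us @ y # x # vs))"
        if "x \<in> gr U i" "y \<in> gr U j" for us vs x y i j
        using 2[OF that, of "as @ us" vs] by (simp only: append_assoc)
    qed
    show "gsym_form U (\<lambda>zs. \<phi> (zs @ as))"
      unfolding gsym_form_def multilinear_form_def
    proof (intro conjI allI ballI)
      show "Vector_Spaces.linear (scl U) (*) (\<lambda>x. \<phi> ((us @ x # vs) @ as))" for us vs
        using 1[of us "vs @ as"] by simp
      show "\<phi> ((us @ x # y # vs) @ as) = ksign i j (\<phi> ((us @ y # x # vs) @ as))"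
        if "x \<in> gr U i" "y \<in> gr U j" for us vs x y i j
        using 2[OF that, of us "vs @ as"] by (simp only: append_assoc append_Cons)
    qed
  qed
  then show ?thesis by (auto simp: sym_mult_def mon_def fun_eq_iff)
qed

end

theory Submission
  imports Defs
begin

text \<open>
  A morphism \<open>f\<close> of MV-algebras is encoded by its exponential, and under this encoding composition is
  composition of maps.  That the MV-algebras form a category therefore amounts to \<open>exp\<close> and \<open>log\<close> being
  mutually inverse.  For this, an \<open>R\<close>-linear map is replaced by its restriction \<open>V \<rightarrow> W[[\<hbar>]]\<close>
  (\<open>R_linear_eq_ser_ext\<close>), and convolution by sums over the Sweedler representation of the coproduct.  Conilpotency
  makes the convolution powers of a map with \<open>f(1) \<in> \<hbar>W[[\<hbar>]]\<close> tend to \<open>0\<close> pointwise (\<open>pw_vanish\<close>), so every power series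
  over \<open>\<bbbk>\<close> can be evaluated at \<open>f\<close>, compatibly with products and substitution (\<open>ev_mult\<close>, \<open>ev_compose\<close>); \<open>exp\<close> and
  \<open>log\<close> are then inverse because they are so as power series.

  The condition \<open>f\<^bsup>(k)\<^esup>(S\<^sup>n(U)) = 0\<close> for \<open>n > k\<close> says that \<open>f\<close> maps \<open>S\<^sup>n(U)\<close> into \<open>\<hbar>\<^bsup>n-1\<^esup>S(U'')[[\<hbar>]]\<close>
  (\<open>IBL_mor_iff\<close>).  The identity of \<open>S(U)\<close> satisfies it because \<open>log(id)\<close> is the projection onto \<open>U\<close>
  (\<open>log_id_mon\<close>).  The point of the proof is that it passes to \<open>h = log(exp(f) \<circ> exp(g))\<close> for
  \<open>g : S(U') \<rightarrow> S(U)[[\<hbar>]]\<close> and \<open>f : S(U) \<rightarrow> S(U'')[[\<hbar>]]\<close>.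

  Let \<open>m : S(S(U)) \<rightarrow> S(U)\<close> be the homomorphism of algebras that multiplies words, and let \<open>\<iota>g\<close> be \<open>g\<close> with values
  regarded as generators of \<open>S(S(U))\<close>.  The exponential of a map into the generators is a morphism of coalgebras, so
  composing with \<open>exp(\<iota>g)\<close> respects convolution (\<open>E_cv_GG\<close>) and hence commutes with \<open>log\<close>.  As \<open>m \<circ> exp(\<iota>g) = exp(g)\<close>,
  this gives \<open>h = \<kappa> \<circ> exp(\<iota>g)\<close> with \<open>\<kappa> = log(exp(f) \<circ> m)\<close> (\<open>log_compose\<close>).  The values
  \<open>\<kappa>(w\<^sub>1,\<dots>,w\<^sub>n)\<close> are the cumulants of \<open>exp(f)\<close>.  They satisfy
  \<open>\<kappa>(ab, c) = \<kappa>(a, b, c) + \<Sum> \<plusminus> \<kappa>(a, c') \<kappa>(b, c'')\<close>, where \<open>c\<close> stands for the remaining words and the sum is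
  over its unshuffles (\<open>cumulant_lm_mult\<close>), and on words of length one they are the values of \<open>f\<close>
  (\<open>cumulant_letters\<close>).  Splitting words into letters shows that \<open>\<kappa>(w\<^sub>1,\<dots>,w\<^sub>n)\<close> is divisible by \<open>\<hbar>\<^bsup>n-1\<^esup>\<close> for words of any
  length (\<open>cumulant_words\<close>).  The part of \<open>exp(\<iota>g)\<close> with \<open>j\<close> factors is divisible by \<open>\<hbar>\<^bsup>n-j\<^esup>\<close> on \<open>S\<^sup>n(U')\<close> (\<open>pw_order\<close>),
  so \<open>h\<close> is divisible by \<open>\<hbar>\<^bsup>n-1\<^esup>\<close> there.

  A last point is that an MV-algebra may be presented as \<open>S(U)\<close> in several ways; the subspaces \<open>S\<^sup>n(U)\<close> are nevertheless
  determined (\<open>sym_mv_sym_pow\<close>), so that composable morphisms refer to the same ones.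
\<close>

(* pointwise rules for functions would apply to tensors, which are functions on forms *)
declare zero_fun_apply [simp del] plus_fun_apply [simp del]

section \<open>Linear algebra on graded subspaces\<close>

lemma linear_map_on_add: "linear_map_on s s' A f \<Longrightarrow> x \<in> A \<Longrightarrow> y \<in> A \<Longrightarrow> f (x + y) = f x + f y"
  by (simp add: linear_map_on_def)

lemma linear_map_on_scl: "linear_map_on s s' A f \<Longrightarrow> x \<in> A \<Longrightarrow> f (s c x) = s' c (f x)"
  by (simp add: linear_map_on_def)

lemma ksign_simps [simp]:
  "ksign i j 0 = 0" "ksign i j (ksign i j x) = x" "ksign i j (- x) = - ksign i j x"
  "ksign i j (x + y) = ksign i j x + ksign i j y" "ksign 0 j x = x" "ksign i 0 x = x"
  by (auto simp: ksign_def)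

lemma linear_ksign: "Vector_Spaces.linear s s' L \<Longrightarrow> L (ksign i j x) = ksign i j (L x)"
  unfolding ksign_def by (auto simp: module_hom.neg[OF Vector_Spaces.linear.axioms(3)])

lemma linear_sum_list:
  assumes "Vector_Spaces.linear s s' L"
  shows "L (\<Sum>(a, b)\<leftarrow>ps. g a b) = (\<Sum>(a, b)\<leftarrow>ps. L (g a b))"
proof -
  interpret Vector_Spaces.linear s s' L by fact
  show ?thesis by (induction ps) (auto simp: zero add)
qed

lemma linear_eq_on_span:
  assumes "Vector_Spaces.linear s s' L" "Vector_Spaces.linear s s' M"
    and "\<And>x. x \<in> B \<Longrightarrow> L x = M x" "x \<in> module.span s B"
  shows "L x = M x"
proof -
  interpret L: Vector_Spaces.linear s s' L by fact
  interpret M: Vector_Spaces.linear s s' M by fact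
  show ?thesis using assms(4)
    by (induction rule: L.vs1.span_induct_alt) (auto simp: L.zero M.zero L.add M.add L.scale M.scale assms(3))
qed

locale gvec =
  fixes V :: "('k::field_char_0, 'v::ab_group_add, 'z) gvs_scheme"
  assumes graded: "graded_vs V"
begin

sublocale vs: vector_space "scl V"
  using graded by (simp add: graded_vs_def)

lemma gr_subspace: "vs.subspace (gr V n)"
  using graded by (simp add: graded_vs_def)

lemma gr_add: "x \<in> gr V n \<Longrightarrow> y \<in> gr V n \<Longrightarrow> x + y \<in> gr V n"
  and gr_scl: "x \<in> gr V n \<Longrightarrow> scl V c x \<in> gr V n"
  and gr_zero [simp]: "0 \<in> gr V n"
  and gr_neg: "x \<in> gr V n \<Longrightarrow> - x \<in> gr V n"
  and gr_diff: "x \<in> gr V n \<Longrightarrow> y \<in> gr V n \<Longrightarrow> x - y \<in> gr V n"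
  and gr_sum: "(\<And>i. i \<in> I \<Longrightarrow> f i \<in> gr V n) \<Longrightarrow> sum f I \<in> gr V n"
  using gr_subspace[of n]
  by (auto intro: vs.subspace_add vs.subspace_scale vs.subspace_0 vs.subspace_neg vs.subspace_diff vs.subspace_sum)

lemma carr_subspace: "vs.subspace (carr V)"
  unfolding carr_def by (rule vs.subspace_span)

lemma carr_add: "x \<in> carr V \<Longrightarrow> y \<in> carr V \<Longrightarrow> x + y \<in> carr V"
  and carr_scl: "x \<in> carr V \<Longrightarrow> scl V c x \<in> carr V"
  and carr_zero [simp]: "0 \<in> carr V"
  and carr_neg: "x \<in> carr V \<Longrightarrow> - x \<in> carr V"
  and carr_diff: "x \<in> carr V \<Longrightarrow> y \<in> carr V \<Longrightarrow> x - y \<in> carr V"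
  and carr_sum: "(\<And>i. i \<in> I \<Longrightarrow> f i \<in> carr V) \<Longrightarrow> sum f I \<in> carr V"
  using carr_subspace
  by (auto intro: vs.subspace_add vs.subspace_scale vs.subspace_0 vs.subspace_neg vs.subspace_diff vs.subspace_sum)

lemma gr_carr: "x \<in> gr V n \<Longrightarrow> x \<in> carr V"
  unfolding carr_def by (auto intro: vs.span_base)

lemma carr_induct [consumes 1, case_names zero add hom]:
  assumes "x \<in> carr V" "P 0"
    and "\<And>x y. x \<in> carr V \<Longrightarrow> y \<in> carr V \<Longrightarrow> P x \<Longrightarrow> P y \<Longrightarrow> P (x + y)"
    and "\<And>n x. x \<in> gr V n \<Longrightarrow> P x"
  shows "P x"
proof -
  have "x \<in> vs.span (\<Union>n. gr V n)" using assms(1) by (simp add: carr_def)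
  then have "x \<in> carr V \<and> P x"
  proof (induction rule: vs.span_induct_alt)
    case base then show ?case using assms(2) by simp
  next
    case (step c x y)
    then obtain n where "x \<in> gr V n" by blast
    then have "scl V c x \<in> gr V n" by (rule gr_scl)
    with step assms(3)[of "scl V c x" y] assms(4)[of "scl V c x" n] show ?case
      by (auto intro: carr_add gr_carr)
  qed
  then show ?thesis ..
qed

lemma ksign_gr: "x \<in> gr V n \<Longrightarrow> ksign i j x \<in> gr V n"
  by (simp add: ksign_def gr_neg)

definition dcmp :: "'v \<Rightarrow> (int \<Rightarrow> 'v) \<Rightarrow> bool" where
  "dcmp x d \<longleftrightarrow> (\<forall>n. d n \<in> gr V n) \<and> finite {n. d n \<noteq> 0} \<and> x = (\<Sum>n | d n \<noteq> 0. d n)"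

lemma dcmpI:
  assumes "\<And>n. d n \<in> gr V n" "finite N" "\<And>n. n \<notin> N \<Longrightarrow> d n = 0" "x = sum d N"
  shows "dcmp x d"
proof -
  have "{n. d n \<noteq> 0} \<subseteq> N" using assms(3) by blast
  moreover from this have "sum d N = (\<Sum>n | d n \<noteq> 0. d n)"
    using assms(2) by (intro sum.mono_neutral_right) auto
  ultimately show ?thesis using assms finite_subset by (auto simp: dcmp_def)
qed

lemma dcmp_sum: "dcmp x d \<Longrightarrow> finite N \<Longrightarrow> {n. d n \<noteq> 0} \<subseteq> N \<Longrightarrow> x = sum d N"
  unfolding dcmp_def by (auto intro: sum.mono_neutral_left)

lemma gr_direct:
  assumes "finite N" "\<And>n. n \<in> N \<Longrightarrow> x n \<in> gr V n" "sum x N = 0" "n \<in> N"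
  shows "x n = 0"
proof -
  have *: "\<forall>N x. finite N \<and> (\<forall>n\<in>N. x n \<in> gr V n) \<and> (\<Sum>n\<in>N. x n) = 0 \<longrightarrow> (\<forall>n\<in>N. x n = 0)"
    using graded unfolding graded_vs_def by (elim conjE)
  show ?thesis using *[THEN spec, THEN spec, of N x] assms by blast
qed

lemma dcmp_unique:
  assumes "dcmp x d" "dcmp x e" shows "d = e"
proof
  fix n
  let ?N = "insert n ({n. d n \<noteq> 0} \<union> {n. e n \<noteq> 0})"
  have fin: "finite ?N" using assms by (auto simp: dcmp_def)
  have "x = sum d ?N" "x = sum e ?N" by (rule dcmp_sum; use assms fin in auto)+
  then have "(\<Sum>n\<in>?N. d n - e n) = 0" by (simp only: sum_subtractf) (metis diff_self)
  moreover have "\<forall>n\<in>?N. d n - e n \<in> gr V n" using assms unfolding dcmp_def by (blast intro: gr_diff)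
  ultimately have "d n - e n = 0" by (intro gr_direct[OF fin, of "\<lambda>n. d n - e n"]) auto
  then show "d n = e n" by simp
qed

lemma dcmp_hom: "x \<in> gr V n \<Longrightarrow> dcmp x (\<lambda>m. if m = n then x else 0)"
  by (rule dcmpI[where N="{n}"]) auto

lemma dcmp_add: 
  assumes "dcmp x d" "dcmp y e" shows "dcmp (x + y) (\<lambda>n. d n + e n)"
proof (rule dcmpI[where N="{n. d n \<noteq> 0} \<union> {n. e n \<noteq> 0}"])
  have fin: "finite ({n. d n \<noteq> 0} \<union> {n. e n \<noteq> 0})" using assms by (auto simp: dcmp_def)
  show "x + y = (\<Sum>n\<in>{n. d n \<noteq> 0} \<union> {n. e n \<noteq> 0}. d n + e n)"
    using dcmp_sum[OF assms(1) fin] dcmp_sum[OF assms(2) fin] by (simp add: sum.distrib)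
qed (use assms in \<open>auto simp: dcmp_def gr_add\<close>)

lemma dcmp_scl: 
  assumes "dcmp x d" shows "dcmp (scl V c x) (\<lambda>n. scl V c (d n))"
  by (rule dcmpI[where N="{n. d n \<noteq> 0}"]) (use assms in \<open>auto simp: dcmp_def gr_scl vs.scale_sum_right\<close>)

lemma dcmp_ex: "x \<in> carr V \<Longrightarrow> \<exists>d. dcmp x d"
proof (induction rule: carr_induct)
  case zero show ?case using dcmp_hom[of 0 0] by auto
next
  case (add x y) then show ?case using dcmp_add by blast
next
  case (hom n x) then show ?case using dcmp_hom by blast
qed

text \<open>An operator that is a prescribed scalar on each homogeneous part.  The parity involution and the operators separating
  degrees are of this kind.\<close>

lemma gr_scaling:
  "\<exists>T. Vector_Spaces.linear (scl V) (scl V) T \<and> (\<forall>n. \<forall>x\<in>gr V n. T x = scl V (c n) x) \<and> range T \<subseteq> carr V"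
proof -
  obtain p where p: "Vector_Spaces.linear (scl V) (scl V) p" "range p \<subseteq> carr V" "\<forall>x\<in>carr V. p x = x"
    using subspace_projection[OF vs.vector_space_axioms carr_subspace] by blast
  interpret p: Vector_Spaces.linear "scl V" "scl V" p by (rule p(1))
  define d where "d = (\<lambda>x. THE d. dcmp (p x) d)"
  have d: "dcmp (p x) (d x)" for x
  proof -
    obtain e where "dcmp (p x) e" using dcmp_ex p(2) by blast
    then show ?thesis unfolding d_def by (rule theI[of "dcmp (p x)"]) (rule dcmp_unique[OF _ \<open>dcmp (p x) e\<close>])
  qed
  define T where "T = (\<lambda>x. \<Sum>n | d x n \<noteq> 0. scl V (c n) (d x n))"
  have fin: "finite {n. d x n \<noteq> 0}" for x using d[of x] by (simp add: dcmp_def)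
  have T: "T x = (\<Sum>n\<in>N. scl V (c n) (d x n))" if "finite N" "{n. d x n \<noteq> 0} \<subseteq> N" for x N
    unfolding T_def using that by (intro sum.mono_neutral_left) auto
  have dadd: "d (x + y) = (\<lambda>n. d x n + d y n)" for x y
    by (rule dcmp_unique[OF d]) (use dcmp_add[OF d d, of x y] p.add in simp)
  have dscl: "d (scl V a x) = (\<lambda>n. scl V a (d x n))" for x a
    by (rule dcmp_unique[OF d]) (use dcmp_scl[OF d, of a x] p.scale in simp)
  have "T (x + y) = T x + T y" for x y
  proof -
    let ?N = "{n. d x n \<noteq> 0} \<union> {n. d y n \<noteq> 0}"
    have "T (x + y) = (\<Sum>n\<in>?N. scl V (c n) (d (x + y) n))" by (rule T) (use fin in \<open>auto simp: dadd\<close>)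
    moreover have "T x = (\<Sum>n\<in>?N. scl V (c n) (d x n))" by (rule T) (use fin in \<open>auto\<close>)
    moreover have "T y = (\<Sum>n\<in>?N. scl V (c n) (d y n))" by (rule T) (use fin in \<open>auto\<close>)
    ultimately show ?thesis by (simp add: dadd vs.scale_right_distrib sum.distrib)
  qed
  moreover have "T (scl V a x) = scl V a (T x)" for x a
  proof -
    let ?N = "{n. d x n \<noteq> 0}"
    have "T (scl V a x) = (\<Sum>n\<in>?N. scl V (c n) (d (scl V a x) n))" by (rule T) (use fin in \<open>auto simp: dscl\<close>)
    then show ?thesis by (simp add: T_def dscl vs.scale_sum_right mult.commute)
  qed
  ultimately have "Vector_Spaces.linear (scl V) (scl V) T"
    by (simp add: Vector_Spaces.linear_iff vs.vector_space_axioms)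
  moreover have "T x = scl V (c n) x" if "x \<in> gr V n" for n x
  proof -
    have "d x = (\<lambda>m. if m = n then x else 0)"
      by (rule dcmp_unique[OF d]) (use dcmp_hom[OF that] p(3) gr_carr[OF that] in simp)
    then show ?thesis by (subst T[of "{n}"]) auto
  qed
  moreover have "T x \<in> carr V" for x
    unfolding T_def using d[of x] by (auto simp: dcmp_def intro!: carr_sum carr_scl intro: gr_carr)
  ultimately show ?thesis by blast
qed

end

text \<open>The parity involution, \<open>x \<mapsto> (-1)\<^bsup>|x|\<^esup> x\<close>, and its \<open>i\<close>-th power.  They express Koszul signs by linear maps, which
  makes sense for inhomogeneous elements.\<close>

definition par :: "('k::field_char_0, 'v::ab_group_add, 'z) gvs_scheme \<Rightarrow> 'v \<Rightarrow> 'v" where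
  "par V = (SOME T. Vector_Spaces.linear (scl V) (scl V) T \<and> (\<forall>n. \<forall>x\<in>gr V n. T x = ksign 1 n x) \<and> range T \<subseteq> carr V)"

definition tw :: "('k::field_char_0, 'v::ab_group_add, 'z) gvs_scheme \<Rightarrow> int \<Rightarrow> 'v \<Rightarrow> 'v" where
  "tw V i x = (if odd i then par V x else x)"

context gvec
begin

lemma par_ex: "Vector_Spaces.linear (scl V) (scl V) (par V) \<and> (\<forall>n. \<forall>x\<in>gr V n. par V x = ksign 1 n x) \<and> range (par V) \<subseteq> carr V"
proof -
  obtain T where "Vector_Spaces.linear (scl V) (scl V) T" "range T \<subseteq> carr V" 
    "\<forall>n. \<forall>x\<in>gr V n. T x = scl V (if odd n then -1 else 1) x" using gr_scaling[of "\<lambda>n. if odd n then -1 else 1"] by (elim exE conjE)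
  then have "Vector_Spaces.linear (scl V) (scl V) T \<and> (\<forall>n. \<forall>x\<in>gr V n. T x = ksign 1 n x) \<and> range T \<subseteq> carr V"
    by (auto simp: ksign_def)
  then show ?thesis
    unfolding par_def by (intro someI[where P="\<lambda>T. Vector_Spaces.linear (scl V) (scl V) T \<and>
      (\<forall>n. \<forall>x\<in>gr V n. T x = ksign 1 n x) \<and> range T \<subseteq> carr V"])
qed

lemma par_linear: "Vector_Spaces.linear (scl V) (scl V) (par V)"
  and par_hom: "x \<in> gr V n \<Longrightarrow> par V x = ksign 1 n x"
  and par_carr: "par V x \<in> carr V"
  using par_ex by auto

lemma tw_hom: "x \<in> gr V n \<Longrightarrow> tw V i x = ksign i n x"
  by (simp add: tw_def par_hom ksign_def)

lemma tw_carr: "x \<in> carr V \<Longrightarrow> tw V i x \<in> carr V"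
  by (simp add: tw_def par_carr)

lemma tw_linear: "Vector_Spaces.linear (scl V) (scl V) (tw V i)"
proof -
  have "tw V i = (if odd i then par V else (\<lambda>x. x))" by (auto simp: tw_def fun_eq_iff)
  moreover have "Vector_Spaces.linear (scl V) (scl V) (\<lambda>x. x)"
    by (simp add: Vector_Spaces.linear_iff vs.vector_space_axioms)
  ultimately show ?thesis by (simp add: par_linear)
qed

lemma tw_add: "tw V i (x + y) = tw V i x + tw V i y"
  and tw_scl: "tw V i (scl V c x) = scl V c (tw V i x)"
  and tw_zero [simp]: "tw V i 0 = 0"
proof -
  interpret L: Vector_Spaces.linear "scl V" "scl V" "tw V i" by (rule tw_linear)
  show "tw V i (x + y) = tw V i x + tw V i y" "tw V i (scl V c x) = scl V c (tw V i x)" "tw V i 0 = 0"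
    by (rule L.add L.scale L.zero)+
qed

lemma tw_gr: "x \<in> gr V n \<Longrightarrow> tw V i x \<in> gr V n"
  by (simp add: tw_hom ksign_gr)

end

section \<open>Power series with coefficients in a vector space\<close>

lemma fps_suminf_nth:
  fixes a :: "nat \<Rightarrow> 'a::ab_group_add fps"
  assumes loc: "\<And>i. \<exists>N. \<forall>n\<ge>N. fps_nth (a n) i = 0" and N: "\<And>n. n \<ge> N \<Longrightarrow> fps_nth (a n) i = 0"
  shows "fps_nth (suminf a) i = (\<Sum>n<N. fps_nth (a n) i)"
proof -
  define s where "s = Abs_fps (\<lambda>i. \<Sum>n<(SOME N. \<forall>n\<ge>N. fps_nth (a n) i = 0). fps_nth (a n) i)"
  have s: "fps_nth s i = (\<Sum>n<N. fps_nth (a n) i)" if "\<forall>n\<ge>N. fps_nth (a n) i = 0" for N i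
  proof -
    define M where "M = (SOME N. \<forall>n\<ge>N. fps_nth (a n) i = 0)"
    have M: "\<forall>n\<ge>M. fps_nth (a n) i = 0" unfolding M_def by (rule someI_ex) (use loc in blast)
    have "(\<Sum>n<M. fps_nth (a n) i) = (\<Sum>n<min M N. fps_nth (a n) i)"
      using that by (intro sum.mono_neutral_right) auto
    also have "\<dots> = (\<Sum>n<N. fps_nth (a n) i)"
      using M by (intro sum.mono_neutral_left) auto
    finally show ?thesis by (simp add: s_def M_def)
  qed
  have "a sums s"
    unfolding sums_def
  proof (rule tendsto_fpsI)
    fix i
    obtain N where "\<forall>n\<ge>N. fps_nth (a n) i = 0" using loc by blast
    then have "fps_nth (\<Sum>n<M. a n) i = fps_nth s i" if "M \<ge> N" for M
      using s[of M i] that by (simp add: fps_sum_nth)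
    then show "\<forall>\<^sub>F M in sequentially. fps_nth (\<Sum>n<M. a n) i = fps_nth s i"
      by (auto simp: eventually_sequentially)
  qed
  then have "suminf a = s" by (rule sums_unique[symmetric])
  then show ?thesis using s N by blast
qed

text \<open>Membership in \<open>\<hbar>\<^sup>mV[[\<hbar>]]\<close>, without reference to \<open>V\<close>.\<close>

definition vanish :: "nat \<Rightarrow> 'a::zero fps \<Rightarrow> bool" where
  "vanish m x \<longleftrightarrow> (\<forall>i<m. fps_nth x i = 0)"

lemma vanish_0 [simp]: "vanish 0 x" "vanish m 0" by (auto simp: vanish_def)
lemma vanish_mono: "vanish m x \<Longrightarrow> n \<le> m \<Longrightarrow> vanish n x" by (auto simp: vanish_def)
lemma vanish_add: "vanish m x \<Longrightarrow> vanish m y \<Longrightarrow> vanish m (x + y)" for x :: "'a::ab_group_add fps"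
  by (auto simp: vanish_def)
lemma vanish_neg: "vanish m x \<Longrightarrow> vanish m (- x)" for x :: "'a::ab_group_add fps"
  by (auto simp: vanish_def)
lemma vanish_diff: "vanish m x \<Longrightarrow> vanish m y \<Longrightarrow> vanish m (x - y)" for x :: "'a::ab_group_add fps"
  by (auto simp: vanish_def)
lemma vanish_sum_list: "(\<And>a b. (a, b) \<in> set ps \<Longrightarrow> vanish m (g a b)) \<Longrightarrow> vanish m (\<Sum>(a, b)\<leftarrow>ps. g a b)"
  for g :: "_ \<Rightarrow> _ \<Rightarrow> 'a::ab_group_add fps"
  by (induction ps) (auto intro!: vanish_add)
lemma vanish_sum: "(\<And>i. i \<in> I \<Longrightarrow> vanish m (g i)) \<Longrightarrow> vanish m (sum g I)"
  for g :: "_ \<Rightarrow> 'a::ab_group_add fps"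
  by (auto simp: vanish_def fps_sum_nth)
lemma vanish_eqI: "(\<And>m. vanish m (x - y)) \<Longrightarrow> x = y" for x :: "'a::ab_group_add fps"
  unfolding vanish_def fps_eq_iff by (metis fps_sub_nth lessI right_minus_eq)

lemma ser_nth: "v \<in> ser A \<Longrightarrow> fps_nth v n \<in> A" by (simp add: ser_def)
lemma serI: "(\<And>n. fps_nth v n \<in> A) \<Longrightarrow> v \<in> ser A" by (simp add: ser_def)
lemma ser_const [simp]: "0 \<in> A \<Longrightarrow> fps_const x \<in> ser A \<longleftrightarrow> x \<in> A" by (auto simp: ser_def)
context gvec
begin

lemma k_act_nth [simp]: "fps_nth (k_act (scl V) c v) n = scl V c (fps_nth v n)"
proof -
  have "fps_nth (k_act (scl V) c v) n = (\<Sum>i\<in>{..n}. if i = 0 then scl V c (fps_nth v n) else 0)"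
    unfolding k_act_def R_act_def fps_nth_Abs_fps by (rule sum.cong) auto
  then show ?thesis by simp
qed

lemma k_act_vs: "vector_space (k_act (scl V))"
  by unfold_locales (auto simp: fps_eq_iff vs.scale_right_distrib vs.scale_left_distrib)

sublocale ks: vector_space "k_act (scl V)" by (rule k_act_vs)

lemma vanish_k_act: "vanish m x \<Longrightarrow> vanish m (k_act (scl V) c x)"
  by (simp add: vanish_def)

lemma R_act_nth: "fps_nth (R_act (scl V) a v) n = (\<Sum>i\<le>n. scl V (fps_nth a i) (fps_nth v (n - i)))"
  by (simp add: R_act_def)

lemma R_act_X_power: "fps_nth (R_act (scl V) (fps_X ^ m) v) n = (if n < m then 0 else fps_nth v (n - m))"
proof -
  have "fps_nth (R_act (scl V) (fps_X ^ m) v) n = (\<Sum>i\<le>n. if i = m then fps_nth v (n - i) else 0)"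
    unfolding R_act_nth by (rule sum.cong) (auto simp: fps_X_power_nth)
  then show ?thesis by simp
qed

lemma ser_carr_add: "x \<in> ser (carr V) \<Longrightarrow> y \<in> ser (carr V) \<Longrightarrow> x + y \<in> ser (carr V)"
  and ser_carr_zero [simp]: "0 \<in> ser (carr V)"
  and ser_carr_neg: "x \<in> ser (carr V) \<Longrightarrow> - x \<in> ser (carr V)"
  and ser_carr_diff: "x \<in> ser (carr V) \<Longrightarrow> y \<in> ser (carr V) \<Longrightarrow> x - y \<in> ser (carr V)"
  and ser_carr_k: "x \<in> ser (carr V) \<Longrightarrow> k_act (scl V) c x \<in> ser (carr V)"
  and ser_carr_R: "x \<in> ser (carr V) \<Longrightarrow> R_act (scl V) a x \<in> ser (carr V)"
  by (auto simp: ser_def R_act_nth intro!: carr_add carr_neg carr_diff carr_scl carr_sum)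

lemma ser_gr_add: "x \<in> ser (gr V n) \<Longrightarrow> y \<in> ser (gr V n) \<Longrightarrow> x + y \<in> ser (gr V n)"
  and ser_gr_zero [simp]: "0 \<in> ser (gr V n)"
  and ser_gr_diff: "x \<in> ser (gr V n) \<Longrightarrow> y \<in> ser (gr V n) \<Longrightarrow> x - y \<in> ser (gr V n)"
  and ser_gr_neg: "x \<in> ser (gr V n) \<Longrightarrow> - x \<in> ser (gr V n)"
  and ser_gr_k: "x \<in> ser (gr V n) \<Longrightarrow> k_act (scl V) c x \<in> ser (gr V n)"
  and ser_gr_carr: "x \<in> ser (gr V n) \<Longrightarrow> x \<in> ser (carr V)"
  by (auto simp: ser_def intro!: gr_add gr_diff gr_scl gr_neg gr_carr)

end

section \<open>Sweedler sums\<close>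

lemma vs_tensor: "vector_space (dscl :: 'k::field \<Rightarrow> (('a \<Rightarrow> 'k) \<Rightarrow> 'k) \<Rightarrow> _)"
  by (rule vector_space_dscl)

lemma tens_split_add:
  assumes "vector_space s"
  shows "tens s (xs @ (x + y) # ys) = tens s (xs @ x # ys) + tens s (xs @ y # ys)"
    and "tens s (xs @ s c x # ys) = dscl c (tens s (xs @ x # ys))"
  using multilinear_tens[OF assms, of xs ys] by (simp_all add: Vector_Spaces.linear_iff)

lemma tens_app_left_add: "tens_app s (t + t') u = tens_app s t u + tens_app s t' u"
  by (auto simp: tens_app_def fun_eq_iff zero_fun_apply plus_fun_apply)

lemma tens_app_left_zero [simp]: "tens_app s 0 u = 0"
  by (auto simp: tens_app_def fun_eq_iff zero_fun_apply plus_fun_apply)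

lemma tens_app_sum_left:
  "tens_app s (\<Sum>(a, b)\<leftarrow>ps. tens s [a, b]) (tens s ys) = (\<Sum>(a, b)\<leftarrow>ps. tens s (a # b # ys))"
  by (induction ps) (auto simp: tens_app_left_add tens_app_tens)

lemma multilinear_form_add:
  "multilinear_form s \<phi> \<Longrightarrow> multilinear_form s \<psi> \<Longrightarrow> multilinear_form s (\<lambda>xs. \<phi> xs + \<psi> xs)"
  by (simp add: multilinear_form_def Vector_Spaces.linear_iff algebra_simps)

lemma multilinear_form_append: "multilinear_form s \<phi> \<Longrightarrow> multilinear_form s (\<lambda>xs. \<phi> (xs @ ys))"
  by (simp add: multilinear_form_def)

lemma multilinear_form_prepend: 
  assumes "multilinear_form s \<phi>" shows "multilinear_form s (\<lambda>xs. \<phi> (ys @ xs))"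
  unfolding multilinear_form_def
proof (intro allI)
  fix us vs
  from assms have "Vector_Spaces.linear s (*) (\<lambda>x. \<phi> ((ys @ us) @ x # vs))"
    unfolding multilinear_form_def by blast
  then show "Vector_Spaces.linear s (*) (\<lambda>x. \<phi> (ys @ us @ x # vs))" by simp
qed

lemma tens_app_sum_right:
  assumes "vector_space s"
  shows "tens_app s (tens s xs) (\<Sum>(a, b)\<leftarrow>ps. tens s [a, b]) = (\<Sum>(a, b)\<leftarrow>ps. tens s (xs @ [a, b]))"
proof
  fix \<phi>
  have z: "multilinear_form s (\<lambda>_. 0)"
    using assms by (simp add: multilinear_form_def Vector_Spaces.linear_iff vector_space_field)
  show "tens_app s (tens s xs) (\<Sum>(a, b)\<leftarrow>ps. tens s [a, b]) \<phi> = (\<Sum>(a, b)\<leftarrow>ps. tens s (xs @ [a, b])) \<phi>"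
  proof (cases "multilinear_form s \<phi>")
    case True
    have 1: "(\<Sum>(a, b)\<leftarrow>ps. tens s (us @ [a, b])) \<psi> = (\<Sum>(a, b)\<leftarrow>ps. \<psi> (us @ [a, b]))"
      if "multilinear_form s \<psi>" for us \<psi>
      using that by (induction ps) (auto simp: tens_def zero_fun_apply plus_fun_apply)
    have 2: "(\<Sum>(a, b)\<leftarrow>ps. tens s [a, b]) (\<lambda>ys. \<phi> (us @ ys)) = (\<Sum>(a, b)\<leftarrow>ps. \<phi> (us @ [a, b]))" for us
      using 1[OF multilinear_form_prepend[OF True], of "[]" us] by simp
    have 3: "multilinear_form s (\<lambda>us. \<Sum>(a, b)\<leftarrow>ps. \<phi> (us @ [a, b]))"
      by (induction ps) (auto simp: z intro!: multilinear_form_add multilinear_form_append True)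
    show ?thesis using True 3 by (simp add: tens_app_def 1 2 tens_def[of s xs])
  next
    case False
    have "(\<Sum>(a, b)\<leftarrow>ps. tens s (xs @ [a, b])) \<phi> = 0"
      using False by (induction ps) (auto simp: tens_def zero_fun_apply plus_fun_apply)
    then show ?thesis using False by (simp add: tens_app_def)
  qed
qed

definition hom_pairs :: "('k::field, 'v::ab_group_add, 'z) gvs_scheme \<Rightarrow> ('v \<times> 'v) list \<Rightarrow> bool" where
  "hom_pairs V ps \<longleftrightarrow> (\<forall>(a, b)\<in>set ps. \<exists>i j. a \<in> gr V i \<and> b \<in> gr V j)"

definition bilin ::
  "('k::field, 'v::ab_group_add, 'z) gvs_scheme \<Rightarrow> ('k \<Rightarrow> 'x::ab_group_add \<Rightarrow> 'x) \<Rightarrow> ('v \<Rightarrow> 'v \<Rightarrow> 'x) \<Rightarrow> bool" where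
  "bilin V s' \<beta> \<longleftrightarrow> (\<forall>a\<in>carr V. linear_map_on (scl V) s' (carr V) (\<beta> a)) \<and>
     (\<forall>b\<in>carr V. linear_map_on (scl V) s' (carr V) (\<lambda>a. \<beta> a b))"

definition trilin ::
  "('k::field, 'v::ab_group_add, 'z) gvs_scheme \<Rightarrow> ('k \<Rightarrow> 'x::ab_group_add \<Rightarrow> 'x) \<Rightarrow> ('v \<Rightarrow> 'v \<Rightarrow> 'v \<Rightarrow> 'x) \<Rightarrow> bool" where
  "trilin V s' T \<longleftrightarrow> (\<forall>a\<in>carr V. bilin V s' (T a)) \<and>
     (\<forall>b\<in>carr V. \<forall>c\<in>carr V. linear_map_on (scl V) s' (carr V) (\<lambda>a. T a b c))"

lemma bilin_cong:
  "gvec V \<Longrightarrow> (\<And>a b. a \<in> carr V \<Longrightarrow> b \<in> carr V \<Longrightarrow> \<beta> a b = \<gamma> a b) \<Longrightarrow> bilin V s' \<beta> = bilin V s' \<gamma>"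
  unfolding bilin_def linear_map_on_def using gvec.carr_add[of V] gvec.carr_scl[of V]
  by (auto simp: Ball_def)

lemma bilinD:
  assumes "bilin V s' \<beta>"
  shows "a \<in> carr V \<Longrightarrow> b \<in> carr V \<Longrightarrow> c \<in> carr V \<Longrightarrow> \<beta> (a + b) c = \<beta> a c + \<beta> b c"
    and "a \<in> carr V \<Longrightarrow> b \<in> carr V \<Longrightarrow> c \<in> carr V \<Longrightarrow> \<beta> a (b + c) = \<beta> a b + \<beta> a c"
    and "a \<in> carr V \<Longrightarrow> b \<in> carr V \<Longrightarrow> \<beta> (scl V k a) b = s' k (\<beta> a b)"
    and "a \<in> carr V \<Longrightarrow> b \<in> carr V \<Longrightarrow> \<beta> a (scl V k b) = s' k (\<beta> a b)"
  using assms by (auto simp: bilin_def linear_map_on_def)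

lemma bilinI:
  assumes "\<And>a b c. a \<in> carr V \<Longrightarrow> b \<in> carr V \<Longrightarrow> c \<in> carr V \<Longrightarrow> \<beta> (a + b) c = \<beta> a c + \<beta> b c"
    and "\<And>a b c. a \<in> carr V \<Longrightarrow> b \<in> carr V \<Longrightarrow> c \<in> carr V \<Longrightarrow> \<beta> a (b + c) = \<beta> a b + \<beta> a c"
    and "\<And>a b k. a \<in> carr V \<Longrightarrow> b \<in> carr V \<Longrightarrow> \<beta> (scl V k a) b = s' k (\<beta> a b)"
    and "\<And>a b k. a \<in> carr V \<Longrightarrow> b \<in> carr V \<Longrightarrow> \<beta> a (scl V k b) = s' k (\<beta> a b)"
  shows "bilin V s' \<beta>"
  using assms by (auto simp: bilin_def linear_map_on_def)

lemma trilinI: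
  assumes "\<And>a b c d. a \<in> carr V \<Longrightarrow> b \<in> carr V \<Longrightarrow> c \<in> carr V \<Longrightarrow> d \<in> carr V \<Longrightarrow> T (a + b) c d = T a c d + T b c d"
    and "\<And>a b c d. a \<in> carr V \<Longrightarrow> b \<in> carr V \<Longrightarrow> c \<in> carr V \<Longrightarrow> d \<in> carr V \<Longrightarrow> T a (b + c) d = T a b d + T a c d"
    and "\<And>a b c d. a \<in> carr V \<Longrightarrow> b \<in> carr V \<Longrightarrow> c \<in> carr V \<Longrightarrow> d \<in> carr V \<Longrightarrow> T a b (c + d) = T a b c + T a b d"
    and "\<And>a b c k. a \<in> carr V \<Longrightarrow> b \<in> carr V \<Longrightarrow> c \<in> carr V \<Longrightarrow> T (scl V k a) b c = s' k (T a b c)"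
    and "\<And>a b c k. a \<in> carr V \<Longrightarrow> b \<in> carr V \<Longrightarrow> c \<in> carr V \<Longrightarrow> T a (scl V k b) c = s' k (T a b c)"
    and "\<And>a b c k. a \<in> carr V \<Longrightarrow> b \<in> carr V \<Longrightarrow> c \<in> carr V \<Longrightarrow> T a b (scl V k c) = s' k (T a b c)"
  shows "trilin V s' T"
  using assms by (auto simp: trilin_def bilin_def linear_map_on_def)

lemma trilinD:
  assumes "trilin V s' T"
  shows "a \<in> carr V \<Longrightarrow> b \<in> carr V \<Longrightarrow> c \<in> carr V \<Longrightarrow> d \<in> carr V \<Longrightarrow> T (a + b) c d = T a c d + T b c d"
    and "a \<in> carr V \<Longrightarrow> b \<in> carr V \<Longrightarrow> c \<in> carr V \<Longrightarrow> d \<in> carr V \<Longrightarrow> T a (b + c) d = T a b d + T a c d"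
    and "a \<in> carr V \<Longrightarrow> b \<in> carr V \<Longrightarrow> c \<in> carr V \<Longrightarrow> d \<in> carr V \<Longrightarrow> T a b (c + d) = T a b c + T a b d"
    and "a \<in> carr V \<Longrightarrow> b \<in> carr V \<Longrightarrow> c \<in> carr V \<Longrightarrow> T (scl V k a) b c = s' k (T a b c)"
    and "a \<in> carr V \<Longrightarrow> b \<in> carr V \<Longrightarrow> c \<in> carr V \<Longrightarrow> T a (scl V k b) c = s' k (T a b c)"
    and "a \<in> carr V \<Longrightarrow> b \<in> carr V \<Longrightarrow> c \<in> carr V \<Longrightarrow> T a b (scl V k c) = s' k (T a b c)"
  using assms by (auto simp: trilin_def bilin_def linear_map_on_def)

context gvec
begin

lemma tens2_bilin: "bilin V dscl (\<lambda>a b. tens (scl V) [a, b])"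
  using tens_split_add[OF vs.vector_space_axioms, of "[]" _ _ "[_]"]
    tens_split_add[OF vs.vector_space_axioms, of "[_]" _ _ "[]"]
  by (intro bilinI) simp_all

lemma tens3_trilin: "trilin V dscl (\<lambda>a b c. tens (scl V) [a, b, c])"
  using tens_split_add[OF vs.vector_space_axioms, of "[]" _ _ "[_, _]"]
    tens_split_add[OF vs.vector_space_axioms, of "[_]" _ _ "[_]"]
    tens_split_add[OF vs.vector_space_axioms, of "[_, _]" _ _ "[]"]
  by (intro trilinI) simp_all

lemma tens_zero: "tens (scl V) (xs @ 0 # ys) = 0"
  using tens_split_add(2)[OF vs.vector_space_axioms, of xs 0 0 ys] by (auto simp: dscl_def fun_eq_iff zero_fun_apply)

lemma tens_pow2_hom:
  assumes "t \<in> tens_pow V 2"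
  shows "\<exists>ps. hom_pairs V ps \<and> t = (\<Sum>(a, b)\<leftarrow>ps. tens (scl V) [a, b])"
proof -
  define good where "good = (\<lambda>t. \<exists>ps. hom_pairs V ps \<and> t = (\<Sum>(a, b)\<leftarrow>ps. tens (scl V) [a, b]))"
  interpret T: vector_space "dscl :: 'k \<Rightarrow> ('k, 'v) tensor \<Rightarrow> _" by (rule vs_tensor)
  note tb = bilinD[OF tens2_bilin]
  have z: "good 0" unfolding good_def by (rule exI[of _ "[]"]) (simp add: hom_pairs_def)
  have gadd: "good (t + u)" if tu: "good t" "good u" for t u
  proof -
    obtain ps qs where "hom_pairs V ps" "t = (\<Sum>(a, b)\<leftarrow>ps. tens (scl V) [a, b])"
      "hom_pairs V qs" "u = (\<Sum>(a, b)\<leftarrow>qs. tens (scl V) [a, b])"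
      using tu unfolding good_def by blast
    then show ?thesis unfolding good_def
      by (intro exI[of _ "ps @ qs"]) (auto simp: hom_pairs_def)
  qed
  have base: "good (tens (scl V) [x, y])" if "x \<in> carr V" "y \<in> carr V" for x y
    using that
  proof (induction rule: carr_induct)
    case zero show ?case using z tens_zero[of "[]"] by simp
  next
    case (add x x') then show ?case by (simp add: tb(1) gadd)
  next
    case (hom n x)
    note x = hom
    from that(2) show ?case
    proof (induction rule: carr_induct)
      case zero show ?case using z tens_zero[of "[_]" "[]"] by simp
    next
      case (add y y') then show ?case using x by (simp add: tb(2) gr_carr gadd)
    next
      case (hom m y) then show ?case using x unfolding good_def hom_pairs_def
        by (intro exI[of _ "[(x, y)]"]) auto
    qed
  qed
  have "t \<in> T.span {tens (scl V) xs |xs. xs \<in> lists (carr V) \<and> length xs = 2}"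
    using assms by (simp add: tens_pow_def)
  then have "good t"
  proof (induction rule: T.span_induct_alt)
    case base show ?case by (rule z)
  next
    case (step c e u)
    then obtain xs where xs: "e = tens (scl V) xs" "xs \<in> lists (carr V)" "length xs = 2" by blast
    then obtain a b where "xs = [a, b]" by (metis length_0_conv length_Suc_conv numeral_2_eq_2)
    with xs base[of "scl V c a" b] tb(3)[of a b c] have "good (dscl c e)" by (auto simp: carr_scl)
    with step show ?case by (intro gadd)
  qed
  then show ?thesis by (simp add: good_def)
qed

lemma tens_lift_props:
  assumes "vector_space s'"
    and "\<And>xs ys. xs \<in> lists (carr V) \<Longrightarrow> ys \<in> lists (carr V) \<Longrightarrow> length xs + length ys + 1 = n \<Longrightarrow>
              linear_map_on (scl V) s' (carr V) (\<lambda>x. b (xs @ x # ys))"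
  shows "Vector_Spaces.linear dscl s' (tens_lift (scl V) s' (carr V) n b)"
    and "xs \<in> lists (carr V) \<Longrightarrow> length xs = n \<Longrightarrow> tens_lift (scl V) s' (carr V) n b (tens (scl V) xs) = b xs"
proof -
  have "\<exists>L. Vector_Spaces.linear dscl s' L \<and> (\<forall>xs\<in>lists (carr V). length xs = n \<longrightarrow> L (tens (scl V) xs) = b xs)"
    by (rule tensor_universal[OF vs.vector_space_axioms assms(1) carr_subspace assms(2)])
  from someI_ex[OF this]
  have "Vector_Spaces.linear dscl s' (tens_lift (scl V) s' (carr V) n b) \<and> 
    (\<forall>xs\<in>lists (carr V). length xs = n \<longrightarrow> tens_lift (scl V) s' (carr V) n b (tens (scl V) xs) = b xs)"
    unfolding tens_lift_def .
  then show "Vector_Spaces.linear dscl s' (tens_lift (scl V) s' (carr V) n b)"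
    "xs \<in> lists (carr V) \<Longrightarrow> length xs = n \<Longrightarrow> tens_lift (scl V) s' (carr V) n b (tens (scl V) xs) = b xs"
    by blast+
qed

lemma tens_lift2:
  assumes "vector_space s'" "bilin V s' \<beta>"
  shows "Vector_Spaces.linear dscl s' (tens_lift (scl V) s' (carr V) 2 (\<lambda>xs. \<beta> (xs ! 0) (xs ! 1)))"
    and "a \<in> carr V \<Longrightarrow> b \<in> carr V \<Longrightarrow>
      tens_lift (scl V) s' (carr V) 2 (\<lambda>xs. \<beta> (xs ! 0) (xs ! 1)) (tens (scl V) [a, b]) = \<beta> a b"
proof -
  have *: "linear_map_on (scl V) s' (carr V) (\<lambda>x. (\<lambda>xs. \<beta> (xs ! 0) (xs ! 1)) (xs @ x # ys))"
    if "xs \<in> lists (carr V)" "ys \<in> lists (carr V)" "length xs + length ys + 1 = 2" for xs ys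
  proof (cases xs)
    case Nil
    with that obtain y where "ys = [y]" by (cases ys) auto
    with Nil that assms(2) show ?thesis by (simp add: bilin_def)
  next
    case (Cons x xs')
    with that have "xs' = []" "ys = []" by auto
    with Cons that assms(2) show ?thesis by (simp add: bilin_def)
  qed
  show "Vector_Spaces.linear dscl s' (tens_lift (scl V) s' (carr V) 2 (\<lambda>xs. \<beta> (xs ! 0) (xs ! 1)))"
    by (rule tens_lift_props(1)[OF assms(1) *])
  show "a \<in> carr V \<Longrightarrow> b \<in> carr V \<Longrightarrow>
      tens_lift (scl V) s' (carr V) 2 (\<lambda>xs. \<beta> (xs ! 0) (xs ! 1)) (tens (scl V) [a, b]) = \<beta> a b"
    using tens_lift_props(2)[OF assms(1) *, where xs="[a, b]"] by (simp add: numeral_2_eq_2)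
qed

lemma bilin_lift: 
  assumes "vector_space s'" "bilin V s' \<beta>"
  obtains L where "Vector_Spaces.linear dscl s' L" 
    "\<And>a b. a \<in> carr V \<Longrightarrow> b \<in> carr V \<Longrightarrow> L (tens (scl V) [a, b]) = \<beta> a b"
  by (rule that[OF tens_lift2[OF assms]])

lemma trilin_lift: 
  assumes "vector_space s'" "trilin V s' T"
  obtains L where "Vector_Spaces.linear dscl s' L" 
    "\<And>a b c. a \<in> carr V \<Longrightarrow> b \<in> carr V \<Longrightarrow> c \<in> carr V \<Longrightarrow> L (tens (scl V) [a, b, c]) = T a b c"
proof -
  have *: "linear_map_on (scl V) s' (carr V) (\<lambda>x. (\<lambda>xs. T (xs ! 0) (xs ! 1) (xs ! 2)) (xs @ x # ys))"
    if "xs \<in> lists (carr V)" "ys \<in> lists (carr V)" "length xs + length ys + 1 = 3" for xs ys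
  proof -
    from that(3) consider "length xs = 0" "length ys = 2" | "length xs = 1" "length ys = 1" | "length xs = 2" "length ys = 0"
      by linarith
    then show ?thesis
    proof cases
      case 1
      then obtain y z where "xs = []" "ys = [y, z]" by (auto simp: length_Suc_conv numeral_2_eq_2)
      with that assms(2) show ?thesis by (simp add: trilin_def bilin_def)
    next
      case 2
      then obtain y z where "xs = [y]" "ys = [z]" by (auto simp: length_Suc_conv)
      with that assms(2) show ?thesis by (simp add: trilin_def bilin_def)
    next
      case 3
      then obtain y z where "ys = []" "xs = [y, z]" by (auto simp: length_Suc_conv numeral_2_eq_2)
      with that assms(2) show ?thesis by (simp add: trilin_def bilin_def)
    qed
  qed
  have "\<exists>L. Vector_Spaces.linear dscl s' L \<and> (\<forall>xs\<in>lists (carr V). length xs = 3 \<longrightarrow> L (tens (scl V) xs) = 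
      (\<lambda>xs. T (xs ! 0) (xs ! 1) (xs ! 2)) xs)"
    by (rule tensor_universal[OF vs.vector_space_axioms assms(1) carr_subspace *])
  then obtain L where L: "Vector_Spaces.linear dscl s' L" "\<And>xs. xs\<in>lists (carr V) \<Longrightarrow> length xs = 3 \<Longrightarrow> L (tens (scl V) xs) = 
      T (xs ! 0) (xs ! 1) (xs ! 2)" by blast
  show ?thesis by (rule that[OF L(1)]) (use L(2)[of "[_, _, _]"] in simp)
qed

end

text \<open>A list of pairs of homogeneous elements representing \<open>\<delta>(v) = \<Sum> a \<otimes> b\<close>, and the sum over it of the
  values of a bilinear map, which does not depend on the choice.\<close>

definition sw :: "('k::field_char_0, 'v::ab_group_add) mv \<Rightarrow> 'v \<Rightarrow> ('v \<times> 'v) list" where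
  "sw V v = (SOME ps. hom_pairs V ps \<and> coprod V v = (\<Sum>(a, b)\<leftarrow>ps. tens (scl V) [a, b]))"

definition Sw :: "('k::field_char_0, 'v::ab_group_add) mv \<Rightarrow> ('v \<Rightarrow> 'v \<Rightarrow> 'x::ab_group_add) \<Rightarrow> 'v \<Rightarrow> 'x" where
  "Sw V \<beta> v = (\<Sum>(a, b)\<leftarrow>sw V v. \<beta> a b)"

locale precog = gvec V for V :: "('k::field_char_0, 'v::ab_group_add) mv" +
  assumes coprod_mem: "v \<in> carr V \<Longrightarrow> coprod V v \<in> tens_pow V 2"
    and coprod_linear: "linear_map_on (scl V) dscl (carr V) (coprod V)"
begin

lemma sw_spec:
  assumes "v \<in> carr V"
  shows "hom_pairs V (sw V v)" "coprod V v = (\<Sum>(a, b)\<leftarrow>sw V v. tens (scl V) [a, b])"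
  using someI_ex[OF tens_pow2_hom[OF coprod_mem[OF assms]]] unfolding sw_def by blast+

lemma sw_hom: "v \<in> carr V \<Longrightarrow> (a, b) \<in> set (sw V v) \<Longrightarrow> \<exists>i j. a \<in> gr V i \<and> b \<in> gr V j"
  using sw_spec(1) by (fastforce simp: hom_pairs_def)

lemma sw_carr: "v \<in> carr V \<Longrightarrow> (a, b) \<in> set (sw V v) \<Longrightarrow> a \<in> carr V \<and> b \<in> carr V"
  using sw_hom gr_carr by blast

lemma coprod_Sw: "v \<in> carr V \<Longrightarrow> coprod V v = Sw V (\<lambda>a b. tens (scl V) [a, b]) v"
  using sw_spec by (simp add: Sw_def)

lemma Sw_cong_hom:
  assumes "v \<in> carr V" "\<And>a b i j. a \<in> gr V i \<Longrightarrow> b \<in> gr V j \<Longrightarrow> \<beta> a b = \<gamma> a b"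
  shows "Sw V \<beta> v = Sw V \<gamma> v"
proof -
  have "map (\<lambda>(a, b). \<beta> a b) (sw V v) = map (\<lambda>(a, b). \<gamma> a b) (sw V v)"
    using sw_hom[OF assms(1)] assms(2) by (auto; blast)
  then show ?thesis unfolding Sw_def by (rule arg_cong)
qed

lemma Sw_cong:
  "v \<in> carr V \<Longrightarrow> (\<And>a b. a \<in> carr V \<Longrightarrow> b \<in> carr V \<Longrightarrow> \<beta> a b = \<gamma> a b) \<Longrightarrow> Sw V \<beta> v = Sw V \<gamma> v"
  by (rule Sw_cong_hom) (auto intro: gr_carr)

lemma Sw_plus: "Sw V (\<lambda>a b. \<beta> a b + \<gamma> a b) v = Sw V \<beta> v + Sw V \<gamma> v"
proof -
  have "(\<Sum>(a, b)\<leftarrow>ps. \<beta> a b + \<gamma> a b) = (\<Sum>(a, b)\<leftarrow>ps. \<beta> a b) + (\<Sum>(a, b)\<leftarrow>ps. \<gamma> a b)" for ps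
    by (induction ps) (auto simp: algebra_simps)
  then show ?thesis by (simp add: Sw_def)
qed

lemma Sw_sum: 
  fixes \<beta> :: "'i \<Rightarrow> 'v \<Rightarrow> 'v \<Rightarrow> 'b::ab_group_add"
  shows "Sw V (\<lambda>a b. \<Sum>i\<in>I. \<beta> i a b) v = (\<Sum>i\<in>I. Sw V (\<beta> i) v)"
proof -
  have "(\<Sum>(a, b)\<leftarrow>ps. 0 :: 'b) = 0" for ps :: "('v \<times> 'v) list" by (induction ps) auto
  then have z: "Sw V (\<lambda>a b. 0 :: 'b) v = 0" by (simp add: Sw_def)
  show ?thesis by (induction I rule: infinite_finite_induct) (simp_all add: Sw_plus z)
qed

lemma Sw_push:
  assumes "v \<in> carr V" "\<And>a b. a \<in> carr V \<Longrightarrow> b \<in> carr V \<Longrightarrow> \<beta> a b \<in> A"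
    and "0 \<in> A" "\<And>x y. x \<in> A \<Longrightarrow> y \<in> A \<Longrightarrow> x + y \<in> A"
    and "\<And>x y. x \<in> A \<Longrightarrow> y \<in> A \<Longrightarrow> f (x + y) = f x + f y"
  shows "f (Sw V \<beta> v) = Sw V (\<lambda>a b. f (\<beta> a b)) v" and "Sw V \<beta> v \<in> A"
proof -
  have f0: "f 0 = 0" using assms(5)[OF assms(3,3)] by simp
  have "(\<Sum>(a, b)\<leftarrow>ps. \<beta> a b) \<in> A \<and> f (\<Sum>(a, b)\<leftarrow>ps. \<beta> a b) = (\<Sum>(a, b)\<leftarrow>ps. f (\<beta> a b))"
    if "\<forall>(a, b)\<in>set ps. a \<in> carr V \<and> b \<in> carr V" for ps
    using that by (induction ps) (auto simp: f0 assms)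
  moreover have "\<forall>(a, b)\<in>set (sw V v). a \<in> carr V \<and> b \<in> carr V" using sw_carr[OF assms(1)] by blast
  ultimately show "f (Sw V \<beta> v) = Sw V (\<lambda>a b. f (\<beta> a b)) v" "Sw V \<beta> v \<in> A"
    unfolding Sw_def by blast+
qed

lemma Sw_linear_app: "v \<in> carr V \<Longrightarrow> Vector_Spaces.linear s s' L \<Longrightarrow> L (Sw V \<beta> v) = Sw V (\<lambda>a b. L (\<beta> a b)) v"
  unfolding Sw_def by (rule linear_sum_list)

lemma Sw_scl_right: "vector_space s' \<Longrightarrow> v \<in> carr V \<Longrightarrow> Sw V (\<lambda>a b. s' c (\<beta> a b)) v = s' c (Sw V \<beta> v)"
  by (rule sym, rule Sw_push(1)[where A=UNIV]) (auto simp: vector_space.vector_space_assms)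

lemma Sw_eqI:
  assumes "v \<in> carr V" "vector_space s'" "bilin V s' \<beta>"
    and "coprod V v = (\<Sum>(a, b)\<leftarrow>ps. tens (scl V) [a, b])" "\<And>a b. (a, b) \<in> set ps \<Longrightarrow> a \<in> carr V \<and> b \<in> carr V"
  shows "Sw V \<beta> v = (\<Sum>(a, b)\<leftarrow>ps. \<beta> a b)"
proof -
  obtain L where L: "Vector_Spaces.linear dscl s' L" 
    "\<And>a b. a \<in> carr V \<Longrightarrow> b \<in> carr V \<Longrightarrow> L (tens (scl V) [a, b]) = \<beta> a b"
    using bilin_lift[OF assms(2,3)] by blast
  have *: "L (\<Sum>(a, b)\<leftarrow>qs. tens (scl V) [a, b]) = (\<Sum>(a, b)\<leftarrow>qs. \<beta> a b)"
    if "\<And>a b. (a, b) \<in> set qs \<Longrightarrow> a \<in> carr V \<and> b \<in> carr V" for qs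
  proof -
    have "map (\<lambda>(a, b). L (tens (scl V) [a, b])) qs = map (\<lambda>(a, b). \<beta> a b) qs"
      using that L(2) by (auto; blast)
    then show ?thesis unfolding linear_sum_list[OF L(1)] by (rule arg_cong)
  qed
  show ?thesis using *[of ps] *[of "sw V v"] assms(5) sw_carr[OF assms(1)] sw_spec(2)[OF assms(1)] assms(4)
    by (simp add: Sw_def)
qed

lemma Sw_lift:
  assumes "v \<in> carr V" "vector_space s'" "bilin V s' \<beta>"
  shows "tens_lift (scl V) s' (carr V) 2 (\<lambda>xs. \<beta> (xs ! 0) (xs ! 1)) (coprod V v) = Sw V \<beta> v"
  unfolding coprod_Sw[OF assms(1)] Sw_linear_app[OF assms(1) tens_lift2(1)[OF assms(2,3)]]
  by (rule Sw_cong[OF assms(1)]) (rule tens_lift2(2)[OF assms(2,3)])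

lemma Sw_linear:
  assumes "vector_space s'" "bilin V s' \<beta>"
  shows "linear_map_on (scl V) s' (carr V) (Sw V \<beta>)"
proof -
  define L where "L = tens_lift (scl V) s' (carr V) 2 (\<lambda>xs. \<beta> (xs ! 0) (xs ! 1))"
  have L: "Vector_Spaces.linear dscl s' L" unfolding L_def by (rule tens_lift2(1)[OF assms])
  interpret L: Vector_Spaces.linear dscl s' L by (rule L)
  have "Sw V \<beta> v = L (coprod V v)" if "v \<in> carr V" for v
    unfolding L_def by (rule Sw_lift[OF that assms, symmetric])
  then show ?thesis using coprod_linear
    unfolding linear_map_on_def by (auto simp: carr_add carr_scl L.add L.scale)
qed

lemma Sw_add: "vector_space s' \<Longrightarrow> bilin V s' \<beta> \<Longrightarrow> v \<in> carr V \<Longrightarrow> w \<in> carr V \<Longrightarrow> Sw V \<beta> (v + w) = Sw V \<beta> v + Sw V \<beta> w"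
  and Sw_scl: "vector_space s' \<Longrightarrow> bilin V s' \<beta> \<Longrightarrow> v \<in> carr V \<Longrightarrow> Sw V \<beta> (scl V c v) = s' c (Sw V \<beta> v)"
  using Sw_linear[of s' \<beta>] by (auto simp: linear_map_on_def)

lemma bilin_Sw1:
  assumes "vector_space s'" "trilin V s' T"
  shows "bilin V s' (\<lambda>a b. Sw V (\<lambda>a1 a2. T a1 a2 b) a)"
proof -
  have b: "bilin V s' (\<lambda>a1 a2. T a1 a2 b)" if "b \<in> carr V" for b
    using trilinD[OF assms(2)] that by (intro bilinI) auto
  have p: "Sw V (\<lambda>a1 a2. T a1 a2 (b + c)) a = Sw V (\<lambda>a1 a2. T a1 a2 b) a + Sw V (\<lambda>a1 a2. T a1 a2 c) a"
    if "a \<in> carr V" "b \<in> carr V" "c \<in> carr V" for a b c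
    unfolding Sw_plus[symmetric] by (rule Sw_cong) (use that trilinD[OF assms(2)] in auto)
  have q: "Sw V (\<lambda>a1 a2. T a1 a2 (scl V c b)) a = s' c (Sw V (\<lambda>a1 a2. T a1 a2 b) a)"
    if "a \<in> carr V" "b \<in> carr V" for a b c
    unfolding Sw_scl_right[OF assms(1) that(1), symmetric] by (rule Sw_cong) (use that trilinD[OF assms(2)] in auto)
  show ?thesis by (rule bilinI) (auto simp: p q Sw_add[OF assms(1) b] Sw_scl[OF assms(1) b])
qed

lemma bilin_Sw2:
  assumes "vector_space s'" "trilin V s' T"
  shows "bilin V s' (\<lambda>a b. Sw V (\<lambda>b1 b2. T a b1 b2) b)"
proof -
  have b: "bilin V s' (\<lambda>b1 b2. T a b1 b2)" if "a \<in> carr V" for a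
    using trilinD[OF assms(2)] that by (intro bilinI) auto
  have p: "Sw V (\<lambda>a1 a2. T (b + c) a1 a2) a = Sw V (\<lambda>a1 a2. T b a1 a2) a + Sw V (\<lambda>a1 a2. T c a1 a2) a"
    if "a \<in> carr V" "b \<in> carr V" "c \<in> carr V" for a b c
    unfolding Sw_plus[symmetric] by (rule Sw_cong) (use that trilinD[OF assms(2)] in auto)
  have q: "Sw V (\<lambda>a1 a2. T (scl V c b) a1 a2) a = s' c (Sw V (\<lambda>a1 a2. T b a1 a2) a)"
    if "a \<in> carr V" "b \<in> carr V" for a b c
    unfolding Sw_scl_right[OF assms(1) that(1), symmetric] by (rule Sw_cong) (use that trilinD[OF assms(2)] in auto)
  show ?thesis by (rule bilinI) (auto simp: p q Sw_add[OF assms(1) b] Sw_scl[OF assms(1) b])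
qed

end

section \<open>Graded cocommutative coalgebras\<close>

text \<open>Conilpotency is added only in the next locale: it speaks of the iterated reduced coproduct, and for the symmetric bialgebra
  its proof uses the rest of the coalgebra structure.\<close>

locale gcog0 = gvec V for V :: "('k::field_char_0, 'v::ab_group_add) mv" +
  assumes cog: "graded_cocomm_coalgebra V"
    and unit_gr: "unit V \<in> gr V 0"
    and coprod_unit: "coprod V (unit V) = tens (scl V) [unit V, unit V]"
    and counit_unit: "counit V (unit V) = 1"

locale gcog = gcog0 +
  assumes conil: "conilpotent V"

sublocale gcog0 \<subseteq> precog
  using cog by unfold_locales (auto simp: graded_cocomm_coalgebra_def)

context gvec
begin

lemma tens2_neg: "a \<in> carr V \<Longrightarrow> b \<in> carr V \<Longrightarrow> tens (scl V) [- a, b] = - tens (scl V) [a, b]"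
  "a \<in> carr V \<Longrightarrow> b \<in> carr V \<Longrightarrow> tens (scl V) [a, - b] = - tens (scl V) [a, b]"
  using bilinD(3,4)[OF tens2_bilin, of a b "-1"] by (auto simp: dscl_def fun_eq_iff)

lemma tens_swap_props:
  shows "Vector_Spaces.linear dscl dscl (tens_swap V)"
    and "x \<in> gr V i \<Longrightarrow> y \<in> gr V j \<Longrightarrow> tens_swap V (tens (scl V) [x, y]) = ksign i j (tens (scl V) [y, x])"
proof -
  \<comment> \<open>the sign is the bilinear expression \<open>(1 + p + q - p q) / 2\<close> in the parities \<open>p, q = \<plusminus> 1\<close>\<close>
  define \<sigma> where "\<sigma> = (\<lambda>x y. dscl (1/2) (tens (scl V) [y, x] + tens (scl V) [y, par V x]
      + tens (scl V) [par V y, x] - tens (scl V) [par V y, par V x]))"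
  interpret par: Vector_Spaces.linear "scl V" "scl V" "par V" by (rule par_linear)
  note tb = bilinD[OF tens2_bilin]
  have b: "bilin V dscl \<sigma>"
    by (rule bilinI) (auto simp: \<sigma>_def par.add par.scale tb par_carr fun_eq_iff dscl_def plus_fun_apply algebra_simps
        add_divide_distrib)
  have dscl_half: "dscl (1/2) (t + t) = t" for t :: "('k, 'v) tensor"
    by (auto simp: dscl_def fun_eq_iff plus_fun_apply)
  have val: "\<sigma> x y = ksign i j (tens (scl V) [y, x])" if "x \<in> gr V i" "y \<in> gr V j" for x y i j
    using that[THEN gr_carr] dscl_half[of "tens (scl V) [y, x]"] dscl_half[of "- tens (scl V) [y, x]"]
    by (auto simp: \<sigma>_def par_hom[OF that(1)] par_hom[OF that(2)] ksign_def tens2_neg carr_neg)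
  obtain L where L: "Vector_Spaces.linear dscl dscl L" 
    "\<And>a b. a \<in> carr V \<Longrightarrow> b \<in> carr V \<Longrightarrow> L (tens (scl V) [a, b]) = \<sigma> a b"
    using bilin_lift[OF vs_tensor b] by blast
  have "Vector_Spaces.linear dscl dscl L \<and>
        (\<forall>i j. \<forall>x\<in>gr V i. \<forall>y\<in>gr V j. L (tens (scl V) [x, y]) = ksign i j (tens (scl V) [y, x]))"
    using L val by (auto simp: gr_carr)
  from someI[where P="\<lambda>L. Vector_Spaces.linear dscl dscl L \<and>
        (\<forall>i j. \<forall>x\<in>gr V i. \<forall>y\<in>gr V j. L (tens (scl V) [x, y]) = ksign i j (tens (scl V) [y, x]))", OF this]
  have *: "Vector_Spaces.linear dscl dscl (tens_swap V) \<and>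
        (\<forall>i j. \<forall>x\<in>gr V i. \<forall>y\<in>gr V j. tens_swap V (tens (scl V) [x, y]) = ksign i j (tens (scl V) [y, x]))"
    unfolding tens_swap_def .
  show "Vector_Spaces.linear dscl dscl (tens_swap V)" using * by blast
  show "x \<in> gr V i \<Longrightarrow> y \<in> gr V j \<Longrightarrow> tens_swap V (tens (scl V) [x, y]) = ksign i j (tens (scl V) [y, x])"
    using * by blast
qed

lemma tens2_gr_pairs:
  assumes "t \<in> tens2_gr V n"
  shows "\<exists>ps. (\<forall>(a, b)\<in>set ps. \<exists>i j. a \<in> gr V i \<and> b \<in> gr V j \<and> i + j = n) \<and> t = (\<Sum>(a, b)\<leftarrow>ps. tens (scl V) [a, b])"
proof -
  interpret T: vector_space "dscl :: 'k \<Rightarrow> ('k, 'v) tensor \<Rightarrow> _" by (rule vs_tensor)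
  have "t \<in> T.span {tens (scl V) [x, y] | x y i j. x \<in> gr V i \<and> y \<in> gr V j \<and> i + j = n}"
    using assms by (simp add: tens2_gr_def)
  then show ?thesis
  proof (induction rule: T.span_induct_alt)
    case base show ?case by (intro exI[of _ "[]"]) simp
  next
    case (step c e u)
    then obtain x y i j where e: "e = tens (scl V) [x, y]" "x \<in> gr V i" "y \<in> gr V j" "i + j = n" by blast
    from step obtain ps where ps: "\<forall>(a, b)\<in>set ps. \<exists>i j. a \<in> gr V i \<and> b \<in> gr V j \<and> i + j = n"
      "u = (\<Sum>(a, b)\<leftarrow>ps. tens (scl V) [a, b])" by blast
    have "dscl c e + u = (\<Sum>(a, b)\<leftarrow>(scl V c x, y) # ps. tens (scl V) [a, b])"
      using bilinD(3)[OF tens2_bilin, of x y c] e ps by (simp add: gr_carr)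
    moreover have "\<forall>(a, b)\<in>set ((scl V c x, y) # ps). \<exists>i j. a \<in> gr V i \<and> b \<in> gr V j \<and> i + j = n"
      using ps e gr_scl by (auto; blast)
    ultimately show ?case by blast
  qed
qed

end

context precog
begin

lemma coassoc_left:
  assumes "v \<in> carr V"
  shows "tens_lift (scl V) dscl (carr V) 2
      (\<lambda>xs. tens_app (scl V) (coprod V (xs ! 0)) (tens (scl V) [xs ! 1])) (coprod V v) =
    Sw V (\<lambda>a b. Sw V (\<lambda>a1 a2. tens (scl V) [a1, a2, b]) a) v"
proof -
  have l: "tens_app (scl V) (coprod V a) (tens (scl V) [b]) = Sw V (\<lambda>a1 a2. tens (scl V) [a1, a2, b]) a" if "a \<in> carr V" for a b
    unfolding Sw_def sw_spec(2)[OF that] tens_app_sum_left ..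
  have bl: "bilin V dscl (\<lambda>a b. tens_app (scl V) (coprod V a) (tens (scl V) [b]))"
    by (subst bilin_cong[OF gvec_axioms l]) (auto intro: bilin_Sw1[OF vs_tensor tens3_trilin])
  show ?thesis unfolding Sw_lift[OF assms vs_tensor bl] by (rule Sw_cong[OF assms l])
qed

lemma coassoc_right:
  assumes "v \<in> carr V"
  shows "tens_lift (scl V) dscl (carr V) 2
      (\<lambda>xs. tens_app (scl V) (tens (scl V) [xs ! 0]) (coprod V (xs ! 1))) (coprod V v) =
    Sw V (\<lambda>a b. Sw V (\<lambda>b1 b2. tens (scl V) [a, b1, b2]) b) v"
proof -
  have r: "tens_app (scl V) (tens (scl V) [a]) (coprod V b) = Sw V (\<lambda>b1 b2. tens (scl V) [a, b1, b2]) b" if "b \<in> carr V" for a b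
    using tens_app_sum_right[OF vs.vector_space_axioms, of "[a]" "sw V b"]
    unfolding Sw_def sw_spec(2)[OF that] by simp
  have br: "bilin V dscl (\<lambda>a b. tens_app (scl V) (tens (scl V) [a]) (coprod V b))"
    by (subst bilin_cong[OF gvec_axioms r]) (auto intro: bilin_Sw2[OF vs_tensor tens3_trilin])
  show ?thesis unfolding Sw_lift[OF assms vs_tensor br] by (rule Sw_cong[OF assms r])
qed

lemma Sw_gr_pairs:
  assumes "v \<in> carr V" "coprod V v \<in> tens2_gr V n"
  obtains ps where "\<And>a b. (a, b) \<in> set ps \<Longrightarrow> \<exists>i j. a \<in> gr V i \<and> b \<in> gr V j \<and> i + j = n"
    and "\<And>s' \<beta>. vector_space s' \<Longrightarrow> bilin V s' \<beta> \<Longrightarrow> Sw V \<beta> v = (\<Sum>(a, b)\<leftarrow>ps. \<beta> a b)"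
proof -
  from tens2_gr_pairs[OF assms(2)] obtain ps where
    ps: "\<forall>(a, b)\<in>set ps. \<exists>i j. a \<in> gr V i \<and> b \<in> gr V j \<and> i + j = n" 
    "coprod V v = (\<Sum>(a, b)\<leftarrow>ps. tens (scl V) [a, b])" by blast
  show ?thesis
  proof (rule that[of ps])
    show "\<exists>i j. a \<in> gr V i \<and> b \<in> gr V j \<and> i + j = n" if "(a, b) \<in> set ps" for a b
      using ps(1) that by blast
    show "Sw V \<beta> v = (\<Sum>(a, b)\<leftarrow>ps. \<beta> a b)" if "vector_space s'" "bilin V s' \<beta>" for s' \<beta>
      by (rule Sw_eqI[OF assms(1) that ps(2)]) (use ps(1) gr_carr in blast)
  qed
qed

end

context gcog0
begin

lemma counit_add: "v \<in> carr V \<Longrightarrow> w \<in> carr V \<Longrightarrow> counit V (v + w) = counit V v + counit V w"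
  and counit_scl: "v \<in> carr V \<Longrightarrow> counit V (scl V c v) = c * counit V v"
  and counit_deg: "n \<noteq> 0 \<Longrightarrow> v \<in> gr V n \<Longrightarrow> counit V v = 0"
  using cog by (auto simp: graded_cocomm_coalgebra_def linear_map_on_def)

lemma unit_carr: "unit V \<in> carr V"
  using unit_gr by (rule gr_carr)

lemma Sw_unit: 
  assumes "vector_space s'" "bilin V s' \<beta>" shows "Sw V \<beta> (unit V) = \<beta> (unit V) (unit V)"
  using Sw_eqI[OF unit_carr assms, of "[(unit V, unit V)]"] by (simp add: coprod_unit unit_carr)

lemma Sw_gr_mem:
  assumes "v \<in> gr V n" "vector_space s'" "bilin V s' \<beta>"
    and A: "0 \<in> A" "\<And>x y. x \<in> A \<Longrightarrow> y \<in> A \<Longrightarrow> x + y \<in> A"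
    and "\<And>a b i j. a \<in> gr V i \<Longrightarrow> b \<in> gr V j \<Longrightarrow> i + j = n \<Longrightarrow> \<beta> a b \<in> A"
  shows "Sw V \<beta> v \<in> A"
proof -
  have "coprod V v \<in> tens2_gr V n" using cog assms(1) by (auto simp: graded_cocomm_coalgebra_def)
  from tens2_gr_pairs[OF this] obtain ps where
    ps: "\<forall>(a, b)\<in>set ps. \<exists>i j. a \<in> gr V i \<and> b \<in> gr V j \<and> i + j = n" 
    "coprod V v = (\<Sum>(a, b)\<leftarrow>ps. tens (scl V) [a, b])" by blast
  have "Sw V \<beta> v = (\<Sum>(a, b)\<leftarrow>ps. \<beta> a b)"
    by (rule Sw_eqI[OF gr_carr[OF assms(1)] assms(2,3) ps(2)]) (use ps(1) gr_carr in blast)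
  also have "\<dots> \<in> A" using ps(1) assms(6)
    by (induction ps) (auto intro: A)
  finally show ?thesis .
qed

lemma Sw_counit: 
  assumes "v \<in> carr V"
  shows "Sw V (\<lambda>a b. scl V (counit V a) b) v = v" "Sw V (\<lambda>a b. scl V (counit V b) a) v = v"
proof -
  have b: "bilin V (scl V) (\<lambda>a b. scl V (counit V a) b)" "bilin V (scl V) (\<lambda>a b. scl V (counit V b) a)"
    by (rule bilinI; simp add: counit_add counit_scl vs.scale_left_distrib vs.scale_right_distrib mult.commute)+
  show "Sw V (\<lambda>a b. scl V (counit V a) b) v = v" "Sw V (\<lambda>a b. scl V (counit V b) a) v = v"
    using Sw_lift[OF assms vs.vector_space_axioms b(1)] Sw_lift[OF assms vs.vector_space_axioms b(2)] cog assms 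
    by (simp_all add: graded_cocomm_coalgebra_def)
qed

text \<open>A bilinear map factors through the tensor product, so identities between tensors turn into identities between Sweedler
  sums.  In this form coassociativity and cocommutativity are applied from here on.\<close>

lemma coassoc:
  assumes "vector_space s'" "trilin V s' T" "v \<in> carr V"
  shows "Sw V (\<lambda>a b. Sw V (\<lambda>a1 a2. T a1 a2 b) a) v = Sw V (\<lambda>a b. Sw V (\<lambda>b1 b2. T a b1 b2) b) v"
proof -
  define t where "t = (\<lambda>a b c. tens (scl V) [a, b, c])"
  have *: "Sw V (\<lambda>a b. Sw V (\<lambda>a1 a2. t a1 a2 b) a) v = Sw V (\<lambda>a b. Sw V (\<lambda>b1 b2. t a b1 b2) b) v"
    using cog assms(3) unfolding t_def coassoc_left[OF assms(3), symmetric] coassoc_right[OF assms(3), symmetric]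
      graded_cocomm_coalgebra_def by blast
  obtain L where L: "Vector_Spaces.linear dscl s' L" 
    "\<And>a b c. a \<in> carr V \<Longrightarrow> b \<in> carr V \<Longrightarrow> c \<in> carr V \<Longrightarrow> L (t a b c) = T a b c"
    unfolding t_def using trilin_lift[OF assms(1,2)] by blast
  have "L (Sw V (\<lambda>a b. Sw V (\<lambda>a1 a2. t a1 a2 b) a) v) = Sw V (\<lambda>a b. Sw V (\<lambda>a1 a2. T a1 a2 b) a) v"
    unfolding Sw_linear_app[OF assms(3) L(1)]
    by (rule Sw_cong[OF assms(3)]) (auto simp: Sw_linear_app[OF _ L(1)] L(2) intro!: Sw_cong)
  moreover have "L (Sw V (\<lambda>a b. Sw V (\<lambda>b1 b2. t a b1 b2) b) v) = Sw V (\<lambda>a b. Sw V (\<lambda>b1 b2. T a b1 b2) b) v"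
    unfolding Sw_linear_app[OF assms(3) L(1)]
    by (rule Sw_cong[OF assms(3)]) (auto simp: Sw_linear_app[OF _ L(1)] L(2) intro!: Sw_cong)
  ultimately show ?thesis using * by simp
qed

lemma cocomm:
  assumes "vector_space s'" "bilin V s' \<gamma>" "v \<in> carr V"
    and sym: "\<And>a b i j. a \<in> gr V i \<Longrightarrow> b \<in> gr V j \<Longrightarrow> \<beta> a b = ksign i j (\<gamma> b a)"
  shows "Sw V \<beta> v = Sw V \<gamma> v"
proof -
  obtain L where L: "Vector_Spaces.linear dscl s' L" 
    "\<And>a b. a \<in> carr V \<Longrightarrow> b \<in> carr V \<Longrightarrow> L (tens (scl V) [a, b]) = \<gamma> a b"
    using bilin_lift[OF assms(1,2)] by blast
  have "tens_swap V (coprod V v) = coprod V v"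
    using cog assms(3) by (simp add: graded_cocomm_coalgebra_def)
  then have "L (Sw V (\<lambda>a b. tens (scl V) [a, b]) v) = L (Sw V (\<lambda>a b. tens_swap V (tens (scl V) [a, b])) v)"
    using Sw_linear_app[OF assms(3) tens_swap_props(1)] by (simp add: coprod_Sw[OF assms(3)])
  also have "\<dots> = Sw V \<beta> v"
    unfolding Sw_linear_app[OF assms(3) L(1)]
    by (rule Sw_cong_hom[OF assms(3)]) (simp add: tens_swap_props(2) linear_ksign[OF L(1)] L(2) gr_carr sym)
  also have "L (Sw V (\<lambda>a b. tens (scl V) [a, b]) v) = Sw V \<gamma> v"
    unfolding Sw_linear_app[OF assms(3) L(1)] by (rule Sw_cong[OF assms(3)]) (rule L(2))
  finally show ?thesis by simp
qed

end

section \<open>Graded commutative algebras\<close>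

locale galg = gvec W for W :: "('k::field_char_0, 'w::ab_group_add) mv" +
  assumes alg: "graded_comm_algebra W"
begin

lemma mult_carr: 
  assumes "x \<in> carr W" "y \<in> carr W" shows "mult W x y \<in> carr W"
  using assms(1)
proof (induction rule: carr_induct)
  case zero
  have "mult W (0 + 0) y = mult W 0 y + mult W 0 y"
    using alg assms(2) unfolding graded_comm_algebra_def linear_map_on_def by (metis carr_zero)
  then show ?case by simp
next
  case (add x x')
  have "mult W (x + x') y = mult W x y + mult W x' y"
    using alg assms(2) add(1,2) unfolding graded_comm_algebra_def linear_map_on_def by blast
  then show ?case using add by (simp add: carr_add)
next
  case (hom n x)
  note x = hom
  from assms(2) show ?case
  proof (induction rule: carr_induct)
    case zero
    have "mult W x (0 + 0) = mult W x 0 + mult W x 0"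
      using alg gr_carr[OF x] unfolding graded_comm_algebra_def linear_map_on_def by (metis carr_zero)
    then show ?case by simp
  next
    case (add y y')
    have "mult W x (y + y') = mult W x y + mult W x y'"
      using alg add(1,2) gr_carr[OF x] unfolding graded_comm_algebra_def linear_map_on_def by blast
    then show ?case using add by (simp add: carr_add)
  next
    case (hom m y)
    have "mult W x y \<in> gr W (n + m)" using alg x hom unfolding graded_comm_algebra_def by blast
    then show ?case by (rule gr_carr)
  qed
qed

lemma mult_bilin: "bilin W (scl W) (mult W)"
  using alg by (auto simp: graded_comm_algebra_def bilin_def)

lemmas mult_lin = bilinD[OF mult_bilin]

lemma mult_zero [simp]: "x \<in> carr W \<Longrightarrow> mult W x 0 = 0" "x \<in> carr W \<Longrightarrow> mult W 0 x = 0"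
  using mult_lin(4)[of x 0 0] mult_lin(3)[of 0 x 0] by simp_all

lemma mult_gr: "x \<in> gr W i \<Longrightarrow> y \<in> gr W j \<Longrightarrow> mult W x y \<in> gr W (i + j)"
  and mult_comm: "x \<in> gr W i \<Longrightarrow> y \<in> gr W j \<Longrightarrow> mult W x y = ksign i j (mult W y x)"
  and mult_assoc: "x \<in> carr W \<Longrightarrow> y \<in> carr W \<Longrightarrow> z \<in> carr W \<Longrightarrow> mult W (mult W x y) z = mult W x (mult W y z)"
  and unit_gr: "unit W \<in> gr W 0"
  and mult_unit [simp]: "x \<in> carr W \<Longrightarrow> mult W (unit W) x = x" "x \<in> carr W \<Longrightarrow> mult W x (unit W) = x"
  using alg unfolding graded_comm_algebra_def by blast+

lemma unit_carr [simp]: "unit W \<in> carr W"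
  using unit_gr by (rule gr_carr)

lemma mult_sum: 
  assumes "\<And>i. i \<in> I \<Longrightarrow> f i \<in> carr W" "y \<in> carr W"
  shows "mult W (sum f I) y = (\<Sum>i\<in>I. mult W (f i) y)" "mult W y (sum f I) = (\<Sum>i\<in>I. mult W y (f i))"
  using assms by (induction I rule: infinite_finite_induct) (auto simp: mult_lin carr_sum)

abbreviation sm :: "'w fps \<Rightarrow> 'w fps \<Rightarrow> 'w fps" (infixl "\<odot>" 70) where
  "x \<odot> y \<equiv> ser_mult (mult W) x y"

lemma sm_nth: "fps_nth (x \<odot> y) n = (\<Sum>i\<le>n. mult W (fps_nth x i) (fps_nth y (n - i)))"
  by (simp add: ser_mult_def)

lemma sm_carr: "x \<in> ser (carr W) \<Longrightarrow> y \<in> ser (carr W) \<Longrightarrow> x \<odot> y \<in> ser (carr W)"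
  by (auto simp: ser_def sm_nth intro!: carr_sum mult_carr)

lemma sm_gr: "x \<in> ser (gr W i) \<Longrightarrow> y \<in> ser (gr W j) \<Longrightarrow> x \<odot> y \<in> ser (gr W (i + j))"
  by (auto simp: ser_def sm_nth intro!: gr_sum mult_gr)

lemma sm_add_left: "x \<in> ser (carr W) \<Longrightarrow> x' \<in> ser (carr W) \<Longrightarrow> y \<in> ser (carr W) \<Longrightarrow> (x + x') \<odot> y = x \<odot> y + x' \<odot> y"
  and sm_add_right: "x \<in> ser (carr W) \<Longrightarrow> y \<in> ser (carr W) \<Longrightarrow> y' \<in> ser (carr W) \<Longrightarrow> x \<odot> (y + y') = x \<odot> y + x \<odot> y'"
  and sm_k_left: "x \<in> ser (carr W) \<Longrightarrow> y \<in> ser (carr W) \<Longrightarrow> k_act (scl W) c x \<odot> y = k_act (scl W) c (x \<odot> y)"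
  and sm_k_right: "x \<in> ser (carr W) \<Longrightarrow> y \<in> ser (carr W) \<Longrightarrow> x \<odot> k_act (scl W) c y = k_act (scl W) c (x \<odot> y)"
  by (auto simp: fps_eq_iff sm_nth ser_nth mult_lin sum.distrib vs.scale_sum_right)

lemma sm_zero [simp]: "x \<in> ser (carr W) \<Longrightarrow> x \<odot> 0 = 0" "x \<in> ser (carr W) \<Longrightarrow> 0 \<odot> x = 0"
  by (auto simp: fps_eq_iff sm_nth ser_nth)

lemma sm_comm: "x \<in> ser (gr W i) \<Longrightarrow> y \<in> ser (gr W j) \<Longrightarrow> x \<odot> y = ksign i j (y \<odot> x)"
proof (rule fps_ext)
  fix n assume a: "x \<in> ser (gr W i)" "y \<in> ser (gr W j)"
  have "fps_nth (x \<odot> y) n = (\<Sum>l\<le>n. ksign i j (mult W (fps_nth y (n - l)) (fps_nth x l)))"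
    unfolding sm_nth by (rule sum.cong) (use a in \<open>auto simp: mult_comm[where i=i and j=j] ser_nth\<close>)
  also have "\<dots> = (\<Sum>l\<le>n. ksign i j (mult W (fps_nth y l) (fps_nth x (n - l))))"
    by (rule sum.reindex_bij_witness[where i="\<lambda>l. n - l" and j="\<lambda>l. n - l"]) auto
  also have "\<dots> = fps_nth (ksign i j (y \<odot> x)) n"
    by (auto simp: ksign_def sm_nth sum_negf)
  finally show "fps_nth (x \<odot> y) n = fps_nth (ksign i j (y \<odot> x)) n" .
qed

lemma sm_assoc:
  assumes "x \<in> ser (carr W)" "y \<in> ser (carr W)" "z \<in> ser (carr W)"
  shows "(x \<odot> y) \<odot> z = x \<odot> (y \<odot> z)"
proof (rule fps_ext)
  fix n
  let ?f = "\<lambda>i j k. mult W (fps_nth x i) (mult W (fps_nth y j) (fps_nth z k))"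
  have "fps_nth ((x \<odot> y) \<odot> z) n = (\<Sum>j=0..n. \<Sum>i=0..j. ?f i (j - i) (n - j))"
    unfolding sm_nth atLeast0AtMost using assms
    by (auto intro!: sum.cong simp: mult_sum mult_carr ser_nth mult_assoc)
  also have "\<dots> = (\<Sum>j=0..n. \<Sum>i=0..n - j. ?f j i (n - j - i))" by (rule fps_mult_assoc_lemma)
  also have "\<dots> = fps_nth (x \<odot> (y \<odot> z)) n"
    unfolding sm_nth atLeast0AtMost using assms
    by (auto intro!: sum.cong simp: mult_sum mult_carr ser_nth)
  finally show "fps_nth ((x \<odot> y) \<odot> z) n = fps_nth (x \<odot> (y \<odot> z)) n" .
qed

lemma sm_const_left: 
  assumes "c \<in> carr W" "x \<in> ser (carr W)"
  shows "fps_nth (fps_const c \<odot> x) n = mult W c (fps_nth x n)"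
proof -
  have "fps_nth (fps_const c \<odot> x) n = (\<Sum>i\<le>n. if i = 0 then mult W c (fps_nth x n) else 0)"
    unfolding sm_nth by (rule sum.cong) (use assms in \<open>auto simp: ser_nth\<close>)
  then show ?thesis by simp
qed

lemma sm_const_right: 
  assumes "c \<in> carr W" "x \<in> ser (carr W)"
  shows "fps_nth (x \<odot> fps_const c) n = mult W (fps_nth x n) c"
proof -
  have "fps_nth (x \<odot> fps_const c) n = (\<Sum>i\<le>n. if i = n then mult W (fps_nth x n) c else 0)"
    unfolding sm_nth by (rule sum.cong) (use assms in \<open>auto simp: ser_nth\<close>)
  then show ?thesis by simp
qed

lemma sm_unit [simp]: "x \<in> ser (carr W) \<Longrightarrow> fps_const (unit W) \<odot> x = x" "x \<in> ser (carr W) \<Longrightarrow> x \<odot> fps_const (unit W) = x"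
  by (auto simp: fps_eq_iff sm_const_left sm_const_right ser_nth)

lemma sm_even_comm:
  assumes "c \<in> ser (gr W 0)" "x \<in> ser (carr W)" shows "c \<odot> x = x \<odot> c"
proof -
  have *: "mult W a b = mult W b a" if "a \<in> gr W 0" "b \<in> carr W" for a b
    using that(2)
  proof (induction rule: carr_induct)
    case zero show ?case using that by (simp add: gr_carr)
  next
    case (add x y) then show ?case using that(1) by (simp add: mult_lin gr_carr)
  next
    case (hom n x) then show ?case using mult_comm[OF that(1), of x n] by simp
  qed
  show ?thesis
  proof (rule fps_ext)
    fix n
    have "fps_nth (c \<odot> x) n = (\<Sum>l\<le>n. mult W (fps_nth x (n - l)) (fps_nth c l))"
      unfolding sm_nth by (rule sum.cong[OF refl *]) (use assms in \<open>auto simp: ser_nth\<close>)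
    also have "\<dots> = (\<Sum>l\<le>n. mult W (fps_nth x l) (fps_nth c (n - l)))"
      by (rule sum.reindex_bij_witness[where i="\<lambda>l. n - l" and j="\<lambda>l. n - l"]) auto
    finally show "fps_nth (c \<odot> x) n = fps_nth (x \<odot> c) n" by (simp add: sm_nth)
  qed
qed

lemma vanish_sm:
  assumes "vanish m x" "vanish n y" "x \<in> ser (carr W)" "y \<in> ser (carr W)"
  shows "vanish (m + n) (x \<odot> y)"
  unfolding vanish_def
proof (intro allI impI)
  fix i assume i: "i < m + n"
  have "mult W (fps_nth x j) (fps_nth y (i - j)) = 0" if "j \<le> i" for j
  proof (cases "j < m")
    case True then show ?thesis using assms by (simp add: vanish_def ser_nth)
  next
    case False
    then have "i - j < n" using i that by arith
    then show ?thesis using assms by (simp add: vanish_def ser_nth)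
  qed
  then show "fps_nth (x \<odot> y) i = 0" by (simp add: sm_nth)
qed

end

section \<open>The convolution algebra\<close>

definition lin :: "('k::field, 'v::ab_group_add, 'y) gvs_scheme \<Rightarrow> ('k, 'w::ab_group_add, 'z) gvs_scheme \<Rightarrow> ('v \<Rightarrow> 'w fps) \<Rightarrow> bool" where
  "lin V W \<phi> \<longleftrightarrow> \<phi> \<in> carr V \<rightarrow> ser (carr W) \<and> linear_map_on (scl V) (k_act (scl W)) (carr V) \<phi>"

definition hdeg :: "('k::field, 'v::ab_group_add, 'y) gvs_scheme \<Rightarrow> ('k, 'w::ab_group_add, 'z) gvs_scheme \<Rightarrow> int \<Rightarrow> ('v \<Rightarrow> 'w fps) \<Rightarrow> bool" where
  "hdeg V W d \<phi> \<longleftrightarrow> (\<forall>n. \<forall>x\<in>gr V n. \<phi> x \<in> ser (gr W (n + d)))"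

text \<open>Convolution for the restrictions of \<open>R\<close>-linear maps to \<open>V\<close>; \<open>ce\<close> is its unit, and \<open>pw\<close> forms the powers.\<close>

definition cv :: "('k::field_char_0, 'v::ab_group_add) mv \<Rightarrow> ('k, 'w::ab_group_add) mv \<Rightarrow> ('v \<Rightarrow> 'w fps) \<Rightarrow> ('v \<Rightarrow> 'w fps) \<Rightarrow> 'v \<Rightarrow> 'w fps" where
  "cv V W \<phi> \<psi> = Sw V (\<lambda>a b. ser_mult (mult W) (\<phi> a) (\<psi> b))"

definition ce :: "('k::field_char_0, 'v::ab_group_add) mv \<Rightarrow> ('k, 'w::ab_group_add) mv \<Rightarrow> 'v \<Rightarrow> 'w fps" where
  "ce V W v = fps_const (scl W (counit V v) (unit W))"

primrec pw :: "('k::field_char_0, 'v::ab_group_add) mv \<Rightarrow> ('k, 'w::ab_group_add) mv \<Rightarrow> ('v \<Rightarrow> 'w fps) \<Rightarrow> nat \<Rightarrow> 'v \<Rightarrow> 'w fps" where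
  "pw V W \<phi> 0 = ce V W"
| "pw V W \<phi> (Suc n) = cv V W \<phi> (pw V W \<phi> n)"

text \<open>The restrictions to \<open>V\<close> of the elements of \<open>Lin\<^sup>0\<close>.\<close>

definition small :: "('k::field_char_0, 'v::ab_group_add) mv \<Rightarrow> ('k, 'w::ab_group_add) mv \<Rightarrow> ('v \<Rightarrow> 'w fps) \<Rightarrow> bool" where
  "small V W \<phi> \<longleftrightarrow> lin V W \<phi> \<and> hdeg V W 0 \<phi> \<and> vanish 1 (\<phi> (unit V))"

text \<open>Substitution of \<open>\<phi>\<close> for the variable of a power series over \<open>\<bbbk>\<close>, with respect to convolution.\<close>

definition ev :: "('k::field_char_0, 'v::ab_group_add) mv \<Rightarrow> ('k, 'w::ab_group_add) mv \<Rightarrow> 'k fps \<Rightarrow> ('v \<Rightarrow> 'w fps) \<Rightarrow> 'v \<Rightarrow> 'w fps" where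
  "ev V W p \<phi> v = (\<Sum>n. k_act (scl W) (fps_nth p n) (pw V W \<phi> n v))"

primrec lprod :: "('k, 'w::ab_group_add) mv \<Rightarrow> ('v \<Rightarrow> 'w fps) \<Rightarrow> 'v list \<Rightarrow> 'w fps" where
  "lprod W g [] = fps_const (unit W)"
| "lprod W g (x # xs) = ser_mult (mult W) (g x) (lprod W g xs)"

lemma lin_mem: "lin V W \<phi> \<Longrightarrow> v \<in> carr V \<Longrightarrow> \<phi> v \<in> ser (carr W)"
  and lin_add: "lin V W \<phi> \<Longrightarrow> v \<in> carr V \<Longrightarrow> w \<in> carr V \<Longrightarrow> \<phi> (v + w) = \<phi> v + \<phi> w"
  and lin_scl: "lin V W \<phi> \<Longrightarrow> v \<in> carr V \<Longrightarrow> \<phi> (scl V c v) = k_act (scl W) c (\<phi> v)"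
  by (auto simp: lin_def linear_map_on_def)

lemma lin_scl_nth: "gvec W \<Longrightarrow> lin V W \<phi> \<Longrightarrow> v \<in> carr V \<Longrightarrow> fps_nth (\<phi> (scl V c v)) i = scl W c (fps_nth (\<phi> v) i)"
  by (simp add: lin_scl gvec.k_act_nth)

lemma linI:
  assumes "\<And>v. v \<in> carr V \<Longrightarrow> \<phi> v \<in> ser (carr W)"
    and "\<And>v w. v \<in> carr V \<Longrightarrow> w \<in> carr V \<Longrightarrow> \<phi> (v + w) = \<phi> v + \<phi> w"
    and "\<And>v c. v \<in> carr V \<Longrightarrow> \<phi> (scl V c v) = k_act (scl W) c (\<phi> v)"
  shows "lin V W \<phi>"
  using assms by (auto simp: lin_def linear_map_on_def)

lemma hdegD: "hdeg V W d \<phi> \<Longrightarrow> x \<in> gr V n \<Longrightarrow> \<phi> x \<in> ser (gr W (n + d))"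
  by (simp add: hdeg_def)

lemma smallD: 
  assumes "small V W \<phi>" shows "lin V W \<phi>" "hdeg V W 0 \<phi>" "vanish 1 (\<phi> (unit V))"
  using assms by (auto simp: small_def)

locale cpair = V: gcog V + W: galg W
  for V :: "('k::field_char_0, 'v::ab_group_add) mv" and W :: "('k, 'w::ab_group_add) mv"
begin

lemma lin_neg: assumes "lin V W \<phi>" "v \<in> carr V" shows "\<phi> (- v) = - \<phi> v"
  using lin_scl[OF assms, of "-1"] by (simp add: fps_eq_iff)

lemma lin_diff: "lin V W \<phi> \<Longrightarrow> v \<in> carr V \<Longrightarrow> w \<in> carr V \<Longrightarrow> \<phi> (v - w) = \<phi> v - \<phi> w"
  using lin_add[of V W \<phi> v "- w"] by (simp add: lin_neg V.carr_neg)

lemma lin_ksign: "lin V W \<phi> \<Longrightarrow> v \<in> carr V \<Longrightarrow> \<phi> (ksign i j v) = ksign i j (\<phi> v)"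
  by (simp add: ksign_def lin_neg)

lemma ksign_sm: 
  assumes "x \<in> ser (carr W)" "y \<in> ser (carr W)" shows "ksign i j x \<odot> y = ksign i j (x \<odot> y)"
proof -
  have "k_act (scl W) (-1) z = - z" for z by (simp add: fps_eq_iff)
  then have "(- x) \<odot> y = - (x \<odot> y)" using W.sm_k_left[OF assms, of "-1"] by simp
  then show ?thesis by (simp add: ksign_def)
qed

lemma sm_diff_left: "x \<in> ser (carr W) \<Longrightarrow> y \<in> ser (carr W) \<Longrightarrow> z \<in> ser (carr W) \<Longrightarrow> (x - y) \<odot> z = x \<odot> z - y \<odot> z"
  using W.sm_add_left[of "x - y" y z] by (simp add: W.ser_carr_diff)

lemma sm_diff_right: "x \<in> ser (carr W) \<Longrightarrow> y \<in> ser (carr W) \<Longrightarrow> z \<in> ser (carr W) \<Longrightarrow> z \<odot> (x - y) = z \<odot> x - z \<odot> y"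
  using W.sm_add_right[of z "x - y" y] by (simp add: W.ser_carr_diff)

lemma sm_bilin: "lin V W \<phi> \<Longrightarrow> lin V W \<psi> \<Longrightarrow> bilin V (k_act (scl W)) (\<lambda>a b. \<phi> a \<odot> \<psi> b)"
  by (rule bilinI) (simp_all add: lin_add lin_scl lin_mem W.sm_add_left W.sm_add_right W.sm_k_left W.sm_k_right)

lemma sm_trilin:
  assumes "lin V W \<phi>" "lin V W \<psi>" "lin V W \<chi>"
  shows "trilin V (k_act (scl W)) (\<lambda>a b c. (\<phi> a \<odot> \<psi> b) \<odot> \<chi> c)"
  by (rule trilinI)
    (simp_all add: assms[THEN lin_add] assms[THEN lin_scl] assms[THEN lin_mem] W.sm_carr W.ser_carr_k
      W.sm_add_left W.sm_add_right W.sm_k_left W.sm_k_right)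

lemma lin_ce: "lin V W (ce V W)"
  by (rule linI) (auto simp: ce_def V.counit_add V.counit_scl W.carr_scl fps_eq_iff W.vs.scale_left_distrib)

lemma hdeg_ce: "hdeg V W 0 (ce V W)"
  unfolding hdeg_def
proof (intro allI ballI)
  fix n x assume x: "x \<in> gr V n"
  show "ce V W x \<in> ser (gr W (n + 0))"
    by (cases "n = 0") (use x in \<open>auto simp: ce_def V.counit_deg W.gr_scl W.unit_gr\<close>)
qed

lemma ce_unit: "ce V W (unit V) = fps_const (unit W)"
  by (simp add: ce_def V.counit_unit)

lemma cv_mem: "lin V W \<phi> \<Longrightarrow> lin V W \<psi> \<Longrightarrow> v \<in> carr V \<Longrightarrow> cv V W \<phi> \<psi> v \<in> ser (carr W)"
  unfolding cv_def by (rule V.Sw_push(2)[where f="\<lambda>x. x"]) (auto intro: W.sm_carr lin_mem W.ser_carr_add)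

lemma lin_cv: "lin V W \<phi> \<Longrightarrow> lin V W \<psi> \<Longrightarrow> lin V W (cv V W \<phi> \<psi>)"
  using V.Sw_linear[OF W.k_act_vs sm_bilin[of \<phi> \<psi>]] cv_mem unfolding lin_def cv_def by auto

lemma cv_cong: "v \<in> carr V \<Longrightarrow> (\<And>x. x \<in> carr V \<Longrightarrow> \<phi> x = \<phi>' x) \<Longrightarrow> (\<And>x. x \<in> carr V \<Longrightarrow> \<psi> x = \<psi>' x) \<Longrightarrow>
    cv V W \<phi> \<psi> v = cv V W \<phi>' \<psi>' v"
  unfolding cv_def by (rule V.Sw_cong) auto

lemma hdeg_cv:
  assumes "lin V W \<phi>" "lin V W \<psi>" "hdeg V W p \<phi>" "hdeg V W q \<psi>" shows "hdeg V W (p + q) (cv V W \<phi> \<psi>)"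
  unfolding hdeg_def
proof (intro allI ballI)
  fix n x assume x: "x \<in> gr V n"
  show "cv V W \<phi> \<psi> x \<in> ser (gr W (n + (p + q)))"
    unfolding cv_def
  proof (rule V.Sw_gr_mem[OF x W.k_act_vs sm_bilin[OF assms(1,2)]])
    fix a b i j assume ab: "a \<in> gr V i" "b \<in> gr V j" "i + j = n"
    then have e: "i + p + (j + q) = n + (p + q)" by simp
    show "\<phi> a \<odot> \<psi> b \<in> ser (gr W (n + (p + q)))"
      using W.sm_gr[OF hdegD[OF assms(3) ab(1)] hdegD[OF assms(4) ab(2)]] unfolding e .
  qed (auto intro: W.ser_gr_add)
qed

lemma cv_unit: "lin V W \<phi> \<Longrightarrow> lin V W \<psi> \<Longrightarrow> cv V W \<phi> \<psi> (unit V) = \<phi> (unit V) \<odot> \<psi> (unit V)"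
  unfolding cv_def by (rule V.Sw_unit[OF W.k_act_vs sm_bilin])

lemma cv_assoc:
  assumes "lin V W \<phi>" "lin V W \<psi>" "lin V W \<chi>" "v \<in> carr V"
  shows "cv V W (cv V W \<phi> \<psi>) \<chi> v = cv V W \<phi> (cv V W \<psi> \<chi>) v"
proof -
  note mem = assms(1-3)[THEN lin_mem]
  have "cv V W (cv V W \<phi> \<psi>) \<chi> v = Sw V (\<lambda>a b. Sw V (\<lambda>a1 a2. (\<phi> a1 \<odot> \<psi> a2) \<odot> \<chi> b) a) v"
    unfolding cv_def[of V W "cv V W \<phi> \<psi>"]
  proof (rule V.Sw_cong[OF assms(4)])
    fix a b assume "a \<in> carr V" "b \<in> carr V"
    then show "cv V W \<phi> \<psi> a \<odot> \<chi> b = Sw V (\<lambda>a1 a2. (\<phi> a1 \<odot> \<psi> a2) \<odot> \<chi> b) a"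
      unfolding cv_def
      by (intro V.Sw_push(1)[where A="ser (carr W)"]) (auto simp: mem W.sm_carr W.ser_carr_add W.sm_add_left)
  qed
  also have "\<dots> = Sw V (\<lambda>a b. Sw V (\<lambda>b1 b2. (\<phi> a \<odot> \<psi> b1) \<odot> \<chi> b2) b) v"
    by (rule V.coassoc[OF W.k_act_vs sm_trilin[OF assms(1-3)] assms(4)])
  also have "\<dots> = cv V W \<phi> (cv V W \<psi> \<chi>) v"
    unfolding cv_def[of V W \<phi>]
  proof (rule V.Sw_cong[OF assms(4)])
    fix a b assume ab: "a \<in> carr V" "b \<in> carr V"
    have "\<phi> a \<odot> cv V W \<psi> \<chi> b = Sw V (\<lambda>b1 b2. \<phi> a \<odot> (\<psi> b1 \<odot> \<chi> b2)) b"
      unfolding cv_def using ab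
      by (intro V.Sw_push(1)[where A="ser (carr W)"]) (auto simp: mem W.sm_carr W.ser_carr_add W.sm_add_right)
    also have "\<dots> = Sw V (\<lambda>b1 b2. (\<phi> a \<odot> \<psi> b1) \<odot> \<chi> b2) b"
      by (rule V.Sw_cong) (use ab in \<open>auto simp: W.sm_assoc mem\<close>)
    finally show "Sw V (\<lambda>b1 b2. (\<phi> a \<odot> \<psi> b1) \<odot> \<chi> b2) b = \<phi> a \<odot> cv V W \<psi> \<chi> b" by simp
  qed
  finally show ?thesis .
qed

text \<open>The counit axiom, which makes the maps \<open>c \<epsilon>\<close> act as scalars.\<close>

lemma cv_const_left:
  assumes "lin V W \<psi>" "c \<in> ser (carr W)" "v \<in> carr V"
  shows "cv V W (\<lambda>x. k_act (scl W) (counit V x) c) \<psi> v = c \<odot> \<psi> v"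
proof -
  have "cv V W (\<lambda>x. k_act (scl W) (counit V x) c) \<psi> v = Sw V (\<lambda>a b. c \<odot> \<psi> (scl V (counit V a) b)) v"
    unfolding cv_def
    by (rule V.Sw_cong) (use assms in \<open>auto simp: lin_scl lin_mem W.sm_k_left W.sm_k_right\<close>)
  also have "\<dots> = c \<odot> \<psi> (Sw V (\<lambda>a b. scl V (counit V a) b) v)"
    by (rule V.Sw_push(1)[where A="carr V", symmetric])
      (use assms in \<open>auto simp: V.carr_scl V.carr_add lin_add lin_mem W.sm_add_right\<close>)
  finally show ?thesis using assms by (simp add: V.Sw_counit)
qed

lemma ce_alt: "ce V W = (\<lambda>x. k_act (scl W) (counit V x) (fps_const (unit W)))"
  by (auto simp: ce_def fun_eq_iff fps_eq_iff)

lemma cv_ce_left: "lin V W \<psi> \<Longrightarrow> v \<in> carr V \<Longrightarrow> cv V W (ce V W) \<psi> v = \<psi> v"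
  unfolding ce_alt by (subst cv_const_left) (auto simp: lin_mem)

lemma cv_ce_right:
  assumes "lin V W \<psi>" "v \<in> carr V" shows "cv V W \<psi> (ce V W) v = \<psi> v"
proof -
  have "cv V W \<psi> (ce V W) v = Sw V (\<lambda>a b. \<psi> (scl V (counit V b) a)) v"
    unfolding cv_def ce_alt
    by (rule V.Sw_cong) (use assms in \<open>auto simp: lin_scl lin_mem W.sm_k_right\<close>)
  also have "\<dots> = \<psi> (Sw V (\<lambda>a b. scl V (counit V b) a) v)"
    by (rule V.Sw_push(1)[where A="carr V", symmetric])
      (use assms in \<open>auto simp: V.carr_scl V.carr_add lin_add lin_mem\<close>)
  finally show ?thesis using assms by (simp add: V.Sw_counit)
qed

text \<open>Commutativity of convolution.  For a map \<open>\<psi>\<close> of degree \<open>i\<close> the Koszul sign is absorbed by the \<open>i\<close>-th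
  power of the parity involution.\<close>

lemma cv_tw_comm:
  assumes "lin V W \<phi>" "lin V W \<psi>" "hdeg V W 0 \<phi>" "hdeg V W i \<psi>" "v \<in> carr V"
  shows "cv V W (\<lambda>x. \<phi> (tw V i x)) \<psi> v = cv V W \<psi> \<phi> v"
  unfolding cv_def
proof (rule V.cocomm[OF W.k_act_vs sm_bilin[OF assms(2,1)] assms(5)])
  fix a b p q assume ab: "a \<in> gr V p" "b \<in> gr V q"
  have m: "\<phi> a \<in> ser (gr W p)" "\<psi> b \<in> ser (gr W (q + i))"
    using hdegD[OF assms(3) ab(1)] hdegD[OF assms(4) ab(2)] by simp_all
  have "\<phi> (tw V i a) \<odot> \<psi> b = ksign i p (\<phi> a \<odot> \<psi> b)"
    using ab m by (simp add: V.tw_hom lin_ksign[OF assms(1)] V.gr_carr ksign_sm W.ser_gr_carr)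
  also have "\<dots> = ksign i p (ksign p (q + i) (\<psi> b \<odot> \<phi> a))" by (simp add: W.sm_comm[OF m])
  also have "\<dots> = ksign p q (\<psi> b \<odot> \<phi> a)" by (auto simp: ksign_def)
  finally show "\<phi> (tw V i a) \<odot> \<psi> b = ksign p q (\<psi> b \<odot> \<phi> a)" .
qed

lemma cv_add_left:
  assumes "lin V W \<phi>" "lin V W \<phi>'" "lin V W \<psi>" "v \<in> carr V"
  shows "cv V W (\<lambda>x. \<phi> x + \<phi>' x) \<psi> v = cv V W \<phi> \<psi> v + cv V W \<phi>' \<psi> v"
  unfolding cv_def V.Sw_plus[symmetric]
  by (rule V.Sw_cong) (use assms in \<open>auto simp: W.sm_add_left lin_mem\<close>)

lemma cv_add_right:
  assumes "lin V W \<phi>" "lin V W \<phi>'" "lin V W \<psi>" "v \<in> carr V"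
  shows "cv V W \<psi> (\<lambda>x. \<phi> x + \<phi>' x) v = cv V W \<psi> \<phi> v + cv V W \<psi> \<phi>' v"
  unfolding cv_def V.Sw_plus[symmetric]
  by (rule V.Sw_cong) (use assms in \<open>auto simp: W.sm_add_right lin_mem\<close>)

lemma cv_k_left:
  assumes "lin V W \<phi>" "lin V W \<psi>" "v \<in> carr V"
  shows "cv V W (\<lambda>x. k_act (scl W) c (\<phi> x)) \<psi> v = k_act (scl W) c (cv V W \<phi> \<psi> v)"
  unfolding cv_def V.Sw_scl_right[OF W.k_act_vs assms(3), symmetric]
  by (rule V.Sw_cong) (use assms in \<open>auto simp: W.sm_k_left lin_mem\<close>)

lemma cv_k_right:
  assumes "lin V W \<phi>" "lin V W \<psi>" "v \<in> carr V"
  shows "cv V W \<psi> (\<lambda>x. k_act (scl W) c (\<phi> x)) v = k_act (scl W) c (cv V W \<psi> \<phi> v)"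
  unfolding cv_def V.Sw_scl_right[OF W.k_act_vs assms(3), symmetric]
  by (rule V.Sw_cong) (use assms in \<open>auto simp: W.sm_k_right lin_mem\<close>)

lemma lin_plus: "lin V W \<phi> \<Longrightarrow> lin V W \<psi> \<Longrightarrow> lin V W (\<lambda>x. \<phi> x + \<psi> x)"
  by (rule linI) (auto simp: lin_add lin_scl lin_mem W.ser_carr_add W.ks.scale_right_distrib)

lemma lin_minus: "lin V W \<phi> \<Longrightarrow> lin V W \<psi> \<Longrightarrow> lin V W (\<lambda>x. \<phi> x - \<psi> x)"
  by (rule linI) (auto simp: lin_add lin_scl lin_mem W.ser_carr_diff W.ks.scale_right_diff_distrib)

lemma lin_k: "lin V W \<phi> \<Longrightarrow> lin V W (\<lambda>x. k_act (scl W) c (\<phi> x))"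
  by (rule linI) (auto simp: lin_add lin_scl lin_mem W.ser_carr_k W.ks.scale_right_distrib mult.commute)

lemma lin_const: "c \<in> ser (carr W) \<Longrightarrow> lin V W (\<lambda>x. k_act (scl W) (counit V x) c)"
  by (rule linI) (auto simp: V.counit_add V.counit_scl W.ser_carr_k W.ks.scale_left_distrib)

lemma lin_tw: "lin V W \<phi> \<Longrightarrow> lin V W (\<lambda>x. \<phi> (tw V i x))"
  by (rule linI) (auto simp: V.tw_add V.tw_scl V.tw_carr lin_add lin_scl lin_mem)

lemma lin_pw: "lin V W \<phi> \<Longrightarrow> lin V W (pw V W \<phi> n)"
  by (induction n) (auto intro: lin_ce lin_cv)

lemma hdeg_pw: "lin V W \<phi> \<Longrightarrow> hdeg V W 0 \<phi> \<Longrightarrow> hdeg V W 0 (pw V W \<phi> n)"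
proof (induction n)
  case (Suc n) then show ?case using hdeg_cv[of \<phi> "pw V W \<phi> n" 0 0] by (simp add: lin_pw)
qed (simp add: hdeg_ce)

lemma pw_add: "lin V W \<phi> \<Longrightarrow> v \<in> carr V \<Longrightarrow> cv V W (pw V W \<phi> m) (pw V W \<phi> n) v = pw V W \<phi> (m + n) v"
proof (induction m arbitrary: v)
  case 0 then show ?case by (simp add: cv_ce_left lin_pw)
next
  case (Suc m)
  have "cv V W (pw V W \<phi> (Suc m)) (pw V W \<phi> n) v = cv V W \<phi> (cv V W (pw V W \<phi> m) (pw V W \<phi> n)) v"
    using Suc by (simp add: cv_assoc lin_pw)
  also have "\<dots> = cv V W \<phi> (pw V W \<phi> (m + n)) v" by (rule cv_cong) (use Suc in auto)
  finally show ?case by simp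
qed

lemma pw_cong: "v \<in> carr V \<Longrightarrow> (\<And>x. x \<in> carr V \<Longrightarrow> \<phi> x = \<psi> x) \<Longrightarrow> pw V W \<phi> n v = pw V W \<psi> n v"
  by (induction n arbitrary: v) (auto intro!: cv_cong)

section \<open>Conilpotency and convergence\<close>

lemma lprod_mem: "lin V W g \<Longrightarrow> xs \<in> lists (carr V) \<Longrightarrow> lprod W g xs \<in> ser (carr W)"
  by (induction xs) (auto simp: W.sm_carr lin_mem)

lemma lprod_linear:
  assumes "lin V W g" "xs \<in> lists (carr V)" "ys \<in> lists (carr V)"
  shows "linear_map_on (scl V) (k_act (scl W)) (carr V) (\<lambda>x. lprod W g (xs @ x # ys))"
  using assms(2)
proof (induction xs)
  case Nil
  show ?case unfolding linear_map_on_def using assms lprod_mem[OF assms(1,3)]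
    by (auto simp: lin_add lin_scl lin_mem W.sm_add_left W.sm_k_left)
next
  case (Cons a xs)
  have "lprod W g (xs @ x # ys) \<in> ser (carr W)" if "x \<in> carr V" for x
    by (rule lprod_mem[OF assms(1)]) (use that Cons assms in auto)
  with Cons assms show ?case unfolding linear_map_on_def
    by (auto simp: lin_mem W.sm_add_right W.sm_k_right)
qed

text \<open>The map on \<open>V\<^sup>\<otimes>\<^sup>n\<close> induced by \<open>h(x\<^sub>1) g(x\<^sub>2) \<cdots> g(x\<^sub>n)\<close>.  The first factor differs because the iterates of the reduced
  coproduct expand the first factor only.\<close>

definition lift_prod :: "('v \<Rightarrow> 'w fps) \<Rightarrow> ('v \<Rightarrow> 'w fps) \<Rightarrow> nat \<Rightarrow> ('k, 'v) tensor \<Rightarrow> 'w fps" where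
  "lift_prod h g n = tens_lift (scl V) (k_act (scl W)) (carr V) n (\<lambda>xs. h (hd xs) \<odot> lprod W g (tl xs))"

lemma lift_prod_props:
  assumes "lin V W h" "lin V W g"
  shows "Vector_Spaces.linear dscl (k_act (scl W)) (lift_prod h g n)"
    and "xs \<in> lists (carr V) \<Longrightarrow> length xs = n \<Longrightarrow> lift_prod h g n (tens (scl V) xs) = h (hd xs) \<odot> lprod W g (tl xs)"
proof -
  have *: "linear_map_on (scl V) (k_act (scl W)) (carr V) (\<lambda>x. (\<lambda>xs. h (hd xs) \<odot> lprod W g (tl xs)) (xs @ x # ys))"
    if "xs \<in> lists (carr V)" "ys \<in> lists (carr V)" "length xs + length ys + 1 = n" for xs ys
  proof (cases xs)
    case Nil
    then show ?thesis unfolding linear_map_on_def using assms lprod_mem[OF assms(2) that(2)]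
      by (auto simp: lin_add lin_scl lin_mem W.sm_add_left W.sm_k_left)
  next
    case (Cons a xs')
    have "lprod W g (xs' @ x # ys) \<in> ser (carr W)" if "x \<in> carr V" for x
      by (rule lprod_mem[OF assms(2)]) (use that Cons \<open>xs \<in> _\<close> \<open>ys \<in> _\<close> in auto)
    then show ?thesis using lprod_linear[OF assms(2), of xs' ys] that Cons assms(1)
      unfolding linear_map_on_def by (auto simp: lin_mem W.sm_add_right W.sm_k_right)
  qed
  show "Vector_Spaces.linear dscl (k_act (scl W)) (lift_prod h g n)"
    unfolding lift_prod_def by (rule V.tens_lift_props(1)[OF W.k_act_vs *])
  show "xs \<in> lists (carr V) \<Longrightarrow> length xs = n \<Longrightarrow> lift_prod h g n (tens (scl V) xs) = h (hd xs) \<odot> lprod W g (tl xs)"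
    unfolding lift_prod_def by (rule V.tens_lift_props(2)[OF W.k_act_vs *])
qed

end

lemma tens_app_left_scl: "tens_app s (dscl c t) u = dscl c (tens_app s t u)"
  by (auto simp: tens_app_def fun_eq_iff dscl_def)

lemma linear_map_on_sum_list:
  assumes "vector_space s'" "\<And>p. p \<in> set ps \<Longrightarrow> linear_map_on s s' A (f p)"
  shows "linear_map_on s s' A (\<lambda>x. \<Sum>p\<leftarrow>ps. f p x)"
proof -
  interpret vector_space s' by fact
  show ?thesis using assms(2)
    by (induction ps) (auto simp: linear_map_on_def scale_right_distrib algebra_simps)
qed

context gcog0
begin

lemma counit_ker_carr: "a \<in> carr V \<Longrightarrow> a - scl V (counit V a) (unit V) \<in> carr V"
  by (simp add: carr_diff carr_scl unit_carr)

lemma red_coprod_pairs: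
  assumes "a \<in> carr V"
  shows "\<exists>ps. (\<forall>(p, q)\<in>set ps. p \<in> carr V \<and> q \<in> carr V) \<and> red_coprod V a = (\<Sum>(p, q)\<leftarrow>ps. tens (scl V) [p, q])"
proof -
  define u where "u = a - scl V (counit V a) (unit V)"
  have u: "u \<in> carr V" unfolding u_def by (rule counit_ker_carr[OF assms])
  have "red_coprod V a = (\<Sum>(p, q)\<leftarrow>sw V u @ [(- u, unit V), (unit V, - u)]. tens (scl V) [p, q])"
    using sw_spec(2)[OF u] by (simp add: red_coprod_def u_def[symmetric] tens2_neg u unit_carr)
  moreover have "\<forall>(p, q)\<in>set (sw V u @ [(- u, unit V), (unit V, - u)]). p \<in> carr V \<and> q \<in> carr V"
    using sw_carr[OF u] u unit_carr by (auto simp: carr_neg)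
  ultimately show ?thesis by blast
qed

lemma red_coprod_linear: "linear_map_on (scl V) dscl (carr V) (red_coprod V)"
proof -
  interpret T: vector_space "dscl :: 'k \<Rightarrow> ('k, 'v) tensor \<Rightarrow> _" by (rule vs_tensor)
  define k where "k = (\<lambda>a. a - scl V (counit V a) (unit V))"
  have k: "a \<in> carr V \<Longrightarrow> k a \<in> carr V" for a unfolding k_def by (rule counit_ker_carr)
  have kl: "k (a + b) = k a + k b" "k (scl V c a) = scl V c (k a)" if "a \<in> carr V" "b \<in> carr V" for a b c
    using that by (simp_all add: k_def counit_add counit_scl vs.scale_left_distrib vs.scale_right_diff_distrib)
  note tb = bilinD[OF tens2_bilin]
  have r: "red_coprod V a = coprod V (k a) - tens (scl V) [k a, unit V] - tens (scl V) [unit V, k a]" for a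
    by (simp add: red_coprod_def k_def Let_def)
  show ?thesis unfolding linear_map_on_def
    using coprod_linear by (auto simp: r kl k tb unit_carr linear_map_on_def T.scale_right_diff_distrib)
qed

lemma red_coprod_apply:
  assumes "Vector_Spaces.linear dscl s' L" "vector_space s'" "bilin V s' \<beta>"
    and "\<And>a b. a \<in> carr V \<Longrightarrow> b \<in> carr V \<Longrightarrow> L (tens (scl V) [a, b]) = \<beta> a b"
    and "a \<in> carr V" and u: "u = a - scl V (counit V a) (unit V)"
  shows "L (red_coprod V a) = Sw V \<beta> u - \<beta> u (unit V) - \<beta> (unit V) u"
proof -
  interpret L: Vector_Spaces.linear dscl s' L by fact
  have uc: "u \<in> carr V" unfolding u by (rule counit_ker_carr[OF assms(5)])
  have "L (coprod V u) = Sw V \<beta> u"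
    unfolding coprod_Sw[OF uc] Sw_linear_app[OF uc assms(1)] by (rule Sw_cong[OF uc assms(4)])
  then show ?thesis
    using assms(4) uc unit_carr by (simp add: red_coprod_def u[symmetric] L.diff)
qed

definition red_step :: "nat \<Rightarrow> ('k, 'v) tensor \<Rightarrow> ('k, 'v) tensor" where
  "red_step k = tens_lift (scl V) dscl (carr V) (Suc k)
       (\<lambda>xs. tens_app (scl V) (red_coprod V (hd xs)) (tens (scl V) (tl xs)))"

lemma red_coprod_iter_step: "red_coprod_iter V (Suc k) v = red_step k (red_coprod_iter V k v)"
  by (simp add: red_step_def)

lemma red_step_props:
  shows "Vector_Spaces.linear dscl dscl (red_step k)"
    and "xs \<in> lists (carr V) \<Longrightarrow> length xs = Suc k \<Longrightarrow>
      red_step k (tens (scl V) xs) = tens_app (scl V) (red_coprod V (hd xs)) (tens (scl V) (tl xs))"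
proof -
  have *: "linear_map_on (scl V) dscl (carr V)
      (\<lambda>x. (\<lambda>xs. tens_app (scl V) (red_coprod V (hd xs)) (tens (scl V) (tl xs))) (xs @ x # ys))"
    if "xs \<in> lists (carr V)" "ys \<in> lists (carr V)" "length xs + length ys + 1 = Suc k" for xs ys
  proof (cases xs)
    case Nil
    then show ?thesis using red_coprod_linear
      by (auto simp: linear_map_on_def tens_app_left_add tens_app_left_scl)
  next
    case (Cons a xs')
    with that obtain ps where ps: "red_coprod V a = (\<Sum>(p, q)\<leftarrow>ps. tens (scl V) [p, q])"
      using red_coprod_pairs[of a] by auto
    have "linear_map_on (scl V) dscl (carr V) (\<lambda>x. \<Sum>p\<leftarrow>ps. tens (scl V) ((fst p # snd p # xs') @ x # ys))"
      by (rule linear_map_on_sum_list[OF vs_tensor])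
        (simp only: linear_map_on_def tens_split_add[OF vs.vector_space_axioms] simp_thms Ball_def)
    then show ?thesis by (simp add: Cons ps tens_app_sum_left) (simp add: case_prod_unfold)
  qed
  show "Vector_Spaces.linear dscl dscl (red_step k)"
    unfolding red_step_def by (rule tens_lift_props(1)[OF vs_tensor *])
  show "xs \<in> lists (carr V) \<Longrightarrow> length xs = Suc k \<Longrightarrow>
      red_step k (tens (scl V) xs) = tens_app (scl V) (red_coprod V (hd xs)) (tens (scl V) (tl xs))"
    unfolding red_step_def by (rule tens_lift_props(2)[OF vs_tensor *])
qed

lemma red_coprod_iter_mem: "v \<in> carr V \<Longrightarrow> red_coprod_iter V k v \<in> tens_pow V (Suc k)"
proof (induction k)
  case 0
  interpret T: vector_space "dscl :: 'k \<Rightarrow> ('k, 'v) tensor \<Rightarrow> _" by (rule vs_tensor)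
  show ?case unfolding tens_pow_def using 0 by (auto intro!: T.span_base exI[of _ "[v]"])
next
  case (Suc k)
  interpret T: vector_space "dscl :: 'k \<Rightarrow> ('k, 'v) tensor \<Rightarrow> _" by (rule vs_tensor)
  interpret L: Vector_Spaces.linear dscl dscl "red_step k" by (rule red_step_props(1))
  have sub: "T.subspace (tens_pow V n)" for n unfolding tens_pow_def by (rule T.subspace_span)
  have "red_step k t \<in> tens_pow V (Suc (Suc k))" if "t \<in> tens_pow V (Suc k)" for t
    using that unfolding tens_pow_def[of V "Suc k"]
  proof (induction rule: T.span_induct_alt)
    case base show ?case using sub by (auto simp: L.zero T.subspace_0)
  next
    case (step c e u)
    then obtain xs where xs: "e = tens (scl V) xs" "xs \<in> lists (carr V)" "length xs = Suc k" by blast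
    then obtain a ys where a: "xs = a # ys" by (cases xs) auto
    with xs obtain ps where ps: "red_coprod V a = (\<Sum>(p, q)\<leftarrow>ps. tens (scl V) [p, q])"
      "\<forall>(p, q)\<in>set ps. p \<in> carr V \<and> q \<in> carr V"
      using red_coprod_pairs[of a] by auto
    have "(\<Sum>(p, q)\<leftarrow>ps. tens (scl V) (p # q # ys)) \<in> tens_pow V (Suc (Suc k))"
      using ps(2)
    proof (induction ps)
      case Nil show ?case using sub by (simp add: T.subspace_0)
    next
      case (Cons p ps)
      obtain a b where "p = (a, b)" by (cases p)
      with Cons xs \<open>xs = _\<close> have "a # b # ys \<in> lists (carr V)" "length (a # b # ys) = Suc (Suc k)" by auto
      then have "tens (scl V) (a # b # ys) \<in> tens_pow V (Suc (Suc k))"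
        unfolding tens_pow_def by (intro T.span_base) blast
      with Cons \<open>p = (a, b)\<close> show ?case using sub by (auto intro: T.subspace_add)
    qed
    then have "red_step k e \<in> tens_pow V (Suc (Suc k))"
      using red_step_props(2)[of xs k] xs by (simp add: a ps(1) tens_app_sum_left)
    then show ?case using step sub by (simp add: L.add L.scale T.subspace_add T.subspace_scale)
  qed
  then show ?case using Suc by (simp only: red_coprod_iter_step)
qed

end

context cpair
begin

text \<open>The convolution power is the product over the iterated coproduct; on maps killing \<open>1\<close> only
  the iterated reduced coproduct contributes.\<close>

lemma lift_prod_red_iter:
  assumes "lin V W h" "h (unit V) = 0" "lin V W g" "g (unit V) = 0" "v \<in> carr V"
  shows "lift_prod h g (Suc k) (red_coprod_iter V k v) = cv V W h (pw V W g k) v"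
  using assms(1,2)
proof (induction k arbitrary: h)
  case 0
  show ?case using lift_prod_props(2)[OF 0(1) assms(3), of "[v]" 1] 0 assms(5)
    by (simp add: lin_mem cv_ce_right)
next
  case (Suc k)
  define hg where "hg = cv V W h g"
  have hg: "lin V W hg" "hg (unit V) = 0"
    using Suc.prems assms by (simp_all add: hg_def lin_cv cv_unit)
  let ?\<beta> = "\<lambda>a b. h a \<odot> g b"
  have \<beta>: "bilin V (k_act (scl W)) ?\<beta>" by (rule sm_bilin[OF Suc.prems(1) assms(3)])
  obtain L where L: "Vector_Spaces.linear dscl (k_act (scl W)) L" 
    "\<And>a b. a \<in> carr V \<Longrightarrow> b \<in> carr V \<Longrightarrow> L (tens (scl V) [a, b]) = ?\<beta> a b"
    using V.bilin_lift[OF W.k_act_vs \<beta>] by blast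
  have Lred: "L (red_coprod V a) = hg a" if a: "a \<in> carr V" for a
  proof -
    define u where "u = a - scl V (counit V a) (unit V)"
    have u: "u \<in> carr V" unfolding u_def by (rule V.counit_ker_carr[OF a])
    have "L (red_coprod V a) = hg u"
      using V.red_coprod_apply[OF L(1) W.k_act_vs \<beta> L(2) a u_def] Suc.prems assms u
      by (simp add: hg_def cv_def lin_mem)
    also have "\<dots> = hg a"
      using hg a by (simp add: u_def lin_diff lin_scl V.carr_scl V.unit_carr)
    finally show ?thesis .
  qed
  have "lift_prod h g (Suc (Suc k)) (V.red_step k (red_coprod_iter V k v)) = lift_prod hg g (Suc k) (red_coprod_iter V k v)"
  proof (rule linear_eq_on_span[where L="\<lambda>t. lift_prod h g (Suc (Suc k)) (V.red_step k t)" and x="red_coprod_iter V k v"])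
    show "red_coprod_iter V k v \<in> module.span dscl {tens (scl V) xs | xs. xs \<in> lists (carr V) \<and> length xs = Suc k}"
      using V.red_coprod_iter_mem[OF assms(5), of k] by (simp add: tens_pow_def)
    show "Vector_Spaces.linear dscl (k_act (scl W)) (\<lambda>t. lift_prod h g (Suc (Suc k)) (V.red_step k t))"
      using Vector_Spaces.linear_compose[OF V.red_step_props(1) lift_prod_props(1)[OF Suc.prems(1) assms(3)]]
      by (simp add: o_def)
    show "Vector_Spaces.linear dscl (k_act (scl W)) (lift_prod hg g (Suc k))"
      by (rule lift_prod_props(1)[OF hg(1) assms(3)])
    fix t assume "t \<in> {tens (scl V) xs | xs. xs \<in> lists (carr V) \<and> length xs = Suc k}"
    then obtain xs where xs: "t = tens (scl V) xs" "xs \<in> lists (carr V)" "length xs = Suc k" by blast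
    then obtain a ys where a: "xs = a # ys" by (cases xs) auto
    with xs obtain ps where ps: "red_coprod V a = (\<Sum>(p, q)\<leftarrow>ps. tens (scl V) [p, q])"
      "\<forall>(p, q)\<in>set ps. p \<in> carr V \<and> q \<in> carr V"
      using V.red_coprod_pairs[of a] by auto
    have ys: "ys \<in> lists (carr V)" "length ys = k" "a \<in> carr V" using xs a by auto
    have m: "lprod W g ys \<in> ser (carr W)" by (rule lprod_mem[OF assms(3) ys(1)])
    have "(\<Sum>(p, q)\<leftarrow>ps. lift_prod h g (Suc (Suc k)) (tens (scl V) (p # q # ys))) = (\<Sum>(p, q)\<leftarrow>ps. L (tens (scl V) [p, q])) \<odot> lprod W g ys
      \<and> (\<Sum>(p, q)\<leftarrow>ps. L (tens (scl V) [p, q])) \<in> ser (carr W)"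
      using ps(2)
    proof (induction ps)
      case Nil show ?case using m by simp
    next
      case (Cons p ps)
      obtain x y where p: "p = (x, y)" by (cases p)
      then have xy: "x \<in> carr V" "y \<in> carr V" using Cons by auto
      have "lift_prod h g (Suc (Suc k)) (tens (scl V) (x # y # ys)) = h x \<odot> (g y \<odot> lprod W g ys)"
        using lift_prod_props(2)[OF Suc.prems(1) assms(3), of "x # y # ys" "Suc (Suc k)"] xy ys by simp
      then show ?case using Cons p xy m Suc.prems assms
        by (simp add: L(2) W.sm_assoc lin_mem W.sm_carr W.sm_add_left W.ser_carr_add)
    qed
    then show "lift_prod h g (Suc (Suc k)) (V.red_step k t) = lift_prod hg g (Suc k) t"
      using V.red_step_props(2)[OF xs(2,3)] lift_prod_props(2)[OF hg(1) assms(3) xs(2,3)] Lred[OF ys(3)]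
      by (simp add: xs(1) a ps(1) tens_app_sum_left linear_sum_list[OF L(1)]
          linear_sum_list[OF lift_prod_props(1)[OF Suc.prems(1) assms(3)]])
  qed
  then have "lift_prod h g (Suc (Suc k)) (red_coprod_iter V (Suc k) v) = cv V W hg (pw V W g k) v"
    using Suc.IH[OF hg] by (simp only: V.red_coprod_iter_step)
  also have "\<dots> = cv V W h (pw V W g (Suc k)) v"
    unfolding hg_def pw.simps by (rule cv_assoc) (use Suc.prems assms in \<open>auto intro: lin_pw\<close>)
  finally show ?case .
qed

text \<open>As \<open>g(1) = 0\<close>, the powers of \<open>g\<close> are computed from the iterated reduced coproduct of \<open>v\<close>, which conilpotency kills from some
  index on.\<close>

lemma pw_nilpotent:
  assumes "lin V W g" "g (unit V) = 0" "v \<in> carr V"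
  shows "\<exists>K. \<forall>n\<ge>K. pw V W g n v = 0"
proof -
  obtain K where K: "\<forall>k\<ge>K. red_coprod_iter V k v = 0"
    using V.conil assms(3) by (auto simp: conilpotent_def)
  interpret L: Vector_Spaces.linear dscl "k_act (scl W)" "lift_prod g g k" for k
    by (rule lift_prod_props(1)[OF assms(1,1)])
  have "pw V W g (Suc k) v = 0" if "k \<ge> K" for k
    using lift_prod_red_iter[OF assms(1,2,1,2,3), of k] K that by (simp add: L.zero)
  then show ?thesis by (metis Suc_le_D Suc_le_mono)
qed

text \<open>Write \<open>\<phi> = c \<epsilon> + \<psi>\<close> with \<open>c = \<phi>(1)\<close> divisible by \<open>\<hbar>\<close> and \<open>\<psi>(1) = 0\<close>, and expand the factors of \<open>\<phi>\<^sup>n\<close> one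
  at a time.  Each of them yields either a factor \<open>c\<close>, which can be pulled out because \<open>c \<epsilon>\<close> acts as a scalar of degree
  \<open>0\<close>, or a further factor \<open>\<psi>\<close>; high powers of \<open>\<psi>\<close> vanish on the tensor factors of \<open>\<delta>(v)\<close>.\<close>

lemma pw_vanish:
  assumes "small V W \<phi>" "v \<in> carr V"
  shows "\<exists>N. \<forall>n\<ge>N. vanish m (pw V W \<phi> n v)"
proof -
  note \<phi> = smallD[OF assms(1)]
  define c where "c = \<phi> (unit V)"
  have c: "c \<in> ser (gr W 0)" "vanish 1 c" "c \<in> ser (carr W)"
    using hdegD[OF \<phi>(2) V.unit_gr] \<phi>(3) by (auto simp: c_def W.ser_gr_carr)
  define \<kappa> where "\<kappa> = (\<lambda>x. k_act (scl W) (counit V x) c)"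
  have \<kappa>: "lin V W \<kappa>" unfolding \<kappa>_def by (rule lin_const[OF c(3)])
  define g where "g = (\<lambda>x. \<phi> x - \<kappa> x)"
  have g: "lin V W g" "g (unit V) = 0"
    unfolding g_def using \<phi>(1) \<kappa> by (auto intro: lin_minus simp: \<kappa>_def c_def V.counit_unit)
  have "\<forall>x\<in>fst ` set (sw V v). \<exists>K. \<forall>n\<ge>K. pw V W g n x = 0"
    using pw_nilpotent[OF g] V.sw_carr[OF assms(2)] by fastforce
  then obtain K0 where K0: "\<And>x n. x \<in> fst ` set (sw V v) \<Longrightarrow> n \<ge> K0 x \<Longrightarrow> pw V W g n x = 0" by metis
  define K where "K = Max (insert 0 (K0 ` fst ` set (sw V v)))"
  have K: "cv V W (pw V W g n) \<psi> v = 0" if "n \<ge> K" "lin V W \<psi>" for n \<psi>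
  proof -
    have "pw V W g n a \<odot> \<psi> b = 0" if ab: "(a, b) \<in> set (sw V v)" for a b
    proof -
      have "K0 a \<le> K" unfolding K_def using ab by (intro Max_ge) (auto intro!: image_eqI[of _ fst "(a, b)"])
      then have "pw V W g n a = 0" using K0[of a n] ab \<open>n \<ge> K\<close> by (force simp: image_iff)
      then show ?thesis using V.sw_carr[OF assms(2) ab] \<open>lin V W \<psi>\<close> by (simp add: lin_mem)
    qed
    then have "(\<Sum>(a, b)\<leftarrow>sw V v. pw V W g n a \<odot> \<psi> b) = (\<Sum>(a, b)\<leftarrow>sw V v. 0)"
      by (intro arg_cong[where f=sum_list] map_cong) auto
    also have "\<dots> = 0" by (induction "sw V v") auto
    finally show ?thesis by (simp add: cv_def Sw_def)
  qed
  have claim: "vanish l (cv V W (pw V W g b) (pw V W \<phi> n) v)" if "b + n \<ge> l + K" for b l n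
    using that
  proof (induction n arbitrary: b l)
    case 0 then show ?case using K[of b] lin_pw[OF \<phi>(1), of 0] by simp
  next
    case (Suc n)
    let ?p = "pw V W g b" and ?q = "pw V W \<phi> n"
    have pq: "lin V W ?p" "lin V W ?q" using lin_pw g \<phi> by auto
    have "cv V W ?p (pw V W \<phi> (Suc n)) v = cv V W ?p (\<lambda>x. cv V W \<kappa> ?q x + cv V W g ?q x) v"
    proof (rule cv_cong[OF assms(2)])
      fix x assume x: "x \<in> carr V"
      have "pw V W \<phi> (Suc n) x = cv V W (\<lambda>y. \<kappa> y + g y) ?q x" by (simp add: g_def)
      then show "pw V W \<phi> (Suc n) x = cv V W \<kappa> ?q x + cv V W g ?q x"
        using cv_add_left[OF \<kappa> g(1) pq(2) x] by simp
    qed simp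
    also have "\<dots> = cv V W ?p (cv V W \<kappa> ?q) v + cv V W ?p (cv V W g ?q) v"
      by (rule cv_add_right) (use pq \<kappa> g assms in \<open>auto intro: lin_cv\<close>)
    also have "cv V W ?p (cv V W \<kappa> ?q) v = c \<odot> cv V W ?p ?q v"
    proof -
      have "cv V W ?p (cv V W \<kappa> ?q) v = cv V W ?p (\<lambda>x. ?q x \<odot> c) v"
        unfolding \<kappa>_def
        by (rule cv_cong[OF assms(2) refl])
          (use pq c W.sm_even_comm[OF c(1)] in \<open>simp add: cv_const_left lin_mem\<close>)
      also have "\<dots> = Sw V (\<lambda>a b. (?p a \<odot> ?q b) \<odot> c) v"
        unfolding cv_def by (rule V.Sw_cong[OF assms(2)]) (use pq c in \<open>auto simp: lin_mem W.sm_assoc\<close>)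
      also have "\<dots> = cv V W ?p ?q v \<odot> c"
        unfolding cv_def by (rule V.Sw_push(1)[where A="ser (carr W)", symmetric])
          (use pq c assms in \<open>auto simp: lin_mem W.sm_carr W.ser_carr_add W.sm_add_left\<close>)
      finally show ?thesis using W.sm_even_comm[OF c(1) cv_mem[OF pq assms(2)]] by simp
    qed
    also have "cv V W ?p (cv V W g ?q) v = cv V W (pw V W g (Suc b)) ?q v"
    proof -
      have "cv V W ?p (cv V W g ?q) v = cv V W (cv V W ?p g) ?q v"
        by (rule cv_assoc[symmetric]) (use pq g assms in auto)
      also have "\<dots> = cv V W (pw V W g (Suc b)) ?q v"
      proof (rule cv_cong[OF assms(2)])
        fix x assume x: "x \<in> carr V"
        have "cv V W ?p g x = cv V W ?p (pw V W g 1) x"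
          by (rule cv_cong[OF x]) (auto simp: cv_ce_right g)
        then show "cv V W ?p g x = pw V W g (Suc b) x" using pw_add[OF g(1) x, of b 1] by simp
      qed simp
      finally show ?thesis .
    qed
    finally have eq: "cv V W ?p (pw V W \<phi> (Suc n)) v = c \<odot> cv V W ?p ?q v + cv V W (pw V W g (Suc b)) ?q v" .
    have "vanish l (c \<odot> cv V W ?p ?q v)"
    proof (cases l)
      case (Suc l')
      have "vanish l' (cv V W ?p ?q v)" by (rule Suc.IH) (use Suc.prems \<open>l = Suc l'\<close> in simp)
      then have "vanish (1 + l') (c \<odot> cv V W ?p ?q v)"
        by (intro W.vanish_sm) (use c pq assms in \<open>auto intro: cv_mem\<close>)
      with Suc show ?thesis by simp
    qed simp
    moreover have "vanish l (cv V W (pw V W g (Suc b)) ?q v)" by (rule Suc.IH) (use Suc.prems in simp)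
    ultimately show ?case unfolding eq by (rule vanish_add)
  qed
  have "vanish m (pw V W \<phi> n v)" if "n \<ge> m + K" for n
    using claim[of m 0 n] that cv_ce_left[OF lin_pw[OF \<phi>(1)] assms(2), of n] by simp
  then show ?thesis by blast
qed

lemma pw_vanish_finite:
  assumes "small V W \<phi>" "finite X" "X \<subseteq> carr V"
  shows "\<exists>N. \<forall>x\<in>X. \<forall>n\<ge>N. vanish m (pw V W \<phi> n x)"
  using assms(2,3)
proof (induction X)
  case (insert x X)
  then obtain N where "\<forall>x\<in>X. \<forall>n\<ge>N. vanish m (pw V W \<phi> n x)" by auto
  moreover obtain N' where "\<forall>n\<ge>N'. vanish m (pw V W \<phi> n x)" using pw_vanish[OF assms(1)] insert by blast
  ultimately show ?case by (intro exI[of _ "max N N'"]) auto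
qed simp

end

section \<open>Power series in the convolution algebra\<close>

context cpair
begin

lemma pw_mem: "small V W \<phi> \<Longrightarrow> v \<in> carr V \<Longrightarrow> pw V W \<phi> n v \<in> ser (carr W)"
  by (rule lin_mem[OF lin_pw[OF smallD(1)]])

lemma ev_nth:
  assumes "small V W \<phi>" "v \<in> carr V" "\<And>n. n \<ge> N \<Longrightarrow> fps_nth (pw V W \<phi> n v) i = 0"
  shows "fps_nth (ev V W p \<phi> v) i = (\<Sum>n<N. scl W (fps_nth p n) (fps_nth (pw V W \<phi> n v) i))"
  unfolding ev_def
proof (subst fps_suminf_nth[where N=N])
  fix j
  obtain M where "\<forall>n\<ge>M. vanish (Suc j) (pw V W \<phi> n v)" using pw_vanish[OF assms(1,2)] by blast
  then show "\<exists>M. \<forall>n\<ge>M. fps_nth (k_act (scl W) (fps_nth p n) (pw V W \<phi> n v)) j = 0"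
    by (auto simp: vanish_def)
qed (use assms(3) in auto)

lemma ev_nth_ex:
  assumes "small V W \<phi>" "finite X" "X \<subseteq> carr V"
  obtains N where "\<And>x n j. x \<in> X \<Longrightarrow> n \<ge> N \<Longrightarrow> j \<le> i \<Longrightarrow> fps_nth (pw V W \<phi> n x) j = 0"
    and "\<And>x p j. x \<in> X \<Longrightarrow> j \<le> i \<Longrightarrow> fps_nth (ev V W p \<phi> x) j = (\<Sum>n<N. scl W (fps_nth p n) (fps_nth (pw V W \<phi> n x) j))"
proof -
  obtain N where N: "\<forall>x\<in>X. \<forall>n\<ge>N. vanish (Suc i) (pw V W \<phi> n x)"
    using pw_vanish_finite[OF assms] by blast
  show ?thesis
  proof (rule that[of N])
    show *: "fps_nth (pw V W \<phi> n x) j = 0" if "x \<in> X" "n \<ge> N" "j \<le> i" for x n j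
      using N that by (auto simp: vanish_def)
    show "fps_nth (ev V W p \<phi> x) j = (\<Sum>n<N. scl W (fps_nth p n) (fps_nth (pw V W \<phi> n x) j))"
      if "x \<in> X" "j \<le> i" for x p j
      by (rule ev_nth) (use that * assms in auto)
  qed
qed

lemma ev_nth_ex1:
  assumes "small V W \<phi>" "v \<in> carr V"
  obtains N where "\<And>n. n \<ge> N \<Longrightarrow> fps_nth (pw V W \<phi> n v) i = 0"
    and "\<And>p. fps_nth (ev V W p \<phi> v) i = (\<Sum>n<N. scl W (fps_nth p n) (fps_nth (pw V W \<phi> n v) i))"
proof -
  have X: "finite {v}" "{v} \<subseteq> carr V" using assms by auto
  show ?thesis by (rule ev_nth_ex[OF assms(1) X, of i]) (rule that; simp)
qed

lemma lin_ev: assumes "small V W \<phi>" shows "lin V W (ev V W p \<phi>)"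
proof (rule linI)
  note l = lin_pw[OF smallD(1)[OF assms]]
  show "ev V W p \<phi> v \<in> ser (carr W)" if v: "v \<in> carr V" for v
  proof (rule serI)
    fix i
    obtain N where "\<And>p. fps_nth (ev V W p \<phi> v) i = (\<Sum>n<N. scl W (fps_nth p n) (fps_nth (pw V W \<phi> n v) i))"
      by (rule ev_nth_ex1[OF assms v, of i]) blast
    then show "fps_nth (ev V W p \<phi> v) i \<in> carr W"
      using pw_mem[OF assms v] by (auto intro!: W.carr_sum W.carr_scl ser_nth)
  qed
  show "ev V W p \<phi> (v + w) = ev V W p \<phi> v + ev V W p \<phi> w" if vw: "v \<in> carr V" "w \<in> carr V" for v w
  proof (rule fps_ext)
    fix i
    have X: "finite {v, w, v + w}" "{v, w, v + w} \<subseteq> carr V" using vw by (auto simp: V.carr_add)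
    obtain N where "\<And>x p. x \<in> {v, w, v + w} \<Longrightarrow>
      fps_nth (ev V W p \<phi> x) i = (\<Sum>n<N. scl W (fps_nth p n) (fps_nth (pw V W \<phi> n x) i))"
      by (rule ev_nth_ex[OF assms X, of i]) (simp only: order_refl)
    then show "fps_nth (ev V W p \<phi> (v + w)) i = fps_nth (ev V W p \<phi> v + ev V W p \<phi> w) i"
      using vw by (simp add: lin_add[OF l] W.vs.scale_right_distrib sum.distrib)
  qed
  show "ev V W p \<phi> (scl V c v) = k_act (scl W) c (ev V W p \<phi> v)" if v: "v \<in> carr V" for v c
  proof (rule fps_ext)
    fix i
    have X: "finite {v, scl V c v}" "{v, scl V c v} \<subseteq> carr V" using v by (auto simp: V.carr_scl)
    obtain N where "\<And>x p. x \<in> {v, scl V c v} \<Longrightarrow>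
      fps_nth (ev V W p \<phi> x) i = (\<Sum>n<N. scl W (fps_nth p n) (fps_nth (pw V W \<phi> n x) i))"
      by (rule ev_nth_ex[OF assms X, of i]) (simp only: order_refl)
    then show "fps_nth (ev V W p \<phi> (scl V c v)) i = fps_nth (k_act (scl W) c (ev V W p \<phi> v)) i"
      using v by (simp add: lin_scl[OF l] W.vs.scale_sum_right mult.commute)
  qed
qed

lemma hdeg_ev: assumes "small V W \<phi>" shows "hdeg V W 0 (ev V W p \<phi>)"
  unfolding hdeg_def
proof (intro allI ballI serI)
  fix n x i assume x: "x \<in> gr V n"
  obtain N where "fps_nth (ev V W p \<phi> x) i = (\<Sum>n<N. scl W (fps_nth p n) (fps_nth (pw V W \<phi> n x) i))"
    by (rule ev_nth_ex1[OF assms V.gr_carr[OF x], of i]) blast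
  then show "fps_nth (ev V W p \<phi> x) i \<in> gr W (n + 0)"
    using hdegD[OF hdeg_pw[OF smallD(1,2)[OF assms]] x] by (auto intro!: W.gr_sum W.gr_scl ser_nth)
qed

lemma ev_plus: 
  assumes "small V W \<phi>" "v \<in> carr V" shows "ev V W (p + q) \<phi> v = ev V W p \<phi> v + ev V W q \<phi> v"
proof (rule fps_ext)
  fix i
  obtain N where "\<And>p. fps_nth (ev V W p \<phi> v) i = (\<Sum>n<N. scl W (fps_nth p n) (fps_nth (pw V W \<phi> n v) i))"
    by (rule ev_nth_ex1[OF assms, of i]) blast
  then show "fps_nth (ev V W (p + q) \<phi> v) i = fps_nth (ev V W p \<phi> v + ev V W q \<phi> v) i"
    by (simp add: W.vs.scale_left_distrib sum.distrib)
qed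

lemma ev_X_power: 
  assumes "small V W \<phi>" "v \<in> carr V" shows "ev V W (fps_X ^ k) \<phi> v = pw V W \<phi> k v"
proof (rule fps_ext)
  fix i
  obtain N where N: "\<forall>n\<ge>N. vanish (Suc i) (pw V W \<phi> n v)" using pw_vanish[OF assms] by blast
  have "fps_nth (ev V W (fps_X ^ k) \<phi> v) i = 
      (\<Sum>n<max N (Suc k). scl W (fps_nth (fps_X ^ k) n) (fps_nth (pw V W \<phi> n v) i))"
    by (rule ev_nth[OF assms]) (use N in \<open>auto simp: vanish_def\<close>)
  also have "\<dots> = (\<Sum>n<max N (Suc k). if n = k then fps_nth (pw V W \<phi> k v) i else 0)"
    by (rule sum.cong) (auto simp: fps_X_power_nth)
  finally show "fps_nth (ev V W (fps_X ^ k) \<phi> v) i = fps_nth (pw V W \<phi> k v) i" by (simp add: less_max_iff_disj)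
qed

lemma ev_1: "small V W \<phi> \<Longrightarrow> v \<in> carr V \<Longrightarrow> ev V W 1 \<phi> v = ce V W v"
  using ev_X_power[of \<phi> v 0] by simp

lemma ev_X: "small V W \<phi> \<Longrightarrow> v \<in> carr V \<Longrightarrow> ev V W fps_X \<phi> v = \<phi> v"
  using ev_X_power[of \<phi> v 1] by (simp add: cv_ce_right smallD)

lemma sm_congr:
  assumes "vanish m (x - x')" "vanish m (y - y')"
    and "x \<in> ser (carr W)" "x' \<in> ser (carr W)" "y \<in> ser (carr W)" "y' \<in> ser (carr W)"
  shows "vanish m (x \<odot> y - x' \<odot> y')"
proof -
  have "x \<odot> y - x' \<odot> y' = (x - x') \<odot> y + x' \<odot> (y - y')"
    using assms by (simp add: sm_diff_left sm_diff_right)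
  moreover have "vanish (m + 0) ((x - x') \<odot> y)" "vanish (0 + m) (x' \<odot> (y - y'))"
    by (rule W.vanish_sm; use assms in \<open>simp add: W.ser_carr_diff\<close>)+
  ultimately show ?thesis by (simp add: vanish_add)
qed

lemma Sw_congr:
  fixes \<beta> :: "_ \<Rightarrow> _ \<Rightarrow> 'w fps"
  assumes "v \<in> carr V" "\<And>a b. (a, b) \<in> set (sw V v) \<Longrightarrow> vanish m (\<beta> a b - \<gamma> a b)"
  shows "vanish m (Sw V \<beta> v - Sw V \<gamma> v)"
proof -
  have "(\<Sum>(a, b)\<leftarrow>ps. \<beta> a b) - (\<Sum>(a, b)\<leftarrow>ps. \<gamma> a b) = (\<Sum>(a, b)\<leftarrow>ps. \<beta> a b - \<gamma> a b)" for ps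
    by (induction ps) (auto simp: algebra_simps)
  then show ?thesis unfolding Sw_def using assms(2) by (simp add: vanish_sum_list)
qed

text \<open>The bound is uniform in the power series and in finitely many arguments, so that it applies to all tensor factors of
  a Sweedler sum at once.\<close>

lemma ev_approx:
  assumes "small V W \<phi>" "finite X" "X \<subseteq> carr V"
  obtains N where "\<And>x n. x \<in> X \<Longrightarrow> n \<ge> N \<Longrightarrow> vanish m (pw V W \<phi> n x)"
    and "\<And>x p. x \<in> X \<Longrightarrow> vanish m (ev V W p \<phi> x - (\<Sum>n<N. k_act (scl W) (fps_nth p n) (pw V W \<phi> n x)))"
proof -
  obtain N where "\<And>x n j. x \<in> X \<Longrightarrow> n \<ge> N \<Longrightarrow> j \<le> m \<Longrightarrow> fps_nth (pw V W \<phi> n x) j = 0"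
    and "\<And>x p j. x \<in> X \<Longrightarrow> j \<le> m \<Longrightarrow> fps_nth (ev V W p \<phi> x) j = (\<Sum>n<N. scl W (fps_nth p n) (fps_nth (pw V W \<phi> n x) j))"
    by (rule ev_nth_ex[OF assms, of m]) blast
  then show ?thesis by (intro that[of N]) (auto simp: vanish_def fps_sum_nth)
qed

lemma lin_sum: "(\<And>i. i \<in> I \<Longrightarrow> lin V W (f i)) \<Longrightarrow> lin V W (\<lambda>x. \<Sum>i\<in>I. f i x)"
proof (induction I rule: infinite_finite_induct)
  case (insert i I) then show ?case by (simp add: lin_plus)
qed (auto intro!: linI)

lemma cv_sum_left:
  assumes "finite I" "\<And>i. i \<in> I \<Longrightarrow> lin V W (f i)" "lin V W \<psi>" "v \<in> carr V"
  shows "cv V W (\<lambda>x. \<Sum>i\<in>I. f i x) \<psi> v = (\<Sum>i\<in>I. cv V W (f i) \<psi> v)"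
  using assms(1,2)
proof (induction I)
  case empty
  have "cv V W (\<lambda>x. 0) \<psi> v = Sw V (\<lambda>a b. \<Sum>i\<in>{}. 0) v"
    unfolding cv_def by (rule V.Sw_cong) (use assms in \<open>auto simp: lin_mem\<close>)
  then show ?case unfolding V.Sw_sum by simp
next
  case (insert i I) then show ?case using assms by (simp add: cv_add_left lin_sum)
qed

lemma cv_sum_right:
  assumes "finite I" "\<And>i. i \<in> I \<Longrightarrow> lin V W (f i)" "lin V W \<psi>" "v \<in> carr V"
  shows "cv V W \<psi> (\<lambda>x. \<Sum>i\<in>I. f i x) v = (\<Sum>i\<in>I. cv V W \<psi> (f i) v)"
  using assms(1,2)
proof (induction I)
  case empty
  have "cv V W \<psi> (\<lambda>x. 0) v = Sw V (\<lambda>a b. \<Sum>i\<in>{}. 0) v"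
    unfolding cv_def by (rule V.Sw_cong) (use assms in \<open>auto simp: lin_mem\<close>)
  then show ?case unfolding V.Sw_sum by simp
next
  case (insert i I) then show ?case using assms by (simp add: cv_add_right lin_sum)
qed

lemma cv_congr:
  assumes "v \<in> carr V" "lin V W \<phi>" "lin V W \<phi>'" "lin V W \<psi>" "lin V W \<psi>'"
    and "\<And>x. x \<in> fst ` set (sw V v) \<Longrightarrow> vanish m (\<phi> x - \<phi>' x)" "\<And>x. x \<in> snd ` set (sw V v) \<Longrightarrow> vanish m (\<psi> x - \<psi>' x)"
  shows "vanish m (cv V W \<phi> \<psi> v - cv V W \<phi>' \<psi>' v)"
  unfolding cv_def
proof (rule Sw_congr[OF assms(1)])
  fix a b assume ab: "(a, b) \<in> set (sw V v)"
  then have "a \<in> fst ` set (sw V v)" "b \<in> snd ` set (sw V v)" by force+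
  with ab show "vanish m (\<phi> a \<odot> \<psi> b - \<phi>' a \<odot> \<psi>' b)"
    using V.sw_carr[OF assms(1) ab] assms by (intro sm_congr) (auto simp: lin_mem)
qed

text \<open>Evaluation at \<open>v\<close> modulo \<open>\<hbar>\<^sup>m\<close> only sees finitely many powers of \<open>\<phi>\<close>, also on the finitely many tensor factors of
  \<open>\<delta>(v)\<close>.  For polynomials the claim is the addition law for powers.\<close>

lemma ev_mult:
  assumes "small V W \<phi>" "v \<in> carr V"
  shows "cv V W (ev V W p \<phi>) (ev V W q \<phi>) v = ev V W (p * q) \<phi> v"
proof (rule vanish_eqI)
  fix m
  note l = lin_pw[OF smallD(1)[OF assms(1)]]
  define X where "X = insert v (fst ` set (sw V v) \<union> snd ` set (sw V v))"
  have X: "finite X" "X \<subseteq> carr V" using V.sw_carr[OF assms(2)] assms(2) by (auto simp: X_def)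
  obtain N where N: "\<And>x n. x \<in> X \<Longrightarrow> n \<ge> N \<Longrightarrow> vanish m (pw V W \<phi> n x)"
    and A: "\<And>x p. x \<in> X \<Longrightarrow> vanish m (ev V W p \<phi> x - (\<Sum>n<N. k_act (scl W) (fps_nth p n) (pw V W \<phi> n x)))"
    by (rule ev_approx[OF assms(1) X, of m]) blast
  define P where "P = (\<lambda>p x. \<Sum>n<N. k_act (scl W) (fps_nth p n) (pw V W \<phi> n x))"
  have P: "lin V W (P p)" for p unfolding P_def by (intro lin_sum lin_k l)
  have 1: "vanish m (cv V W (ev V W p \<phi>) (ev V W q \<phi>) v - cv V W (P p) (P q) v)"
    by (rule cv_congr[OF assms(2)]) (use lin_ev[OF assms(1)] P A in \<open>auto simp: X_def P_def\<close>)
  have "cv V W (P p) (P q) v = (\<Sum>i<N. \<Sum>j<N. k_act (scl W) (fps_nth p i * fps_nth q j) (pw V W \<phi> (i + j) v))"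
    unfolding P_def
    by (simp add: cv_sum_left cv_sum_right lin_sum lin_k l cv_k_left cv_k_right assms(2) pw_add smallD(1)[OF assms(1)]
        W.ks.scale_sum_right)
  also have "vanish m (\<dots> - P (p * q) v)"
    unfolding vanish_def
  proof (intro allI impI)
    fix i assume i: "i < m"
    define c where "c = (\<lambda>n. fps_nth (pw V W \<phi> n v) i)"
    have c: "c n = 0" if "n \<ge> N" for n using N[of v n] that i by (simp add: c_def vanish_def X_def)
    then have c': "n < N" if "c n \<noteq> 0" for n using that by (meson not_less)
    let ?g = "\<lambda>a b. scl W (fps_nth p a * fps_nth q b) (c (a + b))"
    have "(\<Sum>a<N. \<Sum>b<N. ?g a b) = (\<Sum>(a, b)\<in>{..<N} \<times> {..<N}. ?g a b)" by (simp add: sum.cartesian_product)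
    also have "\<dots> = (\<Sum>(a, b)\<in>{(a, b). a + b < N}. ?g a b)"
      by (rule sum.mono_neutral_right) (auto dest: c')
    also have "\<dots> = (\<Sum>k<N. \<Sum>a\<le>k. ?g a (k - a))" by (rule sum.triangle_reindex)
    also have "\<dots> = (\<Sum>k<N. scl W (fps_nth (p * q) k) (c k))"
      by (rule sum.cong) (auto simp: fps_mult_nth W.vs.scale_sum_left atLeast0AtMost)
    finally show "fps_nth ((\<Sum>i<N. \<Sum>j<N. k_act (scl W) (fps_nth p i * fps_nth q j) (pw V W \<phi> (i + j) v)) - P (p * q) v) i = 0"
      by (simp add: fps_sum_nth P_def c_def)
  qed
  finally have 2: "vanish m (cv V W (P p) (P q) v - P (p * q) v)" .
  have 3: "vanish m (ev V W (p * q) \<phi> v - P (p * q) v)" unfolding P_def by (rule A) (simp add: X_def)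
  from vanish_diff[OF vanish_add[OF 1 2] 3]
  show "vanish m (cv V W (ev V W p \<phi>) (ev V W q \<phi>) v - ev V W (p * q) \<phi> v)" by simp
qed

lemma small_ev:
  assumes "small V W \<phi>" "fps_nth q 0 = 0" shows "small V W (ev V W q \<phi>)"
proof -
  note l = lin_pw[OF smallD(1)[OF assms(1)]]
  have "vanish 1 (pw V W \<phi> (Suc n) (unit V))" for n
  proof -
    have "vanish (1 + 0) (\<phi> (unit V) \<odot> pw V W \<phi> n (unit V))"
      by (rule W.vanish_sm) (use smallD[OF assms(1)] lin_mem[OF l V.unit_carr] in \<open>auto simp: lin_mem V.unit_carr\<close>)
    then show ?thesis using l smallD(1)[OF assms(1)] by (simp add: cv_unit)
  qed
  then have *: "scl W (fps_nth q n) (fps_nth (pw V W \<phi> n (unit V)) 0) = 0" for n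
    using assms(2) by (cases n) (auto simp: vanish_def)
  obtain N where "fps_nth (ev V W q \<phi> (unit V)) 0 = (\<Sum>n<N. scl W (fps_nth q n) (fps_nth (pw V W \<phi> n (unit V)) 0))"
    by (rule ev_nth_ex1[OF assms(1) V.unit_carr, of 0]) blast
  then have "vanish 1 (ev V W q \<phi> (unit V))" by (simp add: * vanish_def)
  then show ?thesis using lin_ev hdeg_ev assms by (simp add: small_def)
qed

lemma pw_ev:
  assumes "small V W \<phi>" "v \<in> carr V"
  shows "pw V W (ev V W q \<phi>) n v = ev V W (q ^ n) \<phi> v"
  using assms(2)
proof (induction n arbitrary: v)
  case 0 then show ?case by (simp add: ev_1 assms)
next
  case (Suc n)
  have "pw V W (ev V W q \<phi>) (Suc n) v = cv V W (ev V W q \<phi>) (ev V W (q ^ n) \<phi>) v"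
    unfolding pw.simps by (rule cv_cong) (use Suc in auto)
  then show ?case using ev_mult[OF assms(1) Suc.prems] by simp
qed

text \<open>Since \<open>q\<close> has no constant term, \<open>q\<^sup>n\<close> has order at least \<open>n\<close>, so that each coefficient is a finite double sum
  whose order of summation can be exchanged.\<close>

lemma ev_compose:
  assumes "small V W \<phi>" "v \<in> carr V" "fps_nth q 0 = 0"
  shows "ev V W p (ev V W q \<phi>) v = ev V W (p oo q) \<phi> v"
proof (rule fps_ext)
  fix i
  obtain N where N: "\<And>n. n \<ge> N \<Longrightarrow> fps_nth (pw V W \<phi> n v) i = 0"
    and E: "\<And>p. fps_nth (ev V W p \<phi> v) i = (\<Sum>n<N. scl W (fps_nth p n) (fps_nth (pw V W \<phi> n v) i))"
    by (rule ev_nth_ex1[OF assms(1,2), of i]) blast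
  have z: "fps_nth (q ^ n) j = 0" if "j < n" for n j
    using startsby_zero_power_prefix[OF assms(3)] that by auto
  have "fps_nth (ev V W p (ev V W q \<phi>) v) i = (\<Sum>n<N. scl W (fps_nth p n) (fps_nth (pw V W (ev V W q \<phi>) n v) i))"
  proof (rule ev_nth[OF small_ev[OF assms(1,3)] assms(2)])
    fix n assume "n \<ge> N"
    then show "fps_nth (pw V W (ev V W q \<phi>) n v) i = 0" by (simp add: pw_ev assms E z)
  qed
  also have "\<dots> = (\<Sum>n<N. \<Sum>j<N. scl W (fps_nth p n * fps_nth (q ^ n) j) (fps_nth (pw V W \<phi> j v) i))"
    by (simp add: pw_ev assms E W.vs.scale_sum_right)
  also have "\<dots> = (\<Sum>j<N. \<Sum>n<N. scl W (fps_nth p n * fps_nth (q ^ n) j) (fps_nth (pw V W \<phi> j v) i))"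
    by (rule sum.swap)
  also have "\<dots> = (\<Sum>j<N. scl W (fps_nth (p oo q) j) (fps_nth (pw V W \<phi> j v) i))"
  proof (rule sum.cong[OF refl])
    fix j assume j: "j \<in> {..<N}"
    have "(\<Sum>n<N. scl W (fps_nth p n * fps_nth (q ^ n) j) (fps_nth (pw V W \<phi> j v) i)) =
        (\<Sum>n=0..j. scl W (fps_nth p n * fps_nth (q ^ n) j) (fps_nth (pw V W \<phi> j v) i))"
      by (rule sum.mono_neutral_right) (use j z in auto)
    then show "(\<Sum>n<N. scl W (fps_nth p n * fps_nth (q ^ n) j) (fps_nth (pw V W \<phi> j v) i)) = 
        scl W (fps_nth (p oo q) j) (fps_nth (pw V W \<phi> j v) i)"
      by (simp add: fps_compose_nth W.vs.scale_sum_left)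
  qed
  finally show "fps_nth (ev V W p (ev V W q \<phi>) v) i = fps_nth (ev V W (p oo q) \<phi> v) i" by (simp add: E)
qed

lemma ev_cong: 
  assumes "v \<in> carr V" "\<And>x. x \<in> carr V \<Longrightarrow> \<phi> x = \<psi> x" shows "ev V W p \<phi> v = ev V W p \<psi> v"
  unfolding ev_def using pw_cong[OF assms] by simp

end

lemma exp_ln_compose:
  "(fps_exp 1 - 1) oo fps_ln 1 = (fps_X :: 'k::field_char_0 fps)" "fps_ln 1 oo (fps_exp 1 - 1) = (fps_X :: 'k fps)"
proof -
  have "fps_nth (fps_exp 1 - 1 :: 'k fps) 0 = 0" "fps_nth (fps_exp 1 - 1 :: 'k fps) 1 \<noteq> 0" by simp_all
  then show "(fps_exp 1 - 1) oo fps_ln 1 = (fps_X :: 'k fps)" "fps_ln 1 oo (fps_exp 1 - 1) = (fps_X :: 'k fps)"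
    unfolding fps_ln_fps_exp_inv[OF one_neq_zero] by (rule fps_inv_right fps_inv; simp)+
qed

section \<open>\<open>R\<close>-linear maps and their restrictions\<close>

locale gpair = V: gvec V + W: gvec W
  for V :: "('k::field_char_0, 'v::ab_group_add, 'y) gvs_scheme" and W :: "('k, 'w::ab_group_add, 'z) gvs_scheme"
begin

lemma const_carr: "x \<in> carr V \<Longrightarrow> fps_const x \<in> ser (carr V)"
  by simp

lemma ser_ext_nth: "v \<in> ser (carr V) \<Longrightarrow> fps_nth (ser_ext (carr V) \<phi> v) n = (\<Sum>i\<le>n. fps_nth (\<phi> (fps_nth v i)) (n - i))"
  by (simp add: ser_ext_def)

lemma ser_ext_cong: "(\<And>x. x \<in> carr V \<Longrightarrow> \<phi> x = \<psi> x) \<Longrightarrow> ser_ext (carr V) \<phi> = ser_ext (carr V) \<psi>"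
  unfolding ser_ext_def by (rule restrict_ext) (simp add: ser_nth)

lemma lin_0: "lin V W \<phi> \<Longrightarrow> \<phi> 0 = 0"
  using lin_add[of V W \<phi> 0 0] by simp

lemma ser_ext_const:
  assumes "lin V W \<phi>" "x \<in> carr V" shows "ser_ext (carr V) \<phi> (fps_const x) = \<phi> x"
proof (rule fps_ext)
  fix n
  have "fps_nth (ser_ext (carr V) \<phi> (fps_const x)) n = (\<Sum>i\<le>n. if i = 0 then fps_nth (\<phi> x) n else 0)"
    unfolding ser_ext_nth[OF const_carr[OF assms(2)]]
    by (rule sum.cong) (auto simp: lin_0[OF assms(1)])
  then show "fps_nth (ser_ext (carr V) \<phi> (fps_const x)) n = fps_nth (\<phi> x) n" by simp
qed

lemma lin_sum_arg:
  assumes "lin V W \<phi>" "\<And>i. i \<in> I \<Longrightarrow> f i \<in> carr V"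
  shows "\<phi> (sum f I) = (\<Sum>i\<in>I. \<phi> (f i))"
  using assms(2) by (induction I rule: infinite_finite_induct) (simp_all add: lin_0[OF assms(1)] lin_add[OF assms(1)] V.carr_sum)

lemma R_linear_ser_ext:
  assumes "lin V W \<phi>" shows "R_linear V W (ser_ext (carr V) \<phi>)"
  unfolding R_linear_def
proof (intro conjI ballI allI)
  show "ser_ext (carr V) \<phi> \<in> ser (carr V) \<rightarrow>\<^sub>E ser (carr W)"
  proof (rule PiE_I)
    fix v assume v: "v \<in> ser (carr V)"
    show "ser_ext (carr V) \<phi> v \<in> ser (carr W)"
      by (rule serI) (simp add: ser_ext_nth[OF v] W.carr_sum ser_nth[OF lin_mem[OF assms ser_nth[OF v]]])
  qed (simp add: ser_ext_def)
  show "ser_ext (carr V) \<phi> (v + w) = ser_ext (carr V) \<phi> v + ser_ext (carr V) \<phi> w"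
    if "v \<in> ser (carr V)" "w \<in> ser (carr V)" for v w
    using that by (simp add: fps_eq_iff ser_ext_nth V.ser_carr_add lin_add[OF assms] ser_nth sum.distrib)
  show "ser_ext (carr V) \<phi> (R_act (scl V) a v) = R_act (scl W) a (ser_ext (carr V) \<phi> v)"
    if v: "v \<in> ser (carr V)" for a v
  proof (rule fps_ext)
    fix n
    let ?f = "\<lambda>i j k. scl W (fps_nth a i) (fps_nth (\<phi> (fps_nth v j)) k)"
    have "fps_nth (ser_ext (carr V) \<phi> (R_act (scl V) a v)) n = (\<Sum>i=0..n. \<Sum>j=0..i. ?f j (i - j) (n - i))"
      using v by (simp add: ser_ext_nth V.ser_carr_R V.R_act_nth lin_sum_arg[OF assms] V.carr_scl ser_nth
          fps_sum_nth lin_scl_nth[OF W.gvec_axioms assms] atLeast0AtMost)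
    also have "\<dots> = (\<Sum>i=0..n. \<Sum>j=0..n - i. ?f i j (n - i - j))" by (rule fps_mult_assoc_lemma)
    also have "\<dots> = fps_nth (R_act (scl W) a (ser_ext (carr V) \<phi> v)) n"
      using v by (simp add: W.R_act_nth ser_ext_nth W.vs.scale_sum_right atLeast0AtMost)
    finally show "fps_nth (ser_ext (carr V) \<phi> (R_act (scl V) a v)) n = fps_nth (R_act (scl W) a (ser_ext (carr V) \<phi> v)) n" .
  qed
qed

lemma R_linearD:
  assumes "R_linear V W F"
  shows "v \<in> ser (carr V) \<Longrightarrow> F v \<in> ser (carr W)"
    and "v \<in> ser (carr V) \<Longrightarrow> w \<in> ser (carr V) \<Longrightarrow> F (v + w) = F v + F w"
    and "v \<in> ser (carr V) \<Longrightarrow> F (R_act (scl V) a v) = R_act (scl W) a (F v)"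
    and "F \<in> extensional (ser (carr V))"
  using assms by (auto simp: R_linear_def PiE_def)

lemma R_linear_lin:
  assumes "R_linear V W F" shows "lin V W (\<lambda>x. F (fps_const x))"
proof (rule linI)
  note F = R_linearD[OF assms]
  show "F (fps_const (x + y)) = F (fps_const x) + F (fps_const y)" if "x \<in> carr V" "y \<in> carr V" for x y
    using F(2)[of "fps_const x" "fps_const y"] that by (simp add: const_carr)
  show "F (fps_const (scl V c x)) = k_act (scl W) c (F (fps_const x))" if "x \<in> carr V" for x c
  proof -
    have "fps_const (scl V c x) = k_act (scl V) c (fps_const x)" by (simp add: fps_eq_iff)
    then show ?thesis using F(3)[of "fps_const x"] that by (simp add: const_carr k_act_def)
  qed
  show "F (fps_const x) \<in> ser (carr W)" if "x \<in> carr V" for x using F(1) that by (simp add: const_carr)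
qed

text \<open>An \<open>R\<close>-linear map respects the \<open>\<hbar>\<close>-adic filtration and so is determined by its values on \<open>V\<close>.\<close>

lemma R_linear_eq_ser_ext:
  assumes "R_linear V W F" shows "F = ser_ext (carr V) (\<lambda>x. F (fps_const x))"
proof (rule extensionalityI[of _ "ser (carr V)"])
  note F = R_linearD[OF assms]
  show "F \<in> extensional (ser (carr V))" by (rule F(4))
  show "ser_ext (carr V) (\<lambda>x. F (fps_const x)) \<in> extensional (ser (carr V))" by (simp add: ser_ext_def)
  fix v assume v: "v \<in> ser (carr V)"
  show "F v = ser_ext (carr V) (\<lambda>x. F (fps_const x)) v"
  proof (rule fps_ext)
    fix n
    define t where "t = (\<lambda>i. R_act (scl V) (fps_X ^ i) (fps_const (fps_nth v i)))"
    define r where "r = Abs_fps (\<lambda>i. fps_nth v (i + Suc n))"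
    have t: "t i \<in> ser (carr V)" for i unfolding t_def by (rule V.ser_carr_R) (simp add: ser_nth[OF v])
    have r: "r \<in> ser (carr V)" by (auto simp: r_def ser_def ser_nth[OF v])
    have st: "sum t I \<in> ser (carr V)" for I
      by (induction I rule: infinite_finite_induct) (auto simp: t V.ser_carr_add)
    have F0: "F 0 = 0" using F(2)[of 0 0] by simp
    have Fs: "F (sum t I) = (\<Sum>i\<in>I. F (t i))" for I
      by (induction I rule: infinite_finite_induct) (auto simp: F0 F(2)[OF t st])
    have "v = sum t {..n} + R_act (scl V) (fps_X ^ Suc n) r"
    proof (rule fps_ext)
      fix j
      have "fps_nth (sum t {..n}) j = (\<Sum>i\<le>n. if i = j then fps_nth v j else 0)"
        unfolding fps_sum_nth t_def V.R_act_X_power by (rule sum.cong) auto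
      then show "fps_nth v j = fps_nth (sum t {..n} + R_act (scl V) (fps_X ^ Suc n) r) j"
        by (simp del: power_Suc add: V.R_act_X_power r_def)
    qed
    then have "F v = F (sum t {..n} + R_act (scl V) (fps_X ^ Suc n) r)" by simp
    also have "\<dots> = (\<Sum>i\<le>n. F (t i)) + R_act (scl W) (fps_X ^ Suc n) (F r)"
      using F(2)[OF st V.ser_carr_R[OF r], of "{..n}"] F(3)[OF r] by (simp del: power_Suc add: Fs)
    finally have "fps_nth (F v) n = (\<Sum>i\<le>n. fps_nth (F (t i)) n)"
      by (simp del: power_Suc add: W.R_act_X_power fps_sum_nth)
    also have "\<dots> = (\<Sum>i\<le>n. fps_nth (F (fps_const (fps_nth v i))) (n - i))"
      unfolding t_def by (rule sum.cong) (auto simp: F(3) ser_nth[OF v] W.R_act_X_power)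
    finally show "fps_nth (F v) n = fps_nth (ser_ext (carr V) (\<lambda>x. F (fps_const x)) v) n"
      using v by (simp add: ser_ext_nth)
  qed
qed

lemma R_linear_continuous:
  assumes "R_linear V W F" shows "continuous_on (ser (carr V)) F"
  unfolding continuous_on_def
proof (intro ballI tendsto_fpsI)
  fix v n assume v: "v \<in> ser (carr V)"
  have F: "fps_nth (F w) n = (\<Sum>i\<le>n. fps_nth (F (fps_const (fps_nth w i))) (n - i))" if "w \<in> ser (carr V)" for w
    by (subst R_linear_eq_ser_ext[OF assms]) (simp add: ser_ext_nth that)
  have "((\<lambda>w. w) \<longlongrightarrow> v) (at v within ser (carr V))" by (rule tendsto_ident_at)
  then have "\<forall>\<^sub>F w in at v within ser (carr V). fps_nth w i = fps_nth v i" for i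
    unfolding tendsto_fps_iff by blast
  then have "\<forall>\<^sub>F w in at v within ser (carr V). \<forall>i\<in>{..n}. fps_nth w i = fps_nth v i"
    by (intro eventually_ball_finite) auto
  moreover have "\<forall>\<^sub>F w in at v within ser (carr V). w \<in> ser (carr V)"
    by (simp add: eventually_at_filter)
  ultimately show "\<forall>\<^sub>F w in at v within ser (carr V). fps_nth (F w) n = fps_nth (F v) n"
  proof eventually_elim
    case (elim w)
    then show ?case unfolding F[OF elim(2)] F[OF v] by (intro sum.cong) auto
  qed
qed

lemma has_degree_ser_ext:
  assumes "hdeg V W d \<phi>" shows "has_degree V W d (ser_ext (carr V) \<phi>)"
  unfolding has_degree_def
proof (intro allI subsetI)
  fix n x assume "x \<in> ser_ext (carr V) \<phi> ` ser (gr V n)"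
  then obtain v where v: "v \<in> ser (gr V n)" "x = ser_ext (carr V) \<phi> v" by blast
  show "x \<in> ser (gr W (n + d))"
    unfolding v(2) by (rule serI)
      (simp add: ser_ext_nth V.ser_gr_carr[OF v(1)] W.gr_sum ser_nth[OF hdegD[OF assms ser_nth[OF v(1)]]])
qed

lemma has_degree_hdeg: "has_degree V W d F \<Longrightarrow> hdeg V W d (\<lambda>x. F (fps_const x))"
  unfolding has_degree_def hdeg_def by (auto simp: image_subset_iff)

end

lemma R_linear_comp:
  assumes "gvec X" "gvec Y" "gvec Z" "R_linear Y Z F" "R_linear X Y G"
  shows "R_linear X Z (compose (ser (carr X)) F G)"
proof -
  interpret XY: gpair X Y using assms by (simp add: gpair_def)
  interpret YZ: gpair Y Z using assms by (simp add: gpair_def)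
  show ?thesis unfolding R_linear_def
    using XY.R_linearD[OF assms(5)] YZ.R_linearD[OF assms(4)]
    by (auto simp: compose_def XY.V.ser_carr_add XY.V.ser_carr_R)
qed

section \<open>Exponential and logarithm\<close>

text \<open>The restrictions to \<open>V\<close> of the elements of \<open>\<e> + Lin\<^sup>0\<close>.\<close>

definition glike :: "('k::field_char_0, 'v::ab_group_add) mv \<Rightarrow> ('k, 'w::ab_group_add) mv \<Rightarrow> ('v \<Rightarrow> 'w fps) \<Rightarrow> bool" where
  "glike V W \<Phi> \<longleftrightarrow> lin V W \<Phi> \<and> hdeg V W 0 \<Phi> \<and> vanish 1 (\<Phi> (unit V) - fps_const (unit W))"

sublocale cpair \<subseteq> P: gpair V W ..

context cpair
begin

abbreviation "ex \<equiv> ev V W (fps_exp 1)"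
abbreviation "lg \<Phi> \<equiv> ev V W (fps_ln 1) (\<lambda>x. \<Phi> x - ce V W x)"

lemma small_minus_ce: "glike V W \<Phi> \<Longrightarrow> small V W (\<lambda>x. \<Phi> x - ce V W x)"
  unfolding glike_def small_def using lin_minus[OF _ lin_ce] hdegD[OF hdeg_ce]
  by (auto simp: ce_unit hdeg_def intro!: W.ser_gr_diff)

lemma ex_minus:
  assumes "small V W \<phi>" "v \<in> carr V" shows "ex \<phi> v - ce V W v = ev V W (fps_exp 1 - 1) \<phi> v"
  using ev_plus[OF assms, of "fps_exp 1 - 1" 1] ev_1[OF assms] by simp

lemma glike_ex: assumes "small V W \<phi>" shows "glike V W (ex \<phi>)"
proof -
  have "vanish 1 (ev V W (fps_exp 1 - 1) \<phi> (unit V))" by (rule smallD(3)[OF small_ev[OF assms]]) simp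
  then have "vanish 1 (ex \<phi> (unit V) - fps_const (unit W))"
    using ex_minus[OF assms V.unit_carr] by (simp add: ce_unit)
  then show ?thesis by (simp add: glike_def lin_ev hdeg_ev assms)
qed

lemma small_lg: "glike V W \<Phi> \<Longrightarrow> small V W (lg \<Phi>)"
  by (rule small_ev[OF small_minus_ce]) simp_all

lemma lg_ex: assumes "small V W \<phi>" "v \<in> carr V" shows "lg (ex \<phi>) v = \<phi> v"
proof -
  have "lg (ex \<phi>) v = ev V W (fps_ln 1) (ev V W (fps_exp 1 - 1) \<phi>) v"
    by (rule ev_cong[OF assms(2)]) (simp add: ex_minus assms)
  then show ?thesis using assms by (simp add: ev_compose exp_ln_compose ev_X)
qed

lemma ex_lg: assumes "glike V W \<Phi>" "v \<in> carr V" shows "ex (lg \<Phi>) v = \<Phi> v"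
proof -
  note s = small_minus_ce[OF assms(1)]
  have "ex (lg \<Phi>) v - ce V W v = ev V W (fps_exp 1 - 1) (lg \<Phi>) v"
    by (rule ex_minus[OF small_lg[OF assms(1)] assms(2)])
  also have "\<dots> = \<Phi> v - ce V W v" using s assms(2) by (simp add: ev_compose exp_ln_compose ev_X)
  finally show ?thesis by simp
qed

lemma conv_ser_ext:
  assumes "lin V W \<phi>" "lin V W \<psi>" 
    "\<And>x. x \<in> carr V \<Longrightarrow> f (fps_const x) = \<phi> x" "\<And>x. x \<in> carr V \<Longrightarrow> g (fps_const x) = \<psi> x"
  shows "conv V W f g = ser_ext (carr V) (cv V W \<phi> \<psi>)"
  unfolding conv_def
proof (rule P.ser_ext_cong)
  fix x assume x: "x \<in> carr V"
  let ?\<beta> = "\<lambda>a b. f (fps_const a) \<odot> g (fps_const b)"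
  have b: "bilin V (k_act (scl W)) ?\<beta>"
    by (subst bilin_cong[OF V.gvec_axioms, of _ "\<lambda>a b. \<phi> a \<odot> \<psi> b"]) (use assms sm_bilin in auto)
  show "tens_lift (scl V) (k_act (scl W)) (carr V) 2
         (\<lambda>xs. f (fps_const (xs ! 0)) \<odot> g (fps_const (xs ! 1))) (coprod V x) = cv V W \<phi> \<psi> x"
    unfolding V.Sw_lift[OF x W.k_act_vs b] cv_def by (rule V.Sw_cong[OF x]) (simp add: assms)
qed

lemma conv_unit_ser_ext: "conv_unit V W = ser_ext (carr V) (ce V W)"
  unfolding conv_unit_def ce_def ..

lemma conv_pow_ser_ext:
  assumes "lin V W \<phi>" "\<And>x. x \<in> carr V \<Longrightarrow> f (fps_const x) = \<phi> x"
  shows "conv_pow V W f n = ser_ext (carr V) (pw V W \<phi> n)"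
proof (induction n)
  case 0 show ?case by (simp add: conv_unit_ser_ext)
next
  case (Suc n)
  then show ?case using assms lin_pw[OF assms(1), of n]
    by (simp add: conv_ser_ext P.ser_ext_const)
qed

lemma suminf_ser_ext:
  assumes "small V W \<phi>" "v \<in> ser (carr V)"
  shows "(\<Sum>n. k_act (scl W) (fps_nth p n) (ser_ext (carr V) (pw V W \<phi> n) v)) = ser_ext (carr V) (ev V W p \<phi>) v"
    and "\<exists>N. \<forall>n\<ge>N. fps_nth (k_act (scl W) (c n) (ser_ext (carr V) (pw V W \<phi> n) v)) i = 0"
proof -
  have *: "\<exists>N. (\<forall>n\<ge>N. fps_nth (ser_ext (carr V) (pw V W \<phi> n) v) i = 0) \<and>
      fps_nth (ser_ext (carr V) (ev V W p \<phi>) v) i = 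
        (\<Sum>n<N. scl W (fps_nth p n) (fps_nth (ser_ext (carr V) (pw V W \<phi> n) v) i))" for i
  proof -
    let ?X = "fps_nth v ` {..i}"
    have X: "finite ?X" "?X \<subseteq> carr V" using assms(2) by (auto simp: ser_nth)
    obtain N where N: "\<And>x n j. x \<in> ?X \<Longrightarrow> n \<ge> N \<Longrightarrow> j \<le> i \<Longrightarrow> fps_nth (pw V W \<phi> n x) j = 0"
      and E: "\<And>x p j. x \<in> ?X \<Longrightarrow> j \<le> i \<Longrightarrow> fps_nth (ev V W p \<phi> x) j = (\<Sum>n<N. scl W (fps_nth p n) (fps_nth (pw V W \<phi> n x) j))"
      by (rule ev_nth_ex[OF assms(1) X, of i]) blast
    have "fps_nth (ser_ext (carr V) (ev V W p \<phi>) v) i = 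
        (\<Sum>j\<le>i. \<Sum>n<N. scl W (fps_nth p n) (fps_nth (pw V W \<phi> n (fps_nth v j)) (i - j)))"
      unfolding P.ser_ext_nth[OF assms(2)] by (rule sum.cong) (auto simp: E)
    also have "\<dots> = (\<Sum>n<N. \<Sum>j\<le>i. scl W (fps_nth p n) (fps_nth (pw V W \<phi> n (fps_nth v j)) (i - j)))"
      by (rule sum.swap)
    also have "\<dots> = (\<Sum>n<N. scl W (fps_nth p n) (fps_nth (ser_ext (carr V) (pw V W \<phi> n) v) i))"
      by (simp add: P.ser_ext_nth[OF assms(2)] W.vs.scale_sum_right)
    finally show ?thesis using N by (intro exI[of _ N]) (auto simp: P.ser_ext_nth[OF assms(2)])
  qed
  show loc: "\<exists>N. \<forall>n\<ge>N. fps_nth (k_act (scl W) (c n) (ser_ext (carr V) (pw V W \<phi> n) v)) i = 0" for c i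
    using *[of i] by auto
  show "(\<Sum>n. k_act (scl W) (fps_nth p n) (ser_ext (carr V) (pw V W \<phi> n) v)) = ser_ext (carr V) (ev V W p \<phi>) v"
  proof (rule fps_ext)
    fix i
    obtain N where N: "\<forall>n\<ge>N. fps_nth (ser_ext (carr V) (pw V W \<phi> n) v) i = 0"
      "fps_nth (ser_ext (carr V) (ev V W p \<phi>) v) i = 
        (\<Sum>n<N. scl W (fps_nth p n) (fps_nth (ser_ext (carr V) (pw V W \<phi> n) v) i))" using *[of i] by blast
    show "fps_nth (\<Sum>n. k_act (scl W) (fps_nth p n) (ser_ext (carr V) (pw V W \<phi> n) v)) i = 
        fps_nth (ser_ext (carr V) (ev V W p \<phi>) v) i"
      by (subst fps_suminf_nth[where N=N, OF loc]) (use N in auto)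
  qed
qed

lemma mv_exp_ser_ext:
  assumes "small V W \<phi>" "\<And>x. x \<in> carr V \<Longrightarrow> f (fps_const x) = \<phi> x"
  shows "mv_exp V W f = ser_ext (carr V) (ex \<phi>)"
proof (rule extensionalityI[of _ "ser (carr V)"])
  fix v assume v: "v \<in> ser (carr V)"
  show "mv_exp V W f v = ser_ext (carr V) (ex \<phi>) v"
    using suminf_ser_ext(1)[OF assms(1) v, of "fps_exp 1"] v
    by (simp add: mv_exp_def conv_pow_ser_ext[OF smallD(1)[OF assms(1)] assms(2)])
qed (simp_all add: mv_exp_def ser_ext_def)

lemma mv_log_ser_ext:
  assumes "glike V W \<Phi>" "\<And>x. x \<in> carr V \<Longrightarrow> h (fps_const x) = \<Phi> x"
  shows "mv_log V W h = ser_ext (carr V) (lg \<Phi>)"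
proof (rule extensionalityI[of _ "ser (carr V)"])
  fix v assume v: "v \<in> ser (carr V)"
  let ?\<gamma> = "\<lambda>x. \<Phi> x - ce V W x"
  note s = small_minus_ce[OF assms(1)]
  define g where "g = (\<lambda>v\<in>ser (carr V). h v - conv_unit V W v)"
  have g: "g (fps_const x) = ?\<gamma> x" if "x \<in> carr V" for x
    using that by (simp add: g_def assms(2) conv_unit_ser_ext P.ser_ext_const lin_ce)
  have cp: "conv_pow V W g n = ser_ext (carr V) (pw V W ?\<gamma> n)" for n
    by (rule conv_pow_ser_ext[OF smallD(1)[OF s] g])
  have "mv_log V W h v = (\<Sum>n. k_act (scl W) (fps_nth (fps_ln 1) (Suc n)) (ser_ext (carr V) (pw V W ?\<gamma> (Suc n)) v))"
    using v by (simp add: mv_log_def Let_def g_def[symmetric] cp fps_ln_nth del: conv_pow.simps pw.simps)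
  also have "\<dots> = (\<Sum>n. k_act (scl W) (fps_nth (fps_ln 1) n) (ser_ext (carr V) (pw V W ?\<gamma> n) v))"
    (is "suminf ?a = suminf ?b")
  proof (rule fps_ext)
    fix i
    have loc: "\<exists>N. \<forall>n\<ge>N. fps_nth (?b n) i = 0" for i by (rule suminf_ser_ext(2)[OF s v])
    obtain N where N: "\<forall>n\<ge>N. fps_nth (?b n) i = 0" using loc by blast
    have loc': "\<exists>N. \<forall>n\<ge>N. fps_nth (?a n) i = 0" for i using loc[of i] by (meson le_SucI)
    have "fps_nth (suminf ?a) i = (\<Sum>n<N. fps_nth (?a n) i)"
      by (rule fps_suminf_nth[OF loc']) (use N in \<open>meson le_SucI\<close>)
    also have "\<dots> = (\<Sum>n<Suc N. fps_nth (?b n) i)"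
      by (subst sum.lessThan_Suc_shift) simp
    also have "\<dots> = fps_nth (suminf ?b) i"
      by (rule fps_suminf_nth[OF loc, symmetric]) (use N in simp)
    finally show "fps_nth (suminf ?a) i = fps_nth (suminf ?b) i" .
  qed
  also have "\<dots> = ser_ext (carr V) (lg \<Phi>) v" by (rule suminf_ser_ext(1)[OF s v])
  finally show "mv_log V W h v = ser_ext (carr V) (lg \<Phi>) v" .
qed (simp_all add: mv_log_def Let_def ser_ext_def)

lemma Lin_R_iff: "f \<in> Lin_R V W \<longleftrightarrow> R_linear V W f \<and> has_degree V W 0 f"
  using P.R_linear_continuous by (auto simp: Lin_R_def)

lemma Lin0_small:
  assumes "f \<in> Lin0_R V W" shows "small V W (\<lambda>x. f (fps_const x))" "f = ser_ext (carr V) (\<lambda>x. f (fps_const x))"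
  using assms P.R_linear_lin[of f] P.has_degree_hdeg[of 0 f] P.R_linear_eq_ser_ext[of f]
  by (auto simp: Lin0_R_def Lin_R_iff small_def vanish_def)

lemma small_Lin0: assumes "small V W \<phi>" shows "ser_ext (carr V) \<phi> \<in> Lin0_R V W"
  using smallD[OF assms] by (simp add: Lin0_R_def Lin_R_iff P.R_linear_ser_ext P.has_degree_ser_ext
      P.ser_ext_const V.unit_carr vanish_def)

end

text \<open>The target \<open>\<e> + Lin\<^sup>0\<close> of the exponential.\<close>

definition GL :: "('k::field_char_0, 'v::ab_group_add) mv \<Rightarrow> ('k, 'w::ab_group_add) mv \<Rightarrow> ('v fps \<Rightarrow> 'w fps) set" where
  "GL V W = {F. R_linear V W F \<and> has_degree V W 0 F \<and> fps_nth (F (fps_const (unit V))) 0 = unit W}"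

context cpair
begin

lemma GL_glike: assumes "F \<in> GL V W" shows "glike V W (\<lambda>x. F (fps_const x))"
  using assms P.R_linear_lin[of F] P.has_degree_hdeg[of 0 F]
  by (auto simp: GL_def glike_def vanish_def)

lemma glike_GL: assumes "glike V W \<Phi>" shows "ser_ext (carr V) \<Phi> \<in> GL V W"
  using assms by (auto simp: GL_def glike_def P.R_linear_ser_ext P.has_degree_ser_ext
      P.ser_ext_const V.unit_carr vanish_def)

lemma exp_GL: "f \<in> Lin0_R V W \<Longrightarrow> mv_exp V W f \<in> GL V W"
  using mv_exp_ser_ext[where f=f, OF Lin0_small(1) refl] glike_GL[OF glike_ex[OF Lin0_small(1)]] by simp

lemma log_Lin0: "F \<in> GL V W \<Longrightarrow> mv_log V W F \<in> Lin0_R V W"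
  using mv_log_ser_ext[where h=F, OF GL_glike refl] small_Lin0[OF small_lg[OF GL_glike]] by simp

lemma exp_log: assumes "F \<in> GL V W" shows "mv_exp V W (mv_log V W F) = F"
proof -
  note g = GL_glike[OF assms]
  have "mv_exp V W (mv_log V W F) = ser_ext (carr V) (ex (lg (\<lambda>x. F (fps_const x))))"
    by (rule mv_exp_ser_ext[OF small_lg[OF g]])
      (simp add: mv_log_ser_ext[OF g refl] P.ser_ext_const smallD(1)[OF small_lg[OF g]])
  also have "\<dots> = ser_ext (carr V) (\<lambda>x. F (fps_const x))" by (rule P.ser_ext_cong) (rule ex_lg[OF g])
  also have "\<dots> = F" using P.R_linear_eq_ser_ext[of F] assms by (simp add: GL_def)
  finally show ?thesis .
qed

lemma log_exp: assumes "f \<in> Lin0_R V W" shows "mv_log V W (mv_exp V W f) = f"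
proof -
  note s = Lin0_small[OF assms]
  have "mv_log V W (mv_exp V W f) = ser_ext (carr V) (lg (ex (\<lambda>x. f (fps_const x))))"
    by (rule mv_log_ser_ext[OF glike_ex[OF s(1)]])
      (simp add: mv_exp_ser_ext[OF s(1) refl] P.ser_ext_const lin_ev[OF s(1)])
  also have "\<dots> = ser_ext (carr V) (\<lambda>x. f (fps_const x))" by (rule P.ser_ext_cong) (rule lg_ex[OF s(1)])
  finally show ?thesis using s(2) by simp
qed

end

section \<open>The category of MV-algebras\<close>

lemma mv_gcog: "mv_algebra V \<Longrightarrow> gcog V" and mv_galg: "mv_algebra V \<Longrightarrow> galg V"
proof -
  have *: "graded_cocomm_coalgebra V \<Longrightarrow> graded_vs V" "graded_comm_algebra V \<Longrightarrow> graded_vs V \<and> unit V \<in> gr V 0" for V :: "('k::field_char_0, 'v::ab_group_add) mv"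
    unfolding graded_cocomm_coalgebra_def graded_comm_algebra_def by blast+
  then show "mv_algebra V \<Longrightarrow> gcog V" "mv_algebra V \<Longrightarrow> galg V"
    unfolding mv_algebra_def gcog_def gcog0_def gcog0_axioms_def gcog_axioms_def galg_def galg_axioms_def gvec_def by blast+
qed

lemma mv_cpair: "mv_algebra V \<Longrightarrow> mv_algebra W \<Longrightarrow> cpair V W"
  by (simp add: cpair_def mv_gcog mv_galg)

lemma mv_BV: "mv_algebra V \<Longrightarrow> v \<in> ser (carr V) \<Longrightarrow> BV V v \<in> ser (carr V)"
  unfolding mv_algebra_def R_linear_def by blast

lemma GL_compose:
  assumes "cpair X Y" "cpair Y Z" "cpair X Z" "F \<in> GL Y Z" "G \<in> GL X Y"
  shows "compose (ser (carr X)) F G \<in> GL X Z"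
proof -
  interpret XY: cpair X Y by fact
  interpret YZ: cpair Y Z by fact
  have F: "R_linear Y Z F" "has_degree Y Z 0 F" "fps_nth (F (fps_const (unit Y))) 0 = unit Z"
    and G: "R_linear X Y G" "has_degree X Y 0 G" "fps_nth (G (fps_const (unit X))) 0 = unit Y"
    using assms by (auto simp: GL_def)
  have "has_degree X Z 0 (compose (ser (carr X)) F G)"
    unfolding has_degree_def
  proof (intro allI subsetI)
    fix n y assume "y \<in> compose (ser (carr X)) F G ` ser (gr X n)"
    then obtain v where v: "v \<in> ser (gr X n)" "y = compose (ser (carr X)) F G v" by blast
    then have "G v \<in> ser (gr Y n)" using G(2) by (force simp: has_degree_def)
    then have "F (G v) \<in> ser (gr Z n)" using F(2) by (force simp: has_degree_def)
    then show "y \<in> ser (gr Z (n + 0))" using v by (simp add: compose_def XY.V.ser_gr_carr)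
  qed
  moreover have "fps_nth (F (G (fps_const (unit X)))) 0 = unit Z"
  proof -
    let ?w = "G (fps_const (unit X))"
    have w: "?w \<in> ser (carr Y)" by (rule XY.P.R_linearD(1)[OF G(1)]) (simp add: XY.V.unit_carr)
    have "fps_nth (F ?w) 0 = fps_nth (F (fps_const (fps_nth ?w 0))) 0"
      by (subst YZ.P.R_linear_eq_ser_ext[OF F(1)]) (simp add: YZ.P.ser_ext_nth[OF w])
    then show ?thesis by (simp add: G(3) F(3))
  qed
  ultimately show ?thesis
    using R_linear_comp[OF XY.V.gvec_axioms XY.W.gvec_axioms YZ.W.gvec_axioms F(1) G(1)] XY.V.unit_carr
    by (simp add: GL_def compose_def)
qed

lemma GL_id:
  assumes "cpair X X" shows "(\<lambda>v\<in>ser (carr X). v) \<in> GL X X"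
proof -
  interpret cpair X X by fact
  have "x \<in> ser (gr X n) \<Longrightarrow> x \<in> ser (carr X)" for x n by (rule V.ser_gr_carr)
  then show ?thesis
    by (auto simp: GL_def R_linear_def has_degree_def V.ser_carr_add V.ser_carr_R V.unit_carr)
qed

lemma MV_mor_iff: "f \<in> MV_mor V W \<longleftrightarrow> f \<in> Lin0_R V W \<and> (\<forall>v\<in>ser (carr V). BV W (mv_exp V W f v) = mv_exp V W f (BV V v))"
  by (auto simp: MV_mor_def)

lemma exp_MV_id: "cpair X X \<Longrightarrow> mv_exp X X (MV_id X) = (\<lambda>v\<in>ser (carr X). v)"
  unfolding MV_id_def by (rule cpair.exp_log[OF _ GL_id])

lemma exp_MV_comp:
  assumes "cpair X Y" "cpair Y Z" "cpair X Z" "f \<in> Lin0_R Y Z" "g \<in> Lin0_R X Y"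
  shows "mv_exp X Z (MV_comp X Y Z f g) = compose (ser (carr X)) (mv_exp Y Z f) (mv_exp X Y g)"
  unfolding MV_comp_def
  by (rule cpair.exp_log[OF assms(3) GL_compose[OF assms(1-3)]]) (use assms cpair.exp_GL in auto)

lemma MV_comp_Lin0:
  assumes "cpair X Y" "cpair Y Z" "cpair X Z" "f \<in> Lin0_R Y Z" "g \<in> Lin0_R X Y"
  shows "MV_comp X Y Z f g \<in> Lin0_R X Z"
  unfolding MV_comp_def
  by (rule cpair.log_Lin0[OF assms(3) GL_compose[OF assms(1-3)]]) (use assms cpair.exp_GL in auto)

lemma MV_id_mor: 
  assumes "mv_algebra X" shows "MV_id X \<in> MV_mor X X"
proof -
  have c: "cpair X X" using assms by (simp add: mv_cpair)
  have "MV_id X \<in> Lin0_R X X" unfolding MV_id_def by (rule cpair.log_Lin0[OF c GL_id[OF c]])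
  then show ?thesis using mv_BV[OF assms] by (simp add: MV_mor_iff exp_MV_id[OF c])
qed

lemma exp_mem: "cpair X Y \<Longrightarrow> f \<in> Lin0_R X Y \<Longrightarrow> v \<in> ser (carr X) \<Longrightarrow> mv_exp X Y f v \<in> ser (carr Y)"
  using cpair.exp_GL[of X Y f] by (auto simp: GL_def R_linear_def)

lemma MV_comp_mor:
  assumes "mv_algebra X" "mv_algebra Y" "mv_algebra Z" "g \<in> MV_mor X Y" "f \<in> MV_mor Y Z"
  shows "MV_comp X Y Z f g \<in> MV_mor X Z"
proof -
  note c = mv_cpair[OF assms(1,2)] mv_cpair[OF assms(2,3)] mv_cpair[OF assms(1,3)]
  have fg: "f \<in> Lin0_R Y Z" "g \<in> Lin0_R X Y" using assms by (auto simp: MV_mor_iff)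
  show ?thesis
    using assms(4,5) MV_comp_Lin0[OF c fg] exp_mem[OF c(1) fg(2)] mv_BV[OF assms(1)]
    by (simp add: MV_mor_iff exp_MV_comp[OF c fg] compose_def)
qed

lemma compose_id_left: 
  "F \<in> extensional A \<Longrightarrow> F \<in> A \<rightarrow> B \<Longrightarrow> compose A (\<lambda>v\<in>B. v) F = F"
  "F \<in> extensional A \<Longrightarrow> compose A F (\<lambda>v\<in>A. v) = F"
  by (auto simp: compose_def fun_eq_iff extensional_def)

theorem MV_category: "is_category (MV_cat :: (('k::field_char_0, 'v::ab_group_add) mv, 'v fps \<Rightarrow> 'v fps) category)"
  unfolding is_category_def MV_cat_def category.simps mem_Collect_eq
proof (intro conjI ballI allI impI)
  fix X :: "('k, 'v) mv" assume X: "X \<in> {V. mv_algebra V}"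
  then show "MV_id X \<in> MV_mor X X" by (simp add: MV_id_mor)
next
  fix X Y Z :: "('k, 'v) mv" and g f
  assume "X \<in> {V. mv_algebra V}" "Y \<in> {V. mv_algebra V}" "Z \<in> {V. mv_algebra V}" "g \<in> MV_mor X Y" "f \<in> MV_mor Y Z"
  then show "MV_comp X Y Z f g \<in> MV_mor X Z" by (simp add: MV_comp_mor)
next
  fix X Y :: "('k, 'v) mv" and f
  assume a: "X \<in> {V. mv_algebra V}" "Y \<in> {V. mv_algebra V}" "f \<in> MV_mor X Y"
  then have c: "cpair X X" "cpair Y Y" "cpair X Y" and f: "f \<in> Lin0_R X Y"
    by (simp_all add: mv_cpair MV_mor_iff)
  have F: "mv_exp X Y f \<in> extensional (ser (carr X))" "mv_exp X Y f \<in> ser (carr X) \<rightarrow> ser (carr Y)"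
    using cpair.exp_GL[OF c(3) f] by (auto simp: GL_def R_linear_def PiE_def)
  show "MV_comp X Y Y (MV_id Y) f = f"
    by (simp only: MV_comp_def exp_MV_id[OF c(2)] compose_id_left(1)[OF F] cpair.log_exp[OF c(3) f])
  show "MV_comp X X Y f (MV_id X) = f"
    by (simp only: MV_comp_def exp_MV_id[OF c(1)] compose_id_left(2)[OF F(1)] cpair.log_exp[OF c(3) f])
next
  fix W X Y Z :: "('k, 'v) mv" and h g f
  assume a: "W \<in> {V. mv_algebra V}" "X \<in> {V. mv_algebra V}" "Y \<in> {V. mv_algebra V}" "Z \<in> {V. mv_algebra V}"
    "h \<in> MV_mor W X" "g \<in> MV_mor X Y" "f \<in> MV_mor Y Z"
  then have c: "cpair W X" "cpair W Y" "cpair W Z" "cpair X Y" "cpair X Z" "cpair Y Z" 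
    and m: "h \<in> Lin0_R W X" "g \<in> Lin0_R X Y" "f \<in> Lin0_R Y Z"
    by (simp_all add: mv_cpair MV_mor_iff)
  have "compose (ser (carr W)) (compose (ser (carr X)) (mv_exp Y Z f) (mv_exp X Y g)) (mv_exp W X h) =
    compose (ser (carr W)) (mv_exp Y Z f) (compose (ser (carr W)) (mv_exp X Y g) (mv_exp W X h))"
    using exp_mem[OF c(1) m(1)] by (auto simp: compose_def fun_eq_iff)
  then show "MV_comp W X Z (MV_comp X Y Z f g) h = MV_comp W Y Z f (MV_comp W X Y g h)"
    unfolding MV_comp_def[of W X Z] MV_comp_def[of W Y Z] exp_MV_comp[OF c(4,6,5) m(3,2)] exp_MV_comp[OF c(1,4,2) m(2,1)]
    by simp
qed

section \<open>The graded symmetric algebra\<close>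

text \<open>Eigenvectors for distinct eigenvalues are linearly independent.  This is how the sum of the homogeneous parts of \<open>S(U)\<close> is seen
  to be direct, without choosing bases.\<close>

lemma eigen_independent:
  assumes "Vector_Spaces.linear s s L" "finite N" "\<And>n. n \<in> N \<Longrightarrow> L (x n) = s (c n) (x n)" "inj_on c N" "sum x N = 0"
  shows "\<forall>n\<in>N. x n = 0"
  using assms(2-)
proof (induction N arbitrary: x)
  case (insert m N)
  interpret L: Vector_Spaces.linear s s L by fact
  define y where "y = (\<lambda>n. s (c n - c m) (x n))"
  have "0 = L (sum x (insert m N)) - s (c m) (sum x (insert m N))"
    by (simp only: insert.prems(3) L.zero L.vs1.scale_zero_right diff_self)
  also have "\<dots> = (\<Sum>n\<in>insert m N. L (x n) - s (c m) (x n))"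
    by (simp only: L.sum L.vs1.scale_sum_right sum_subtractf)
  also have "\<dots> = (\<Sum>n\<in>insert m N. y n)"
    by (rule sum.cong) (simp_all add: insert.prems(1) y_def L.vs1.scale_left_diff_distrib)
  also have "\<dots> = sum y N" using insert.hyps by (simp add: y_def)
  finally have "sum y N = 0" by simp
  moreover have "L (y n) = s (c n) (y n)" if "n \<in> N" for n
    unfolding y_def L.scale insert.prems(1)[OF insertI2[OF that]] L.vs1.scale_scale by (simp only: mult.commute)
  moreover have "inj_on c N" using insert.prems(2) by (rule inj_on_subset) auto
  ultimately have y0: "\<forall>n\<in>N. y n = 0" by (intro insert.IH)
  have "x n = 0" if "n \<in> N" for n
  proof -
    have "c n \<noteq> c m" using insert.prems(2) insert.hyps that by (auto simp: inj_on_def)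
    then show ?thesis using bspec[OF y0 that] by (simp add: y_def)
  qed
  then show ?case using insert by simp
qed simp

lemma two_powi_inj: 
  assumes "(2::'k::field_char_0) powi i = 2 powi j" shows "i = j"
proof -
  have *: "\<not> i < j" if "(2::'k) powi i = 2 powi j" for i j
  proof
    assume ij: "i < j"
    have e: "(2::'k) powi (i + (j - i)) = 2 powi i * 2 powi (j - i)" by (rule power_int_add) (rule disjI1, rule zero_neq_numeral[symmetric])
    have nz: "(2::'k) powi i \<noteq> 0" unfolding power_int_eq_0_iff by (rule notI, elim conjE notE[OF zero_neq_numeral[symmetric]])
    have "i + (j - i) = j" by simp
    then have "2 powi i * (2::'k) powi (j - i) = 2 powi i * 1" using e that by (simp only: mult_1_right)
    then have "(2::'k) powi (j - i) = 1" using nz by (simp only: mult_cancel_left) blast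
    moreover have "(2::'k) powi (j - i) = 2 ^ nat (j - i)" using ij unfolding power_int_def by (simp only: diff_ge_0_iff_ge less_imp_le if_True)
    ultimately have "of_nat (2 ^ nat (j - i)) = (of_nat 1 :: 'k)" by (simp only: of_nat_power of_nat_numeral of_nat_1)
    then have "(2::nat) ^ nat (j - i) = 1" by (simp only: of_nat_eq_iff)
    moreover have "nat (j - i) \<noteq> 0" using ij by simp
    ultimately show False by simp
  qed
  show ?thesis using *[of i j] *[of j i] assms by auto
qed

lemma gsym_formI:
  "multilinear_form (scl U) \<phi> \<Longrightarrow> (\<And>us vs i j x y. x \<in> gr U i \<Longrightarrow> y \<in> gr U j \<Longrightarrow>
    \<phi> (us @ x # y # vs) = ksign i j (\<phi> (us @ y # x # vs))) \<Longrightarrow> gsym_form U \<phi>"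
  unfolding gsym_form_def by blast

lemma gsym_formD:
  assumes "gsym_form U \<phi>"
  shows "multilinear_form (scl U) \<phi>"
    and "x \<in> gr U i \<Longrightarrow> y \<in> gr U j \<Longrightarrow> \<phi> (us @ x # y # vs) = ksign i j (\<phi> (us @ y # x # vs))"
  using assms unfolding gsym_form_def by blast+

lemma gsym_form_prepend: assumes "gsym_form U \<phi>" shows "gsym_form U (\<lambda>zs. \<phi> (as @ zs))"
proof (rule gsym_formI[OF multilinear_form_prepend[OF gsym_formD(1)[OF assms]]])
  fix us vs i j x y assume "x \<in> gr U i" "y \<in> gr U j"
  from gsym_formD(2)[OF assms this, of "as @ us" vs]
  show "\<phi> (as @ us @ x # y # vs) = ksign i j (\<phi> (as @ us @ y # x # vs))" by (simp only: append_assoc)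
qed

lemma gsym_form_append: assumes "gsym_form U \<phi>" shows "gsym_form U (\<lambda>zs. \<phi> (zs @ as))"
  by (rule gsym_formI[OF multilinear_form_append[OF gsym_formD(1)[OF assms]]])
    (simp only: append_assoc append_Cons, rule gsym_formD(2)[OF assms])

lemma gsym_form_lincomb:
  assumes "gsym_form U \<phi>" "gsym_form U \<psi>" shows "gsym_form U (\<lambda>xs. c * \<phi> xs + \<psi> xs)"
proof -
  have "multilinear_form (scl U) (\<lambda>xs. c * \<phi> xs + \<psi> xs)"
    using assms[THEN gsym_formD(1)] by (simp add: multilinear_form_def Vector_Spaces.linear_iff algebra_simps)
  moreover have "c * \<phi> (us @ x # y # vs) + \<psi> (us @ x # y # vs) = ksign i j (c * \<phi> (us @ y # x # vs) + \<psi> (us @ y # x # vs))"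
    if "x \<in> gr U i" "y \<in> gr U j" for us vs x y i j
  proof -
    have "\<phi> (us @ x # y # vs) = ksign i j (\<phi> (us @ y # x # vs))" "\<psi> (us @ x # y # vs) = ksign i j (\<psi> (us @ y # x # vs))"
      by (rule gsym_formD(2)[OF _ that]; rule assms)+
    then show ?thesis by (simp add: ksign_def)
  qed
  ultimately show ?thesis by (rule gsym_formI)
qed

locale symalg = gvec U for U :: "('k::field_char_0, 'u::ab_group_add) gvs" +
  fixes D :: "('k, 'u) tensor fps \<Rightarrow> ('k, 'u) tensor fps"
begin

abbreviation S :: "('k, ('k, 'u) tensor) mv" where "S \<equiv> sym_mv U D"

lemma S_simps [simp]: "scl S = dscl" "gr S = sym_gr U" "mult S = sym_mult U" "unit S = mon U []" "coprod S = sym_coprod U"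
  "counit S = (\<lambda>s. s (\<lambda>xs. if xs = [] then 1 else 0))" "BV S = D"
  by (simp_all add: sym_mv_def)

sublocale T: vector_space "dscl :: 'k \<Rightarrow> ('k, 'u) tensor \<Rightarrow> _" by (rule vs_tensor)

definition hom :: "'u list \<Rightarrow> bool" where "hom xs \<longleftrightarrow> (\<forall>x\<in>set xs. \<exists>i. x \<in> gr U i)"

lemma hom_Nil [simp]: "hom []" by (simp add: hom_def)
lemma hom_Cons: "hom (x # xs) \<longleftrightarrow> (\<exists>i. x \<in> gr U i) \<and> hom xs"
  by (simp add: hom_def)
lemma hom_append: "hom (xs @ ys) \<longleftrightarrow> hom xs \<and> hom ys"
  by (auto simp: hom_def)
lemma hom_lists: "hom xs \<Longrightarrow> xs \<in> lists (carr U)"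
  using gr_carr by (fastforce simp: hom_def)
lemma homogeneous_list_Cons:
  "homogeneous_list U (x # xs) ds \<longleftrightarrow> (\<exists>d ds'. ds = d # ds' \<and> x \<in> gr U d \<and> homogeneous_list U xs ds')"
  by (simp add: homogeneous_list_def list_all2_Cons1)
lemma homogeneous_list_hom: "homogeneous_list U xs ds \<Longrightarrow> hom xs"
proof (induction xs arbitrary: ds)
  case (Cons x xs) then show ?case unfolding homogeneous_list_Cons hom_Cons by blast
qed simp
lemma hom_ex: "hom xs \<Longrightarrow> \<exists>ds. homogeneous_list U xs ds"
proof (induction xs)
  case Nil then show ?case by (simp add: homogeneous_list_def)
next
  case (Cons x xs) then show ?case unfolding homogeneous_list_Cons hom_Cons by blast
qed
lemma hom_iff: "hom xs \<longleftrightarrow> (\<exists>ds. homogeneous_list U xs ds)"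
  using hom_ex homogeneous_list_hom by blast

lemma gsym_multilinear: 
  assumes "gsym_form U \<phi>" 
  shows "\<phi> (xs @ (x + y) # ys) = \<phi> (xs @ x # ys) + \<phi> (xs @ y # ys)" "\<phi> (xs @ scl U c x # ys) = c * \<phi> (xs @ x # ys)"
proof -
  have "Vector_Spaces.linear (scl U) (*) (\<lambda>x. \<phi> (xs @ x # ys))"
    using gsym_formD(1)[OF assms] unfolding multilinear_form_def by blast
  note * = this[unfolded Vector_Spaces.linear_iff, THEN conjunct2, THEN conjunct2]
  show "\<phi> (xs @ (x + y) # ys) = \<phi> (xs @ x # ys) + \<phi> (xs @ y # ys)" by (rule *[THEN conjunct1, THEN spec, THEN spec])
  show "\<phi> (xs @ scl U c x # ys) = c * \<phi> (xs @ x # ys)" by (rule *[THEN conjunct2, THEN spec, THEN spec])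
qed

lemma mon_add: "mon U (xs @ (x + y) # ys) = mon U (xs @ x # ys) + mon U (xs @ y # ys)"
  and mon_scl: "mon U (xs @ scl U c x # ys) = dscl c (mon U (xs @ x # ys))"
  by (auto simp: mon_def fun_eq_iff dscl_def plus_fun_apply gsym_multilinear)

lemma mon_zero: "mon U (xs @ 0 # ys) = 0"
  using mon_scl[of xs 0 0 ys] by (auto simp: dscl_def fun_eq_iff zero_fun_apply)

lemma mon_in_hom_span:
  assumes "xs \<in> lists (carr U)" "hom pre"
  shows "mon U (pre @ xs) \<in> T.span {mon U ys | ys. hom ys \<and> length ys = length pre + length xs}"
  using assms
proof (induction xs arbitrary: pre)
  case Nil then show ?case by (auto intro!: T.span_base)
next
  case (Cons x xs)
  have "x \<in> carr U" using Cons by simp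
  then show ?case
  proof (induction rule: carr_induct)
    case zero show ?case by (simp add: mon_zero T.span_zero)
  next
    case (add x y) then show ?case by (simp add: mon_add T.span_add)
  next
    case (hom n x)
    have "hom (pre @ [x])" using hom Cons by (auto simp: hom_append hom_Cons)
    then have "mon U ((pre @ [x]) @ xs) \<in> T.span {mon U ys | ys. hom ys \<and> length ys = length (pre @ [x]) + length xs}"
      by (intro Cons.IH) (use Cons.prems in auto)
    then show ?case by simp
  qed
qed

lemma sym_pow_hom: "sym_pow U n = T.span {mon U ys | ys. hom ys \<and> length ys = n}"
proof (rule antisym)
  show "sym_pow U n \<subseteq> T.span {mon U ys | ys. hom ys \<and> length ys = n}"
    unfolding sym_pow_def by (rule T.span_minimal) (use mon_in_hom_span[of _ "[]"] in auto)
  show "T.span {mon U ys | ys. hom ys \<and> length ys = n} \<subseteq> sym_pow U n"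
    unfolding sym_pow_def by (rule T.span_mono) (use hom_lists in blast)
qed

lemma carr_S: "carr S = T.span {mon U xs | xs. hom xs}"
proof (rule antisym)
  show "carr S \<subseteq> T.span {mon U xs | xs. hom xs}"
    unfolding carr_def S_simps
  proof (rule T.span_minimal)
    show "(\<Union>n. sym_gr U n) \<subseteq> T.span {mon U xs | xs. hom xs}"
      unfolding sym_gr_def hom_iff by (intro UN_least T.span_mono) blast
  qed simp
  show "T.span {mon U xs | xs. hom xs} \<subseteq> carr S"
    unfolding carr_def S_simps
  proof (rule T.span_minimal)
    show "{mon U xs | xs. hom xs} \<subseteq> T.span (\<Union>n. sym_gr U n)"
    proof
      fix t assume "t \<in> {mon U xs | xs. hom xs}"
      then obtain xs ds where "t = mon U xs" "homogeneous_list U xs ds" using hom_ex by blast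
      then have "t \<in> sym_gr U (sum_list ds)" unfolding sym_gr_def by (auto intro!: T.span_base)
      then show "t \<in> T.span (\<Union>n. sym_gr U n)" by (auto intro: T.span_base)
    qed
  qed simp
qed

lemma mon_carr: "xs \<in> lists (carr U) \<Longrightarrow> mon U xs \<in> carr S"
  unfolding carr_S using mon_in_hom_span[of xs "[]"] T.span_mono[of "{mon U ys | ys. hom ys \<and> length ys = length xs}" "{mon U xs | xs. hom xs}"]
  by auto

lemma mon_gr: "homogeneous_list U xs ds \<Longrightarrow> mon U xs \<in> sym_gr U (sum_list ds)"
  unfolding sym_gr_def by (auto intro!: T.span_base)

lemma sym_gr_subspace: "T.subspace (sym_gr U n)" unfolding sym_gr_def by simp

lemma sym_lift:
  assumes "vector_space s'"
    and "\<And>xs ys. xs \<in> lists (carr U) \<Longrightarrow> ys \<in> lists (carr U) \<Longrightarrow> linear_map_on (scl U) s' (carr U) (\<lambda>x. b (xs @ x # ys))"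
    and "\<And>xs ys i j x y. xs \<in> lists (carr U) \<Longrightarrow> ys \<in> lists (carr U) \<Longrightarrow> x \<in> gr U i \<Longrightarrow> y \<in> gr U j \<Longrightarrow>
              b (xs @ x # y # ys) = ksign i j (b (xs @ y # x # ys))"
  obtains L where "Vector_Spaces.linear dscl s' L" "\<And>xs. xs \<in> lists (carr U) \<Longrightarrow> L (mon U xs) = b xs"
proof -
  have "\<exists>L. Vector_Spaces.linear dscl s' L \<and> (\<forall>xs\<in>lists (carr U). L (mon U xs) = b xs)"
    by (rule sym_universal[OF graded assms])
  then show ?thesis using that by blast
qed

text \<open>The operator \<open>u \<mapsto> 2\<^bsup>|u|\<^esup> u\<close> on \<open>U\<close> extends to an algebra endomorphism of \<open>S(U)\<close>, whose eigenspaces for the pairwise distinct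
  eigenvalues \<open>2\<^sup>n\<close> contain the homogeneous parts.\<close>

lemma S_graded: "graded_vs S"
proof -
  obtain s where s: "Vector_Spaces.linear (scl U) (scl U) s" "\<forall>n. \<forall>x\<in>gr U n. s x = scl U (2 powi n) x" "range s \<subseteq> carr U"
    using gr_scaling[of "\<lambda>n. 2 powi n"] by (elim exE conjE)
  interpret s: Vector_Spaces.linear "scl U" "scl U" s by (rule s(1))
  have sg: "s x \<in> gr U n" if "x \<in> gr U n" for x n using s(2) that by (simp add: gr_scl)
  obtain L where L: "Vector_Spaces.linear dscl dscl L" "\<And>xs. xs \<in> lists (carr U) \<Longrightarrow> L (mon U xs) = mon U (map s xs)"
  proof (rule sym_lift[OF vs_tensor, where b="\<lambda>xs. mon U (map s xs)"])
    show "linear_map_on (scl U) dscl (carr U) (\<lambda>x. mon U (map s (xs @ x # ys)))" for xs ys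
      by (simp add: linear_map_on_def s.add s.scale mon_add mon_scl)
    show "mon U (map s (xs @ x # y # ys)) = ksign i j (mon U (map s (xs @ y # x # ys)))"
      if "x \<in> gr U i" "y \<in> gr U j" for xs ys i j x y
      using mon_swap[OF sg[OF that(1)] sg[OF that(2)]] by simp
  qed blast
  interpret L: Vector_Spaces.linear dscl dscl L by (rule L(1))
  have ms: "mon U (pre @ map s xs) = dscl (2 powi (sum_list ds)) (mon U (pre @ xs))" if "homogeneous_list U xs ds" for pre xs ds
    using that
  proof (induction xs arbitrary: ds pre)
    case Nil then show ?case by (simp add: homogeneous_list_def)
  next
    case (Cons x xs)
    then obtain d ds' where d: "ds = d # ds'" "x \<in> gr U d" "homogeneous_list U xs ds'"
      unfolding homogeneous_list_Cons by blast
    have "mon U (pre @ map s (x # xs)) = dscl (2 powi d) (mon U ((pre @ [x]) @ map s xs))"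
      using s(2) d(2) by (simp add: mon_scl)
    also have "\<dots> = dscl (2 powi d) (dscl (2 powi (sum_list ds')) (mon U ((pre @ [x]) @ xs)))"
      by (simp only: Cons.IH[OF d(3)])
    finally show ?case by (simp add: d(1) power_int_add)
  qed
  have eig: "L t = dscl (2 powi n) t" if "t \<in> sym_gr U n" for t n
  proof (rule linear_eq_on_span[OF L(1)])
    show "Vector_Spaces.linear dscl dscl (dscl (2 powi n) :: ('k, 'u) tensor \<Rightarrow> _)" by (rule T.linear_scale_self)
    show "t \<in> T.span {mon U xs | xs ds. homogeneous_list U xs ds \<and> sum_list ds = n}" using that by (simp add: sym_gr_def)
    fix x assume "x \<in> {mon U xs | xs ds. homogeneous_list U xs ds \<and> sum_list ds = n}"
    then obtain xs ds where "x = mon U xs" "homogeneous_list U xs ds" "sum_list ds = n" by blast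
    then show "L x = dscl (2 powi n) x" using ms[of xs ds "[]"] L(2)[OF hom_lists[OF homogeneous_list_hom]] by simp
  qed
  have inj: "inj_on (\<lambda>n. (2::'k) powi n) N" for N using two_powi_inj by (auto simp: inj_on_def)
  show ?thesis unfolding graded_vs_def S_simps
  proof (intro conjI allI impI)
    fix N x assume a: "finite N \<and> (\<forall>n\<in>N. x n \<in> sym_gr U n) \<and> (\<Sum>n\<in>N. x n) = 0"
    have fin: "finite N" and z: "(\<Sum>n\<in>N. x n) = 0" and m: "\<And>n. n \<in> N \<Longrightarrow> x n \<in> sym_gr U n" using a by blast+
    show "\<forall>n\<in>N. x n = 0"
      by (rule eigen_independent[OF L(1) fin eig[OF m] inj z])
  qed (rule vs_tensor sym_gr_subspace)+
qed

sublocale G: gvec S by unfold_locales (rule S_graded)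

lemma S_induct [consumes 1, case_names zero add scale unit step]:
  assumes "s \<in> carr S" "P 0" 
    and "\<And>s t. s \<in> carr S \<Longrightarrow> t \<in> carr S \<Longrightarrow> P s \<Longrightarrow> P t \<Longrightarrow> P (s + t)"
    and "\<And>s c. s \<in> carr S \<Longrightarrow> P s \<Longrightarrow> P (dscl c s)"
    and "P (mon U [])"
    and "\<And>u i s. u \<in> gr U i \<Longrightarrow> s \<in> carr S \<Longrightarrow> P s \<Longrightarrow> P (sym_mult U (mon U [u]) s)"
  shows "P s"
proof -
  have m: "P (mon U xs)" if "hom xs" for xs
    using that
  proof (induction xs)
    case (Cons x xs)
    then obtain i where "x \<in> gr U i" "hom xs" by (auto simp: hom_Cons)
    then show ?case using assms(6)[of x i "mon U xs"] Cons mon_carr[OF hom_lists] by (simp add: sym_mult_mon)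
  qed (simp add: assms(5))
  have "s \<in> carr S \<and> P s"
    using assms(1) unfolding carr_S
  proof (induction rule: T.span_induct_alt)
    case base then show ?case using assms(2) by (simp add: T.span_zero)
  next
    case (step c x y)
    then obtain xs where x: "x = mon U xs" "hom xs" by blast
    then have "x \<in> carr S" using mon_carr[OF hom_lists] by blast
    with step x show ?case using assms(3)[of "dscl c x" y] assms(4)[of x c] m[of xs]
      by (auto simp: carr_S[symmetric] intro: G.carr_add G.carr_scl[unfolded S_simps])
  qed
  then show ?thesis ..
qed

subsection \<open>Multiplication\<close>

lemma gsym_form_partial:
  assumes "t \<in> carr S" "gsym_form U \<phi>"
  shows "gsym_form U (\<lambda>xs. t (\<lambda>ys. \<phi> (xs @ ys)))"
  using assms(1) unfolding carr_S
proof (induction rule: T.span_induct_alt)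
  case base
  have "gsym_form U (\<lambda>xs. (0::'k))"
    using vs.vector_space_axioms vector_space_field by (intro gsym_formI) (simp_all add: multilinear_form_def Vector_Spaces.linear_iff)
  then show ?case by (simp add: zero_fun_apply)
next
  case (step c x y)
  then obtain zs where x: "x = mon U zs" by blast
  have "gsym_form U (\<lambda>xs. c * \<phi> (xs @ zs) + y (\<lambda>ys. \<phi> (xs @ ys)))"
    by (rule gsym_form_lincomb[OF gsym_form_append[OF assms(2)]]) (use step in simp)
  then show ?case by (simp add: x mon_def gsym_form_prepend[OF assms(2)] dscl_def plus_fun_apply)
qed

lemma sym_mult_add_left: "sym_mult U (s + t) r = sym_mult U s r + sym_mult U t r"
  and sym_mult_scl_left: "sym_mult U (dscl c s) r = dscl c (sym_mult U s r)"
  and sym_mult_zero_left: "sym_mult U 0 r = 0"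
  by (auto simp: sym_mult_def fun_eq_iff plus_fun_apply zero_fun_apply dscl_def)

lemma mon_mult_apply: "t \<in> carr S \<Longrightarrow> sym_mult U (mon U xs) t = (\<lambda>\<phi>. if gsym_form U \<phi> then t (\<lambda>ys. \<phi> (xs @ ys)) else 0)"
  by (auto simp: sym_mult_def mon_def gsym_form_partial fun_eq_iff)

lemma carr_S_induct [consumes 1, case_names base step]:
  assumes "s \<in> carr S" "P 0" "\<And>c xs y. hom xs \<Longrightarrow> y \<in> carr S \<Longrightarrow> P y \<Longrightarrow> P (dscl c (mon U xs) + y)"
  shows "P s"
proof -
  have "s \<in> carr S \<and> P s"
    using assms(1) unfolding carr_S
  proof (induction rule: T.span_induct_alt)
    case base then show ?case using assms(2) by (simp add: T.span_zero)
  next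
    case (step c x y)
    then obtain xs where "x = mon U xs" "hom xs" by blast
    with step assms(3)[of xs y c] show ?case by (auto simp: carr_S intro: T.span_add T.span_scale T.span_base)
  qed
  then show ?thesis ..
qed

lemma sym_mult_add_right: "s \<in> carr S \<Longrightarrow> t \<in> carr S \<Longrightarrow> r \<in> carr S \<Longrightarrow> sym_mult U s (t + r) = sym_mult U s t + sym_mult U s r"
proof (induction rule: carr_S_induct)
  case base then show ?case by (simp add: sym_mult_zero_left)
next
  case (step c xs y)
  have "sym_mult U (mon U xs) (t + r) = sym_mult U (mon U xs) t + sym_mult U (mon U xs) r"
    using step by (auto simp: mon_mult_apply G.carr_add plus_fun_apply fun_eq_iff)
  then show ?case using step by (simp add: sym_mult_add_left sym_mult_scl_left T.scale_right_distrib)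
qed

lemma sym_mult_scl_right: "s \<in> carr S \<Longrightarrow> t \<in> carr S \<Longrightarrow> sym_mult U s (dscl a t) = dscl a (sym_mult U s t)"
proof (induction rule: carr_S_induct)
  case base then show ?case by (simp add: sym_mult_zero_left)
next
  case (step c xs y)
  have "sym_mult U (mon U xs) (dscl a t) = dscl a (sym_mult U (mon U xs) t)"
    using step G.carr_scl[of t a] by (auto simp: mon_mult_apply dscl_def fun_eq_iff)
  then show ?case using step by (simp add: sym_mult_add_left sym_mult_scl_left T.scale_right_distrib mult.commute)
qed

lemma sym_mult_bilin: "bilin S dscl (sym_mult U)"
  by (rule bilinI) (auto simp: sym_mult_add_left sym_mult_scl_left sym_mult_add_right sym_mult_scl_right)

lemma sym_mult_zero_right: "s \<in> carr S \<Longrightarrow> sym_mult U s 0 = 0"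
  using sym_mult_scl_right[of s 0 0] by simp

lemma carr_S_subspace: "T.subspace (carr S)"
  unfolding carr_S by simp

lemma sym_gr_induct2:
  assumes "s \<in> sym_gr U i" "t \<in> sym_gr U j"
    and "bilin S dscl \<beta>" "T.subspace A"
    and "\<And>xs ds ys es. homogeneous_list U xs ds \<Longrightarrow> sum_list ds = i \<Longrightarrow> homogeneous_list U ys es \<Longrightarrow> sum_list es = j \<Longrightarrow> 
      \<beta> (mon U xs) (mon U ys) \<in> A"
  shows "\<beta> s t \<in> A"
proof -
  note b = bilinD[OF assms(3), unfolded S_simps]
  have c: "mon U xs \<in> carr S" if "homogeneous_list U xs ds" for xs ds
    by (rule mon_carr[OF hom_lists[OF homogeneous_list_hom[OF that]]])
  have z: "\<beta> 0 y = 0" "\<beta> y 0 = 0" if "y \<in> carr S" for y using b(3)[of 0 y 0] b(4)[of y 0 0] that by simp_all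
  have 1: "t \<in> carr S \<and> \<beta> (mon U xs) t \<in> A" if xs: "homogeneous_list U xs ds" "sum_list ds = i" for xs ds
    using assms(2) unfolding sym_gr_def
  proof (induction rule: T.span_induct_alt)
    case base then show ?case using T.subspace_0[OF assms(4)] c[OF xs(1)] by (simp add: z)
  next
    case (step k x y)
    then obtain ys es where ys: "x = mon U ys" "homogeneous_list U ys es" "sum_list es = j" by blast
    then show ?case using step c[OF xs(1)] c[OF ys(2)] assms(5)[OF xs ys(2,3)] assms(4)
      by (auto simp: b G.carr_scl[unfolded S_simps] intro!: T.subspace_add T.subspace_scale carr_S_subspace)
  qed
  have t: "t \<in> carr S" using assms(2) G.gr_carr by simp
  have "s \<in> carr S \<and> \<beta> s t \<in> A" using assms(1) unfolding sym_gr_def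
  proof (induction rule: T.span_induct_alt)
    case base then show ?case using T.subspace_0[OF assms(4)] t by (simp add: z)
  next
    case (step k x y)
    then obtain xs ds where xs: "x = mon U xs" "homogeneous_list U xs ds" "sum_list ds = i" by blast
    then show ?case using step c[OF xs(2)] 1[OF xs(2,3)] t assms(4)
      by (auto simp: b G.carr_scl[unfolded S_simps] intro!: T.subspace_add T.subspace_scale carr_S_subspace)
  qed
  then show ?thesis ..
qed

lemma homogeneous_list_append: "homogeneous_list U xs ds \<Longrightarrow> homogeneous_list U ys es \<Longrightarrow> homogeneous_list U (xs @ ys) (ds @ es)"
  by (simp add: homogeneous_list_def list_all2_appendI)

lemma sym_mult_gr: "s \<in> sym_gr U i \<Longrightarrow> t \<in> sym_gr U j \<Longrightarrow> sym_mult U s t \<in> sym_gr U (i + j)"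
proof (rule sym_gr_induct2[OF _ _ sym_mult_bilin sym_gr_subspace])
  fix xs ds ys es assume "homogeneous_list U xs ds" "sum_list ds = i" "homogeneous_list U ys es" "sum_list es = j"
  then show "sym_mult U (mon U xs) (mon U ys) \<in> sym_gr U (i + j)"
    using mon_gr[OF homogeneous_list_append[of xs ds ys es]] by (simp add: sym_mult_mon)
qed

lemma mon_move_front:
  assumes "homogeneous_list U xs ds" "y \<in> gr U j"
  shows "mon U (pre @ xs @ y # zs) = ksign (sum_list ds) j (mon U (pre @ y # xs @ zs))"
  using assms(1)
proof (induction xs arbitrary: pre ds)
  case Nil then show ?case by (simp add: homogeneous_list_def)
next
  case (Cons x xs)
  then obtain d ds' where d: "ds = d # ds'" "x \<in> gr U d" "homogeneous_list U xs ds'"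
    unfolding homogeneous_list_Cons by blast
  have "mon U (pre @ (x # xs) @ y # zs) = ksign (sum_list ds') j (mon U (pre @ x # y # xs @ zs))"
    using Cons.IH[OF d(3), of "pre @ [x]"] by simp
  also have "\<dots> = ksign (sum_list ds') j (ksign d j (mon U (pre @ y # x # xs @ zs)))"
    by (simp only: mon_swap[OF d(2) assms(2)])
  also have "\<dots> = ksign (sum_list ds) j (mon U (pre @ y # (x # xs) @ zs))"
    by (auto simp: d(1) ksign_def)
  finally show ?case .
qed

lemma mon_comm:
  assumes "homogeneous_list U xs ds" "homogeneous_list U ys es"
  shows "mon U (xs @ ys) = ksign (sum_list ds) (sum_list es) (mon U (ys @ xs))"
proof -
  have "mon U (pre @ xs @ ys) = ksign (sum_list ds) (sum_list es) (mon U (pre @ ys @ xs))" for pre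
    using assms(2)
  proof (induction ys arbitrary: pre es)
    case Nil then show ?case by (simp add: homogeneous_list_def)
  next
    case (Cons y ys)
    then obtain e es' where e: "es = e # es'" "y \<in> gr U e" "homogeneous_list U ys es'"
      unfolding homogeneous_list_Cons by blast
    have "mon U (pre @ xs @ y # ys) = ksign (sum_list ds) e (mon U ((pre @ [y]) @ xs @ ys))"
      using mon_move_front[OF assms(1) e(2), of pre ys] by simp
    also have "\<dots> = ksign (sum_list ds) e (ksign (sum_list ds) (sum_list es') (mon U ((pre @ [y]) @ ys @ xs)))"
      by (simp only: Cons.IH[OF e(3)])
    also have "\<dots> = ksign (sum_list ds) (sum_list es) (mon U (pre @ (y # ys) @ xs))"
      by (auto simp: e(1) ksign_def)
    finally show ?case .
  qed
  from this[of "[]"] show ?thesis by simp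
qed

lemma sym_mult_comm: 
  assumes "s \<in> sym_gr U i" "t \<in> sym_gr U j" shows "sym_mult U s t = ksign i j (sym_mult U t s)"
proof -
  have n: "dscl (-1) x = - x" for x :: "('k, 'u) tensor" by (simp add: dscl_def fun_eq_iff)
  have kk: "ksign i j x = dscl (if odd i \<and> odd j then -1 else 1) x" for x :: "('k, 'u) tensor"
    by (simp add: ksign_def n)
  define \<beta> where "\<beta> = (\<lambda>s t. sym_mult U s t - dscl (if odd i \<and> odd j then -1 else 1) (sym_mult U t s))"
  have b: "bilin S dscl \<beta>"
    by (rule bilinI) (auto simp: \<beta>_def sym_mult_add_left sym_mult_scl_left sym_mult_add_right sym_mult_scl_right 
      T.scale_right_distrib T.scale_right_diff_distrib mult.commute)
  have "\<beta> s t \<in> {0}"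
  proof (rule sym_gr_induct2[OF assms b])
    fix xs ds ys es assume "homogeneous_list U xs ds" "sum_list ds = i" "homogeneous_list U ys es" "sum_list es = j"
    then show "\<beta> (mon U xs) (mon U ys) \<in> {0}" using mon_comm[of xs ds ys es]
      by (simp add: \<beta>_def sym_mult_mon flip: kk)
  qed simp
  then show ?thesis by (simp add: \<beta>_def flip: kk)
qed

lemma sym_mult_assoc: "r \<in> carr S \<Longrightarrow> sym_mult U (sym_mult U s t) r = sym_mult U s (sym_mult U t r)"
  by (auto simp: sym_mult_def fun_eq_iff gsym_form_partial gsym_form_prepend)

lemma sym_mult_unit: 
  assumes "s \<in> carr S" shows "sym_mult U (mon U []) s = s" "sym_mult U s (mon U []) = s"
  using assms
proof (induction rule: carr_S_induct)
  case base
  { case 1 show ?case using mon_carr[of "[]"] by (simp add: sym_mult_zero_right) }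
  { case 2 show ?case by (simp add: sym_mult_zero_left) }
next
  case (step c xs y)
  have c: "mon U xs \<in> carr S" "mon U [] \<in> carr S" using step mon_carr[OF hom_lists] by auto
  { case 1 show ?case using step c G.carr_scl[of "mon U xs" c]
    by (simp add: sym_mult_add_right sym_mult_scl_right sym_mult_mon) }
  { case 2 show ?case using step c by (simp add: sym_mult_add_left sym_mult_scl_left sym_mult_mon) }
qed

lemma S_alg: "graded_comm_algebra S"
  unfolding graded_comm_algebra_def S_simps
proof (intro conjI ballI allI)
  show "mon U [] \<in> sym_gr U 0" using mon_gr[of "[]" "[]"] by (simp add: homogeneous_list_def)
  show "linear_map_on dscl dscl (carr S) (sym_mult U x)" "linear_map_on dscl dscl (carr S) (\<lambda>y. sym_mult U y x)"
    if "x \<in> carr S" for x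
    using sym_mult_bilin that unfolding bilin_def S_simps by blast+
qed (rule S_graded sym_mult_gr sym_mult_comm sym_mult_assoc sym_mult_unit; assumption)+

sublocale A: galg S by unfold_locales (rule S_alg)

end

section \<open>The unshuffle coproduct\<close>

abbreviation ks_set :: "int list \<Rightarrow> nat set \<Rightarrow> (nat \<times> nat) set" where
  "ks_set ds I \<equiv> {(i, j). i < j \<and> j < length ds \<and> i \<notin> I \<and> j \<in> I \<and> odd (ds ! i) \<and> odd (ds ! j)}"

lemma finite_ks_set: "finite (ks_set ds I)"
  by (rule finite_subset[of _ "{..<length ds} \<times> {..<length ds}"]) auto

lemma unshuffle_sign_insert0: "unshuffle_sign (d # ds) (insert 0 (Suc ` J)) x = unshuffle_sign ds J x"
proof -
  have "ks_set (d # ds) (insert 0 (Suc ` J)) = map_prod Suc Suc ` ks_set ds J" (is "?l = ?r")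
  proof (rule set_eqI, clarify)
    fix i j show "((i, j) \<in> ?l) = ((i, j) \<in> ?r)" by (cases i; cases j) (auto simp: image_iff)
  qed
  then have "card (ks_set (d # ds) (insert 0 (Suc ` J))) = card (ks_set ds J)"
    by (simp add: card_image inj_on_def)
  then show ?thesis by (simp add: unshuffle_sign_def)
qed

lemma card_odd_nths: "odd (card {j. j < length ds \<and> j \<in> J \<and> odd (ds ! j)}) \<longleftrightarrow> odd (sum_list (nths ds J))" for ds :: "int list"
proof (induction ds arbitrary: J)
  case (Cons d ds)
  let ?A = "{j. j < length ds \<and> j \<in> {j. Suc j \<in> J} \<and> odd (ds ! j)}"
  have fin: "finite ?A" by simp
  have "{j. j < length (d # ds) \<and> j \<in> J \<and> odd ((d # ds) ! j)} = (if 0 \<in> J \<and> odd d then {0} else {}) \<union> Suc ` ?A" (is "?l = ?r")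
  proof (rule set_eqI)
    fix j show "(j \<in> ?l) = (j \<in> ?r)" by (cases j) (auto simp: image_iff)
  qed
  moreover have "card ((if 0 \<in> J \<and> odd d then {0} else {}) \<union> Suc ` ?A) = (if 0 \<in> J \<and> odd d then 1 else 0) + card ?A"
    by (subst card_Un_disjoint) (auto simp: card_image)
  ultimately have "odd (card {j. j < length (d # ds) \<and> j \<in> J \<and> odd ((d # ds) ! j)}) \<longleftrightarrow> odd ((if 0 \<in> J \<and> odd d then 1 else 0) + card ?A)"
    by simp
  then show ?case using Cons.IH[of "{j. Suc j \<in> J}"] by (auto simp: nths_Cons)
qed simp

lemma unshuffle_sign_Suc: "unshuffle_sign (d # ds) (Suc ` J) x = unshuffle_sign ds J (ksign d (sum_list (nths ds J)) x)"
proof -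
  let ?A = "{j. j < length ds \<and> j \<in> J \<and> odd (ds ! j)}"
  have "ks_set (d # ds) (Suc ` J) = map_prod Suc Suc ` ks_set ds J \<union> (if odd d then (\<lambda>j. (0, Suc j)) ` ?A else {})" (is "?l = ?r")
  proof (rule set_eqI, clarify)
    fix i j show "((i, j) \<in> ?l) = ((i, j) \<in> ?r)" by (cases i; cases j) (auto simp: image_iff)
  qed
  moreover have "card (map_prod Suc Suc ` ks_set ds J \<union> (if odd d then (\<lambda>j. (0, Suc j)) ` ?A else {})) =
      card (ks_set ds J) + (if odd d then card ?A else 0)"
    by (subst card_Un_disjoint) (auto simp: finite_ks_set card_image inj_on_def)
  ultimately have "card (ks_set (d # ds) (Suc ` J)) = card (ks_set ds J) + (if odd d then card ?A else 0)" by simp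
  then show ?thesis using card_odd_nths[of ds J] by (simp add: unshuffle_sign_def ksign_def)
qed

lemma sum_Pow_lessThan_Suc:
  fixes f :: "nat set \<Rightarrow> 'a::comm_monoid_add"
  shows "(\<Sum>I\<in>Pow {..<Suc n}. f I) = (\<Sum>J\<in>Pow {..<n}. f (insert 0 (Suc ` J))) + (\<Sum>J\<in>Pow {..<n}. f (Suc ` J))"
proof -
  have P: "Pow (Suc ` {..<n}) = image Suc ` Pow {..<n}" by (rule image_Pow_surj[symmetric]) simp
  have "Pow {..<Suc n} = image Suc ` Pow {..<n} \<union> insert 0 ` image Suc ` Pow {..<n}"
    by (simp only: lessThan_Suc_eq_insert_0 Pow_insert P)
  also have "sum f \<dots> = sum f (image Suc ` Pow {..<n}) + sum f (insert 0 ` image Suc ` Pow {..<n})"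
    by (rule sum.union_disjoint) auto
  also have "sum f (image Suc ` Pow {..<n}) = (\<Sum>J\<in>Pow {..<n}. f (Suc ` J))"
    by (subst sum.reindex) (auto simp: inj_on_def inj_image_eq_iff)
  also have "sum f (insert 0 ` image Suc ` Pow {..<n}) = (\<Sum>J\<in>Pow {..<n}. f (insert 0 (Suc ` J)))"
  proof (unfold image_image, subst sum.reindex)
    show "inj_on (\<lambda>x. insert 0 (Suc ` x)) (Pow {..<n})"
    proof (rule inj_onI)
      fix x y assume "insert 0 (Suc ` x) = insert 0 (Suc ` y)"
      then have "Suc ` x = Suc ` y" by (metis insert_ident image_iff Zero_not_Suc)
      then show "x = y" by (simp add: inj_image_eq_iff)
    qed
  qed simp
  finally show ?thesis by (simp add: add.commute)
qed

lemma linear_unshuffle_sign: "Vector_Spaces.linear s s' L \<Longrightarrow> L (unshuffle_sign ds I x) = unshuffle_sign ds I (L x)"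
  unfolding unshuffle_sign_def by (auto simp: module_hom.neg[OF Vector_Spaces.linear.axioms(3)])

lemma unshuffle_sign_add: "unshuffle_sign ds I (x + y) = unshuffle_sign ds I x + unshuffle_sign ds I y"
  by (simp add: unshuffle_sign_def)

lemma ksign_commute: "ksign i j (ksign k l x) = ksign k l (ksign i j x)"
  by (auto simp: ksign_def)

context symalg
begin

abbreviation tt :: "('k, 'u) tensor \<Rightarrow> ('k, 'u) tensor \<Rightarrow> ('k, ('k, 'u) tensor) tensor" where
  "tt a b \<equiv> tens dscl [a, b]"

abbreviation lm :: "'u \<Rightarrow> ('k, 'u) tensor \<Rightarrow> ('k, 'u) tensor" where
  "lm u \<equiv> sym_mult U (mon U [u])"

lemma lm_carr: "u \<in> carr U \<Longrightarrow> a \<in> carr S \<Longrightarrow> lm u a \<in> carr S"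
  using A.mult_carr[of "mon U [u]" a] mon_carr[of "[u]"] by simp

lemma mon1_gr: "u \<in> gr U i \<Longrightarrow> mon U [u] \<in> sym_gr U i"
  using mon_gr[of "[u]" "[i]"] by (simp add: homogeneous_list_def)

lemma mon1_carr: "u \<in> carr U \<Longrightarrow> mon U [u] \<in> carr S"
  by (rule mon_carr) simp

lemma lm_gr: "u \<in> gr U i \<Longrightarrow> a \<in> sym_gr U p \<Longrightarrow> lm u a \<in> sym_gr U (i + p)"
  by (rule sym_mult_gr[OF mon1_gr])

lemma lm_lin: "u \<in> carr U \<Longrightarrow> a \<in> carr S \<Longrightarrow> b \<in> carr S \<Longrightarrow> lm u (a + b) = lm u a + lm u b"
  "u \<in> carr U \<Longrightarrow> a \<in> carr S \<Longrightarrow> lm u (dscl c a) = dscl c (lm u a)"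
  by (simp_all add: sym_mult_add_right sym_mult_scl_right mon1_carr)

lemma lm_lin_arg: "lm (u + v) a = lm u a + lm v a" "lm (scl U c u) a = dscl c (lm u a)" "lm 0 a = 0"
  using mon_add[of "[]" u v "[]"] mon_scl[of "[]" c u "[]"] mon_zero[of "[]" "[]"]
  by (simp_all add: sym_mult_add_left sym_mult_scl_left sym_mult_zero_left)

lemma lm_ksign: "u \<in> carr U \<Longrightarrow> a \<in> carr S \<Longrightarrow> lm u (ksign i j a) = ksign i j (lm u a)"
proof -
  assume a: "u \<in> carr U" "a \<in> carr S"
  have n: "dscl (-1) x = - x" for x :: "('k, 'u) tensor" by (simp add: dscl_def fun_eq_iff)
  show ?thesis using lm_lin(2)[OF a, of "-1"] by (simp add: ksign_def n)
qed

lemma lm_comm: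
  assumes "x \<in> gr U i" "y \<in> gr U j" "a \<in> carr S"
  shows "lm x (lm y a) = ksign i j (lm y (lm x a))"
proof -
  have "lm x (lm y a) = sym_mult U (sym_mult U (mon U [x]) (mon U [y])) a"
    by (simp only: sym_mult_assoc[OF assms(3)])
  also have "sym_mult U (mon U [x]) (mon U [y]) = ksign i j (sym_mult U (mon U [y]) (mon U [x]))"
    by (rule sym_mult_comm[OF mon1_gr[OF assms(1)] mon1_gr[OF assms(2)]])
  also have "sym_mult U (ksign i j (sym_mult U (mon U [y]) (mon U [x]))) a = ksign i j (lm y (lm x a))"
  proof -
    have n: "- t = dscl (-1) t" for t :: "('k, 'u) tensor" by (simp add: dscl_def fun_eq_iff)
    show ?thesis by (simp only: ksign_def n sym_mult_scl_left sym_mult_assoc[OF assms(3)] split: if_split) simp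
  qed
  finally show ?thesis .
qed

lemmas tt_lin = bilinD[OF G.tens2_bilin, unfolded S_simps]

lemma tt_zero: "tt 0 b = 0" "tt a 0 = 0"
  using G.tens_zero[of "[]" "[b]"] G.tens_zero[of "[a]" "[]"] by simp_all

lemma tt_ksign: "a \<in> carr S \<Longrightarrow> b \<in> carr S \<Longrightarrow> tt (ksign i j a) b = ksign i j (tt a b)"
  "a \<in> carr S \<Longrightarrow> b \<in> carr S \<Longrightarrow> tt a (ksign i j b) = ksign i j (tt a b)"
  using G.tens2_neg[of a b] by (simp_all add: ksign_def)

lemma tt_mem: "a \<in> carr S \<Longrightarrow> b \<in> carr S \<Longrightarrow> tt a b \<in> tens_pow S 2"
proof -
  interpret TT: vector_space "dscl :: 'k \<Rightarrow> ('k, ('k, 'u) tensor) tensor \<Rightarrow> _" by (rule vs_tensor)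
  assume "a \<in> carr S" "b \<in> carr S"
  then have "[a, b] \<in> lists (carr S)" "length [a, b] = 2" by auto
  then show ?thesis unfolding tens_pow_def S_simps by (intro TT.span_base) blast
qed

lemma tp_subspace: "module.subspace dscl (tens_pow S 2)"
proof -
  interpret TT: vector_space "dscl :: 'k \<Rightarrow> ('k, ('k, 'u) tensor) tensor \<Rightarrow> _" by (rule vs_tensor)
  show ?thesis unfolding tens_pow_def by simp
qed

lemma tp_induct [consumes 1, case_names zero add hom]:
  assumes "t \<in> tens_pow S 2" "P 0"
    and "\<And>t r. t \<in> tens_pow S 2 \<Longrightarrow> r \<in> tens_pow S 2 \<Longrightarrow> P t \<Longrightarrow> P r \<Longrightarrow> P (t + r)"
    and "\<And>a b p q. a \<in> sym_gr U p \<Longrightarrow> b \<in> sym_gr U q \<Longrightarrow> P (tt a b)"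
  shows "P t"
proof -
  interpret TT: vector_space "dscl :: 'k \<Rightarrow> ('k, ('k, 'u) tensor) tensor \<Rightarrow> _" by (rule vs_tensor)
  obtain ps where ps: "hom_pairs S ps" "t = (\<Sum>(a, b)\<leftarrow>ps. tt a b)"
    using G.tens_pow2_hom[OF assms(1)] by auto
  have "(\<Sum>(a, b)\<leftarrow>ps. tt a b) \<in> tens_pow S 2 \<and> P (\<Sum>(a, b)\<leftarrow>ps. tt a b)"
    using ps(1)
  proof (induction ps)
    case Nil then show ?case using assms(2) TT.subspace_0[OF tp_subspace] by simp
  next
    case (Cons p ps)
    obtain a b where p: "p = (a, b)" by (cases p)
    with Cons obtain i j where ij: "a \<in> sym_gr U i" "b \<in> sym_gr U j" by (auto simp: hom_pairs_def)
    then have "tt a b \<in> tens_pow S 2" by (intro tt_mem G.gr_carr) simp_all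
    moreover have "hom_pairs S ps" using Cons.prems by (simp add: hom_pairs_def)
    ultimately show ?case using Cons.IH assms(3) assms(4)[OF ij] TT.subspace_add[OF tp_subspace] p by simp
  qed
  with ps(2) show ?thesis by simp
qed

definition pe :: "'u \<Rightarrow> 'u" where "pe u = scl U (1/2) (u + par U u)"
definition po :: "'u \<Rightarrow> 'u" where "po u = scl U (1/2) (u - par U u)"

lemma pe_po_carr: "u \<in> carr U \<Longrightarrow> pe u \<in> carr U" "u \<in> carr U \<Longrightarrow> po u \<in> carr U"
  by (auto simp: pe_def po_def intro!: carr_scl carr_add carr_diff par_carr)

lemma par_lin: "par U (u + v) = par U u + par U v" "par U (scl U c u) = scl U c (par U u)"
proof -
  interpret P: Vector_Spaces.linear "scl U" "scl U" "par U" by (rule par_linear)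
  show "par U (u + v) = par U u + par U v" "par U (scl U c u) = scl U c (par U u)" by (rule P.add P.scale)+
qed

lemma pe_po_lin: "pe (u + v) = pe u + pe v" "pe (scl U c u) = scl U c (pe u)"
  "po (u + v) = po u + po v" "po (scl U c u) = scl U c (po u)"
  by (simp_all add: pe_def po_def par_lin vs.scale_right_distrib vs.scale_right_diff_distrib mult.commute)

lemma pe_po_gr: 
  assumes "u \<in> gr U i" shows "pe u = (if odd i then 0 else u)" "po u = (if odd i then u else 0)"
proof -
  have "scl U (1/2) (u + u) = scl U (1/2 + 1/2) u" by (simp only: vs.scale_left_distrib vs.scale_right_distrib)
  also have "\<dots> = u" by simp
  finally have h: "scl U (1/2) (u + u) = u" .
  then show "pe u = (if odd i then 0 else u)" "po u = (if odd i then u else 0)"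
    by (simp_all add: pe_def po_def par_hom[OF assms] ksign_def)
qed

text \<open>Multiplication by \<open>\<delta>(u) = u \<otimes> 1 + 1 \<otimes> u\<close> on \<open>S \<otimes> S\<close>; moving \<open>u\<close> past the first factor costs a sign when
  \<open>u\<close> is odd, so \<open>u\<close> is split into its even and odd part to have an expression linear in \<open>u\<close>.\<close>

definition dt :: "'u \<Rightarrow> ('k, 'u) tensor \<Rightarrow> ('k, 'u) tensor \<Rightarrow> ('k, ('k, 'u) tensor) tensor" where
  "dt u a b = tt (lm u a) b + (tt a (lm (pe u) b) + tt (par S a) (lm (po u) b))"

definition dop :: "'u \<Rightarrow> ('k, ('k, 'u) tensor) tensor \<Rightarrow> ('k, ('k, 'u) tensor) tensor" where
  "dop u = tens_lift dscl dscl (carr S) 2 (\<lambda>xs. dt u (xs ! 0) (xs ! 1))"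

lemma parS_lin: "par S (a + b) = par S a + par S b" "par S (dscl c a) = dscl c (par S a)"
proof -
  interpret P: Vector_Spaces.linear "scl S" "scl S" "par S" by (rule G.par_linear)
  show "par S (a + b) = par S a + par S b" "par S (dscl c a) = dscl c (par S a)" using P.add P.scale by simp_all
qed

lemma dt_gr:
  assumes "u \<in> gr U i" "a \<in> carr S" "b \<in> carr S"
  shows "dt u a b = tt (lm u a) b + tt (tw S i a) (lm u b)"
  by (cases "odd i") (simp_all add: dt_def pe_po_gr[OF assms(1)] tw_def lm_lin_arg tt_zero)

lemma dt_bilin: assumes "u \<in> carr U" shows "bilin S dscl (dt u)"
proof -
  interpret TT: vector_space "dscl :: 'k \<Rightarrow> ('k, ('k, 'u) tensor) tensor \<Rightarrow> _" by (rule vs_tensor)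
  note c = pe_po_carr[OF assms] assms
  show ?thesis
    by (rule bilinI) (simp_all add: dt_def tt_lin lm_lin lm_carr c G.par_carr parS_lin TT.scale_right_distrib G.carr_add
      G.carr_scl[unfolded S_simps])
qed

lemma dop_linear: "u \<in> carr U \<Longrightarrow> Vector_Spaces.linear dscl dscl (dop u)"
  unfolding dop_def using G.tens_lift2(1)[OF vs_tensor dt_bilin] by simp

lemma dop_tt: "u \<in> carr U \<Longrightarrow> a \<in> carr S \<Longrightarrow> b \<in> carr S \<Longrightarrow> dop u (tt a b) = dt u a b"
  unfolding dop_def using G.tens_lift2(2)[OF vs_tensor dt_bilin] by simp

lemma dop_add: "u \<in> carr U \<Longrightarrow> dop u (t + r) = dop u t + dop u r"
  and dop_scl: "u \<in> carr U \<Longrightarrow> dop u (dscl c t) = dscl c (dop u t)"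
  and dop_0: "u \<in> carr U \<Longrightarrow> dop u 0 = 0"
proof -
  assume "u \<in> carr U"
  then interpret L: Vector_Spaces.linear dscl dscl "dop u" by (rule dop_linear)
  show "dop u (t + r) = dop u t + dop u r" "dop u (dscl c t) = dscl c (dop u t)" "dop u 0 = 0"
    by (rule L.add L.scale L.zero)+
qed

lemma dop_mem: 
  assumes "u \<in> carr U" "t \<in> tens_pow S 2" shows "dop u t \<in> tens_pow S 2"
  using assms(2)
proof (induction rule: tp_induct)
  case zero
  interpret TT: vector_space "dscl :: 'k \<Rightarrow> ('k, ('k, 'u) tensor) tensor \<Rightarrow> _" by (rule vs_tensor)
  show ?case using TT.subspace_0[OF tp_subspace] by (simp add: dop_0 assms)
next
  case (add t r)
  interpret TT: vector_space "dscl :: 'k \<Rightarrow> ('k, ('k, 'u) tensor) tensor \<Rightarrow> _" by (rule vs_tensor)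
  show ?case using TT.subspace_add[OF tp_subspace add(3,4)] by (simp add: dop_add assms)
next
  case (hom a b p q)
  interpret TT: vector_space "dscl :: 'k \<Rightarrow> ('k, ('k, 'u) tensor) tensor \<Rightarrow> _" by (rule vs_tensor)
  have c: "a \<in> carr S" "b \<in> carr S" using hom by (auto intro: G.gr_carr)
  show ?case unfolding dop_tt[OF assms(1) c] dt_def
    by (intro TT.subspace_add[OF tp_subspace] tt_mem lm_carr G.par_carr pe_po_carr c assms)
qed

lemma dop_lin_arg:
  assumes "t \<in> tens_pow S 2" "x \<in> carr U" "y \<in> carr U"
  shows "dop (x + y) t = dop x t + dop y t" "dop (scl U c x) t = dscl c (dop x t)"
proof -
  interpret TT: vector_space "dscl :: 'k \<Rightarrow> ('k, ('k, 'u) tensor) tensor \<Rightarrow> _" by (rule vs_tensor)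
  note c = carr_add[OF assms(2,3)] carr_scl[OF assms(2)]
  show "dop (x + y) t = dop x t + dop y t" using assms(1)
  proof (induction rule: tp_induct)
    case (hom a b p q)
    then have "a \<in> carr S" "b \<in> carr S" by (auto intro: G.gr_carr)
    then show ?case using assms(2,3) c
      by (simp add: dop_tt dt_def lm_lin_arg pe_po_lin tt_lin lm_carr pe_po_carr G.par_carr)
  qed (simp_all add: dop_0 dop_add assms c)
  show "dop (scl U c x) t = dscl c (dop x t)" using assms(1)
  proof (induction rule: tp_induct)
    case (hom a b p q)
    then have "a \<in> carr S" "b \<in> carr S" by (auto intro: G.gr_carr)
    then show ?case using assms(2,3) c
      by (simp add: dop_tt dt_def lm_lin_arg pe_po_lin tt_lin lm_carr pe_po_carr G.par_carr TT.scale_right_distrib)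
  qed (simp_all add: dop_0 dop_add assms c TT.scale_right_distrib)
qed

lemma dop_ksign: "u \<in> carr U \<Longrightarrow> dop u (ksign i j t) = ksign i j (dop u t)"
  by (rule linear_ksign[OF dop_linear])

lemma dop_comm:
  assumes "x \<in> gr U i" "y \<in> gr U j" "t \<in> tens_pow S 2"
  shows "dop x (dop y t) = ksign i j (dop y (dop x t))"
  using assms(3)
proof (induction rule: tp_induct)
  case zero show ?case using assms by (simp add: dop_0 gr_carr)
next
  case (add t r)
  have c: "x \<in> carr U" "y \<in> carr U" using assms by (auto intro: gr_carr)
  have "dop x (dop y (t + r)) = dop x (dop y t) + dop x (dop y r)" by (simp only: dop_add[OF c(1)] dop_add[OF c(2)])
  also have "\<dots> = ksign i j (dop y (dop x (t + r)))" unfolding add(3,4) by (simp add: dop_add c)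
  finally show ?case .
next
  case (hom a b p q)
  have c: "x \<in> carr U" "y \<in> carr U" "a \<in> carr S" "b \<in> carr S" using assms hom by (auto intro: gr_carr G.gr_carr)
  have m: "lm x a \<in> carr S" "lm x b \<in> carr S" "lm y a \<in> carr S" "lm y b \<in> carr S" by (intro lm_carr c)+
  have m2: "lm x (lm y a) \<in> carr S" "lm x (lm y b) \<in> carr S" "lm y (lm x a) \<in> carr S" "lm y (lm x b) \<in> carr S" by (intro lm_carr c)+
  have tw: "tw S k a = ksign k p a" for k using G.tw_hom[of a p k] hom by simp
  have twx: "tw S k (lm x a) = ksign k (i + p) (lm x a)" for k using G.tw_hom[of "lm x a" "i + p" k] lm_gr[OF assms(1) hom(1)] by simp
  have twy: "tw S k (lm y a) = ksign k (j + p) (lm y a)" for k using G.tw_hom[of "lm y a" "j + p" k] lm_gr[OF assms(2) hom(1)] by simp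
  have twk: "tw S k (ksign l p a) = ksign k p (ksign l p a)" for k l
    using G.tw_hom[of "ksign l p a" p k] G.ksign_gr[of a p l p] hom by simp
  have kc: "ksign k l a \<in> carr S" for k l using G.ksign_gr[of a p k l] hom by (auto intro: G.gr_carr)
  have L: "dop x (dop y (tt a b)) = tt (lm x (lm y a)) b + ksign i (j + p) (tt (lm y a) (lm x b)) +
      (ksign j p (tt (lm x a) (lm y b)) + ksign i p (ksign j p (tt a (lm x (lm y b)))))"
    by (simp add: dop_tt dop_add dop_ksign ksign_commute c m m2 kc dt_gr[OF assms(1)] dt_gr[OF assms(2)] tw twk twy tt_ksign lm_ksign)
  have R: "dop y (dop x (tt a b)) = tt (lm y (lm x a)) b + ksign j (i + p) (tt (lm x a) (lm y b)) +
      (ksign i p (tt (lm y a) (lm x b)) + ksign j p (ksign i p (tt a (lm y (lm x b)))))"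
    by (simp add: dop_tt dop_add dop_ksign ksign_commute c m m2 kc dt_gr[OF assms(1)] dt_gr[OF assms(2)] tw twk twx tt_ksign lm_ksign)
  show ?case unfolding L R lm_comm[OF assms(1,2) c(3)] lm_comm[OF assms(1,2) c(4)] tt_ksign(1)[OF m2(3) c(4)] tt_ksign(2)[OF c(3) m2(4)]
    by (auto simp: ksign_def)
qed

text \<open>The product \<open>\<delta>(u\<^sub>1) \<cdots> \<delta>(u\<^sub>n)\<close> in \<open>S \<otimes> S\<close>.  By graded symmetry it descends to \<open>S(U)\<close>, which shows that the formula for the
  unshuffle coproduct is well defined.\<close>

definition dl :: "'u list \<Rightarrow> ('k, ('k, 'u) tensor) tensor" where
  "dl us = foldr dop us (tt (mon U []) (mon U []))"

lemma dl_simps [simp]: "dl [] = tt (mon U []) (mon U [])" "dl (u # us) = dop u (dl us)"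
  by (simp_all add: dl_def)

lemma one_carr: "mon U [] \<in> carr S" by (rule mon_carr) simp

lemma dl_mem: "us \<in> lists (carr U) \<Longrightarrow> dl us \<in> tens_pow S 2"
  by (induction us) (auto intro: tt_mem one_carr dop_mem)

lemma dl_linear:
  assumes "xs \<in> lists (carr U)" "ys \<in> lists (carr U)"
  shows "linear_map_on (scl U) dscl (carr U) (\<lambda>x. dl (xs @ x # ys))"
  using assms(1)
proof (induction xs)
  case Nil
  show ?case using dop_lin_arg[OF dl_mem[OF assms(2)]] by (simp add: linear_map_on_def)
next
  case (Cons a xs)
  then show ?case by (simp add: linear_map_on_def dop_add dop_scl)
qed

lemma dl_sym:
  assumes "xs \<in> lists (carr U)" "ys \<in> lists (carr U)" "x \<in> gr U i" "y \<in> gr U j"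
  shows "dl (xs @ x # y # ys) = ksign i j (dl (xs @ y # x # ys))"
  using assms(1)
proof (induction xs)
  case Nil
  show ?case using dop_comm[OF assms(3,4) dl_mem[OF assms(2)]] by simp
next
  case (Cons a xs)
  then have "dl ((a # xs) @ x # y # ys) = dop a (ksign i j (dl (xs @ y # x # ys)))" by (simp del: dl_simps(1))
  then show ?case using Cons by (simp add: dop_ksign)
qed

lemma homogeneous_list_nths: "homogeneous_list U xs ds \<Longrightarrow> homogeneous_list U (nths xs J) (nths ds J)"
proof (induction xs arbitrary: ds J)
  case Nil then show ?case by (simp add: homogeneous_list_def)
next
  case (Cons x xs)
  then obtain d ds' where d: "ds = d # ds'" "x \<in> gr U d" "homogeneous_list U xs ds'" unfolding homogeneous_list_Cons by blast
  show ?case using Cons.IH[OF d(3), of "{j. Suc j \<in> J}"] d by (simp add: nths_Cons homogeneous_list_Cons)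
qed

text \<open>Expanding the product, each letter \<open>u\<^sub>i\<close> goes to the left or to the right factor; \<open>I\<close> is the set of those that go to the
  left, and passing them to the front gives the unshuffle sign.\<close>

lemma dl_formula:
  "homogeneous_list U xs ds \<Longrightarrow> dl xs =
    (\<Sum>I\<in>Pow {..<length xs}. unshuffle_sign ds I (tens dscl [mon U (nths xs I), mon U (nths xs (- I))]))"
proof (induction xs arbitrary: ds)
  case Nil then show ?case by (simp add: unshuffle_sign_def)
next
  case (Cons x xs)
  then obtain d ds' where d: "ds = d # ds'" "x \<in> gr U d" "homogeneous_list U xs ds'" unfolding homogeneous_list_Cons by blast
  have x: "x \<in> carr U" by (rule gr_carr[OF d(2)])
  interpret L: Vector_Spaces.linear dscl dscl "dop x" by (rule dop_linear[OF x])
  have l: "length ds' = length xs" using d(3) by (simp add: homogeneous_list_def list_all2_lengthD)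
  have s1: "{j. Suc j \<in> insert 0 (Suc ` J)} = J" "{j. Suc j \<in> Suc ` J} = J" "{j. Suc j \<notin> insert 0 (Suc ` J)} = - J" "{j. Suc j \<notin> Suc ` J} = - J" for J
    by auto
  have step: "dop x (tt (mon U (nths xs J)) (mon U (nths xs (- J)))) =
      tt (mon U (x # nths xs J)) (mon U (nths xs (- J))) + 
      ksign d (sum_list (nths ds' J)) (tt (mon U (nths xs J)) (mon U (x # nths xs (- J))))" for J
  proof -
    note h = homogeneous_list_nths[OF d(3)]
    have c: "mon U (nths xs I) \<in> carr S" for I by (rule mon_carr[OF hom_lists[OF homogeneous_list_hom[OF h]]])
    have "tw S d (mon U (nths xs J)) = ksign d (sum_list (nths ds' J)) (mon U (nths xs J))"
      using G.tw_hom[of "mon U (nths xs J)" _ d] mon_gr[OF h] by simp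
    then show ?thesis
      by (simp add: dop_tt[OF x c c] dt_gr[OF d(2) c c] tt_ksign c lm_carr[OF x c] sym_mult_mon flip: sym_mult_mon) 
        (simp add: sym_mult_mon tt_ksign c lm_carr[OF x c, unfolded sym_mult_mon append.simps])
  qed
  let ?f = "\<lambda>I. unshuffle_sign (d # ds') I (tt (mon U (nths (x # xs) I)) (mon U (nths (x # xs) (- I))))"
  have "dl (x # xs) = (\<Sum>J\<in>Pow {..<length xs}. unshuffle_sign ds' J (dop x (tt (mon U (nths xs J)) (mon U (nths xs (- J))))))"
    by (simp add: Cons.IH[OF d(3)] L.sum linear_unshuffle_sign[OF dop_linear[OF x]])
  also have "\<dots> = (\<Sum>J\<in>Pow {..<length xs}. ?f (insert 0 (Suc ` J))) + (\<Sum>J\<in>Pow {..<length xs}. ?f (Suc ` J))"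
    unfolding step unshuffle_sign_add sum.distrib unshuffle_sign_insert0 unshuffle_sign_Suc
    by (intro arg_cong2[of _ _ _ _ "(+)"] sum.cong) (simp_all add: nths_Cons s1)
  also have "\<dots> = (\<Sum>I\<in>Pow {..<length (x # xs)}. ?f I)" by (simp only: sum_Pow_lessThan_Suc list.size add_0_right add_Suc_right)
  finally show ?case by (simp add: d(1))
qed

lemma sym_coprod_props:
  shows sym_coprod_linear: "Vector_Spaces.linear dscl dscl (sym_coprod U)"
    and sym_coprod_mon: "hom xs \<Longrightarrow> sym_coprod U (mon U xs) = dl xs"
proof -
  let ?P = "\<lambda>L. Vector_Spaces.linear dscl dscl L \<and>
        (\<forall>xs ds. homogeneous_list U xs ds \<longrightarrow>
           L (mon U xs) =
             (\<Sum>I\<in>Pow {..<length xs}. unshuffle_sign ds I (tens dscl [mon U (nths xs I), mon U (nths xs (- I))])))"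
  obtain L where L: "Vector_Spaces.linear dscl dscl L" "\<And>xs. xs \<in> lists (carr U) \<Longrightarrow> L (mon U xs) = dl xs"
  proof (rule sym_lift[OF vs_tensor, where b=dl])
    show "linear_map_on (scl U) dscl (carr U) (\<lambda>x. dl (xs @ x # ys))" if "xs \<in> lists (carr U)" "ys \<in> lists (carr U)" for xs ys
      by (rule dl_linear[OF that])
    show "dl (xs @ x # y # ys) = ksign i j (dl (xs @ y # x # ys))"
      if "xs \<in> lists (carr U)" "ys \<in> lists (carr U)" "x \<in> gr U i" "y \<in> gr U j" for xs ys i j x y
      by (rule dl_sym[OF that])
  qed blast
  have "?P L"
  proof (intro conjI allI impI)
    fix xs ds assume h: "homogeneous_list U xs ds"
    show "L (mon U xs) =
             (\<Sum>I\<in>Pow {..<length xs}. unshuffle_sign ds I (tens dscl [mon U (nths xs I), mon U (nths xs (- I))]))"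
      by (simp only: L(2)[OF hom_lists[OF homogeneous_list_hom[OF h]]] dl_formula[OF h])
  qed (rule L(1))
  then have P: "?P (sym_coprod U)" unfolding sym_coprod_def by (rule someI[where P="?P"])
  show "Vector_Spaces.linear dscl dscl (sym_coprod U)" using P by (rule conjunct1)
  assume "hom xs"
  then obtain ds where h: "homogeneous_list U xs ds" using hom_ex by blast
  show "sym_coprod U (mon U xs) = dl xs" unfolding dl_formula[OF h] using P h by blast
qed

end

section \<open>The symmetric bialgebra\<close>

interpretation TT: vector_space "dscl :: 'k::field \<Rightarrow> ('a \<Rightarrow> 'k) \<Rightarrow> _" by (rule vector_space_dscl)

context symalg
begin

sublocale SC: Vector_Spaces.linear dscl dscl "sym_coprod U" by (rule sym_coprod_linear)

lemma coprod_step: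
  assumes "u \<in> gr U i" "s \<in> carr S" shows "sym_coprod U (lm u s) = dop u (sym_coprod U s)"
  using assms(2)
proof (induction rule: carr_S_induct)
  case base
  show ?case using assms(1) lm_lin(2)[of u 0 0] G.carr_zero by (simp add: gr_carr SC.zero dop_0)
next
  case (step c xs y)
  have u: "u \<in> carr U" by (rule gr_carr[OF assms(1)])
  have h: "hom (u # xs)" using step assms(1) by (auto simp: hom_Cons)
  have m: "mon U xs \<in> carr S" by (rule mon_carr[OF hom_lists[OF step(1)]])
  have "lm u (dscl c (mon U xs) + y) = dscl c (mon U (u # xs)) + lm u y"
    using m step(2) G.carr_scl[OF m] by (simp add: lm_lin u sym_mult_mon)
  then show ?case using step(3) by (simp add: SC.add SC.scale sym_coprod_mon[OF h] sym_coprod_mon[OF step(1)] dop_add dop_scl u)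
qed

lemma sym_coprod_mem: "s \<in> carr S \<Longrightarrow> sym_coprod U s \<in> tens_pow S 2"
proof (induction rule: carr_S_induct)
  case base show ?case using TT.subspace_0[OF tp_subspace] by (simp add: SC.zero)
next
  case (step c xs y)
  then show ?case using dl_mem[OF hom_lists[OF step(1)]]
    by (simp add: SC.add SC.scale sym_coprod_mon TT.subspace_add[OF tp_subspace] TT.subspace_scale[OF tp_subspace])
qed

sublocale C: precog S
  by unfold_locales (simp_all add: sym_coprod_mem linear_map_on_def SC.add SC.scale)

lemma tens2_gr_subspace: "module.subspace dscl (tens2_gr S n)"
  unfolding tens2_gr_def by simp

lemma tt_gr: "a \<in> sym_gr U p \<Longrightarrow> b \<in> sym_gr U q \<Longrightarrow> p + q = n \<Longrightarrow> tt a b \<in> tens2_gr S n"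
  unfolding tens2_gr_def S_simps by (intro TT.span_base) blast

lemma dop_gr:
  assumes "u \<in> gr U i" "t \<in> tens2_gr S n" shows "dop u t \<in> tens2_gr S (i + n)"
  using assms(2) unfolding tens2_gr_def[of S n] S_simps
proof (induction rule: TT.span_induct_alt)
  case base show ?case using TT.subspace_0[OF tens2_gr_subspace] assms by (simp add: dop_0 gr_carr)
next
  case (step c x y)
  have u: "u \<in> carr U" by (rule gr_carr[OF assms(1)])
  obtain a b p q where ab: "x = tt a b" "a \<in> sym_gr U p" "b \<in> sym_gr U q" "p + q = n" using step by blast
  have c: "a \<in> carr S" "b \<in> carr S" using ab by (auto intro: G.gr_carr)
  have "tt (lm u a) b \<in> tens2_gr S (i + n)" by (rule tt_gr[OF lm_gr[OF assms(1) ab(2)] ab(3)]) (use ab in simp)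
  moreover have "tw S i a \<in> sym_gr U p" using G.tw_gr[of a p i] ab by simp
  then have "tt (tw S i a) (lm u b) \<in> tens2_gr S (i + n)" by (rule tt_gr[OF _ lm_gr[OF assms(1) ab(3)]]) (use ab in simp)
  ultimately have "dop u x \<in> tens2_gr S (i + n)"
    using TT.subspace_add[OF tens2_gr_subspace] by (simp add: ab(1) dop_tt u c dt_gr[OF assms(1)])
  then show ?case using step
    by (simp add: dop_add dop_scl u TT.subspace_add[OF tens2_gr_subspace] TT.subspace_scale[OF tens2_gr_subspace])
qed

lemma dl_gr: "homogeneous_list U xs ds \<Longrightarrow> dl xs \<in> tens2_gr S (sum_list ds)"
proof (induction xs arbitrary: ds)
  case Nil
  have "mon U [] \<in> sym_gr U 0" using A.unit_gr by simp
  then show ?case using Nil by (simp add: homogeneous_list_def tt_gr)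
next
  case (Cons x xs)
  then obtain d ds' where d: "ds = d # ds'" "x \<in> gr U d" "homogeneous_list U xs ds'" unfolding homogeneous_list_Cons by blast
  show ?case using dop_gr[OF d(2) Cons.IH[OF d(3)]] by (simp add: d(1))
qed

lemma sym_coprod_gr: "s \<in> sym_gr U n \<Longrightarrow> sym_coprod U s \<in> tens2_gr S n"
  unfolding sym_gr_def
proof (induction rule: T.span_induct_alt)
  case base show ?case using TT.subspace_0[OF tens2_gr_subspace] by (simp add: SC.zero)
next
  case (step c x y)
  then obtain xs ds where "x = mon U xs" "homogeneous_list U xs ds" "sum_list ds = n" by blast
  then have "sym_coprod U x \<in> tens2_gr S n" using dl_gr[of xs ds] by (simp add: sym_coprod_mon homogeneous_list_hom)
  then show ?case using step
    by (simp add: SC.add SC.scale TT.subspace_add[OF tens2_gr_subspace] TT.subspace_scale[OF tens2_gr_subspace])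
qed

text \<open>The coproduct is a morphism of algebras, so that multiplication by a generator acts on Sweedler sums
  as a twisted derivation.\<close>

lemma Sw_step:
  assumes "vector_space s'" "bilin S s' \<beta>" "u \<in> gr U i" "s \<in> carr S"
  shows "Sw S \<beta> (lm u s) = Sw S (\<lambda>a b. \<beta> (lm u a) b + \<beta> (tw S i a) (lm u b)) s"
proof -
  have u: "u \<in> carr U" by (rule gr_carr[OF assms(3)])
  obtain L where L: "Vector_Spaces.linear dscl s' L" 
    "\<And>a b. a \<in> carr S \<Longrightarrow> b \<in> carr S \<Longrightarrow> L (tens (scl S) [a, b]) = \<beta> a b"
    using G.bilin_lift[OF assms(1,2)] by blast
  interpret L: Vector_Spaces.linear dscl s' L by (rule L(1))
  have e: "L (sym_coprod U w) = Sw S \<beta> w" if "w \<in> carr S" for w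
    using C.coprod_Sw[OF that] C.Sw_linear_app[OF that L(1)] C.Sw_cong[OF that L(2)] by simp
  have "Sw S \<beta> (lm u s) = L (dop u (sym_coprod U s))"
    by (simp only: e[OF lm_carr[OF u assms(4)], symmetric] coprod_step[OF assms(3,4)])
  also have "\<dots> = L (dop u (Sw S tt s))" using C.coprod_Sw[OF assms(4)] by simp
  also have "\<dots> = Sw S (\<lambda>a b. L (dop u (tt a b))) s"
    by (simp only: C.Sw_linear_app[OF assms(4) dop_linear[OF u]] C.Sw_linear_app[OF assms(4) L(1)])
  also have "\<dots> = Sw S (\<lambda>a b. \<beta> (lm u a) b + \<beta> (tw S i a) (lm u b)) s"
  proof (rule C.Sw_cong[OF assms(4)])
    fix a b assume ab: "a \<in> carr S" "b \<in> carr S"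
    show "L (dop u (tt a b)) = \<beta> (lm u a) b + \<beta> (tw S i a) (lm u b)"
      using L(2)[of "lm u a" b] L(2)[of "tw S i a" "lm u b"] ab
      by (simp add: dop_tt u dt_gr[OF assms(3)] L.add lm_carr G.tw_carr)
  qed
  finally show ?thesis .
qed

lemma tw_lin: "tw S i (a + b) = tw S i a + tw S i b" "tw S i (dscl c a) = dscl c (tw S i a)" "tw S i 0 = 0"
  using G.tw_add[of i a b] G.tw_scl[of i c a] G.tw_zero[of i] by simp_all

lemma Sw_tw:
  fixes s' :: "'k \<Rightarrow> 'x::ab_group_add \<Rightarrow> 'x"
  assumes "vector_space s'" "bilin S s' \<beta>" "s \<in> carr S"
  shows "Sw S \<beta> (tw S i s) = Sw S (\<lambda>a b. \<beta> (tw S i a) (tw S i b)) s"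
proof -
  have b2: "bilin S s' (\<lambda>a b. \<beta> (tw S i a) (tw S i b))"
    by (rule bilinI) (use bilinD[OF assms(2)] in \<open>simp_all add: tw_lin G.tw_carr\<close>)
  interpret X: vector_space s' by fact
  have neg: "\<beta> (- a) b = - \<beta> a b" "\<beta> a (- b) = - \<beta> a b" if "a \<in> carr S" "b \<in> carr S" for a b
  proof -
    have n: "- x = dscl (-1) x" for x :: "('k, 'u) tensor" by (simp add: dscl_def fun_eq_iff)
    show "\<beta> (- a) b = - \<beta> a b" "\<beta> a (- b) = - \<beta> a b"
      unfolding n using bilinD(3,4)[OF assms(2), of a b "-1"] that by simp_all
  qed
  have Sneg: "Sw S \<beta> (- w) = - Sw S \<beta> w" if "w \<in> carr S" for w
  proof -
    have n: "- x = dscl (-1) x" for x :: "('k, 'u) tensor" by (simp add: dscl_def fun_eq_iff)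
    show ?thesis unfolding n using C.Sw_scl[OF assms(1,2) that, of "-1"] by simp
  qed
  from assms(3) show ?thesis
  proof (induction rule: G.carr_induct)
    case zero
    have "Sw S \<gamma> 0 = 0" if "bilin S s' \<gamma>" for \<gamma>
      using C.Sw_add[OF assms(1) that, of 0 0] by simp
    then show ?case using assms(2) b2 by (simp add: tw_lin)
  next
    case (add x y)
    then show ?case by (simp add: tw_lin C.Sw_add[OF assms(1,2)] C.Sw_add[OF assms(1) b2] G.tw_carr)
  next
    case (hom n x)
    have x: "x \<in> carr S" by (rule G.gr_carr[OF hom])
    have "coprod S x \<in> tens2_gr S n" using hom by (simp add: sym_coprod_gr)
    obtain ps where ps: "\<And>a b. (a, b) \<in> set ps \<Longrightarrow> \<exists>i j. a \<in> gr S i \<and> b \<in> gr S j \<and> i + j = n"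
      and E: "\<And>\<gamma>. bilin S s' \<gamma> \<Longrightarrow> Sw S \<gamma> x = (\<Sum>(a, b)\<leftarrow>ps. \<gamma> a b)"
      by (rule C.Sw_gr_pairs[OF x \<open>coprod S x \<in> _\<close>]) (use assms(1) in blast)
    have "(\<Sum>(a, b)\<leftarrow>ps. \<beta> (tw S i a) (tw S i b)) = (\<Sum>(a, b)\<leftarrow>ps. ksign i n (\<beta> a b))"
    proof (rule arg_cong[where f=sum_list], rule map_cong[OF refl], clarify)
      fix a b assume "(a, b) \<in> set ps"
      then obtain p q where pq: "a \<in> gr S p" "b \<in> gr S q" "p + q = n" using ps by blast
      then have c: "a \<in> carr S" "b \<in> carr S" by (auto intro: G.gr_carr)
      show "\<beta> (tw S i a) (tw S i b) = ksign i n (\<beta> a b)"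
        using pq(3) c by (auto simp: G.tw_hom[OF pq(1)] G.tw_hom[OF pq(2)] ksign_def neg G.carr_neg)
    qed
    also have "\<dots> = ksign i n (\<Sum>(a, b)\<leftarrow>ps. \<beta> a b)"
      by (induction ps) (auto simp: ksign_def)
    also have "\<dots> = Sw S \<beta> (tw S i x)"
      using x by (simp add: E[OF assms(2)] G.tw_hom[OF hom] ksign_def Sneg)
    finally show ?case by (simp add: E[OF b2])
  qed
qed

subsection \<open>Counit\<close>

abbreviation eps :: "('k, 'u) tensor \<Rightarrow> 'k" where "eps s \<equiv> s (\<lambda>xs. if xs = [] then 1 else 0)"

lemma gsym_eps: "gsym_form U (\<lambda>xs. if xs = [] then 1 else 0)"
  using vs.vector_space_axioms vector_space_field
  by (intro gsym_formI) (simp_all add: multilinear_form_def Vector_Spaces.linear_iff)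

lemma eps_mon: "eps (mon U xs) = (if xs = [] then 1 else 0)"
  by (simp add: mon_def gsym_eps)

lemma eps_lin: "eps (s + t) = eps s + eps t" "eps (dscl c s) = c * eps s" "eps 0 = 0"
  by (simp_all add: plus_fun_apply dscl_def zero_fun_apply)

lemma eps_lm: "s \<in> carr S \<Longrightarrow> eps (lm u s) = 0"
proof -
  assume s: "s \<in> carr S"
  have "s (\<lambda>ys. 0) = 0" using s
    by (induction rule: carr_S_induct) (simp_all add: mon_def plus_fun_apply dscl_def zero_fun_apply)
  then show ?thesis by (simp add: mon_mult_apply[OF s] gsym_eps)
qed

lemma eps_deg: "s \<in> sym_gr U n \<Longrightarrow> n \<noteq> 0 \<Longrightarrow> eps s = 0"
  unfolding sym_gr_def
proof (induction rule: T.span_induct_alt)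
  case base show ?case by (rule eps_lin)
next
  case (step c x y)
  then obtain xs ds where "x = mon U xs" "homogeneous_list U xs ds" "sum_list ds = n" by blast
  then have "eps x = 0" using step.prems by (auto simp: eps_mon homogeneous_list_def)
  then show ?case using step by (simp add: eps_lin)
qed

lemma eps_tw: "s \<in> carr S \<Longrightarrow> eps (tw S i s) = eps s"
proof (induction rule: G.carr_induct)
  case (hom n x)
  show ?case
  proof (cases "n = 0")
    case False
    then show ?thesis using G.tw_gr[OF hom, of i] hom eps_deg[of x n] eps_deg[of "tw S i x" n] by simp
  qed (simp add: G.tw_hom[OF hom])
qed (simp_all add: tw_lin eps_lin)

lemma eps_mult: "s \<in> carr S \<Longrightarrow> t \<in> carr S \<Longrightarrow> eps (sym_mult U s t) = eps s * eps t"
proof (induction rule: S_induct)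
  case (step u i s)
  have "sym_mult U s t \<in> carr S" using A.mult_carr[of s t] step by simp
  then show ?case using step by (simp add: sym_mult_assoc eps_lm)
qed (simp_all add: sym_mult_zero_left sym_mult_add_left sym_mult_scl_left eps_lin sym_mult_unit eps_mon algebra_simps)

lemma eps_bilin: "bilin S dscl (\<lambda>a b. dscl (eps a) b)" "bilin S dscl (\<lambda>a b. dscl (eps b) a)"
  by (rule bilinI; simp add: eps_lin T.scale_left_distrib T.scale_right_distrib mult.commute)+

lemma Sw_0: "vector_space s' \<Longrightarrow> bilin S s' \<beta> \<Longrightarrow> Sw S \<beta> 0 = 0"
  using C.Sw_add[of s' \<beta> 0 0] by simp

lemma Sw_one: "vector_space s' \<Longrightarrow> bilin S s' \<beta> \<Longrightarrow> Sw S \<beta> (mon U []) = \<beta> (mon U []) (mon U [])"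
  using C.Sw_eqI[of "mon U []" s' \<beta> "[(mon U [], mon U [])]"] sym_coprod_mon[of "[]"] one_carr by simp

lemma Sw_lm: 
  assumes "s \<in> carr S" "u \<in> carr U" "\<And>a b. a \<in> carr S \<Longrightarrow> b \<in> carr S \<Longrightarrow> \<beta> a b \<in> carr S"
  shows "Sw S (\<lambda>a b. lm u (\<beta> a b)) s = lm u (Sw S \<beta> s)"
  by (rule C.Sw_push(1)[where A="carr S", symmetric]) (use assms in \<open>auto simp: lm_lin G.carr_add\<close>)

lemma Sw_eps: "s \<in> carr S \<Longrightarrow> Sw S (\<lambda>a b. dscl (eps a) b) s = s" "s \<in> carr S \<Longrightarrow> Sw S (\<lambda>a b. dscl (eps b) a) s = s"
proof -
  note sc = G.carr_scl[unfolded S_simps]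
  show "s \<in> carr S \<Longrightarrow> Sw S (\<lambda>a b. dscl (eps a) b) s = s"
  proof (induction rule: S_induct)
    case (step u i s)
    have "Sw S (\<lambda>a b. dscl (eps a) b) (lm u s) = Sw S (\<lambda>a b. lm u (dscl (eps a) b)) s"
      unfolding Sw_step[OF vs_tensor eps_bilin(1) step(1,2)]
      by (rule C.Sw_cong[OF step(2)]) (simp add: eps_lm eps_tw lm_lin gr_carr[OF step(1)])
    also have "\<dots> = lm u (Sw S (\<lambda>a b. dscl (eps a) b) s)" by (rule Sw_lm[OF step(2) gr_carr[OF step(1)]]) (rule sc)
    finally show ?case by (simp only: step(3))
  qed (simp_all add: Sw_0[OF vs_tensor eps_bilin(1)] C.Sw_add[OF vs_tensor eps_bilin(1)] 
      C.Sw_scl[OF vs_tensor eps_bilin(1), unfolded S_simps] Sw_one[OF vs_tensor eps_bilin(1)] eps_mon)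
  show "s \<in> carr S \<Longrightarrow> Sw S (\<lambda>a b. dscl (eps b) a) s = s"
  proof (induction rule: S_induct)
    case (step u i s)
    have "Sw S (\<lambda>a b. dscl (eps b) a) (lm u s) = Sw S (\<lambda>a b. lm u (dscl (eps b) a)) s"
      unfolding Sw_step[OF vs_tensor eps_bilin(2) step(1,2)]
      by (rule C.Sw_cong[OF step(2)]) (simp add: eps_lm lm_lin gr_carr[OF step(1)])
    also have "\<dots> = lm u (Sw S (\<lambda>a b. dscl (eps b) a) s)" by (rule Sw_lm[OF step(2) gr_carr[OF step(1)]]) (rule sc)
    finally show ?case by (simp only: step(3))
  qed (simp_all add: Sw_0[OF vs_tensor eps_bilin(2)] C.Sw_add[OF vs_tensor eps_bilin(2)] 
      C.Sw_scl[OF vs_tensor eps_bilin(2), unfolded S_simps] Sw_one[OF vs_tensor eps_bilin(2)] eps_mon)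
qed

subsection \<open>Coassociativity and cocommutativity\<close>

text \<open>Both sides change in the same way when \<open>s\<close> is multiplied by a generator, so induction on the number of letters suffices.\<close>

lemma S_coassoc:
  fixes t :: "('k, 'u) tensor \<Rightarrow> ('k, 'u) tensor \<Rightarrow> ('k, 'u) tensor \<Rightarrow> ('k, ('k, 'u) tensor) tensor"
  assumes "s \<in> carr S" "trilin S dscl t"
  shows "Sw S (\<lambda>a b. Sw S (\<lambda>a1 a2. t a1 a2 b) a) s = Sw S (\<lambda>a b. Sw S (\<lambda>b1 b2. t a b1 b2) b) s"
  using assms
proof (induction arbitrary: t rule: S_induct)
  case zero then show ?case by (simp add: Sw_0[OF vs_tensor] C.bilin_Sw1[OF vs_tensor] C.bilin_Sw2[OF vs_tensor])
next
  case (add x y) 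
  show ?case unfolding C.Sw_add[OF vs_tensor C.bilin_Sw1[OF vs_tensor add.prems] add(1,2)]
    C.Sw_add[OF vs_tensor C.bilin_Sw2[OF vs_tensor add.prems] add(1,2)] add.IH(1)[OF add.prems] add.IH(2)[OF add.prems] ..
next
  case (scale x c) 
  show ?case using C.Sw_scl[OF vs_tensor C.bilin_Sw1[OF vs_tensor scale.prems] scale(1), of c]
    C.Sw_scl[OF vs_tensor C.bilin_Sw2[OF vs_tensor scale.prems] scale(1), of c] scale.IH[OF scale.prems] by simp
next
  case unit
  have b: "bilin S dscl (\<lambda>a1 a2. t a1 a2 (mon U []))" "bilin S dscl (t (mon U []))"
    by (rule bilinI; use trilinD[OF unit.prems] one_carr in simp)+
  show ?case by (simp add: Sw_one[OF vs_tensor C.bilin_Sw1[OF vs_tensor unit]] Sw_one[OF vs_tensor C.bilin_Sw2[OF vs_tensor unit]]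
    Sw_one[OF vs_tensor b(1)] Sw_one[OF vs_tensor b(2)])
next
  case (step u i s)
  note u = gr_carr[OF step(1)]
  note td = trilinD[OF step.prems, unfolded S_simps]
  define t' where "t' = (\<lambda>a b c. t (lm u a) b c + (t (tw S i a) (lm u b) c + t (tw S i a) (tw S i b) (lm u c)))"
  have t': "trilin S dscl t'"
    by (rule trilinI) (simp_all add: t'_def td lm_lin u tw_lin lm_carr G.tw_carr TT.scale_right_distrib algebra_simps)
  have b1: "bilin S dscl (\<lambda>a1 a2. t a1 a2 b)" if "b \<in> carr S" for b
    by (rule bilinI) (use td that in simp_all)
  have b2: "bilin S dscl (\<lambda>b1 b2. t a b1 b2)" if "a \<in> carr S" for a
    by (rule bilinI) (use td that in simp_all)
  have "Sw S (\<lambda>a b. Sw S (\<lambda>a1 a2. t a1 a2 b) a) (lm u s) = 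
      Sw S (\<lambda>a b. Sw S (\<lambda>a1 a2. t a1 a2 b) (lm u a) + Sw S (\<lambda>a1 a2. t a1 a2 (lm u b)) (tw S i a)) s"
    by (rule Sw_step[OF vs_tensor C.bilin_Sw1[OF vs_tensor step.prems] step(1,2)])
  also have "\<dots> = Sw S (\<lambda>a b. Sw S (\<lambda>a1 a2. t' a1 a2 b) a) s"
  proof (rule C.Sw_cong[OF step(2)])
    fix a b assume ab: "a \<in> carr S" "b \<in> carr S"
    show "Sw S (\<lambda>a1 a2. t a1 a2 b) (lm u a) + Sw S (\<lambda>a1 a2. t a1 a2 (lm u b)) (tw S i a) = Sw S (\<lambda>a1 a2. t' a1 a2 b) a"
      unfolding Sw_step[OF vs_tensor b1[OF ab(2)] step(1) ab(1)] Sw_tw[OF vs_tensor b1[OF lm_carr[OF u ab(2)]] ab(1)] 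
        C.Sw_plus[symmetric] t'_def by (simp only: add.assoc)
  qed
  also have "\<dots> = Sw S (\<lambda>a b. Sw S (\<lambda>b1 b2. t' a b1 b2) b) s" by (rule step.IH[OF t'])
  also have "\<dots> = Sw S (\<lambda>a b. Sw S (\<lambda>b1 b2. t (lm u a) b1 b2) b + Sw S (\<lambda>b1 b2. t (tw S i a) b1 b2) (lm u b)) s"
  proof (rule C.Sw_cong[OF step(2)])
    fix a b assume ab: "a \<in> carr S" "b \<in> carr S"
    show "Sw S (\<lambda>b1 b2. t' a b1 b2) b = Sw S (\<lambda>b1 b2. t (lm u a) b1 b2) b + Sw S (\<lambda>b1 b2. t (tw S i a) b1 b2) (lm u b)"
      unfolding Sw_step[OF vs_tensor b2[OF G.tw_carr[OF ab(1)]] step(1) ab(2)] C.Sw_plus[symmetric] t'_def ..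
  qed
  also have "\<dots> = Sw S (\<lambda>a b. Sw S (\<lambda>b1 b2. t a b1 b2) b) (lm u s)"
    by (rule Sw_step[OF vs_tensor C.bilin_Sw2[OF vs_tensor step.prems] step(1,2), symmetric])
  finally show ?case .
qed

lemma tens_swap_dop:
  assumes "u \<in> gr U i" "t \<in> tens_pow S 2" shows "tens_swap S (dop u t) = dop u (tens_swap S t)"
proof -
  interpret Z: Vector_Spaces.linear dscl dscl "tens_swap S" by (rule G.tens_swap_props(1))
  note u = gr_carr[OF assms(1)]
  note sw = G.tens_swap_props(2)[unfolded S_simps]
  from assms(2) show ?thesis
  proof (induction rule: tp_induct)
    case (hom a b p q)
    have c: "a \<in> carr S" "b \<in> carr S" using hom by (auto intro: G.gr_carr)
    have tw: "tw S k a = ksign k p a" "tw S k b = ksign k q b" for k using G.tw_hom[of a p k] G.tw_hom[of b q k] hom by simp_all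
    have m: "lm u a \<in> carr S" "lm u b \<in> carr S" by (intro lm_carr u c)+
    have "tens_swap S (dop u (tt a b)) = ksign (i + p) q (tt b (lm u a)) + ksign i p (ksign p (i + q) (tt (lm u b) a))"
      by (simp add: dop_tt u c dt_gr[OF assms(1)] Z.add tw tt_ksign m linear_ksign[OF Z.linear_axioms]
        sw[OF lm_gr[OF assms(1) hom(1)] hom(2)] sw[OF hom(1) lm_gr[OF assms(1) hom(2)]])
    also have "\<dots> = ksign p q (tt (lm u b) a + ksign i q (tt b (lm u a)))"
      by (auto simp: ksign_def)
    also have "\<dots> = dop u (tens_swap S (tt a b))"
      by (simp add: sw[OF hom] dop_ksign u dop_tt c dt_gr[OF assms(1)] tw tt_ksign m)
    finally show ?case .
  qed (simp_all add: Z.zero Z.add dop_0 dop_add u)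
qed

lemma S_cocomm: "s \<in> carr S \<Longrightarrow> tens_swap S (sym_coprod U s) = sym_coprod U s"
proof -
  interpret Z: Vector_Spaces.linear dscl dscl "tens_swap S" by (rule G.tens_swap_props(1))
  have one: "mon U [] \<in> gr S 0" using A.unit_gr by simp
  show "s \<in> carr S \<Longrightarrow> tens_swap S (sym_coprod U s) = sym_coprod U s"
  proof (induction rule: S_induct)
    case unit
    show ?case using G.tens_swap_props(2)[OF one one] sym_coprod_mon[of "[]"] by simp
  next
    case (step u i s)
    then show ?case by (simp add: coprod_step tens_swap_dop sym_coprod_mem)
  qed (simp_all add: SC.zero SC.add SC.scale Z.zero Z.add Z.scale)
qed

lemma S_cog: "graded_cocomm_coalgebra S"
  unfolding graded_cocomm_coalgebra_def
proof (intro conjI ballI allI impI)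
  show "graded_vs S" by (rule S_graded)
  show "coprod S \<in> carr S \<rightarrow> tens_pow S 2" using sym_coprod_mem by auto
  show "linear_map_on (scl S) dscl (carr S) (coprod S)" by (rule C.coprod_linear)
  show "coprod S ` gr S n \<subseteq> tens2_gr S n" for n using sym_coprod_gr by auto
  show "linear_map_on (scl S) (*) (carr S) (counit S)" by (simp add: linear_map_on_def eps_lin)
  show "counit S x = 0" if "n \<noteq> 0" "x \<in> gr S n" for n x using eps_deg that by simp
  show "tens_lift (scl S) dscl (carr S) 2
          (\<lambda>xs. tens_app (scl S) (coprod S (xs ! 0)) (tens (scl S) [xs ! 1])) (coprod S v) =
        tens_lift (scl S) dscl (carr S) 2
          (\<lambda>xs. tens_app (scl S) (tens (scl S) [xs ! 0]) (coprod S (xs ! 1))) (coprod S v)" if v: "v \<in> carr S" for v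
    using S_coassoc[OF v, of "\<lambda>a b c. tens dscl [a, b, c]"] G.tens3_trilin C.coassoc_left[OF v] C.coassoc_right[OF v]
    by simp
  show "tens_lift (scl S) (scl S) (carr S) 2 (\<lambda>xs. scl S (counit S (xs ! 0)) (xs ! 1)) (coprod S v) = v"
    "tens_lift (scl S) (scl S) (carr S) 2 (\<lambda>xs. scl S (counit S (xs ! 1)) (xs ! 0)) (coprod S v) = v" if v: "v \<in> carr S" for v
    using C.Sw_lift[OF v vs_tensor eps_bilin(1)] C.Sw_lift[OF v vs_tensor eps_bilin(2)] Sw_eps[OF v] by simp_all
  show "tens_swap S (coprod S v) = coprod S v" if "v \<in> carr S" for v using S_cocomm that by simp
qed

sublocale E: gcog0 S
  using S_cog A.unit_gr sym_coprod_mon[of "[]"] eps_mon[of "[]"] by unfold_locales simp_all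

subsection \<open>Conilpotency\<close>

text \<open>The reduced coproduct splits words into two nonempty words.\<close>

definition redpart :: "nat \<Rightarrow> ('k, ('k, 'u) tensor) tensor set" where
  "redpart m = module.span dscl {tt b c | b c i j. b \<in> sym_pow U i \<and> c \<in> sym_pow U j \<and> i + j = m \<and> 1 \<le> i \<and> 1 \<le> j}"

text \<open>After \<open>k\<close> steps all tensor factors except the first are nonempty words, while the total length is unchanged.  Hence a word of
  length \<open>n\<close> is exhausted after \<open>n\<close> steps, which gives conilpotency.\<close>

definition words :: "nat \<Rightarrow> nat \<Rightarrow> ('k, ('k, 'u) tensor) tensor set" where
  "words k n = module.span dscl {tens dscl as | as ns. length as = Suc k \<and> list_all2 (\<lambda>a m. a \<in> sym_pow U m) as ns \<and>
     (\<forall>m\<in>set (tl ns). 1 \<le> m) \<and> sum_list ns = n}"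

lemma sym_pow_carr: "a \<in> sym_pow U m \<Longrightarrow> a \<in> carr S"
  unfolding sym_pow_hom carr_S using T.span_mono[of "{mon U ys | ys. hom ys \<and> length ys = m}" "{mon U xs | xs. hom xs}"] by blast

lemma mon_sym_pow: "hom xs \<Longrightarrow> length xs = n \<Longrightarrow> mon U xs \<in> sym_pow U n"
  unfolding sym_pow_hom by (intro T.span_base) blast

lemma hom_nths: "hom xs \<Longrightarrow> hom (nths xs I)"
  by (auto simp: hom_def dest: in_set_nthsD)

lemma length_nths_compl:
  assumes "I \<subseteq> {..<length xs}"
  shows "length (nths xs I) = card I" "length (nths xs (- I)) = length xs - card I"
proof -
  have "{i. i < length xs \<and> i \<in> I} = I" "{i. i < length xs \<and> i \<in> - I} = {..<length xs} - I" using assms by auto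
  then show "length (nths xs I) = card I" "length (nths xs (- I)) = length xs - card I"
    using assms finite_subset[OF assms] by (simp_all add: length_nths card_Diff_subset)
qed

lemma red_coprod_mon:
  assumes "hom xs" shows "red_coprod S (mon U xs) \<in> redpart (length xs)"
proof (cases "xs = []")
  case True
  have "mon U [] - dscl 1 (mon U []) = (0 :: ('k, 'u) tensor)" by simp
  then have "red_coprod S (mon U xs) = 0"
    by (simp only: True red_coprod_def Let_def S_simps eps_mon simp_thms if_True SC.zero tt_zero diff_zero diff_self)
  then show ?thesis by (simp add: redpart_def TT.span_zero)
next
  case False
  obtain ds where ds: "homogeneous_list U xs ds" using hom_ex[OF assms] by blast
  let ?A = "{..<length xs}"
  let ?f = "\<lambda>I. unshuffle_sign ds I (tt (mon U (nths xs I)) (mon U (nths xs (- I))))"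
  have l: "length ds = length xs" using ds by (simp add: homogeneous_list_def list_all2_lengthD)
  have n: "nths xs ?A = xs" by (rule nths_all) simp
  have nc: "nths xs (- ?A) = []" using length_nths_compl(2)[of ?A xs] by simp
  have nU: "nths xs (- {}) = xs" by (rule nths_all) simp
  have u0: "unshuffle_sign ds {} x = x" for x :: "('k, ('k, 'u) tensor) tensor" by (simp add: unshuffle_sign_def)
  have "ks_set ds ?A = {}" using l by auto
  then have k0: "card (ks_set ds ?A) = 0" by (simp only: card.empty)
  have uA: "unshuffle_sign ds ?A x = x" for x :: "('k, ('k, 'u) tensor) tensor" unfolding unshuffle_sign_def k0 by simp
  have "sym_coprod U (mon U xs) = (\<Sum>I\<in>Pow ?A. ?f I)"
    unfolding sym_coprod_mon[OF assms] by (rule dl_formula[OF ds])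
  also have "Pow ?A = insert {} (insert ?A (Pow ?A - {{}, ?A}))" by auto
  also have "sum ?f \<dots> = ?f {} + (?f ?A + (\<Sum>I\<in>Pow ?A - {{}, ?A}. ?f I))"
    using False by (subst sum.insert; auto)+
  finally have c: "sym_coprod U (mon U xs) = tt (mon U []) (mon U xs) + (tt (mon U xs) (mon U []) + (\<Sum>I\<in>Pow ?A - {{}, ?A}. ?f I))"
    by (simp only: n nc nU nths_empty u0 uA)
  have "red_coprod S (mon U xs) = sym_coprod U (mon U xs) - tt (mon U xs) (mon U []) - tt (mon U []) (mon U xs)"
    using False by (simp add: red_coprod_def eps_mon Let_def)
  then have "red_coprod S (mon U xs) = (\<Sum>I\<in>Pow ?A - {{}, ?A}. ?f I)" unfolding c by simp
  also have "\<dots> \<in> redpart (length xs)"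
    unfolding redpart_def
  proof (rule TT.span_sum)
    fix I assume "I \<in> Pow ?A - {{}, ?A}"
    then have I: "I \<subseteq> ?A" "I \<noteq> {}" "I \<noteq> ?A" by auto
    have "card I \<noteq> 0" using I finite_subset[OF I(1)] by simp
    moreover have "card I < length xs" using psubset_card_mono[of ?A I] I by auto
    ultimately have e: "card I + (length xs - card I) = length xs" "1 \<le> card I" "1 \<le> length xs - card I" by auto
    have a: "mon U (nths xs I) \<in> sym_pow U (card I)" "mon U (nths xs (- I)) \<in> sym_pow U (length xs - card I)"
      by (rule mon_sym_pow[OF hom_nths[OF assms] length_nths_compl(1)[OF I(1)]]
          mon_sym_pow[OF hom_nths[OF assms] length_nths_compl(2)[OF I(1)]])+
    let ?X = "{tt b c | b c i j. b \<in> sym_pow U i \<and> c \<in> sym_pow U j \<and> i + j = length xs \<and> 1 \<le> i \<and> 1 \<le> j}"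
    have "tt (mon U (nths xs I)) (mon U (nths xs (- I))) \<in> ?X" using a e by blast
    then have t: "tt (mon U (nths xs I)) (mon U (nths xs (- I))) \<in> module.span dscl ?X" by (rule TT.span_base)
    have "unshuffle_sign ds I x = x \<or> unshuffle_sign ds I x = - x" for x :: "('k, ('k, 'u) tensor) tensor"
      by (simp add: unshuffle_sign_def)
    from this[of "tt (mon U (nths xs I)) (mon U (nths xs (- I)))"] show "?f I \<in> module.span dscl ?X"
      by (elim disjE) (simp_all only: t TT.span_neg[OF t])
  qed
  finally show ?thesis .
qed

lemma red_coprod_sym_pow: "a \<in> sym_pow U m \<Longrightarrow> red_coprod S a \<in> redpart m"
proof -
  assume "a \<in> sym_pow U m"
  then have "a \<in> carr S \<and> red_coprod S a \<in> redpart m"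
    unfolding sym_pow_hom
  proof (induction rule: T.span_induct_alt)
    case base
    have "red_coprod S (scl S 0 0) = dscl 0 (red_coprod S 0)" by (rule linear_map_on_scl[OF E.red_coprod_linear]) simp
    then show ?case by (simp add: redpart_def TT.span_zero)
  next
    case (step c x y)
    then obtain xs where x: "x = mon U xs" "hom xs" "length xs = m" by blast
    have c: "x \<in> carr S" "dscl c x \<in> carr S" using x mon_carr[OF hom_lists] G.carr_scl[of x c] by auto
    have "red_coprod S (dscl c x + y) = dscl c (red_coprod S x) + red_coprod S y"
      using linear_map_on_add[OF E.red_coprod_linear c(2)] linear_map_on_scl[OF E.red_coprod_linear c(1), of c] step by simp
    then show ?case using step c red_coprod_mon[OF x(2)] x
      by (auto simp: redpart_def intro!: G.carr_add TT.span_add TT.span_scale)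
  qed
  then show ?thesis ..
qed

lemma red_step_words: assumes "t \<in> words k n" shows "E.red_step k t \<in> words (Suc k) n"
proof -
  interpret R: Vector_Spaces.linear dscl dscl "E.red_step k" by (rule E.red_step_props(1))
  from assms show ?thesis unfolding words_def[of k]
  proof (induction rule: TT.span_induct_alt)
    case base show ?case by (simp add: R.zero words_def TT.span_zero)
  next
    case (step c x y)
    then obtain as ns where x: "x = tens dscl as" "length as = Suc k" "list_all2 (\<lambda>a m. a \<in> sym_pow U m) as ns"
      "\<forall>m\<in>set (tl ns). 1 \<le> m" "sum_list ns = n" by blast
    then obtain a as' m ns' where a: "as = a # as'" "ns = m # ns'" by (cases as; cases ns) auto
    have am: "a \<in> sym_pow U m" "list_all2 (\<lambda>a m. a \<in> sym_pow U m) as' ns'" using x a by auto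
    have l: "as \<in> lists (carr S)"
      using x(3) by (induction rule: list_all2_induct) (auto intro: sym_pow_carr)
    have "E.red_step k x = tens_app dscl (red_coprod S a) (tens dscl as')"
      using E.red_step_props(2)[OF l x(2)] x(1) a by simp
    moreover have "tens_app dscl r (tens dscl as') \<in> words (Suc k) n" if "r \<in> redpart m" for r
      using that unfolding redpart_def
    proof (induction rule: TT.span_induct_alt)
      case base show ?case by (simp add: words_def TT.span_zero)
    next
      case (step d r q)
      then obtain b c i j where r: "r = tt b c" "b \<in> sym_pow U i" "c \<in> sym_pow U j" "i + j = m" "1 \<le> i" "1 \<le> j" by blast
      have "\<forall>m\<in>set ns'. 1 \<le> m" using x(4) a by simp
      then have "tens dscl (b # c # as') \<in> words (Suc k) n"
        unfolding words_def using r am x(2,5) a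
        by (intro TT.span_base CollectI exI[of _ "b # c # as'"] exI[of _ "i # j # ns'"]) auto
      then have "tens_app dscl r (tens dscl as') \<in> words (Suc k) n" by (simp add: r(1) tens_app_tens)
      with step show ?case by (auto simp: tens_app_left_add tens_app_left_scl words_def intro: TT.span_add TT.span_scale)
    qed
    ultimately have "E.red_step k x \<in> words (Suc k) n" using red_coprod_sym_pow[OF am(1)] by simp
    with step show ?case by (simp add: R.add R.scale words_def TT.span_add TT.span_scale)
  qed
qed

lemma red_iter_words: "hom xs \<Longrightarrow> red_coprod_iter S k (mon U xs) \<in> words k (length xs)"
proof (induction k)
  case 0
  then show ?case unfolding words_def
    by (auto intro!: TT.span_base exI[of _ "[mon U xs]"] exI[of _ "[length xs]"] mon_sym_pow)
next
  case (Suc k)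
  then show ?case using red_step_words by (simp only: E.red_coprod_iter_step)
qed

lemma words_0: assumes "n < k" "t \<in> words k n" shows "t = 0"
proof -
  have False if "length as = Suc k" "list_all2 (\<lambda>a m. a \<in> sym_pow U m) as ns" "\<forall>m\<in>set (tl ns). 1 \<le> m" "sum_list ns = n"
    for as ns
  proof -
    have "length ns = Suc k" using that by (simp add: list_all2_lengthD)
    then obtain m ns' where ns: "ns = m # ns'" "length ns' = k" by (cases ns) auto
    have "length ns' \<le> sum_list ns'" using that(3) unfolding ns(1) list.sel by (induction ns') auto
    then show False using ns that(4) assms(1) by simp
  qed
  then have "{tens dscl as | as ns. length as = Suc k \<and> list_all2 (\<lambda>a m. a \<in> sym_pow U m) as ns \<and>
     (\<forall>m\<in>set (tl ns). 1 \<le> m) \<and> sum_list ns = n} = ({} :: ('k, ('k, 'u) tensor) tensor set)" by blast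
  then show ?thesis using assms(2) by (simp only: words_def TT.span_empty singleton_iff)
qed

lemma red_iter_linear: "x \<in> carr S \<Longrightarrow> y \<in> carr S \<Longrightarrow> red_coprod_iter S k (dscl c x + y) = dscl c (red_coprod_iter S k x) + red_coprod_iter S k y"
proof (induction k)
  case 0
  show ?case using tens_split_add(1)[OF vs_tensor, of "[]" "dscl c x" y "[]"] tens_split_add(2)[OF vs_tensor, of "[]" c x "[]"]
    by simp
next
  case (Suc k)
  interpret R: Vector_Spaces.linear dscl dscl "E.red_step k" by (rule E.red_step_props(1))
  show ?case unfolding E.red_coprod_iter_step Suc.IH[OF Suc.prems] by (simp add: R.add R.scale)
qed

lemma S_conil: "conilpotent S"
  unfolding conilpotent_def
proof
  fix v assume "v \<in> carr S"
  then show "\<exists>K. \<forall>k\<ge>K. red_coprod_iter S k v = 0"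
  proof (induction rule: carr_S_induct)
    case base
    have "red_coprod_iter S k 0 = 0" for k using red_iter_linear[of 0 0 k "-1"] by simp
    then show ?case by blast
  next
    case (step c xs y)
    then obtain K where K: "\<forall>k\<ge>K. red_coprod_iter S k y = 0" by blast
    have m: "mon U xs \<in> carr S" by (rule mon_carr[OF hom_lists[OF step(1)]])
    have "red_coprod_iter S k (mon U xs) = 0" if "k > length xs" for k
      by (rule words_0[OF that red_iter_words[OF step(1)]])
    then show ?case using K by (intro exI[of _ "max K (Suc (length xs))"]) (simp add: red_iter_linear m step(2))
  qed
qed

sublocale gcog S by unfold_locales (rule S_conil)

end

section \<open>Maps out of a symmetric bialgebra\<close>

context cpair
begin

text \<open>Exponentials are invertible under convolution, the inverse being \<open>exp(-\<phi>)\<close>.\<close>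

lemma cv_ex_cancel:
  assumes "small V W \<phi>" "lin V W \<alpha>" "lin V W \<beta>" "v \<in> carr V"
    and "\<And>x. x \<in> carr V \<Longrightarrow> cv V W \<alpha> (ex \<phi>) x = cv V W \<beta> (ex \<phi>) x"
  shows "\<alpha> v = \<beta> v"
proof -
  let ?i = "ev V W (fps_exp (-1)) \<phi>"
  have inv: "cv V W (ex \<phi>) ?i x = ce V W x" if "x \<in> carr V" for x
    using ev_mult[OF assms(1) that, of "fps_exp 1" "fps_exp (-1)"] fps_exp_add_mult[of 1 "-1 :: 'k"]
    by (simp add: ev_1[OF assms(1) that])
  have "cv V W (cv V W \<gamma> (ex \<phi>)) ?i v = \<gamma> v" if "lin V W \<gamma>" for \<gamma>
  proof -
    have "cv V W (cv V W \<gamma> (ex \<phi>)) ?i v = cv V W \<gamma> (cv V W (ex \<phi>) ?i) v"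
      by (rule cv_assoc[OF that lin_ev[OF assms(1)] lin_ev[OF assms(1)] assms(4)])
    also have "\<dots> = cv V W \<gamma> (ce V W) v" by (rule cv_cong[OF assms(4) refl inv])
    finally show ?thesis by (simp add: cv_ce_right[OF that assms(4)])
  qed
  moreover have "cv V W (cv V W \<alpha> (ex \<phi>)) ?i v = cv V W (cv V W \<beta> (ex \<phi>)) ?i v"
    by (rule cv_cong[OF assms(4)]) (simp_all add: assms(5))
  ultimately show ?thesis using assms(2,3) by metis
qed

lemma ev_at_unit:
  assumes "small V W \<phi>" "\<phi> (unit V) = 0"
  shows "ev V W q \<phi> (unit V) = k_act (scl W) (fps_nth q 0) (fps_const (unit W))"
proof (rule fps_ext)
  fix i
  have z: "pw V W \<phi> (Suc n) (unit V) = 0" for n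
    using cv_unit[OF smallD(1)[OF assms(1)] lin_pw[OF smallD(1)[OF assms(1)]], of n]
    by (simp add: assms(2) lin_mem[OF lin_pw[OF smallD(1)[OF assms(1)]] V.unit_carr])
  have "fps_nth (ev V W q \<phi> (unit V)) i = (\<Sum>n<1. scl W (fps_nth q n) (fps_nth (pw V W \<phi> n (unit V)) i))"
  proof (rule ev_nth[OF assms(1) V.unit_carr])
    fix n :: nat assume "n \<ge> 1"
    then obtain m where "n = Suc m" by (cases n) auto
    then show "fps_nth (pw V W \<phi> n (unit V)) i = 0" by (simp only: z fps_zero_nth)
  qed
  then show "fps_nth (ev V W q \<phi> (unit V)) i = fps_nth (k_act (scl W) (fps_nth q 0) (fps_const (unit W))) i"
    by (simp add: ce_unit)
qed

end

locale sympair = symalg U D + W: galg W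
  for U :: "('k::field_char_0, 'u::ab_group_add) gvs" and D and W :: "('k, 'w::ab_group_add) mv"
begin

sublocale Q: cpair S W ..

text \<open>In the convolution algebra, which is dual to \<open>S(U)\<close>, these are the derivatives of \<open>\<phi>\<close> along the generators.\<close>

abbreviation rr :: "'u \<Rightarrow> (('k, 'u) tensor \<Rightarrow> 'w fps) \<Rightarrow> ('k, 'u) tensor \<Rightarrow> 'w fps" where
  "rr u \<phi> \<equiv> \<lambda>y. \<phi> (lm u y)"

lemma lin_rr: "lin S W \<phi> \<Longrightarrow> u \<in> carr U \<Longrightarrow> lin S W (rr u \<phi>)"
  by (rule linI) (use lin_add[of S W \<phi>] lin_scl[of S W \<phi>] lin_mem[of S W \<phi>] in \<open>simp_all add: lm_lin lm_carr\<close>)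

lemma hdeg_rr: "hdeg S W 0 \<phi> \<Longrightarrow> u \<in> gr U i \<Longrightarrow> hdeg S W i (rr u \<phi>)"
  unfolding hdeg_def
proof (intro allI ballI)
  fix n x assume h: "\<forall>n. \<forall>x\<in>gr S n. \<phi> x \<in> ser (gr W (n + 0))" and u: "u \<in> gr U i" and x: "x \<in> gr S n"
  have "lm u x \<in> gr S (n + i)" using lm_gr[OF u, of x n] x by (simp add: add.commute)
  then show "\<phi> (lm u x) \<in> ser (gr W (n + i))" using h by fastforce
qed

text \<open>The product rule, up to Koszul signs; it dualises the fact that \<open>u\<close> is primitive.\<close>

lemma cv_step:
  assumes "lin S W \<phi>" "lin S W \<psi>" "u \<in> gr U i" "x \<in> carr S"
  shows "cv S W \<phi> \<psi> (lm u x) = cv S W (rr u \<phi>) \<psi> x + cv S W (\<lambda>y. \<phi> (tw S i y)) (rr u \<psi>) x"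
  unfolding cv_def Sw_step[OF W.k_act_vs Q.sm_bilin[OF assms(1,2)] assms(3,4)] C.Sw_plus ..

lemma ce_lm: "x \<in> carr S \<Longrightarrow> ce S W (lm u x) = 0"
  by (simp add: ce_def eps_lm)

lemma pw_step:
  assumes "lin S W \<phi>" "hdeg S W 0 \<phi>" "u \<in> gr U i" "x \<in> carr S"
  shows "pw S W \<phi> (Suc n) (lm u x) = k_act (scl W) (of_nat (Suc n)) (cv S W (rr u \<phi>) (pw S W \<phi> n) x)"
  using assms(4)
proof (induction n arbitrary: x)
  case 0
  note r = lin_rr[OF assms(1) gr_carr[OF assms(3)]]
  have "cv S W (\<lambda>y. \<phi> (tw S i y)) (rr u (ce S W)) x = cv S W (\<lambda>y. \<phi> (tw S i y)) (\<lambda>y. 0) x"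
    by (rule Q.cv_cong[OF 0]) (simp_all add: ce_lm)
  also have "\<dots> = 0"
    using Q.cv_sum_right[of "{}" "\<lambda>_ _. 0" "\<lambda>y. \<phi> (tw S i y)" x] Q.lin_tw[OF assms(1)] 0 by simp
  finally show ?case using cv_step[OF assms(1) Q.lin_ce assms(3) 0] by simp
next
  case (Suc n)
  note r = lin_rr[OF assms(1) gr_carr[OF assms(3)]]
  note p = Q.lin_pw[OF assms(1)]
  let ?\<phi>t = "\<lambda>y. \<phi> (tw S i y)"
  have t: "lin S W ?\<phi>t" by (rule Q.lin_tw[OF assms(1)])
  have "cv S W ?\<phi>t (rr u (pw S W \<phi> (Suc n))) x = 
      cv S W ?\<phi>t (\<lambda>y. k_act (scl W) (of_nat (Suc n)) (cv S W (rr u \<phi>) (pw S W \<phi> n) y)) x"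
    by (rule Q.cv_cong[OF Suc.prems refl]) (rule Suc.IH)
  also have "\<dots> = k_act (scl W) (of_nat (Suc n)) (cv S W ?\<phi>t (cv S W (rr u \<phi>) (pw S W \<phi> n)) x)"
    by (rule Q.cv_k_right[OF Q.lin_cv[OF r p] t Suc.prems])
  also have "cv S W ?\<phi>t (cv S W (rr u \<phi>) (pw S W \<phi> n)) x = cv S W (cv S W ?\<phi>t (rr u \<phi>)) (pw S W \<phi> n) x"
    by (rule Q.cv_assoc[OF t r p Suc.prems, symmetric])
  also have "\<dots> = cv S W (cv S W (rr u \<phi>) \<phi>) (pw S W \<phi> n) x"
    by (rule Q.cv_cong[OF Suc.prems Q.cv_tw_comm[OF assms(1) r assms(2) hdeg_rr[OF assms(2,3)]] refl])
  also have "\<dots> = cv S W (rr u \<phi>) (pw S W \<phi> (Suc n)) x"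
    unfolding pw.simps by (rule Q.cv_assoc[OF r assms(1) p Suc.prems])
  finally have 2: "cv S W ?\<phi>t (rr u (pw S W \<phi> (Suc n))) x = 
      k_act (scl W) (of_nat (Suc n)) (cv S W (rr u \<phi>) (pw S W \<phi> (Suc n)) x)" .
  have "pw S W \<phi> (Suc (Suc n)) (lm u x) = cv S W (rr u \<phi>) (pw S W \<phi> (Suc n)) x + cv S W ?\<phi>t (rr u (pw S W \<phi> (Suc n))) x"
    unfolding pw.simps(2)[of S W \<phi> "Suc n"] by (rule cv_step[OF assms(1) p assms(3) Suc.prems])
  also have "\<dots> = k_act (scl W) (1 + of_nat (Suc n)) (cv S W (rr u \<phi>) (pw S W \<phi> (Suc n)) x)"
    unfolding 2 W.ks.scale_left_distrib by simp
  finally show ?case by (simp only: of_nat_Suc[of "Suc n"])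
qed

text \<open>Multiplication by a generator is a derivation of convolution, so it satisfies the chain rule for the exponential.\<close>

lemma ex_step:
  assumes "small S W \<phi>" "u \<in> gr U i" "x \<in> carr S"
  shows "Q.ex \<phi> (lm u x) = cv S W (rr u \<phi>) (Q.ex \<phi>) x"
proof (rule vanish_eqI)
  fix m
  note l = smallD(1)[OF assms(1)] and h = smallD(2)[OF assms(1)]
  note u = gr_carr[OF assms(2)]
  note r = lin_rr[OF l u]
  define X where "X = insert (lm u x) (snd ` set (sw S x))"
  have X: "finite X" "X \<subseteq> carr S" using C.sw_carr[OF assms(3)] lm_carr[OF u assms(3)] by (auto simp: X_def)
  obtain N where N: "\<And>x n. x \<in> X \<Longrightarrow> n \<ge> N \<Longrightarrow> vanish m (pw S W \<phi> n x)"
    and A: "\<And>x p. x \<in> X \<Longrightarrow> vanish m (ev S W p \<phi> x - (\<Sum>n<N. k_act (scl W) (fps_nth p n) (pw S W \<phi> n x)))"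
    by (rule Q.ev_approx[OF assms(1) X, of m]) blast
  let ?P = "\<lambda>y. \<Sum>n<N. k_act (scl W) (fps_nth (fps_exp 1) n) (pw S W \<phi> n y)"
  have P: "lin S W ?P" by (intro Q.lin_sum Q.lin_k Q.lin_pw l)
  have "?P (lm u x) + k_act (scl W) (fps_nth (fps_exp 1) N) (pw S W \<phi> N (lm u x)) = 
      (\<Sum>n<Suc N. k_act (scl W) (fps_nth (fps_exp 1) n) (pw S W \<phi> n (lm u x)))" by simp
  also have "\<dots> = (\<Sum>n<N. k_act (scl W) (fps_nth (fps_exp 1) (Suc n)) (pw S W \<phi> (Suc n) (lm u x)))"
    by (subst sum.lessThan_Suc_shift) (simp add: ce_lm[OF assms(3)] del: pw.simps(2))
  also have "\<dots> = (\<Sum>n<N. k_act (scl W) (fps_nth (fps_exp 1) n) (cv S W (rr u \<phi>) (pw S W \<phi> n) x))"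
  proof (rule sum.cong[OF refl])
    fix n
    have "fps_nth (fps_exp (1::'k)) (Suc n) * of_nat (Suc n) = fps_nth (fps_exp 1) n"
      by (simp add: fps_exp_def del: of_nat_Suc)
    then show "k_act (scl W) (fps_nth (fps_exp 1) (Suc n)) (pw S W \<phi> (Suc n) (lm u x)) =
        k_act (scl W) (fps_nth (fps_exp 1) n) (cv S W (rr u \<phi>) (pw S W \<phi> n) x)"
      by (simp only: pw_step[OF l h assms(2,3)] W.ks.scale_scale)
  qed
  also have "\<dots> = cv S W (rr u \<phi>) ?P x"
    by (simp add: Q.cv_sum_right Q.lin_k Q.lin_pw l r assms(3) Q.cv_k_right)
  finally have e: "?P (lm u x) + k_act (scl W) (fps_nth (fps_exp 1) N) (pw S W \<phi> N (lm u x)) = cv S W (rr u \<phi>) ?P x" .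
  have 1: "vanish m (Q.ex \<phi> (lm u x) - ?P (lm u x))" by (rule A) (simp add: X_def)
  have 2: "vanish m (k_act (scl W) (fps_nth (fps_exp 1) N) (pw S W \<phi> N (lm u x)))"
    by (rule W.vanish_k_act[OF N]) (simp_all add: X_def)
  have 3: "vanish m (cv S W (rr u \<phi>) (Q.ex \<phi>) x - cv S W (rr u \<phi>) ?P x)"
  proof (rule Q.cv_congr[OF assms(3) r r Q.lin_ev[OF assms(1)] P])
    fix y assume "y \<in> snd ` set (sw S x)"
    then show "vanish m (Q.ex \<phi> y - ?P y)" by (intro A) (simp add: X_def)
  qed simp
  have r4: "a - c = (a - b) - t - (c - d)" if "b + t = d" for a b c d t :: "'w fps"
    using that by (simp add: algebra_simps)
  show "vanish m (Q.ex \<phi> (lm u x) - cv S W (rr u \<phi>) (Q.ex \<phi>) x)"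
    by (subst r4[OF e]) (rule vanish_diff[OF vanish_diff[OF 1 2] 3])
qed

text \<open>The Sweedler sum of a word runs over its unshuffles, so a property stable under sums and signs can be checked on subwords.\<close>

lemma Sw_mon_mem:
  assumes "hom xs" "bilin S (k_act (scl W)) \<beta>" "0 \<in> A" "\<And>x y. x \<in> A \<Longrightarrow> y \<in> A \<Longrightarrow> x + y \<in> A" "\<And>x. x \<in> A \<Longrightarrow> - x \<in> A"
    and "\<And>I. I \<subseteq> {..<length xs} \<Longrightarrow> \<beta> (mon U (nths xs I)) (mon U (nths xs (- I))) \<in> A"
  shows "Sw S \<beta> (mon U xs) \<in> A"
proof -
  obtain L where L: "Vector_Spaces.linear dscl (k_act (scl W)) L" 
    "\<And>a b. a \<in> carr S \<Longrightarrow> b \<in> carr S \<Longrightarrow> L (tens (scl S) [a, b]) = \<beta> a b"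
    by (rule G.bilin_lift[OF W.k_act_vs assms(2)]) blast
  interpret L: Vector_Spaces.linear dscl "k_act (scl W)" L by (rule L(1))
  have m: "mon U xs \<in> carr S" by (rule mon_carr[OF hom_lists[OF assms(1)]])
  have c: "mon U (nths xs I) \<in> carr S" for I by (rule mon_carr[OF hom_lists[OF hom_nths[OF assms(1)]]])
  obtain ds where ds: "homogeneous_list U xs ds" using hom_ex[OF assms(1)] by blast
  have "Sw S \<beta> (mon U xs) = L (sym_coprod U (mon U xs))"
    using C.coprod_Sw[OF m] C.Sw_linear_app[OF m L(1)] C.Sw_cong[OF m L(2)] by simp
  also have "\<dots> = (\<Sum>I\<in>Pow {..<length xs}. unshuffle_sign ds I (\<beta> (mon U (nths xs I)) (mon U (nths xs (- I)))))"
    unfolding sym_coprod_mon[OF assms(1)] dl_formula[OF ds] L.sum linear_unshuffle_sign[OF L(1)]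
    by (rule sum.cong[OF refl]) (use L(2)[OF c c] in simp)
  also have "\<dots> \<in> A"
  proof -
    have sm: "sum f K \<in> A" if "finite K" "\<And>i. i \<in> K \<Longrightarrow> f i \<in> A" for f :: "nat set \<Rightarrow> _" and K
      using that by (induction K) (auto intro: assms(3,4))
    show ?thesis by (rule sm) (use assms(5,6) in \<open>simp_all add: unshuffle_sign_def\<close>)
  qed
  finally show ?thesis .
qed

end

context symalg
begin

sublocale I: sympair U D S ..

lemma lin_const_id: "lin S S fps_const"
  by (rule linI) (simp_all add: fps_eq_iff G.k_act_nth[unfolded S_simps])

lemma glike_const: "glike S S fps_const"
  unfolding glike_def using lin_const_id by (auto simp: hdeg_def G.gr_zero[unfolded S_simps])

abbreviation "log_id \<equiv> I.Q.lg fps_const"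

lemma small_log_id: "small S S log_id"
  by (rule I.Q.small_lg[OF glike_const])

text \<open>By the chain rule the derivative of \<open>id = exp(log(id))\<close> along \<open>u\<close> is the convolution product of the derivative of
  \<open>log(id)\<close> with \<open>id\<close>.  It is also multiplication by \<open>u\<close>, that is, the convolution product of \<open>x \<mapsto> \<epsilon>(x) u\<close> with \<open>id\<close>.
  The exponential \<open>id\<close> can be cancelled.  In particular, \<open>log(id)\<close> is the projection onto \<open>U\<close>.\<close>

lemma log_id_lm:
  assumes "u \<in> gr U i" "x \<in> carr S"
  shows "log_id (lm u x) = fps_const (dscl (eps x) (mon U [u]))"
proof -
  note u = gr_carr[OF assms(1)]
  let ?c = "fps_const (mon U [u]) :: ('k, 'u) tensor fps"
  have c: "?c \<in> ser (carr S)" using mon1_carr[OF u] by simp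
  have k: "fps_const (dscl (eps x) (mon U [u])) = k_act (scl S) (counit S x) ?c" for x
    by (simp add: fps_eq_iff G.k_act_nth[unfolded S_simps])
  have "log_id (lm u x) = k_act (scl S) (counit S x) ?c"
  proof (rule I.Q.cv_ex_cancel[OF small_log_id I.lin_rr[OF smallD(1)[OF small_log_id] u] I.Q.lin_const[OF c] assms(2)])
    fix y assume y: "y \<in> carr S"
    have "cv S S (I.rr u log_id) (I.Q.ex log_id) y = I.Q.ex log_id (lm u y)"
      by (rule I.ex_step[OF small_log_id assms(1) y, symmetric])
    also have "\<dots> = fps_const (lm u y)" by (rule I.Q.ex_lg[OF glike_const lm_carr[OF u y]])
    also have "\<dots> = ser_mult (mult S) ?c (fps_const y)"
    proof (rule fps_ext)
      fix n
      have z: "sym_mult U (mon U [u]) 0 = 0" by (rule sym_mult_zero_right[OF mon1_carr[OF u]])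
      show "fps_nth (fps_const (lm u y)) n = fps_nth (ser_mult (mult S) ?c (fps_const y)) n"
        using A.sm_const_left[of "mon U [u]" "fps_const y" n] mon1_carr[OF u] y z by simp
    qed
    also have "\<dots> = ser_mult (mult S) ?c (I.Q.ex log_id y)" by (simp only: I.Q.ex_lg[OF glike_const y])
    also have "\<dots> = cv S S (\<lambda>x. k_act (scl S) (counit S x) ?c) (I.Q.ex log_id) y"
      by (rule I.Q.cv_const_left[OF I.Q.lin_ev[OF small_log_id] c y, symmetric])
    finally show "cv S S (I.rr u log_id) (I.Q.ex log_id) y = cv S S (\<lambda>x. k_act (scl S) (counit S x) ?c) (I.Q.ex log_id) y" .
  qed
  then show ?thesis by (simp only: k)
qed

lemma log_id_unit: "log_id (unit S) = 0"
proof -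
  note s = I.Q.small_minus_ce[OF glike_const]
  have "fps_const (unit S) - ce S S (unit S) = 0" by (simp only: I.Q.ce_unit diff_self)
  from I.Q.ev_at_unit[OF s this, of "fps_ln 1"] show ?thesis
    using G.ks.scale_zero_left by (simp only: fps_ln_0 simp_thms)
qed

lemma log_id_mon: "hom xs \<Longrightarrow> log_id (mon U xs) = (if length xs = 1 then fps_const (mon U xs) else 0)"
proof (cases xs)
  case Nil then show ?thesis using log_id_unit by simp
next
  case (Cons u ys)
  assume "hom xs"
  with Cons obtain i where i: "u \<in> gr U i" "hom ys" by (auto simp: hom_Cons)
  have "log_id (lm u (mon U ys)) = fps_const (dscl (eps (mon U ys)) (mon U [u]))"
    by (rule log_id_lm[OF i(1) mon_carr[OF hom_lists[OF i(2)]]])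
  moreover have "fps_const (0 :: ('k, 'u) tensor) = 0" by (simp add: fps_eq_iff)
  ultimately show ?thesis by (cases ys) (simp_all add: Cons sym_mult_mon eps_mon)
qed

end

section \<open>Extending a map to a morphism of coalgebras\<close>

text \<open>The sum \<open>\<Sum> \<hbar>\<^sup>p y\<^sub>p\<close>.\<close>

definition hs :: "(nat \<Rightarrow> 'w::ab_group_add fps) \<Rightarrow> 'w fps" where
  "hs y = Abs_fps (\<lambda>n. \<Sum>p\<le>n. fps_nth (y p) (n - p))"

lemma hs_nth: "fps_nth (hs y) n = (\<Sum>p\<le>n. fps_nth (y p) (n - p))" by (simp add: hs_def)
lemma hs_add: "hs (\<lambda>p. y p + z p) = hs y + hs z" by (simp add: fps_eq_iff hs_nth sum.distrib)
lemma hs_sum: "hs (\<lambda>p. \<Sum>i\<in>I. y i p) = (\<Sum>i\<in>I. hs (y i))"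
  by (auto simp: fps_eq_iff hs_nth fps_sum_nth intro: sum.swap)
lemma hs_Sw: "hs (\<lambda>p. Sw V (\<beta> p) v) = Sw V (\<lambda>a b. hs (\<lambda>p. \<beta> p a b)) v"
proof -
  have z: "hs (\<lambda>p. 0) = 0" by (simp add: fps_eq_iff hs_nth)
  have "hs (\<lambda>p. \<Sum>(a, b)\<leftarrow>ps. \<beta> p a b) = (\<Sum>(a, b)\<leftarrow>ps. hs (\<lambda>p. \<beta> p a b))" for ps
    by (induction ps) (auto simp: z hs_add)
  then show ?thesis by (simp add: Sw_def)
qed

context galg
begin

lemma hs_sm_left:
  assumes "\<And>p. y p \<in> ser (carr W)" "z \<in> ser (carr W)" shows "hs (\<lambda>p. y p \<odot> z) = hs y \<odot> z"
proof (rule fps_ext)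
  fix n
  let ?f = "\<lambda>p i j. mult W (fps_nth (y p) i) (fps_nth z j)"
  have "fps_nth (hs y \<odot> z) n = (\<Sum>j=0..n. \<Sum>p=0..j. ?f p (j - p) (n - j))"
    unfolding sm_nth hs_nth atLeast0AtMost
    by (rule sum.cong[OF refl], rule mult_sum(1)) (use assms in \<open>auto simp: ser_nth\<close>)
  also have "\<dots> = (\<Sum>p=0..n. \<Sum>i=0..n - p. ?f p i (n - p - i))" by (rule fps_mult_assoc_lemma)
  finally show "fps_nth (hs (\<lambda>p. y p \<odot> z)) n = fps_nth (hs y \<odot> z) n" by (simp add: hs_nth sm_nth atLeast0AtMost)
qed

lemma hs_sm_right:
  assumes "\<And>p. y p \<in> ser (carr W)" "z \<in> ser (carr W)" shows "hs (\<lambda>p. z \<odot> y p) = z \<odot> hs y"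
proof (rule fps_ext)
  fix n
  let ?g = "\<lambda>p i. mult W (fps_nth z i) (fps_nth (y p) (n - i - p))"
  have e: "{..n - i} = {p \<in> {..n}. i + p \<le> n}" if "i \<le> n" for i using that by auto
  have "fps_nth (z \<odot> hs y) n = (\<Sum>i\<le>n. \<Sum>p\<le>n - i. ?g p i)"
    unfolding sm_nth hs_nth
    by (rule sum.cong[OF refl], rule mult_sum(2)) (use assms in \<open>auto simp: ser_nth\<close>)
  also have "\<dots> = (\<Sum>i\<in>{..n}. \<Sum>p\<in>{p \<in> {..n}. i + p \<le> n}. ?g p i)" by (rule sum.cong) (auto simp: e)
  also have "\<dots> = (\<Sum>p\<in>{..n}. \<Sum>i\<in>{i \<in> {..n}. i + p \<le> n}. ?g p i)" by (rule sum.swap_restrict) auto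
  also have "\<dots> = (\<Sum>p\<le>n. \<Sum>i\<le>n - p. ?g p i)"
    by (rule sum.cong[OF refl]) (rule sum.cong; auto)
  finally show "fps_nth (hs (\<lambda>p. z \<odot> y p)) n = fps_nth (z \<odot> hs y) n"
    by (simp add: hs_nth sm_nth add.commute)
qed

end

text \<open>\<open>a \<otimes> b \<otimes> c \<mapsto> T a b c\<close> with the Koszul sign of interchanging \<open>a\<close> and \<open>b\<close>; splitting \<open>a\<close> into its even and odd part
  makes this trilinear.\<close>

definition ksw :: "('k::field_char_0, 'v::ab_group_add) mv \<Rightarrow> ('v \<Rightarrow> 'v \<Rightarrow> 'v \<Rightarrow> 'x::ab_group_add) \<Rightarrow> 'v \<Rightarrow> 'v \<Rightarrow> 'v \<Rightarrow> 'x" where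
  "ksw V T a b c = T (scl V (1/2) (a + par V a)) b c + T (scl V (1/2) (a - par V a)) (par V b) c"

context gcog0
begin

lemma ksw_props:
  assumes "vector_space s'" "trilin V s' T"
  shows ksw_trilin: "trilin V s' (ksw V T)"
    and ksw_hom: "a \<in> gr V p \<Longrightarrow> b \<in> gr V q \<Longrightarrow> d \<in> carr V \<Longrightarrow> ksw V T a b d = ksign p q (T a b d)"
proof -
  interpret P: Vector_Spaces.linear "scl V" "scl V" "par V" by (rule par_linear)
  interpret X: vector_space s' by fact
  note td = trilinD[OF assms(2)]
  define pe where "pe = (\<lambda>u. scl V (1/2) (u + par V u))"
  define po where "po = (\<lambda>u. scl V (1/2) (u - par V u))"
  have k: "ksw V T = (\<lambda>a b c. T (pe a) b c + T (po a) (par V b) c)" by (simp add: ksw_def fun_eq_iff pe_def po_def)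
  have c: "u \<in> carr V \<Longrightarrow> pe u \<in> carr V" "u \<in> carr V \<Longrightarrow> po u \<in> carr V" for u
    by (auto simp: pe_def po_def intro!: carr_scl carr_add carr_diff par_carr)
  have l: "pe (u + w) = pe u + pe w" "po (u + w) = po u + po w" "pe (scl V k u) = scl V k (pe u)" "po (scl V k u) = scl V k (po u)" for u w k
    by (simp_all add: pe_def po_def P.add P.scale vs.scale_right_distrib vs.scale_right_diff_distrib mult.commute)
  have g: "pe u = (if odd i then 0 else u)" "po u = (if odd i then u else 0)" if "u \<in> gr V i" for u i
  proof -
    have "scl V (1/2) (u + u) = scl V (1/2 + 1/2) u" by (simp only: vs.scale_left_distrib vs.scale_right_distrib)
    then have "scl V (1/2) (u + u) = u" by simp
    then show "pe u = (if odd i then 0 else u)" "po u = (if odd i then u else 0)"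
      by (simp_all add: pe_def po_def par_hom[OF that] ksign_def)
  qed
  show "trilin V s' (ksw V T)" unfolding k
    by (rule trilinI) (simp_all add: td c l P.add P.scale par_carr X.scale_right_distrib algebra_simps)
  have z: "T 0 b c = 0" if "b \<in> carr V" "c \<in> carr V" for b c
    using td(1)[of 0 0 b c] that by simp
  have neg: "T a (- b) c = - T a b c" if "a \<in> carr V" "b \<in> carr V" "c \<in> carr V" for a b c
    using td(2)[of a b "- b" c] td(2)[of a 0 0 c] that carr_neg[OF that(2)] by (simp add: eq_neg_iff_add_eq_0 add.commute)
  show "ksw V T a b d = ksign p q (T a b d)" if "a \<in> gr V p" "b \<in> gr V q" "d \<in> carr V"
    unfolding k
    using that gr_carr[OF that(1)] gr_carr[OF that(2)] by (auto simp: g[OF that(1)] z neg par_carr par_hom[OF that(2)] ksign_def carr_neg)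
qed

text \<open>From \<open>a \<otimes> b \<otimes> c\<close> in the iterated coproduct one may pass to \<open>b \<otimes> a \<otimes> c\<close> at the cost of the Koszul sign.  This is
  used to bring a factor next to a later one.\<close>

lemma coassoc_swap:
  assumes "vector_space s'" "trilin V s' T" "v \<in> carr V"
  shows "Sw V (\<lambda>a w. Sw V (ksw V T a) w) v = Sw V (\<lambda>b w. Sw V (\<lambda>a c. T a b c) w) v"
proof -
  note td = trilinD[OF assms(2)]
  have "Sw V (\<lambda>a w. Sw V (\<lambda>b c. ksw V T a b c) w) v = Sw V (\<lambda>z c. Sw V (\<lambda>a b. ksw V T a b c) z) v"
    by (rule coassoc[OF assms(1) ksw_trilin[OF assms(1,2)] assms(3), symmetric])
  also have "\<dots> = Sw V (\<lambda>z c. Sw V (\<lambda>b a. T a b c) z) v"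
  proof (rule Sw_cong[OF assms(3)])
    fix w d assume wd: "w \<in> carr V" "d \<in> carr V"
    show "Sw V (\<lambda>a b. ksw V T a b d) w = Sw V (\<lambda>b a. T a b d) w"
      by (rule cocomm[OF assms(1) _ wd(1)]) (use td wd ksw_hom[OF assms(1,2)] in \<open>auto intro!: bilinI\<close>)
  qed
  also have "\<dots> = Sw V (\<lambda>b w. Sw V (\<lambda>a c. T a b c) w) v"
    by (rule coassoc[OF assms(1) _ assms(3), of "\<lambda>b a c. T a b c"]) (rule trilinI; use td in simp)
  finally show ?thesis by simp
qed

end

text \<open>A map \<open>g : K \<rightarrow> U[[\<hbar>]]\<close> from a conilpotent coalgebra, to be extended to a coalgebra morphism into \<open>S(U)[[\<hbar>]]\<close>.\<close>

locale lifted = sympair U D W + K: gcog K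
  for U :: "('k::field_char_0, 'u::ab_group_add) gvs" and D and W :: "('k, 'w::ab_group_add) mv"
    and K :: "('k, 'c::ab_group_add) mv" +
  fixes g :: "'c \<Rightarrow> 'u fps"
  assumes g_lin: "lin K U g" and g_deg: "hdeg K U 0 g" and g_unit: "vanish 1 (g (unit K))"
begin

sublocale KS: cpair K S ..
sublocale KW: cpair K W ..

abbreviation sms (infixl "\<otimes>" 70) where "x \<otimes> y \<equiv> ser_mult (sym_mult U) x y"

text \<open>\<open>g\<close> with values regarded as elements of \<open>S(U)\<close>.\<close>

definition gt :: "'c \<Rightarrow> ('k, 'u) tensor fps" where
  "gt c = Abs_fps (\<lambda>p. mon U [fps_nth (g c) p])"

lemma gt_nth: "fps_nth (gt c) p = mon U [fps_nth (g c) p]" by (simp add: gt_def)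

lemma g_mem: "c \<in> carr K \<Longrightarrow> fps_nth (g c) p \<in> carr U"
  using lin_mem[OF g_lin] by (simp add: ser_nth)

lemma g_gr: "c \<in> gr K i \<Longrightarrow> fps_nth (g c) p \<in> gr U i"
  using hdegD[OF g_deg, of c i] by (simp add: ser_nth)

lemma gt_lin: "lin K S gt"
proof (rule linI)
  show "gt c \<in> ser (carr S)" if "c \<in> carr K" for c using that by (intro serI) (simp add: gt_nth mon1_carr g_mem)
  show "gt (x + y) = gt x + gt y" if "x \<in> carr K" "y \<in> carr K" for x y
    using mon_add[of "[]" _ _ "[]"] by (simp add: fps_eq_iff gt_nth lin_add[OF g_lin that])
  show "gt (scl K k x) = k_act (scl S) k (gt x)" if "x \<in> carr K" for k x
    using mon_scl[of "[]" k _ "[]"] lin_scl_nth[OF gvec_axioms g_lin that] G.k_act_nth by (simp add: fps_eq_iff gt_nth)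
qed

lemma gt_small: "small K S gt"
proof -
  have "hdeg K S 0 gt" unfolding hdeg_def by (auto intro!: serI simp: gt_nth mon1_gr g_gr)
  moreover have "vanish 1 (gt (unit K))" using g_unit mon_zero[of "[]" "[]"] by (simp add: vanish_def gt_nth)
  ultimately show ?thesis using gt_lin by (simp add: small_def)
qed

text \<open>The divided powers of \<open>gt\<close>, which are the components of its exponential.  In contrast to the powers, they behave under the
  coproduct without binomial coefficients.\<close>

definition Gn :: "nat \<Rightarrow> 'c \<Rightarrow> ('k, 'u) tensor fps" where
  "Gn n c = k_act (scl S) (1 / fact n) (pw K S gt n c)"

abbreviation E :: "(('k, 'u) tensor \<Rightarrow> 'w fps) \<Rightarrow> ('k, 'u) tensor fps \<Rightarrow> 'w fps" where
  "E \<theta> \<equiv> ser_ext (carr S) \<theta>"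

lemma E_lin:
  assumes "lin S W \<theta>" 
  shows "x \<in> ser (carr S) \<Longrightarrow> E \<theta> x \<in> ser (carr W)"
    and "x \<in> ser (carr S) \<Longrightarrow> y \<in> ser (carr S) \<Longrightarrow> E \<theta> (x + y) = E \<theta> x + E \<theta> y"
    and "x \<in> ser (carr S) \<Longrightarrow> E \<theta> (k_act (scl S) k x) = k_act (scl W) k (E \<theta> x)"
  using Q.P.R_linearD[OF Q.P.R_linear_ser_ext[OF assms]] by (auto simp: k_act_def)

lemma lin_E: 
  assumes "lin S W \<theta>" "lin K S \<gamma>" shows "lin K W (\<lambda>c. E \<theta> (\<gamma> c))"
  by (rule linI) (use E_lin[OF assms(1)] lin_mem[OF assms(2)] lin_add[OF assms(2)] lin_scl[OF assms(2)] in simp_all)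

lemma Gn_lin: "lin K S (Gn n)"
  unfolding Gn_def by (rule KS.lin_k[OF KS.lin_pw[OF gt_lin]])

lemma Gn_deg: "hdeg K S 0 (Gn n)"
  unfolding hdeg_def Gn_def using hdegD[OF KS.hdeg_pw[OF gt_lin smallD(2)[OF gt_small]]] G.ser_gr_k by blast

lemma cv_gt_Gn: "c \<in> carr K \<Longrightarrow> cv K S gt (Gn n) c = k_act (scl S) (of_nat (Suc n)) (Gn (Suc n) c)"
proof -
  assume c: "c \<in> carr K"
  have "of_nat (Suc n) * (1 / fact (Suc n)) = (1 / fact n :: 'k)" by (simp del: of_nat_Suc)
  then show ?thesis unfolding Gn_def KS.cv_k_right[OF KS.lin_pw[OF gt_lin] gt_lin c] G.ks.scale_scale by simp
qed

text \<open>Each coefficient of \<open>gt c\<close> is a generator, so multiplication by \<open>gt c\<close> before applying \<open>\<theta>\<close> amounts to replacing \<open>\<theta>\<close> by its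
  derivatives.\<close>

lemma E_gt:
  assumes "lin S W \<theta>" "c \<in> carr K" "x \<in> ser (carr S)"
  shows "E \<theta> (gt c \<otimes> x) = hs (\<lambda>p. E (rr (fps_nth (g c) p) \<theta>) x)"
proof (rule fps_ext)
  fix N
  let ?f = "\<lambda>p q r. fps_nth (\<theta> (lm (fps_nth (g c) p) (fps_nth x q))) r"
  have m: "gt c \<otimes> x \<in> ser (carr S)" using A.sm_carr[OF lin_mem[OF gt_lin assms(2)] assms(3)] by simp
  have n: "fps_nth (gt c \<otimes> x) k = (\<Sum>p\<le>k. lm (fps_nth (g c) p) (fps_nth x (k - p)))" for k
    using A.sm_nth[of "gt c" x k] by (simp add: gt_nth)
  have "fps_nth (E \<theta> (gt c \<otimes> x)) N = (\<Sum>k=0..N. \<Sum>p=0..k. ?f p (k - p) (N - k))"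
    unfolding Q.P.ser_ext_nth[OF m] n atLeast0AtMost
    by (rule sum.cong[OF refl], subst Q.P.lin_sum_arg[OF assms(1)])
      (use assms in \<open>auto simp: lm_carr g_mem ser_nth fps_sum_nth\<close>)
  also have "\<dots> = (\<Sum>p=0..N. \<Sum>q=0..N - p. ?f p q (N - p - q))" by (rule fps_mult_assoc_lemma)
  finally show "fps_nth (E \<theta> (gt c \<otimes> x)) N = fps_nth (hs (\<lambda>p. E (rr (fps_nth (g c) p) \<theta>) x)) N"
    by (simp add: hs_nth Q.P.ser_ext_nth[OF assms(3)] atLeast0AtMost)
qed

lemma E_add: "x \<in> ser (carr S) \<Longrightarrow> E (\<lambda>y. \<theta> y + \<eta> y) x = E \<theta> x + E \<eta> x"
  by (simp add: fps_eq_iff Q.P.ser_ext_nth sum.distrib)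

lemma E_tw:
  assumes "lin S W \<theta>" "x \<in> gr K q"
  shows "E (\<lambda>y. \<theta> (tw S d y)) (Gn i x) = ksign d q (E \<theta> (Gn i x))"
proof (rule fps_ext)
  fix n
  have m: "Gn i x \<in> ser (gr S q)" using hdegD[OF Gn_deg assms(2)] by simp
  have "\<theta> (tw S d (fps_nth (Gn i x) j)) = ksign d q (\<theta> (fps_nth (Gn i x) j))" for j
    using G.tw_hom[OF ser_nth[OF m]] Q.lin_ksign[OF assms(1) G.gr_carr[OF ser_nth[OF m]]] by simp
  then show "fps_nth (E (\<lambda>y. \<theta> (tw S d y)) (Gn i x)) n = fps_nth (ksign d q (E \<theta> (Gn i x))) n"
    by (simp add: Q.P.ser_ext_nth[OF G.ser_gr_carr[OF m]] ksign_def sum_negf)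
qed

lemma E_trilin1:
  assumes "lin S W \<phi>" "lin S W \<psi>" "lin K S \<gamma>" "lin K S \<delta>"
  shows "trilin K (k_act (scl W)) (\<lambda>a b c. W.sm (E \<phi> (gt a \<otimes> \<gamma> b)) (E \<psi> (\<delta> c)))"
    and "trilin K (k_act (scl W)) (\<lambda>a b c. W.sm (E \<phi> (\<gamma> b)) (E \<psi> (gt a \<otimes> \<delta> c)))"
proof -
  note l = gt_lin assms(3,4)
  note s = A.sm_add_left[unfolded S_simps] A.sm_add_right[unfolded S_simps] A.sm_k_left[unfolded S_simps] A.sm_k_right[unfolded S_simps]
  note k = l[THEN lin_scl, unfolded S_simps]
  have m: "gt a \<otimes> \<gamma> b \<in> ser (carr S)" "gt a \<otimes> \<delta> b \<in> ser (carr S)" if "a \<in> carr K" "b \<in> carr K" for a b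
    using A.sm_carr[of "gt a"] l[THEN lin_mem] that by simp_all
  show "trilin K (k_act (scl W)) (\<lambda>a b c. W.sm (E \<phi> (gt a \<otimes> \<gamma> b)) (E \<psi> (\<delta> c)))"
    "trilin K (k_act (scl W)) (\<lambda>a b c. W.sm (E \<phi> (\<gamma> b)) (E \<psi> (gt a \<otimes> \<delta> c)))"
    by (rule trilinI; simp add: l[THEN lin_add] k l[THEN lin_mem] s m E_lin[OF assms(1), unfolded S_simps] 
      E_lin[OF assms(2), unfolded S_simps] W.sm_add_left W.sm_add_right W.sm_k_left W.sm_k_right)+
qed

end

context lifted
begin

lemma E_Sw:
  assumes "lin S W \<theta>" "c \<in> carr K" "\<And>a b. a \<in> carr K \<Longrightarrow> b \<in> carr K \<Longrightarrow> \<beta> a b \<in> ser (carr S)"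
  shows "E \<theta> (Sw K \<beta> c) = Sw K (\<lambda>a b. E \<theta> (\<beta> a b)) c"
  by (rule K.Sw_push(1)[OF assms(2), where A = "ser (carr S)"])
    (use assms(3) E_lin[OF assms(1)] G.ser_carr_add G.ser_carr_zero in simp_all)

lemma gt_Gn_mem: "a \<in> carr K \<Longrightarrow> b \<in> carr K \<Longrightarrow> gt a \<otimes> Gn n b \<in> ser (carr S)"
  using A.sm_carr[OF lin_mem[OF gt_lin] lin_mem[OF Gn_lin]] by simp

lemma E_Gn_Suc:
  assumes "lin S W \<theta>" "c \<in> carr K"
  shows "Sw K (\<lambda>a b. E \<theta> (gt a \<otimes> Gn n b)) c = k_act (scl W) (of_nat (Suc n)) (E \<theta> (Gn (Suc n) c))"
proof -
  have "E \<theta> (cv K S gt (Gn n) c) = Sw K (\<lambda>a b. E \<theta> (gt a \<otimes> Gn n b)) c"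
    unfolding cv_def using E_Sw[OF assms gt_Gn_mem] by simp
  then show ?thesis unfolding cv_gt_Gn[OF assms(2)] E_lin(3)[OF assms(1) lin_mem[OF Gn_lin assms(2)]] by simp
qed

lemma E_Gn_Suc_left:
  assumes "lin S W \<theta>" "c \<in> carr K" "z \<in> ser (carr W)"
  shows "Sw K (\<lambda>a b. W.sm (E \<theta> (gt a \<otimes> Gn n b)) z) c = k_act (scl W) (of_nat (Suc n)) (W.sm (E \<theta> (Gn (Suc n) c)) z)"
proof -
  have "W.sm (Sw K (\<lambda>a b. E \<theta> (gt a \<otimes> Gn n b)) c) z = Sw K (\<lambda>a b. W.sm (E \<theta> (gt a \<otimes> Gn n b)) z) c"
    by (rule K.Sw_push(1)[OF assms(2), where A = "ser (carr W)"])
      (use assms(3) E_lin[OF assms(1)] gt_Gn_mem W.ser_carr_add W.ser_carr_zero W.sm_add_left in simp_all)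
  then show ?thesis using E_Gn_Suc[OF assms(1,2)] W.sm_k_left[OF E_lin(1)[OF assms(1) lin_mem[OF Gn_lin assms(2)]] assms(3)] by simp
qed

lemma E_Gn_Suc_right:
  assumes "lin S W \<theta>" "c \<in> carr K" "z \<in> ser (carr W)"
  shows "Sw K (\<lambda>a b. W.sm z (E \<theta> (gt a \<otimes> Gn n b))) c = k_act (scl W) (of_nat (Suc n)) (W.sm z (E \<theta> (Gn (Suc n) c)))"
proof -
  have "W.sm z (Sw K (\<lambda>a b. E \<theta> (gt a \<otimes> Gn n b)) c) = Sw K (\<lambda>a b. W.sm z (E \<theta> (gt a \<otimes> Gn n b))) c"
    by (rule K.Sw_push(1)[OF assms(2), where A = "ser (carr W)"])
      (use assms(3) E_lin[OF assms(1)] gt_Gn_mem W.ser_carr_add W.ser_carr_zero W.sm_add_right in simp_all)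
  then show ?thesis using E_Gn_Suc[OF assms(1,2)] W.sm_k_right[OF assms(3) E_lin(1)[OF assms(1) lin_mem[OF Gn_lin assms(2)]]] by simp
qed

lemma E_Gn_0:
  assumes "lin S W \<theta>" "c \<in> carr K"
  shows "E \<theta> (Gn 0 c) = k_act (scl W) (counit K c) (\<theta> (unit S))"
proof -
  have u: "unit S \<in> carr S" by (rule E.unit_carr)
  have "Gn 0 c = k_act (scl S) (counit K c) (fps_const (unit S))"
    by (simp add: Gn_def KS.ce_alt G.ks.scale_one[unfolded S_simps])
  then show ?thesis
    by (simp only: E_lin(3)[OF assms(1) Q.P.const_carr[OF u]] Q.P.ser_ext_const[OF assms(1) u])
qed

text \<open>The product rule \<open>cv_step\<close> for the first factor of a divided power, combined with the induction hypothesis for the remaining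
  ones.\<close>

lemma E_cv_step:
  assumes l: "lin S W \<phi>" "lin S W \<psi>" and a: "a \<in> gr K d" and b: "b \<in> carr K"
    and IH: "\<And>\<phi> \<psi>. lin S W \<phi> \<Longrightarrow> lin S W \<psi> \<Longrightarrow>
      E (cv S W \<phi> \<psi>) (Gn n b) = (\<Sum>i\<le>n. cv K W (\<lambda>x. E \<phi> (Gn i x)) (\<lambda>x. E \<psi> (Gn (n - i) x)) b)"
  shows "E (cv S W \<phi> \<psi>) (gt a \<otimes> Gn n b) = 
    (\<Sum>i\<le>n. Sw K (\<lambda>x y. W.sm (E \<phi> (gt a \<otimes> Gn i x)) (E \<psi> (Gn (n - i) y))) b) +
    (\<Sum>i\<le>n. Sw K (ksw K (\<lambda>a x y. W.sm (E \<phi> (Gn i x)) (E \<psi> (gt a \<otimes> Gn (n - i) y))) a) b)"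
proof -
  define u where "u = fps_nth (g a)"
  have ac: "a \<in> carr K" by (rule K.gr_carr[OF a])
  have u: "u p \<in> gr U d" for p using g_gr[OF a] by (simp add: u_def)
  have uc: "u p \<in> carr U" for p by (rule gr_carr[OF u])
  note Gm = lin_mem[OF Gn_lin]
  let ?t = "\<lambda>y. \<phi> (tw S d y)"
  have t: "lin S W ?t" by (rule Q.lin_tw[OF l(1)])
  have r: "lin S W (rr (u p) \<phi>)" "lin S W (rr (u p) \<psi>)" for p using l uc by (simp_all add: lin_rr)
  have 1: "E (rr (u p) (cv S W \<phi> \<psi>)) (Gn n b) = 
      (\<Sum>i\<le>n. cv K W (\<lambda>x. E (rr (u p) \<phi>) (Gn i x)) (\<lambda>x. E \<psi> (Gn (n - i) x)) b) +
      (\<Sum>i\<le>n. cv K W (\<lambda>x. E ?t (Gn i x)) (\<lambda>x. E (rr (u p) \<psi>) (Gn (n - i) x)) b)" for p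
  proof -
    have "E (rr (u p) (cv S W \<phi> \<psi>)) = E (\<lambda>x. cv S W (rr (u p) \<phi>) \<psi> x + cv S W ?t (rr (u p) \<psi>) x)"
      by (rule Q.P.ser_ext_cong) (rule cv_step[OF l u])
    then show ?thesis by (simp only: E_add[OF Gm[OF b]] IH[OF r(1) l(2)] IH[OF t r(2)])
  qed
  have 2: "hs (\<lambda>p. cv K W (\<lambda>x. E (rr (u p) \<phi>) (Gn i x)) (\<lambda>x. E \<psi> (Gn j x)) b) = 
      Sw K (\<lambda>x y. W.sm (E \<phi> (gt a \<otimes> Gn i x)) (E \<psi> (Gn j y))) b" for i j
    unfolding cv_def hs_Sw
  proof (rule K.Sw_cong[OF b])
    fix x y assume x: "x \<in> carr K" and y: "y \<in> carr K"
    have "hs (\<lambda>p. W.sm (E (rr (u p) \<phi>) (Gn i x)) (E \<psi> (Gn j y))) = W.sm (hs (\<lambda>p. E (rr (u p) \<phi>) (Gn i x))) (E \<psi> (Gn j y))"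
      by (rule W.hs_sm_left) (intro E_lin(1) r l Gm x y)+
    then show "hs (\<lambda>p. W.sm (E (rr (u p) \<phi>) (Gn i x)) (E \<psi> (Gn j y))) = W.sm (E \<phi> (gt a \<otimes> Gn i x)) (E \<psi> (Gn j y))"
      unfolding E_gt[OF l(1) ac Gm[OF x]] u_def .
  qed
  have 3: "hs (\<lambda>p. cv K W (\<lambda>x. E ?t (Gn i x)) (\<lambda>x. E (rr (u p) \<psi>) (Gn j x)) b) = 
      Sw K (ksw K (\<lambda>a x y. W.sm (E \<phi> (Gn i x)) (E \<psi> (gt a \<otimes> Gn j y))) a) b" for i j
    unfolding cv_def hs_Sw
  proof (rule K.Sw_cong_hom[OF b])
    fix x y e e' assume xe: "x \<in> gr K e" and "y \<in> gr K e'"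
    then have x: "x \<in> carr K" and y: "y \<in> carr K" by (auto intro: K.gr_carr)
    have "hs (\<lambda>p. W.sm (E ?t (Gn i x)) (E (rr (u p) \<psi>) (Gn j y))) = W.sm (E ?t (Gn i x)) (hs (\<lambda>p. E (rr (u p) \<psi>) (Gn j y)))"
      by (rule W.hs_sm_right) (intro E_lin(1) r t Gm x y)+
    also have "\<dots> = W.sm (ksign d e (E \<phi> (Gn i x))) (E \<psi> (gt a \<otimes> Gn j y))"
      unfolding E_gt[OF l(2) ac Gm[OF y]] u_def E_tw[OF l(1) xe] ..
    also have "\<dots> = ksign d e (W.sm (E \<phi> (Gn i x)) (E \<psi> (gt a \<otimes> Gn j y)))"
      by (rule KW.ksign_sm) (intro E_lin(1) l Gm gt_Gn_mem x y ac)+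
    also have "\<dots> = ksw K (\<lambda>a x y. W.sm (E \<phi> (Gn i x)) (E \<psi> (gt a \<otimes> Gn j y))) a x y"
      by (rule K.ksw_hom[OF W.k_act_vs E_trilin1(2)[OF l Gn_lin Gn_lin] a xe y, symmetric])
    finally show "hs (\<lambda>p. W.sm (E ?t (Gn i x)) (E (rr (u p) \<psi>) (Gn j y))) = 
      ksw K (\<lambda>a x y. W.sm (E \<phi> (Gn i x)) (E \<psi> (gt a \<otimes> Gn j y))) a x y" .
  qed
  have "E (cv S W \<phi> \<psi>) (gt a \<otimes> Gn n b) = hs (\<lambda>p. E (rr (u p) (cv S W \<phi> \<psi>)) (Gn n b))"
    unfolding u_def by (rule E_gt[OF Q.lin_cv[OF l] ac Gm[OF b]])
  then show ?thesis unfolding 1 hs_add hs_sum 2 3 .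
qed

text \<open>Dually, the coproduct of a divided power is the sum of the \<open>G\<^sub>i \<otimes> G\<^sub>j\<close> with \<open>i + j = n\<close>.  By induction: the product rule distributes the
  additional factor to the left or to the right, where it turns \<open>G\<^sub>i\<close> into \<open>(i+1) G\<^bsub>i+1\<^esub>\<close>, and the coefficients add up to
  \<open>n + 1\<close>.\<close>

lemma E_cv_Gn:
  assumes "lin S W \<phi>" "lin S W \<psi>" "c \<in> carr K"
  shows "E (cv S W \<phi> \<psi>) (Gn n c) = (\<Sum>i\<le>n. cv K W (\<lambda>x. E \<phi> (Gn i x)) (\<lambda>x. E \<psi> (Gn (n - i) x)) c)"
  using assms
proof (induction n arbitrary: \<phi> \<psi> c)
  case 0
  note l = 0(1,2) and c = 0(3)
  have u: "unit S \<in> carr S" by (rule E.unit_carr)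
  have "cv K W (\<lambda>x. E \<phi> (Gn 0 x)) (\<lambda>x. E \<psi> (Gn 0 x)) c = 
      cv K W (\<lambda>x. k_act (scl W) (counit K x) (\<phi> (unit S))) (\<lambda>x. E \<psi> (Gn 0 x)) c"
    by (rule KW.cv_cong[OF c]) (simp_all only: E_Gn_0[OF l(1)])
  also have "\<dots> = W.sm (\<phi> (unit S)) (E \<psi> (Gn 0 c))"
    by (rule KW.cv_const_left[OF lin_E[OF l(2) Gn_lin] lin_mem[OF l(1) u] c])
  also have "\<dots> = k_act (scl W) (counit K c) (cv S W \<phi> \<psi> (unit S))"
    unfolding E_Gn_0[OF l(2) c] Q.cv_unit[OF l] by (rule W.sm_k_right[OF lin_mem[OF l(1) u] lin_mem[OF l(2) u]])
  finally show ?case using E_Gn_0[OF Q.lin_cv[OF l] c] by simp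
next
  case (Suc n)
  note l = Suc.prems(1,2) and c = Suc.prems(3)
  define X where "X i = cv K W (\<lambda>x. E \<phi> (Gn i x)) (\<lambda>x. E \<psi> (Gn (Suc n - i) x)) c" for i
  let ?T1 = "\<lambda>i a x y. W.sm (E \<phi> (gt a \<otimes> Gn i x)) (E \<psi> (Gn (n - i) y))"
  let ?T2 = "\<lambda>i a x y. W.sm (E \<phi> (Gn i x)) (E \<psi> (gt a \<otimes> Gn (n - i) y))"
  note Gm = lin_mem[OF Gn_lin]
  have 1: "Sw K (\<lambda>a b. Sw K (?T1 i a) b) c = k_act (scl W) (of_nat (Suc i)) (X (Suc i))" for i
  proof -
    have "Sw K (\<lambda>a b. Sw K (?T1 i a) b) c = Sw K (\<lambda>w y. Sw K (\<lambda>a x. ?T1 i a x y) w) c"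
      by (rule K.coassoc[OF W.k_act_vs E_trilin1(1)[OF l Gn_lin Gn_lin] c, symmetric])
    also have "\<dots> = Sw K (\<lambda>w y. k_act (scl W) (of_nat (Suc i)) (W.sm (E \<phi> (Gn (Suc i) w)) (E \<psi> (Gn (n - i) y)))) c"
      by (rule K.Sw_cong[OF c], rule E_Gn_Suc_left[OF l(1)]) (simp_all add: E_lin(1)[OF l(2)] Gm)
    finally show ?thesis unfolding X_def cv_def diff_Suc_Suc using K.Sw_scl_right[OF W.k_act_vs c] by simp
  qed
  have 2: "Sw K (\<lambda>a b. Sw K (ksw K (?T2 i) a) b) c = k_act (scl W) (of_nat (Suc n - i)) (X i)" if "i \<le> n" for i
  proof -
    have "Sw K (\<lambda>a b. Sw K (ksw K (?T2 i) a) b) c = Sw K (\<lambda>x w. Sw K (\<lambda>a y. ?T2 i a x y) w) c"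
      by (rule K.coassoc_swap[OF W.k_act_vs E_trilin1(2)[OF l Gn_lin Gn_lin] c])
    also have "\<dots> = Sw K (\<lambda>x w. k_act (scl W) (of_nat (Suc (n - i))) (W.sm (E \<phi> (Gn i x)) (E \<psi> (Gn (Suc (n - i)) w)))) c"
      by (rule K.Sw_cong[OF c], rule E_Gn_Suc_right[OF l(2)]) (simp_all add: E_lin(1)[OF l(1)] Gm)
    finally show ?thesis unfolding X_def cv_def Suc_diff_le[OF that] using K.Sw_scl_right[OF W.k_act_vs c] by simp
  qed
  have "k_act (scl W) (of_nat (Suc n)) (E (cv S W \<phi> \<psi>) (Gn (Suc n) c)) = 
      Sw K (\<lambda>a b. E (cv S W \<phi> \<psi>) (gt a \<otimes> Gn n b)) c"
    by (rule E_Gn_Suc[OF Q.lin_cv[OF l] c, symmetric])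
  also have "\<dots> = Sw K (\<lambda>a b. (\<Sum>i\<le>n. Sw K (?T1 i a) b) + (\<Sum>i\<le>n. Sw K (ksw K (?T2 i) a) b)) c"
  proof (rule K.Sw_cong_hom[OF c])
    fix a b i j assume a: "a \<in> gr K i" and b: "b \<in> gr K j"
    show "E (cv S W \<phi> \<psi>) (gt a \<otimes> Gn n b) = (\<Sum>i\<le>n. Sw K (?T1 i a) b) + (\<Sum>i\<le>n. Sw K (ksw K (?T2 i) a) b)"
      by (rule E_cv_step[OF l a K.gr_carr[OF b]]) (rule Suc.IH[OF _ _ K.gr_carr[OF b]])
  qed
  also have "\<dots> = (\<Sum>i\<le>n. k_act (scl W) (of_nat (Suc i)) (X (Suc i))) + (\<Sum>i\<le>n. k_act (scl W) (of_nat (Suc n - i)) (X i))"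
    unfolding K.Sw_plus K.Sw_sum 1 by (rule arg_cong2[where f = "(+)", OF refl sum.cong[OF refl]]) (rule 2; simp)
  also have "\<dots> = (\<Sum>i\<le>Suc n. k_act (scl W) (of_nat i) (X i)) + (\<Sum>i\<le>Suc n. k_act (scl W) (of_nat (Suc n - i)) (X i))"
    unfolding sum.atMost_Suc_shift[of "\<lambda>i. k_act (scl W) (of_nat i) (X i)"] 
      sum.atMost_Suc[of "\<lambda>i. k_act (scl W) (of_nat (Suc n - i)) (X i)"] by simp
  also have "\<dots> = (\<Sum>i\<le>Suc n. k_act (scl W) (of_nat (Suc n)) (X i))"
    unfolding sum.distrib[symmetric] W.ks.scale_left_distrib[symmetric] of_nat_add[symmetric]
    by (rule sum.cong) auto
  also have "\<dots> = k_act (scl W) (of_nat (Suc n)) (\<Sum>i\<le>Suc n. X i)"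
    by (rule W.ks.scale_sum_right[symmetric])
  finally show ?case unfolding X_def W.ks.scale_cancel_left using of_nat_neq_0[where 'a='k] by blast
qed

abbreviation GG :: "'c \<Rightarrow> ('k, 'u) tensor fps" where "GG \<equiv> KS.ex gt"

lemma GG_lin: "lin K S GG" and GG_deg: "hdeg K S 0 GG"
  by (rule KS.lin_ev[OF gt_small] KS.hdeg_ev[OF gt_small])+

lemma GG_approx:
  assumes "finite X" "X \<subseteq> carr K"
  obtains N where "\<And>x n. x \<in> X \<Longrightarrow> n \<ge> N \<Longrightarrow> vanish m (Gn n x)"
    and "\<And>x n. x \<in> X \<Longrightarrow> n \<ge> N \<Longrightarrow> vanish m (GG x - (\<Sum>i<n. Gn i x))"
proof -
  obtain N where N: "\<And>x n. x \<in> X \<Longrightarrow> n \<ge> N \<Longrightarrow> vanish m (pw K S gt n x)"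
    and A: "\<And>x p. x \<in> X \<Longrightarrow> vanish m (ev K S p gt x - (\<Sum>n<N. k_act (scl S) (fps_nth p n) (pw K S gt n x)))"
    by (rule KS.ev_approx[OF gt_small assms, of m]) blast
  have 1: "vanish m (Gn n x)" if "x \<in> X" "n \<ge> N" for x n
    unfolding Gn_def by (rule G.vanish_k_act[OF N[OF that]])
  have 2: "vanish m (GG x - (\<Sum>i<n. Gn i x))" if x: "x \<in> X" and "n \<ge> N" for x n
  proof -
    have "vanish m (GG x - (\<Sum>i<N. Gn i x))" using A[OF x, of "fps_exp 1"] by (simp add: Gn_def)
    then have "vanish m (GG x - (\<Sum>i<N. Gn i x) - (\<Sum>i\<in>{N..<n}. Gn i x))"
      by (rule vanish_diff) (rule vanish_sum, rule 1[OF x], simp)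
    moreover have "(\<Sum>i<n. Gn i x) = (\<Sum>i<N. Gn i x) + (\<Sum>i\<in>{N..<n}. Gn i x)"
      using sum.atLeastLessThan_concat[of 0 N n "\<lambda>i. Gn i x"] \<open>n \<ge> N\<close> by (simp add: lessThan_atLeast0)
    ultimately show ?thesis by (simp add: diff_diff_eq)
  qed
  show ?thesis by (rule that[OF 1 2])
qed

lemma E_vanish:
  assumes "lin S W \<theta>" "x \<in> ser (carr S)" "vanish m x" shows "vanish m (E \<theta> x)"
  using assms(3) by (auto simp: vanish_def Q.P.ser_ext_nth[OF assms(2)] Q.P.lin_0[OF assms(1)])

lemma E_diff: "lin S W \<theta> \<Longrightarrow> x \<in> ser (carr S) \<Longrightarrow> y \<in> ser (carr S) \<Longrightarrow> E \<theta> (x - y) = E \<theta> x - E \<theta> y"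
  using E_lin(2)[of \<theta> "x - y" y] G.ser_carr_diff[of x y] by simp

lemma E_sum:
  assumes "lin S W \<theta>" "c \<in> carr K" shows "E \<theta> (\<Sum>i<n. Gn i c) = (\<Sum>i<n. E \<theta> (Gn i c))"
proof -
  note Gm = lin_mem[OF Gn_lin assms(2)]
  have z: "E \<theta> 0 = 0" using E_diff[OF assms(1) Gm[of 0] Gm[of 0]] by simp
  have "E \<theta> (\<Sum>i<n. Gn i c) = (\<Sum>i<n. E \<theta> (Gn i c)) \<and> (\<Sum>i<n. Gn i c) \<in> ser (carr S)"
    by (induction n) (use Gm G.ser_carr_zero z E_lin(2)[OF assms(1)] G.ser_carr_add in simp_all)
  then show ?thesis by simp
qed

lemma E_GG_approx:
  assumes "finite X" "X \<subseteq> carr K"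
  obtains N where "\<And>\<theta> x n. lin S W \<theta> \<Longrightarrow> x \<in> X \<Longrightarrow> n \<ge> N \<Longrightarrow> vanish m (E \<theta> (Gn n x))"
    and "\<And>\<theta> x n. lin S W \<theta> \<Longrightarrow> x \<in> X \<Longrightarrow> n \<ge> N \<Longrightarrow> vanish m (E \<theta> (GG x) - (\<Sum>i<n. E \<theta> (Gn i x)))"
proof -
  obtain N where N: "\<And>x n. x \<in> X \<Longrightarrow> n \<ge> N \<Longrightarrow> vanish m (Gn n x)"
    and A: "\<And>x n. x \<in> X \<Longrightarrow> n \<ge> N \<Longrightarrow> vanish m (GG x - (\<Sum>i<n. Gn i x))"
    by (rule GG_approx[OF assms, of m]) blast
  have s: "(\<Sum>i<n. Gn i x) \<in> ser (carr S)" if "x \<in> X" for x n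
    by (induction n) (use lin_mem[OF Gn_lin, of x] that assms(2) G.ser_carr_zero G.ser_carr_add in auto)
  show ?thesis
  proof (rule that[of N])
    fix \<theta> x and n :: nat assume l: "lin S W \<theta>" and x: "x \<in> X" and n: "n \<ge> N"
    have c: "x \<in> carr K" using x assms(2) by blast
    show "vanish m (E \<theta> (Gn n x))" by (rule E_vanish[OF l lin_mem[OF Gn_lin c] N[OF x n]])
    have "vanish m (E \<theta> (GG x - (\<Sum>i<n. Gn i x)))"
      by (rule E_vanish[OF l G.ser_carr_diff[OF lin_mem[OF GG_lin c] s[OF x]] A[OF x n]])
    then show "vanish m (E \<theta> (GG x) - (\<Sum>i<n. E \<theta> (Gn i x)))"
      by (simp only: E_diff[OF l lin_mem[OF GG_lin c] s[OF x]] E_sum[OF l c])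
  qed
qed

text \<open>The exponential of a map into the generators is a morphism of coalgebras; dually, composition with it respects convolution.\<close>

lemma E_cv_GG:
  assumes l: "lin S W \<phi>" "lin S W \<psi>" and c: "c \<in> carr K"
  shows "E (cv S W \<phi> \<psi>) (GG c) = cv K W (\<lambda>x. E \<phi> (GG x)) (\<lambda>x. E \<psi> (GG x)) c"
proof (rule vanish_eqI)
  fix m
  define X where "X = insert c (fst ` set (sw K c) \<union> snd ` set (sw K c))"
  have X: "finite X" "X \<subseteq> carr K" using K.sw_carr[OF c] c by (auto simp: X_def)
  have sub: "fst ` set (sw K c) \<subseteq> X" "snd ` set (sw K c) \<subseteq> X" by (auto simp: X_def)
  obtain N where N: "\<And>\<theta> x n. lin S W \<theta> \<Longrightarrow> x \<in> X \<Longrightarrow> n \<ge> N \<Longrightarrow> vanish m (E \<theta> (Gn n x))"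
    and A: "\<And>\<theta> x n. lin S W \<theta> \<Longrightarrow> x \<in> X \<Longrightarrow> n \<ge> N \<Longrightarrow> vanish m (E \<theta> (GG x) - (\<Sum>i<n. E \<theta> (Gn i x)))"
    by (rule E_GG_approx[OF X, of m]) blast
  let ?f = "\<lambda>i x. E \<phi> (Gn i x)" and ?g = "\<lambda>i x. E \<psi> (Gn i x)"
  let ?C = "\<lambda>i j. cv K W (?f i) (?g j) c"
  have f: "lin K W (?f i)" and g: "lin K W (?g i)" for i by (rule lin_E[OF l(1) Gn_lin] lin_E[OF l(2) Gn_lin])+
  have z: "vanish m (?C i j)" if "i \<ge> N \<or> j \<ge> N" for i j
  proof -
    have "vanish m (W.sm (?f i a) (?g j b))" if ab: "(a, b) \<in> set (sw K c)" for a b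
    proof -
      have abX: "a \<in> X" "b \<in> X" using ab by (force simp: X_def)+
      then have "a \<in> carr K" "b \<in> carr K" using X(2) by auto
      then have m: "?f i a \<in> ser (carr W)" "?g j b \<in> ser (carr W)" using lin_mem[OF f] lin_mem[OF g] by auto
      from \<open>i \<ge> N \<or> j \<ge> N\<close> show ?thesis
      proof
        assume "i \<ge> N"
        then have "vanish (m + 0) (W.sm (?f i a) (?g j b))" using m by (intro W.vanish_sm N l abX) simp_all
        then show ?thesis by simp
      next
        assume "j \<ge> N"
        then have "vanish (0 + m) (W.sm (?f i a) (?g j b))" using m by (intro W.vanish_sm N l abX) simp_all
        then show ?thesis by simp
      qed
    qed
    then show ?thesis unfolding cv_def Sw_def by (rule vanish_sum_list)
  qed
  \<comment> \<open>the pairs with \<open>i, j < N\<close> contribute to the right hand side, those with \<open>i + j < 2 N\<close> to the left one;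
    the latter contain the former, and the difference is divisible by \<open>\<hbar>\<^sup>m\<close>\<close>
  define P where "P = {(i, j). i + j < 2 * N}"
  have fin: "finite P" unfolding P_def by (rule finite_subset[of _ "{..<2 * N} \<times> {..<2 * N}"]) auto
  have "(\<Sum>i<2 * N. E (cv S W \<phi> \<psi>) (Gn i c)) = (\<Sum>(i, j)\<in>P. ?C i j)"
    unfolding P_def sum.triangle_reindex E_cv_Gn[OF l c] ..
  also have "\<dots> = (\<Sum>(i, j)\<in>{..<N} \<times> {..<N}. ?C i j) + (\<Sum>(i, j)\<in>P - {..<N} \<times> {..<N}. ?C i j)"
    by (subst sum.subset_diff[OF _ fin, of "{..<N} \<times> {..<N}"]) (auto simp: P_def)
  also have "(\<Sum>(i, j)\<in>{..<N} \<times> {..<N}. ?C i j) = cv K W (\<lambda>x. \<Sum>i<N. ?f i x) (\<lambda>x. \<Sum>i<N. ?g i x) c"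
    using f g c by (simp add: sum.cartesian_product[symmetric] KW.cv_sum_left KW.cv_sum_right KW.lin_sum)
  finally have e: "(\<Sum>i<2 * N. E (cv S W \<phi> \<psi>) (Gn i c)) = 
    cv K W (\<lambda>x. \<Sum>i<N. ?f i x) (\<lambda>x. \<Sum>i<N. ?g i x) c + (\<Sum>(i, j)\<in>P - {..<N} \<times> {..<N}. ?C i j)" .
  have 1: "vanish m (E (cv S W \<phi> \<psi>) (GG c) - (\<Sum>i<2 * N. E (cv S W \<phi> \<psi>) (Gn i c)))"
    by (rule A[OF Q.lin_cv[OF l]]) (simp_all add: X_def)
  have 2: "vanish m (\<Sum>(i, j)\<in>P - {..<N} \<times> {..<N}. ?C i j)"
  proof (rule vanish_sum)
    fix q assume "q \<in> P - {..<N} \<times> {..<N}"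
    then obtain i j where "q = (i, j)" "i \<ge> N \<or> j \<ge> N" by (cases q) (auto simp: not_less)
    then show "vanish m (case q of (i, j) \<Rightarrow> ?C i j)" using z by simp
  qed
  have 3: "vanish m (cv K W (\<lambda>x. E \<phi> (GG x)) (\<lambda>x. E \<psi> (GG x)) c - cv K W (\<lambda>x. \<Sum>i<N. ?f i x) (\<lambda>x. \<Sum>i<N. ?g i x) c)"
    by (rule KW.cv_congr[OF c lin_E[OF l(1) GG_lin] KW.lin_sum[OF f] lin_E[OF l(2) GG_lin] KW.lin_sum[OF g]])
      (rule A[OF l(1)] A[OF l(2)]; use sub in blast | simp)+
  have r: "a - b = (a - s) + t - (b - d)" if "s = d + t" for a b s t d :: "'w fps"
    using that by (simp add: algebra_simps)
  show "vanish m (E (cv S W \<phi> \<psi>) (GG c) - cv K W (\<lambda>x. E \<phi> (GG x)) (\<lambda>x. E \<psi> (GG x)) c)"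
    by (subst r[OF e]) (rule vanish_diff[OF vanish_add[OF 1 2] 3])
qed

text \<open>Only the zeroth divided power has a component along \<open>1\<close>.\<close>

lemma E_ce_GG: assumes c: "c \<in> carr K" shows "E (ce S W) (GG c) = ce K W c"
proof (rule vanish_eqI)
  fix m
  have X: "finite {c}" "{c} \<subseteq> carr K" using c by auto
  obtain N where N: "\<And>\<theta> x n. lin S W \<theta> \<Longrightarrow> x \<in> {c} \<Longrightarrow> n \<ge> N \<Longrightarrow> vanish m (E \<theta> (Gn n x))"
    and A: "\<And>\<theta> x n. lin S W \<theta> \<Longrightarrow> x \<in> {c} \<Longrightarrow> n \<ge> N \<Longrightarrow> vanish m (E \<theta> (GG x) - (\<Sum>i<n. E \<theta> (Gn i x)))"
    by (rule E_GG_approx[OF X, of m]) blast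
  note l = Q.lin_ce
  have 1: "E (ce S W) (Gn (Suc n) c) = 0" for n
  proof -
    have "E (ce S W) (gt a \<otimes> Gn n b) = 0" if "a \<in> carr K" "b \<in> carr K" for a b
    proof -
      have "E (rr (fps_nth (g a) p) (ce S W)) (Gn n b) = 0" for p
        using lin_mem[OF Gn_lin that(2)] by (simp add: fps_eq_iff Q.P.ser_ext_nth ce_lm ser_nth)
      then show ?thesis unfolding E_gt[OF l that(1) lin_mem[OF Gn_lin that(2)]] by (simp add: fps_eq_iff hs_nth)
    qed
    then have "k_act (scl W) (of_nat (Suc n)) (E (ce S W) (Gn (Suc n) c)) = Sw K (\<lambda>a b. 0) c"
      unfolding E_Gn_Suc[OF l c, symmetric] by (intro K.Sw_cong[OF c]) simp
    also have "\<dots> = 0" using K.Sw_sum[of "\<lambda>_ _ _. 0 :: 'w fps" "{} :: nat set" c] by simp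
    finally show ?thesis using of_nat_neq_0[where 'a='k] by (simp only: W.ks.scale_eq_0_iff) blast
  qed
  have 0: "E (ce S W) (Gn 0 c) = ce K W c"
    unfolding E_Gn_0[OF l c] Q.ce_unit by (simp add: KW.ce_alt)
  have "(\<Sum>i<Suc N. E (ce S W) (Gn i c)) = ce K W c"
    unfolding sum.lessThan_Suc_shift 1 0 by simp
  then show "vanish m (E (ce S W) (GG c) - ce K W c)" using A[OF l, of c "Suc N"] by simp
qed

lemma E_pw_GG:
  assumes "lin S W \<kappa>" "c \<in> carr K" shows "E (pw S W \<kappa> n) (GG c) = pw K W (\<lambda>x. E \<kappa> (GG x)) n c"
  using assms(2)
proof (induction n arbitrary: c)
  case 0 then show ?case by (simp add: E_ce_GG)
next
  case (Suc n)
  show ?case unfolding pw.simps E_cv_GG[OF assms(1) Q.lin_pw[OF assms(1)] Suc.prems]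
    by (rule KW.cv_cong[OF Suc.prems refl Suc.IH])
qed

lemma E_ev_GG:
  assumes "small S W \<kappa>" "c \<in> carr K" shows "E (ev S W p \<kappa>) (GG c) = ev K W p (\<lambda>x. E \<kappa> (GG x)) c"
  unfolding ev_def[of K W] E_pw_GG[OF smallD(1)[OF assms(1)] assms(2), symmetric]
  by (rule Q.suminf_ser_ext(1)[OF assms(1) lin_mem[OF GG_lin assms(2)], symmetric])

lemma small_E_GG: assumes "small S W \<kappa>" shows "small K W (\<lambda>x. E \<kappa> (GG x))"
proof -
  note k = smallD[OF assms]
  have u: "unit S \<in> carr S" and uK: "unit K \<in> carr K" by (rule E.unit_carr K.unit_carr)+
  have "vanish 1 (GG (unit K) - fps_const (unit S))" using KS.glike_ex[OF gt_small] by (simp add: glike_def)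
  then have "vanish 1 (E \<kappa> (GG (unit K)) - \<kappa> (unit S))"
    using E_vanish[OF k(1) G.ser_carr_diff[OF lin_mem[OF GG_lin uK] Q.P.const_carr[OF u]]] 
    by (simp only: E_diff[OF k(1) lin_mem[OF GG_lin uK] Q.P.const_carr[OF u]] Q.P.ser_ext_const[OF k(1) u])
  from vanish_add[OF this k(3)] have "vanish 1 (E \<kappa> (GG (unit K)))" by simp
  moreover have "hdeg K W 0 (\<lambda>x. E \<kappa> (GG x))"
    using Q.P.has_degree_ser_ext[OF k(2)] GG_deg unfolding hdeg_def has_degree_def by (auto simp: image_subset_iff)
  ultimately show ?thesis using lin_E[OF k(1) GG_lin] by (simp add: small_def)
qed

end

section \<open>The order in \<open>\<hbar>\<close> of a composite\<close>

text \<open>A map \<open>f\<close> out of \<open>S(U)\<close>, together with the symmetric bialgebra on the graded space underlying \<open>S(U)\<close>: its elements are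
  symmetric products of words.\<close>

locale composite = sympair U D W
  for U :: "('k::field_char_0, 'u::ab_group_add) gvs" and D and W :: "('k, 'w::ab_group_add) mv" +
  fixes f :: "('k, 'u) tensor \<Rightarrow> 'w fps"
  assumes f_small: "small S W f"
begin

abbreviation UU :: "('k, ('k, 'u) tensor) gvs" where "UU \<equiv> \<lparr>scl = dscl, gr = sym_gr U\<rparr>"

lemma UU_graded: "graded_vs UU"
proof -
  have "graded_vs UU \<longleftrightarrow> graded_vs S" unfolding graded_vs_def S_simps gvs.select_convs ..
  then show ?thesis using S_graded by (rule iffD2)
qed

lemma carr_UU [simp]: "carr UU = carr S" unfolding carr_def S_simps gvs.select_convs ..

sublocale Z: sympair UU id W by unfold_locales (rule UU_graded)

definition mm :: "('k, 'u) tensor list \<Rightarrow> ('k, 'u) tensor" where "mm xs = foldr (sym_mult U) xs (mon U [])"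

lemma mult_carr: "a \<in> carr S \<Longrightarrow> b \<in> carr S \<Longrightarrow> sym_mult U a b \<in> carr S"
  using A.mult_carr[of a b] by simp

lemma mm_Cons: "mm (x # xs) = sym_mult U x (mm xs)" by (simp only: mm_def foldr.simps o_apply)

lemma mm_carr: "xs \<in> lists (carr S) \<Longrightarrow> mm xs \<in> carr S"
proof (induction xs rule: lists.induct)
  case Nil
  show ?case unfolding mm_def foldr.simps id_apply by (rule mon_carr[OF lists.Nil])
next
  case (Cons x xs)
  show ?case unfolding mm_Cons by (rule mult_carr[OF Cons(1,3)])
qed

lemma mm_append: 
  assumes "ys \<in> lists (carr S)" shows "mm (xs @ ys) = sym_mult U (mm xs) (mm ys)"
proof (induction xs)
  case Nil
  show ?case using sym_mult_unit(1)[OF mm_carr[OF assms]] by (simp add: mm_def)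
next
  case (Cons z xs)
  then have "mm ((z # xs) @ ys) = sym_mult U z (sym_mult U (mm xs) (mm ys))" by (simp add: mm_def)
  then show ?case unfolding sym_mult_assoc[OF mm_carr[OF assms], symmetric] by (simp add: mm_def)
qed

lemma mm_linear: 
  assumes "xs \<in> lists (carr S)" "ys \<in> lists (carr S)" shows "linear_map_on dscl dscl (carr S) (\<lambda>x. mm (xs @ x # ys))"
proof -
  note r = mm_carr[OF assms(1)] mm_carr[OF assms(2)]
  have e: "mm (xs @ x # ys) = sym_mult U (mm xs) (sym_mult U x (mm ys))" if "x \<in> carr S" for x
    using mm_append[OF lists.Cons[OF that assms(2)], of xs] by (simp only: mm_Cons)
  show ?thesis
    unfolding linear_map_on_def
  proof (intro conjI ballI allI)
    fix x y assume "x \<in> carr S" "y \<in> carr S"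
    then show "mm (xs @ (x + y) # ys) = mm (xs @ x # ys) + mm (xs @ y # ys)"
      by (simp only: e G.carr_add sym_mult_add_left sym_mult_add_right[OF r(1) mult_carr[OF _ r(2)] mult_carr[OF _ r(2)]])
  next
    fix c x assume "x \<in> carr S"
    then show "mm (xs @ dscl c x # ys) = dscl c (mm (xs @ x # ys))"
      using G.carr_scl[of x c] by (simp only: S_simps e sym_mult_scl_left sym_mult_scl_right[OF r(1) mult_carr[OF _ r(2)]])
  qed
qed

lemma mm_sym:
  assumes "xs \<in> lists (carr S)" "ys \<in> lists (carr S)" "x \<in> sym_gr U i" "y \<in> sym_gr U j"
  shows "mm (xs @ x # y # ys) = ksign i j (mm (xs @ y # x # ys))"
proof -
  have n: "dscl (-1) x = - x" for x :: "('k, 'u) tensor" by (simp add: dscl_def fun_eq_iff)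
  note r = mm_carr[OF assms(1)] mm_carr[OF assms(2)]
  have xy: "x \<in> carr S" "y \<in> carr S" using G.gr_carr[of x i] G.gr_carr[of y j] assms(3,4) by simp_all
  have e: "mm (xs @ a # b # ys) = sym_mult U (mm xs) (sym_mult U (sym_mult U a b) (mm ys))" if "a \<in> carr S" "b \<in> carr S" for a b
    using mm_append[OF lists.Cons[OF that(1) lists.Cons[OF that(2) assms(2)]], of xs] by (simp only: mm_Cons sym_mult_assoc[OF r(2)])
  have k: "sym_mult U (mm xs) (sym_mult U (ksign i j t) (mm ys)) = ksign i j (sym_mult U (mm xs) (sym_mult U t (mm ys)))"
    if "t \<in> carr S" for t
    using sym_mult_scl_left[of "-1" t "mm ys"] sym_mult_scl_right[OF r(1) mult_carr[OF that r(2)], of "-1"] by (simp add: ksign_def n)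
  show ?thesis unfolding e[OF xy] e[OF xy(2,1)] sym_mult_comm[OF assms(3,4)] by (rule k[OF mult_carr[OF xy(2,1)]])
qed

text \<open>The homomorphism \<open>m : S(S(U)) \<rightarrow> S(U)\<close> that multiplies the words of a symmetric product.\<close>

definition mult_words :: "('k, ('k, 'u) tensor) tensor \<Rightarrow> ('k, 'u) tensor" where
  "mult_words = (SOME L. Vector_Spaces.linear dscl dscl L \<and> (\<forall>xs\<in>lists (carr S). L (mon UU xs) = mm xs))"

lemma mult_words_spec: "Vector_Spaces.linear dscl dscl mult_words \<and> (\<forall>xs\<in>lists (carr S). mult_words (mon UU xs) = mm xs)"
proof -
  have 1: "linear_map_on (scl UU) dscl (carr UU) (\<lambda>x. mm (xs @ x # ys))" if "xs \<in> lists (carr UU)" "ys \<in> lists (carr UU)" for xs ys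
    using mm_linear[OF that[unfolded carr_UU]] unfolding carr_UU gvs.select_convs .
  have 2: "mm (xs @ x # y # ys) = ksign i j (mm (xs @ y # x # ys))"
    if "xs \<in> lists (carr UU)" "ys \<in> lists (carr UU)" "x \<in> gr UU i" "y \<in> gr UU j" for xs ys i j x y
    by (rule mm_sym[OF that[unfolded carr_UU gvs.select_convs]])
  obtain L where "Vector_Spaces.linear dscl dscl L" "\<And>xs. xs \<in> lists (carr UU) \<Longrightarrow> L (mon UU xs) = mm xs"
    by (rule Z.sym_lift[OF vector_space_dscl 1 2]) (assumption+, rule that, assumption+)
  then have "\<exists>L. Vector_Spaces.linear dscl dscl L \<and> (\<forall>xs\<in>lists (carr S). L (mon UU xs) = mm xs)"
    unfolding carr_UU by blast
  then show ?thesis unfolding mult_words_def by (rule someI_ex)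
qed

sublocale mult_words: Vector_Spaces.linear dscl dscl mult_words using mult_words_spec by blast

lemma mult_words_mon: "xs \<in> lists (carr S) \<Longrightarrow> mult_words (mon UU xs) = mm xs" using mult_words_spec by blast

lemma mult_words_unit: "mult_words (mon UU []) = mon U []" unfolding mult_words_mon[OF lists.Nil] mm_def by simp

lemma mult_words_lm: "x \<in> carr Z.S \<Longrightarrow> a \<in> carr S \<Longrightarrow> mult_words (Z.lm a x) = sym_mult U a (mult_words x)"
  and mult_words_carr: "x \<in> carr Z.S \<Longrightarrow> mult_words x \<in> carr S"
proof -
  have "mult_words x \<in> carr S \<and> (\<forall>a\<in>carr S. mult_words (Z.lm a x) = sym_mult U a (mult_words x))" if "x \<in> carr Z.S" for x
    using that
  proof (induction rule: Z.carr_S_induct)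
    case base
    show ?case using G.carr_zero Z.mon1_carr by (simp add: mult_words.zero Z.sym_mult_zero_right sym_mult_zero_right)
  next
    case (step c xs y)
    have xs: "xs \<in> lists (carr S)" using Z.hom_lists[OF step(1)] unfolding carr_UU .
    have m: "mon UU xs \<in> carr Z.S" by (rule Z.mon_carr[OF Z.hom_lists[OF step(1)]])
    note mc = mm_carr[OF xs]
    have "mult_words (Z.lm a (dscl c (mon UU xs) + y)) = sym_mult U a (mult_words (dscl c (mon UU xs) + y))" if a: "a \<in> carr S" for a
    proof -
      have "mult_words (mon UU (a # xs)) = sym_mult U a (mm xs)" unfolding mult_words_mon[OF lists.Cons[OF a xs]] mm_Cons ..
      moreover have "Z.lm a (dscl c (mon UU xs) + y) = dscl c (mon UU (a # xs)) + Z.lm a y"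
      proof -
        have aU: "a \<in> carr UU" using a unfolding carr_UU .
        have "dscl c (mon UU xs) \<in> carr Z.S" using Z.G.carr_scl[OF m, of c] by (simp only: S_simps Z.S_simps)
        then show ?thesis by (simp only: Z.lm_lin(1)[OF aU _ step(2)] Z.lm_lin(2)[OF aU m] sym_mult_mon append_Cons append_Nil)
      qed
      moreover have "sym_mult U a (dscl c (mm xs) + mult_words y) = dscl c (sym_mult U a (mm xs)) + sym_mult U a (mult_words y)"
        using sym_mult_add_right[OF a, of "dscl c (mm xs)" "mult_words y"] sym_mult_scl_right[OF a mc, of c] step(3) G.carr_scl[OF mc, of c]
        by (simp only: S_simps simp_thms)
      ultimately show ?thesis using step(3) a by (simp only: mult_words.add mult_words.scale mult_words_mon[OF xs])
    qed
    moreover have "mult_words (dscl c (mon UU xs) + y) \<in> carr S"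
      unfolding mult_words.add mult_words.scale mult_words_mon[OF xs] 
      by (rule G.carr_add[OF G.carr_scl[OF mc, unfolded S_simps] conjunct1[OF step(3)]])
    ultimately show ?case by (intro conjI ballI)
  qed
  note h = this
  show "mult_words (Z.lm a x) = sym_mult U a (mult_words x)" if "x \<in> carr Z.S" "a \<in> carr S" by (rule bspec[OF conjunct2[OF h[OF that(1)]] that(2)])
  show "mult_words x \<in> carr S" if "x \<in> carr Z.S" by (rule conjunct1[OF h[OF that]])
qed

lemma mult_words_gr: "x \<in> sym_gr UU n \<Longrightarrow> mult_words x \<in> sym_gr U n"
  unfolding sym_gr_def[of UU]
proof (induction rule: TT.span_induct_alt)
  case base show ?case unfolding mult_words.zero by (rule G.gr_zero[unfolded S_simps])
next
  case (step c x y)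
  have mm: "mm xs \<in> sym_gr U (sum_list ds)" if "homogeneous_list UU xs ds" for xs ds
    using that
  proof (induction xs arbitrary: ds)
    case Nil
    then have "ds = []" by (simp add: homogeneous_list_def)
    then show ?case using mon_gr[of "[]" "[]"] by (simp add: homogeneous_list_def mm_def)
  next
    case (Cons x xs)
    from Cons.prems obtain d ds' where d: "ds = d # ds'" "x \<in> gr UU d" "homogeneous_list UU xs ds'"
      unfolding Z.homogeneous_list_Cons by (elim exE conjE)
    show ?case unfolding d(1) mm_Cons sum_list.Cons by (rule sym_mult_gr[OF d(2)[unfolded gvs.select_convs] Cons.IH[OF d(3)]])
  qed
  from step(1) obtain xs ds where x: "x = mon UU xs" "homogeneous_list UU xs ds" "sum_list ds = n" by (elim CollectE exE conjE)
  have xs: "xs \<in> lists (carr S)" using Z.hom_lists[OF Z.homogeneous_list_hom[OF x(2)]] unfolding carr_UU .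
  have "mult_words x \<in> sym_gr U n" unfolding x(1) mult_words_mon[OF xs] using mm[OF x(2)] unfolding x(3) .
  from G.gr_add[unfolded S_simps, OF G.gr_scl[unfolded S_simps, OF this] step(2)]
  show ?case unfolding mult_words.add mult_words.scale .
qed

abbreviation F where "F \<equiv> Q.ex f"

lemma glike_F_mh: "glike Z.S W (\<lambda>x. F (mult_words x))"
proof -
  note g = Q.glike_ex[OF f_small, unfolded glike_def]
  note Fl = conjunct1[OF g] and Fd = conjunct1[OF conjunct2[OF g]] and Fu = conjunct2[OF conjunct2[OF g]]
  have "lin Z.S W (\<lambda>x. F (mult_words x))"
  proof (rule linI)
    show "F (mult_words x) \<in> ser (carr W)" if "x \<in> carr Z.S" for x by (rule lin_mem[OF Fl mult_words_carr[OF that]])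
    show "F (mult_words (x + y)) = F (mult_words x) + F (mult_words y)" if "x \<in> carr Z.S" "y \<in> carr Z.S" for x y
      unfolding mult_words.add by (rule lin_add[OF Fl mult_words_carr[OF that(1)] mult_words_carr[OF that(2)]])
    show "F (mult_words (scl Z.S k x)) = k_act (scl W) k (F (mult_words x))" if "x \<in> carr Z.S" for x k
      unfolding Z.S_simps mult_words.scale by (rule lin_scl[OF Fl mult_words_carr[OF that], unfolded S_simps])
  qed
  moreover have "hdeg Z.S W 0 (\<lambda>x. F (mult_words x))" unfolding hdeg_def Z.S_simps
  proof (intro allI ballI)
    fix n x assume "x \<in> sym_gr UU n"
    from mult_words_gr[OF this] show "F (mult_words x) \<in> ser (gr W (n + 0))" by (intro hdegD[OF Fd]) (simp only: S_simps)
  qed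
  moreover have "vanish 1 (F (mult_words (unit Z.S)) - fps_const (unit W))" using Fu unfolding Z.S_simps S_simps mult_words_unit .
  ultimately show ?thesis unfolding glike_def by (intro conjI)
qed

text \<open>The cumulants \<open>\<kappa> = log(exp(f) \<circ> m)\<close>.\<close>

definition cumulant :: "('k, ('k, 'u) tensor) tensor \<Rightarrow> 'w fps" where "cumulant = Z.Q.lg (\<lambda>x. F (mult_words x))"

lemma cumulant_small: "small Z.S W cumulant" unfolding cumulant_def by (rule Z.Q.small_lg[OF glike_F_mh])

lemma ex_cumulant: "x \<in> carr Z.S \<Longrightarrow> Z.Q.ex cumulant x = F (mult_words x)" unfolding cumulant_def by (rule Z.Q.ex_lg[OF glike_F_mh])

text \<open>As \<open>exp(\<kappa>)\<close> factors through \<open>m\<close>, it takes the same value on \<open>(ab) x\<close> and on \<open>a (b x)\<close>.  Compute both with the chain rule,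
  the second one with the product rule in addition, and cancel \<open>exp(\<kappa>)\<close>.\<close>

lemma cumulant_lm_mult:
  assumes a: "a \<in> sym_gr U i" and b: "b \<in> sym_gr U j" and x: "x \<in> carr Z.S"
  shows "cumulant (Z.lm (sym_mult U a b) x) = 
    cumulant (Z.lm a (Z.lm b x)) + cv Z.S W (\<lambda>y. cumulant (Z.lm a (tw Z.S j y))) (\<lambda>y. cumulant (Z.lm b y)) x"
proof -
  note k = smallD(1)[OF cumulant_small]
  have aU: "a \<in> gr UU i" and bU: "b \<in> gr UU j" and abU: "sym_mult U a b \<in> gr UU (i + j)"
    unfolding gvs.select_convs by (rule a b sym_mult_gr[OF a b])+
  note ac = Z.gr_carr[OF aU] and bc = Z.gr_carr[OF bU] and abc = Z.gr_carr[OF abU]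
  note acS = ac[unfolded carr_UU] and bcS = bc[unfolded carr_UU] and abcS = abc[unfolded carr_UU]
  have r: "lin Z.S W (Z.rr a cumulant)" "lin Z.S W (Z.rr b cumulant)" by (rule Z.lin_rr[OF k ac] Z.lin_rr[OF k bc])+
  have t: "lin Z.S W (\<lambda>y. Z.rr a cumulant (tw Z.S j y))" by (rule Z.Q.lin_tw[OF r(1)])
  have e: "lin Z.S W (Z.Q.ex cumulant)" by (rule Z.Q.lin_ev[OF cumulant_small])
  have br: "lin Z.S W (Z.rr b (Z.rr a cumulant))" by (rule Z.lin_rr[OF r(1) bc])
  show ?thesis
  proof (rule Z.Q.cv_ex_cancel[OF cumulant_small Z.lin_rr[OF k abc] Z.Q.lin_plus[OF br Z.Q.lin_cv[OF t r(2)]] x])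
    fix y assume y: "y \<in> carr Z.S"
    note by' = Z.lm_carr[OF bc y]
    let ?t = "\<lambda>y. Z.rr a cumulant (tw Z.S j y)" and ?e = "Z.Q.ex cumulant"
    have 1: "cv Z.S W (Z.rr (sym_mult U a b) cumulant) ?e y = F (sym_mult U (sym_mult U a b) (mult_words y))"
      unfolding Z.ex_step[OF cumulant_small abU y, symmetric] ex_cumulant[OF Z.lm_carr[OF abc y]] mult_words_lm[OF y abcS] ..
    have 2: "cv Z.S W (Z.rr a cumulant) ?e (Z.lm b y) = F (sym_mult U (sym_mult U a b) (mult_words y))"
      unfolding Z.ex_step[OF cumulant_small aU by', symmetric] ex_cumulant[OF Z.lm_carr[OF ac by']] mult_words_lm[OF by' acS] mult_words_lm[OF y bcS]
        sym_mult_assoc[OF mult_words_carr[OF y]] ..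
    have 3: "cv Z.S W ?t (Z.rr b ?e) y = cv Z.S W ?t (cv Z.S W (Z.rr b cumulant) ?e) y"
      by (rule Z.Q.cv_cong[OF y refl Z.ex_step[OF cumulant_small bU]])
    have 4: "cv Z.S W (Z.rr a cumulant) ?e (Z.lm b y) = cv Z.S W (Z.rr b (Z.rr a cumulant)) ?e y + cv Z.S W (cv Z.S W ?t (Z.rr b cumulant)) ?e y"
      unfolding Z.Q.cv_assoc[OF t r(2) e y] 3[symmetric] by (rule Z.cv_step[OF r(1) e bU y])
    have 5: "cv Z.S W (\<lambda>x. Z.rr b (Z.rr a cumulant) x + cv Z.S W ?t (Z.rr b cumulant) x) ?e y =
        cv Z.S W (Z.rr b (Z.rr a cumulant)) ?e y + cv Z.S W (cv Z.S W ?t (Z.rr b cumulant)) ?e y"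
      by (rule Z.Q.cv_add_left[OF br Z.Q.lin_cv[OF t r(2)] e y])
    show "cv Z.S W (Z.rr (sym_mult U a b) cumulant) ?e y = cv Z.S W (\<lambda>x. Z.rr b (Z.rr a cumulant) x + cv Z.S W ?t (Z.rr b cumulant) x) ?e y"
      by (rule trans[OF trans[OF 1 2[symmetric]] trans[OF 4 5[symmetric]]])
  qed
qed

text \<open>Here \<open>m(1 x) = m(x)\<close>, and the chain rule again leaves a factor \<open>exp(\<kappa>)\<close> to be cancelled.\<close>

lemma cumulant_lm_unit:
  assumes x: "x \<in> carr Z.S" shows "cumulant (Z.lm (mon U []) x) = ce Z.S W x"
proof -
  have "homogeneous_list U [] []" by (simp add: homogeneous_list_def)
  from mon_gr[OF this] have u: "mon U [] \<in> gr UU 0" unfolding gvs.select_convs sum_list.Nil .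
  note uc = Z.gr_carr[OF u]
  show ?thesis
  proof (rule Z.Q.cv_ex_cancel[OF cumulant_small Z.lin_rr[OF smallD(1)[OF cumulant_small] uc] Z.Q.lin_ce x])
    fix y assume y: "y \<in> carr Z.S"
    have "cv Z.S W (Z.rr (mon U []) cumulant) (Z.Q.ex cumulant) y = Z.Q.ex cumulant (Z.lm (mon U []) y)"
      by (rule Z.ex_step[OF cumulant_small u y, symmetric])
    also have "\<dots> = Z.Q.ex cumulant y"
      unfolding ex_cumulant[OF Z.lm_carr[OF uc y]] ex_cumulant[OF y] mult_words_lm[OF y uc[unfolded carr_UU]] sym_mult_unit(1)[OF mult_words_carr[OF y]] ..
    also have "\<dots> = cv Z.S W (ce Z.S W) (Z.Q.ex cumulant) y"
      by (rule Z.Q.cv_ce_left[OF Z.Q.lin_ev[OF cumulant_small] y, symmetric])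
    finally show "cv Z.S W (Z.rr (mon U []) cumulant) (Z.Q.ex cumulant) y = cv Z.S W (ce Z.S W) (Z.Q.ex cumulant) y" .
  qed
qed

end

subsection \<open>Composition with the exponential of a map\<close>

text \<open>A map \<open>g\<close> from a conilpotent coalgebra \<open>K\<close> to \<open>S(U)[[\<hbar>]]\<close>, whose exponential is followed by \<open>exp(f)\<close>.\<close>

locale composite_source = composite U D W f + K: gcog K
  for U :: "('k::field_char_0, 'u::ab_group_add) gvs" and D and W :: "('k, 'w::ab_group_add) mv" and f
    and K :: "('k, 'c::ab_group_add) mv" +
  fixes g :: "'c \<Rightarrow> ('k, 'u) tensor fps"
  assumes g_small: "small K S g"
begin

lemma lin_UU: "lin K UU g \<longleftrightarrow> lin K S g" unfolding lin_def carr_UU S_simps gvs.select_convs ..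
lemma hdeg_UU: "hdeg K UU 0 g \<longleftrightarrow> hdeg K S 0 g" unfolding hdeg_def S_simps gvs.select_convs ..

sublocale L: lifted UU id W K g
  by unfold_locales (simp_all only: lin_UU hdeg_UU smallD[OF g_small])

sublocale N: cpair K S ..

text \<open>The \<open>\<hbar>\<close>-linear extension of \<open>m\<close>.\<close>

definition push :: "('k, ('k, 'u) tensor) tensor fps \<Rightarrow> ('k, 'u) tensor fps" where
  "push x = Abs_fps (\<lambda>n. mult_words (fps_nth x n))"

lemma push_nth: "fps_nth (push x) n = mult_words (fps_nth x n)" unfolding push_def by (rule fps_nth_Abs_fps)

lemma push_add: "push (x + y) = push x + push y"
  by (rule fps_ext) (simp only: push_nth fps_add_nth mult_words.add)

lemma push_const: "push (fps_const t) = fps_const (mult_words t)"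
  by (rule fps_ext) (simp only: push_nth fps_nth_fps_const mult_words.zero split: if_split, simp)

lemma push_Sw:
  assumes "c \<in> carr K" shows "push (Sw K \<beta> c) = Sw K (\<lambda>a b. push (\<beta> a b)) c"
  by (rule K.Sw_push(1)[where A = UNIV, OF assms UNIV_I UNIV_I UNIV_I push_add])

lemma push_gt:
  assumes "a \<in> carr K" "x \<in> ser (carr Z.S)"
  shows "push (ser_mult (mult Z.S) (L.gt a) x) = ser_mult (mult S) (g a) (push x)"
proof (rule fps_ext)
  fix n
  have "mult_words (sym_mult UU (mon UU [fps_nth (g a) p]) (fps_nth x q)) = sym_mult U (fps_nth (g a) p) (mult_words (fps_nth x q))" for p q
    by (rule mult_words_lm[OF ser_nth[OF assms(2)] ser_nth[OF lin_mem[OF smallD(1)[OF g_small] assms(1)]]])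
  then show "fps_nth (push (ser_mult (mult Z.S) (L.gt a) x)) n = fps_nth (ser_mult (mult S) (g a) (push x)) n"
    unfolding push_nth Z.A.sm_nth A.sm_nth mult_words.sum L.gt_nth unfolding Z.S_simps S_simps by (intro sum.cong refl)
qed

text \<open>\<open>m\<close> is a homomorphism that is the identity on generators, so it takes powers of \<open>\<iota>g\<close> to powers of \<open>g\<close>.\<close>

lemma push_pw:
  assumes "c \<in> carr K" shows "push (pw K Z.S L.gt n c) = pw K S g n c"
  using assms
proof (induction n arbitrary: c)
  case 0
  show ?case unfolding pw.simps ce_def push_const Z.S_simps S_simps mult_words.scale mult_words_unit ..
next
  case (Suc n)
  show ?case unfolding pw.simps cv_def push_Sw[OF Suc.prems]
  proof (rule K.Sw_cong[OF Suc.prems])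
    fix a b assume ab: "a \<in> carr K" "b \<in> carr K"
    show "push (ser_mult (mult Z.S) (L.gt a) (pw K Z.S L.gt n b)) = ser_mult (mult S) (g a) (pw K S g n b)"
      unfolding push_gt[OF ab(1) lin_mem[OF L.KS.lin_pw[OF L.gt_lin] ab(2)]] Suc.IH[OF ab(2)] ..
  qed
qed

lemma push_GG:
  assumes c: "c \<in> carr K" shows "push (L.GG c) = N.ex g c"
proof (rule fps_ext)
  fix i
  obtain M where z: "\<And>n. n \<ge> M \<Longrightarrow> fps_nth (pw K Z.S L.gt n c) i = 0"
    and e: "\<And>p. fps_nth (ev K Z.S p L.gt c) i = (\<Sum>n<M. scl Z.S (fps_nth p n) (fps_nth (pw K Z.S L.gt n c) i))"
    by (rule L.KS.ev_nth_ex1[OF L.gt_small c, of i]) (rule that)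
  have pg: "mult_words (fps_nth (pw K Z.S L.gt n c) i) = fps_nth (pw K S g n c) i" for n
    unfolding push_pw[OF c, symmetric] push_nth ..
  have z': "fps_nth (pw K S g n c) i = 0" if "n \<ge> M" for n
    unfolding pg[symmetric] z[OF that] mult_words.zero ..
  have e': "fps_nth (N.ex g c) i = (\<Sum>n<M. scl S (fps_nth (fps_exp 1) n) (fps_nth (pw K S g n c) i))"
    by (rule N.ev_nth[OF g_small c]) (rule z')
  show "fps_nth (push (L.GG c)) i = fps_nth (N.ex g c) i"
    unfolding push_nth e e' mult_words.sum unfolding Z.S_simps S_simps mult_words.scale pg ..
qed

lemma E_F_mh:
  assumes x: "x \<in> ser (carr Z.S)" shows "L.E (\<lambda>x. F (mult_words x)) x = ser_ext (carr S) F (push x)"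
proof (rule fps_ext)
  fix n
  have p: "push x \<in> ser (carr S)" by (rule serI) (unfold push_nth, rule mult_words_carr[OF ser_nth[OF x]])
  show "fps_nth (L.E (\<lambda>x. F (mult_words x)) x) n = fps_nth (ser_ext (carr S) F (push x)) n"
    unfolding Z.Q.P.ser_ext_nth[OF x] Q.P.ser_ext_nth[OF p] push_nth ..
qed

text \<open>Composition with \<open>exp(\<iota>g)\<close> takes \<open>exp(\<kappa>)\<close> to \<open>exp(\<kappa> \<circ> exp(\<iota>g))\<close>; on the other hand \<open>exp(\<kappa>) = exp(f) \<circ> m\<close>.\<close>

lemma log_compose:
  assumes c: "c \<in> carr K"
  shows "L.KW.lg (\<lambda>c. ser_ext (carr S) F (N.ex g c)) c = L.E cumulant (L.GG c)"
proof -
  have e: "ev K W (fps_exp 1) (\<lambda>c. L.E cumulant (L.GG c)) c = ser_ext (carr S) F (N.ex g c)" if c: "c \<in> carr K" for c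
  proof -
    have "ev K W (fps_exp 1) (\<lambda>c. L.E cumulant (L.GG c)) c = L.E (Z.Q.ex cumulant) (L.GG c)"
      by (rule L.E_ev_GG[OF cumulant_small c, symmetric])
    moreover have "L.E (Z.Q.ex cumulant) = L.E (\<lambda>x. F (mult_words x))" by (rule Z.Q.P.ser_ext_cong[OF ex_cumulant])
    ultimately show ?thesis by (simp only: E_F_mh[OF lin_mem[OF L.GG_lin c]] push_GG[OF c])
  qed
  have "L.KW.lg (\<lambda>c. ser_ext (carr S) F (N.ex g c)) c = L.KW.lg (L.KW.ex (\<lambda>c. L.E cumulant (L.GG c))) c"
    by (rule L.KW.ev_cong[OF c]) (simp only: e)
  also have "\<dots> = L.E cumulant (L.GG c)" by (rule L.KW.lg_ex[OF L.small_E_GG[OF cumulant_small] c])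
  finally show ?thesis .
qed

end

subsection \<open>Cumulants of words\<close>

context composite
begin

sublocale B: composite_source U D W f S log_id
  by unfold_locales (rule small_log_id)

sublocale J: sympair U D Z.S ..

lemma GG_lm:
  assumes "u \<in> gr U i" "x \<in> carr S"
  shows "B.L.GG (lm u x) = ser_mult (mult Z.S) (fps_const (mon UU [mon U [u]])) (B.L.GG x)"
proof -
  let ?c = "fps_const (mon UU [mon U [u]]) :: ('k, ('k, 'u) tensor) tensor fps"
  have "mon U [u] \<in> carr UU" unfolding carr_UU by (rule mon1_carr[OF gr_carr[OF assms(1)]])
  then have c: "?c \<in> ser (carr Z.S)" by (intro Z.Q.P.const_carr Z.mon1_carr)
  have r: "B.L.gt (lm u y) = k_act (scl Z.S) (counit S y) ?c" if y: "y \<in> carr S" for y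
  proof (rule fps_ext)
    fix p
    have s: "mon UU [dscl e m] = dscl e (mon UU [m])" for e m
      using Z.mon_scl[of "[]" e m "[]"] by (simp only: gvs.select_convs append_Nil)
    have "fps_nth (B.L.gt (lm u y)) p = mon UU [if p = 0 then dscl (eps y) (mon U [u]) else 0]"
      unfolding B.L.gt_nth log_id_lm[OF assms(1) y] fps_nth_fps_const ..
    also have "\<dots> = dscl (eps y) (if p = 0 then mon UU [mon U [u]] else 0)"
      using s Z.mon_zero[of "[]" "[]"] by (simp only: append_Nil TT.scale_zero_right split: if_split) blast
    finally show "fps_nth (B.L.gt (lm u y)) p = fps_nth (k_act (scl Z.S) (counit S y) ?c) p"
      unfolding Z.G.k_act_nth fps_nth_fps_const unfolding Z.S_simps S_simps .
  qed
  have "B.L.GG (lm u x) = cv S Z.S (J.rr u B.L.gt) B.L.GG x" by (rule J.ex_step[OF B.L.gt_small assms])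
  also have "\<dots> = cv S Z.S (\<lambda>y. k_act (scl Z.S) (counit S y) ?c) B.L.GG x"
    by (rule B.L.KS.cv_cong[OF assms(2) r refl])
  also have "\<dots> = ser_mult (mult Z.S) ?c (B.L.GG x)" by (rule B.L.KS.cv_const_left[OF B.L.GG_lin c assms(2)])
  finally show ?thesis .
qed

text \<open>For \<open>g = log(id)\<close>, the projection onto \<open>U\<close>, the morphism \<open>exp(\<iota>g)\<close> splits a word into its letters.\<close>

lemma GG_mon: "hom us \<Longrightarrow> B.L.GG (mon U us) = fps_const (mon UU (map (\<lambda>u. mon U [u]) us))"
proof (induction us)
  case Nil
  have fe: "fps_nth (fps_exp (1 :: 'k)) 0 = 1" by simp
  have "B.L.gt (unit S) = 0"
    by (rule fps_ext) (unfold B.L.gt_nth log_id_unit fps_zero_nth, use Z.mon_zero[of "[]" "[]"] in \<open>simp only: append_Nil\<close>)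
  from B.L.KS.ev_at_unit[OF B.L.gt_small this, of "fps_exp 1"]
  have "B.L.GG (unit S) = k_act (scl Z.S) 1 (fps_const (unit Z.S))" by (simp only: fe)
  then show ?case unfolding Z.G.ks.scale_one unfolding S_simps Z.S_simps list.map .
next
  case (Cons u us)
  from Cons.prems obtain i where u: "u \<in> gr U i" "hom us" unfolding hom_Cons by (elim exE conjE)
  let ?m = "mon UU (map (\<lambda>u. mon U [u]) us)"
  have c: "mon U [u] \<in> carr UU" unfolding carr_UU by (rule mon1_carr[OF gr_carr[OF u(1)]])
  have l: "map (\<lambda>u. mon U [u]) us \<in> lists (carr UU)"
    unfolding in_lists_conv_set set_map carr_UU
    using u(2) gr_carr mon1_carr unfolding hom_def by blast
  have e: "mon U (u # us) = lm u (mon U us)" unfolding sym_mult_mon append_Cons append_Nil ..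
  have "fps_nth (B.L.GG (mon U (u # us))) n = (if n = 0 then mon UU (map (\<lambda>u. mon U [u]) (u # us)) else 0)" for n
    unfolding e GG_lm[OF u(1) mon_carr[OF hom_lists[OF u(2)]]] Cons.IH[OF u(2)]
      Z.A.sm_const_left[OF Z.mon1_carr[OF c] Z.Q.P.const_carr[OF Z.mon_carr[OF l]]] fps_nth_fps_const unfolding Z.S_simps
    by (simp only: Z.sym_mult_zero_right[OF Z.mon1_carr[OF c]] sym_mult_mon append_Cons append_Nil list.map split: if_split) blast
  then show ?case by (intro fps_ext) (simp only: fps_nth_fps_const)
qed

text \<open>The general formula for the logarithm of a composite, applied to \<open>g = log(id)\<close>: the composite is \<open>exp(f)\<close> itself.\<close>

lemma cumulant_letters:
  assumes h: "hom us" shows "cumulant (mon UU (map (\<lambda>u. mon U [u]) us)) = f (mon U us)"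
proof -
  have m: "mon U us \<in> carr S" by (rule mon_carr[OF hom_lists[OF h]])
  have l: "map (\<lambda>u. mon U [u]) us \<in> lists (carr UU)"
    unfolding in_lists_conv_set set_map carr_UU
    using h gr_carr mon1_carr unfolding hom_def by blast
  have FF: "lin S W F" by (rule Q.lin_ev[OF f_small])
  have "cumulant (mon UU (map (\<lambda>u. mon U [u]) us)) = B.L.E cumulant (B.L.GG (mon U us))"
    unfolding GG_mon[OF h] by (rule Z.Q.P.ser_ext_const[OF smallD(1)[OF cumulant_small] Z.mon_carr[OF l], symmetric])
  also have "\<dots> = Q.lg (\<lambda>c. ser_ext (carr S) F (I.Q.ex log_id c)) (mon U us)"
    by (rule B.log_compose[OF m, symmetric])
  also have "\<dots> = Q.lg F (mon U us)"
  proof (rule Q.ev_cong[OF m])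
    fix x assume x: "x \<in> carr S"
    show "ser_ext (carr S) F (I.Q.ex log_id x) - ce S W x = F x - ce S W x"
      unfolding I.Q.ex_lg[OF glike_const x] Q.P.ser_ext_const[OF FF x] ..
  qed
  also have "\<dots> = f (mon U us)" by (rule Q.lg_ex[OF f_small m])
  finally show ?thesis .
qed

end

lemma sum_list_nths_le: "sum_list (map h (nths xs I)) \<le> sum_list (map h xs)" for h :: "'a \<Rightarrow> nat"
proof (induction xs arbitrary: I)
  case (Cons x xs)
  show ?case unfolding nths_Cons using Cons.IH[of "{j. Suc j \<in> I}"] by (cases "0 \<in> I") simp_all
qed simp

lemma vanish_ksign: "vanish m x \<Longrightarrow> vanish m (ksign i j x)" for x :: "'a::ab_group_add fps"
  unfolding ksign_def by (simp add: vanish_neg)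

context composite
begin

abbreviation M where "M ws \<equiv> mon UU (map (mon U) ws)"

lemma mon_UU: "hom w \<Longrightarrow> \<exists>j. mon U w \<in> gr UU j"
  unfolding gvs.select_convs using hom_ex mon_gr by blast

lemma homZ: "\<forall>w\<in>set ws. hom w \<Longrightarrow> Z.hom (map (mon U) ws)"
  unfolding Z.hom_def set_map using mon_UU by blast

lemma M_carr: "\<forall>w\<in>set ws. hom w \<Longrightarrow> M ws \<in> carr Z.S"
  by (rule Z.mon_carr[OF Z.hom_lists[OF homZ]])

lemma M_Cons: "M (w # ws) = Z.lm (mon U w) (M ws)"
  unfolding sym_mult_mon list.map append_Cons append_Nil ..

lemma cumulant_front:
  assumes "\<forall>w\<in>set (ps @ w # qs). hom w" "vanish m (cumulant (M (w # ps @ qs)))"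
  shows "vanish m (cumulant (M (ps @ w # qs)))"
proof -
  have h: "\<forall>w\<in>set ps. hom w" "\<forall>v\<in>set (w # ps @ qs). hom v" "hom w" using assms(1) by auto
  obtain ds where ds: "homogeneous_list UU (map (mon U) ps) ds" using Z.hom_ex[OF homZ[OF h(1)]] by (elim exE)
  obtain j where j: "mon U w \<in> gr UU j" using mon_UU[OF h(3)] by (elim exE)
  have "M (ps @ w # qs) = ksign (sum_list ds) j (M (w # ps @ qs))"
    using Z.mon_move_front[OF ds j, of "[]" "map (mon U) qs"] by (simp only: append_Nil map_append list.map)
  then have "cumulant (M (ps @ w # qs)) = ksign (sum_list ds) j (cumulant (M (w # ps @ qs)))"
    using Z.Q.lin_ksign[OF smallD(1)[OF cumulant_small] M_carr[OF h(2)]] by (simp only:)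
  then show ?thesis using vanish_ksign[OF assms(2)] by (simp only:)
qed

text \<open>Splitting a letter off a word increases the number of words and decreases the sum of the squares of their lengths, on which
  the induction is based.  In the quadratic terms of the cumulant formula the orders of the two factors add up to the required
  one.\<close>

lemma cumulant_words:
  assumes f: "\<And>us. hom us \<Longrightarrow> vanish (length us - 1) (f (mon U us))"
  shows "\<forall>w\<in>set ws. hom w \<Longrightarrow> vanish (length ws - 1) (cumulant (M ws))"
proof (induction "sum_list (map (\<lambda>w. length w * length w) ws)" arbitrary: ws rule: less_induct)
  case less
  let ?\<mu> = "\<lambda>ws. sum_list (map (\<lambda>w. length w * length w) ws)"
  note IH = less(1) and hom = less(2)
  note k = smallD(1)[OF cumulant_small]
  consider "length ws \<le> 1" | "length ws \<ge> 2" "[] \<in> set ws" | w where "w \<in> set ws" "length w \<ge> 2" 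
    | "\<forall>w\<in>set ws. length w = 1"
  proof -
    have "length w \<ge> 2 \<or> w = [] \<or> length w = 1" for w :: "'u list" by (cases w; cases "tl w") auto
    then show ?thesis using that by (metis nat_le_linear not_less_eq_eq numeral_2_eq_2 One_nat_def)
  qed
  then show ?case
  proof cases
    case 1
    then have "length ws - 1 = 0" by simp
    then show ?thesis by (simp only: vanish_0)
  next
    case 2
    then obtain ps qs where ws: "ws = ps @ [] # qs" by (meson split_list)
    then obtain v rest where r: "ps @ qs = v # rest" using 2 by (cases "ps @ qs") auto
    have h: "\<forall>w\<in>set (v # rest). hom w" using hom unfolding ws r[symmetric] by auto
    have "cumulant (M ([] # ps @ qs)) = ce Z.S W (M (v # rest))"
      unfolding M_Cons[of "[]"] r by (rule cumulant_lm_unit[OF M_carr[OF h]])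
    also have "\<dots> = 0" unfolding M_Cons by (rule Z.ce_lm[OF M_carr]) (use h in auto)
    finally have "vanish (length ws - 1) (cumulant (M ([] # ps @ qs)))" by (simp only: vanish_0)
    then show ?thesis unfolding ws by (intro cumulant_front) (use hom ws in \<open>simp_all only:\<close>)
  next
    case (3 w)
    then obtain ps qs where ws: "ws = ps @ w # qs" by (meson split_list)
    obtain u v where w: "w = u # v" "length v \<ge> 1" using 3(2) by (cases w) auto
    \<comment> \<open>split off the first letter \<open>u\<close> of the long word \<open>w = u v\<close>\<close>
    define rest where "rest = ps @ qs"
    have h: "\<forall>w\<in>set rest. hom w" and hw: "hom w" using hom unfolding ws rest_def by auto
    from hw obtain i where u: "u \<in> gr U i" "hom v" unfolding w hom_Cons by (elim exE conjE)
    obtain ds where ds: "homogeneous_list U v ds" using hom_ex[OF u(2)] by (elim exE)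
    define j where "j = sum_list ds"
    let ?a = "mon U [u]" and ?b = "mon U v"
    have a: "?a \<in> sym_gr U i" by (rule mon1_gr[OF u(1)])
    have b: "?b \<in> sym_gr U j" unfolding j_def by (rule mon_gr[OF ds])
    have hu: "hom [u]" using u(1) unfolding hom_Cons by (intro conjI exI hom_Nil)
    have ac: "?a \<in> carr UU" unfolding carr_UU by (rule mon1_carr[OF gr_carr[OF u(1)]])
    have bc: "?b \<in> carr UU" unfolding carr_UU by (rule mon_carr[OF hom_lists[OF u(2)]])
    have ab: "mon U w = sym_mult U ?a ?b" unfolding sym_mult_mon w append_Cons append_Nil ..
    have len: "length ws - 1 = length rest" unfolding ws rest_def by simp
    have mu: "?\<mu> ws = length w * length w + ?\<mu> rest" unfolding ws rest_def by simp
    have sq: "length w * length w = 1 + 2 * length v + length v * length v" unfolding w by simp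
    have m1: "?\<mu> ([u] # v # rest) < ?\<mu> ws" unfolding mu sq using w(2) by (cases v) auto
    have m2: "?\<mu> ([u] # nths rest I) < ?\<mu> ws" "?\<mu> (v # nths rest I) < ?\<mu> ws" for I
      using sum_list_nths_le[of "\<lambda>w. length w * length w" rest I] w(2) unfolding mu sq by simp_all
    have hn: "\<forall>w\<in>set (nths rest I). hom w" for I using h by (auto dest: in_set_nthsD)
    have 1: "vanish (length rest) (cumulant (Z.lm ?a (Z.lm ?b (M rest))))"
    proof -
      have "vanish (length ([u] # v # rest) - 1) (cumulant (M ([u] # v # rest)))"
        by (rule IH[OF m1]) (use h hu u(2) in auto)
      from vanish_mono[OF this, of "length rest"] show ?thesis unfolding M_Cons by simp
    qed
    have 2: "vanish (length rest) (cv Z.S W (\<lambda>y. cumulant (Z.lm ?a (tw Z.S j y))) (\<lambda>y. cumulant (Z.lm ?b y)) (M rest))"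
    proof -
      note r = Z.lin_rr[OF k ac] Z.lin_rr[OF k bc]
      note t = Z.Q.lin_tw[OF r(1), of j]
      have "cv Z.S W (\<lambda>y. cumulant (Z.lm ?a (tw Z.S j y))) (\<lambda>y. cumulant (Z.lm ?b y)) (M rest) \<in> {y. vanish (length rest) y}"
        unfolding cv_def
      proof (rule Z.Sw_mon_mem[OF homZ[OF h] Z.Q.sm_bilin[OF t r(2)]]; (unfold mem_Collect_eq)?)
        fix I assume I: "I \<subseteq> {..<length (map (mon U) rest)}"
        let ?P = "nths rest I" and ?Q = "nths rest (- I)"
        obtain es where es: "homogeneous_list UU (map (mon U) ?P) es" using Z.hom_ex[OF homZ[OF hn[of I]]] by (elim exE)
        have tw: "tw Z.S j (M ?P) = ksign j (sum_list es) (M ?P)"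
          by (rule Z.G.tw_hom) (unfold Z.S_simps, rule Z.mon_gr[OF es])
        have "cumulant (Z.lm ?a (tw Z.S j (M ?P))) = ksign j (sum_list es) (cumulant (M ([u] # ?P)))"
          unfolding tw Z.lm_ksign[OF ac M_carr[OF hn]] M_Cons
          by (rule Z.Q.lin_ksign[OF k Z.lm_carr[OF ac M_carr[OF hn]]])
        moreover have "vanish (length ([u] # ?P) - 1) (cumulant (M ([u] # ?P)))"
          by (rule IH[OF m2(1)]) (use hn hu in auto)
        ultimately have v1: "vanish (length ?P) (cumulant (Z.lm ?a (tw Z.S j (M ?P))))" using vanish_ksign by simp
        have "vanish (length (v # ?Q) - 1) (cumulant (M (v # ?Q)))"
          by (rule IH[OF m2(2)]) (use hn u(2) in auto)
        then have v2: "vanish (length ?Q) (cumulant (Z.lm ?b (M ?Q)))" unfolding M_Cons by simp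
        have ln: "length ?P + length ?Q = length rest"
        proof -
          have I': "I \<subseteq> {..<length rest}" using I by simp
          have "card I \<le> length rest" using card_mono[OF finite_lessThan I'] by simp
          then show ?thesis using length_nths_compl[OF I'] by simp
        qed
        show "vanish (length rest) (W.sm (cumulant (Z.lm ?a (tw Z.S j (mon UU (nths (map (mon U) rest) I))))) 
            (cumulant (Z.lm ?b (mon UU (nths (map (mon U) rest) (- I))))))"
          unfolding nths_map using W.vanish_sm[OF v1 v2 lin_mem[OF t M_carr[OF hn]] lin_mem[OF r(2) M_carr[OF hn]]] unfolding ln .
      qed (simp_all add: vanish_add vanish_neg)
      then show ?thesis by simp
    qed
    have "cumulant (M (w # rest)) = cumulant (Z.lm ?a (Z.lm ?b (M rest))) + cv Z.S W (\<lambda>y. cumulant (Z.lm ?a (tw Z.S j y))) (\<lambda>y. cumulant (Z.lm ?b y)) (M rest)"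
      unfolding M_Cons ab by (rule cumulant_lm_mult[OF a b M_carr[OF h]])
    then have "vanish (length rest) (cumulant (M (w # ps @ qs)))" using vanish_add[OF 1 2] unfolding rest_def by (simp only:)
    then show ?thesis unfolding len[symmetric] unfolding ws by (intro cumulant_front) (use hom ws in \<open>simp_all only:\<close>)
  next
    case 4
    define us where "us = map hd ws"
    have e: "ws = map (\<lambda>u. [u]) us" unfolding us_def map_map
      by (rule sym, rule map_idI) (use 4 in \<open>auto simp: length_Suc_conv\<close>)
    have hu: "hom us" unfolding hom_def us_def using hom 4 by (fastforce simp: length_Suc_conv hom_Cons)
    have M: "M ws = mon UU (map (\<lambda>u. mon U [u]) us)" unfolding e map_map o_def ..
    have l: "length ws = length us" unfolding us_def by simp
    show ?thesis unfolding M cumulant_letters[OF hu] l by (rule f[OF hu])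
  qed
qed

text \<open>The span of the products of \<open>j\<close> words, that is, \<open>S\<^sup>j(S(U))\<close>.\<close>

definition SP :: "nat \<Rightarrow> ('k, ('k, 'u) tensor) tensor set" where
  "SP j = module.span dscl {M ws | ws. (\<forall>w\<in>set ws. hom w) \<and> length ws = j}"

lemma SP_base: "\<forall>w\<in>set ws. hom w \<Longrightarrow> length ws = j \<Longrightarrow> M ws \<in> SP j"
  unfolding SP_def by (intro TT.span_base) blast

lemma SP_subspace: "module.subspace dscl (SP j)" unfolding SP_def by (rule TT.subspace_span)

lemma SP_carr: "SP j \<subseteq> carr Z.S"
  unfolding SP_def by (rule TT.span_minimal[OF _ Z.carr_S_subspace]) (use M_carr in blast)

lemma cumulant_SP:
  assumes f: "\<And>us. hom us \<Longrightarrow> vanish (length us - 1) (f (mon U us))"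
  shows "t \<in> SP j \<Longrightarrow> vanish (j - 1) (cumulant t)"
proof -
  note k = smallD(1)[OF cumulant_small]
  have "t \<in> SP j \<Longrightarrow> t \<in> carr Z.S \<and> vanish (j - 1) (cumulant t)"
    unfolding SP_def
  proof (induction rule: TT.span_induct_alt)
    case base
    show ?case using Z.G.carr_zero Z.Q.P.lin_0[OF k] by (simp only: vanish_0 simp_thms)
  next
    case (step c x y)
    then obtain ws where ws: "x = M ws" "\<forall>w\<in>set ws. hom w" "length ws = j" by blast
    have x: "x \<in> carr Z.S" unfolding ws(1) by (rule M_carr[OF ws(2)])
    have cx: "dscl c x \<in> carr Z.S" by (rule Z.G.carr_scl[OF x, unfolded Z.S_simps])
    have "vanish (j - 1) (cumulant x)" using cumulant_words[OF f ws(2)] unfolding ws(1) ws(3) .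
    from W.vanish_k_act[OF this, of c] have v: "vanish (j - 1) (cumulant (dscl c x))"
      unfolding lin_scl[OF k x, unfolded Z.S_simps] .
    note y = conjunct1[OF step(2)]
    show ?case unfolding lin_add[OF k cx y] by (rule conjI[OF Z.G.carr_add[OF cx y] vanish_add[OF v conjunct2[OF step(2)]]])
  qed
  then show "t \<in> SP j \<Longrightarrow> vanish (j - 1) (cumulant t)" by blast
qed

lemma SP_lm: "t \<in> SP j \<Longrightarrow> s \<in> carr S \<Longrightarrow> Z.lm s t \<in> SP (Suc j)"
proof -
  assume t: "t \<in> SP j" and "s \<in> carr S"
  from this(2) show "Z.lm s t \<in> SP (Suc j)"
  proof (induction rule: carr_S_induct)
    case base
    show ?case unfolding Z.lm_lin_arg by (rule TT.subspace_0[OF SP_subspace])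
  next
    case (step c xs y)
    have x: "mon U xs \<in> carr UU" unfolding carr_UU by (rule mon_carr[OF hom_lists[OF step(1)]])
    have "t \<in> SP j \<Longrightarrow> t \<in> carr Z.S \<and> Z.lm (mon U xs) t \<in> SP (Suc j)"
      unfolding SP_def[of j]
    proof (induction rule: TT.span_induct_alt)
      case base
      have "Z.lm (mon U xs) 0 = 0" by (rule Z.sym_mult_zero_right[OF Z.mon1_carr[OF x]])
      then show ?case using Z.G.carr_zero TT.subspace_0[OF SP_subspace] by (simp only: simp_thms)
    next
      case (step c x y)
      then obtain ws where ws: "x = M ws" "\<forall>w\<in>set ws. hom w" "length ws = j" by blast
      have xc: "x \<in> carr Z.S" unfolding ws(1) by (rule M_carr[OF ws(2)])
      have cx: "dscl c x \<in> carr Z.S" by (rule Z.G.carr_scl[OF xc, unfolded Z.S_simps])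
      have "Z.lm (mon U xs) (dscl c x + y) = dscl c (M (xs # ws)) + Z.lm (mon U xs) y"
        unfolding Z.lm_lin(1)[OF x cx conjunct1[OF step(2)]] Z.lm_lin(2)[OF x xc] unfolding M_Cons ws(1) ..
      moreover have "M (xs # ws) \<in> SP (Suc j)" by (rule SP_base) (use ws \<open>hom xs\<close> in auto)
      ultimately have "Z.lm (mon U xs) (dscl c x + y) \<in> SP (Suc j)"
        using TT.subspace_add[OF SP_subspace TT.subspace_scale[OF SP_subspace] conjunct2[OF step(2)]] by (simp only:)
      then show ?case using Z.G.carr_add[OF cx conjunct1[OF step(2)]] by blast
    qed
    then have 1: "Z.lm (mon U xs) t \<in> SP (Suc j)" using t by blast
    have s: "Z.lm (dscl c (mon U xs)) t = dscl c (Z.lm (mon U xs) t)"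
      using Z.lm_lin_arg(2)[of c "mon U xs" t] unfolding gvs.select_convs .
    show ?case unfolding Z.lm_lin_arg(1) s
      by (rule TT.subspace_add[OF SP_subspace TT.subspace_scale[OF SP_subspace 1] step(3)])
  qed
qed

end

context composite_source
begin

lemma pw_SP:
  assumes "c \<in> carr K" shows "fps_nth (pw K Z.S L.gt j c) l \<in> SP j"
  using assms
proof (induction j arbitrary: c l)
  case 0
  have "mon UU [] \<in> SP 0" using SP_base[of "[]" 0] by simp
  then show ?case unfolding pw.simps ce_def fps_nth_fps_const Z.S_simps
    using TT.subspace_scale[OF SP_subspace] TT.subspace_0[OF SP_subspace] by (simp only: split: if_split) blast
next
  case (Suc j)
  let ?A = "{x. \<forall>l. fps_nth x l \<in> SP (Suc j)}"
  have "Sw K (\<lambda>a b. ser_mult (mult Z.S) (L.gt a) (pw K Z.S L.gt j b)) c \<in> ?A"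
  proof (rule K.Sw_push(2)[where f = "\<lambda>x. x" and A = ?A, OF Suc.prems])
    fix a b assume ab: "a \<in> carr K" "b \<in> carr K"
    show "ser_mult (mult Z.S) (L.gt a) (pw K Z.S L.gt j b) \<in> ?A"
    proof (intro CollectI allI)
      fix l
      have "Z.lm (fps_nth (g a) p) (fps_nth (pw K Z.S L.gt j b) q) \<in> SP (Suc j)" for p q
        by (rule SP_lm[OF Suc.IH[OF ab(2)] ser_nth[OF lin_mem[OF smallD(1)[OF g_small] ab(1)]]])
      then show "fps_nth (ser_mult (mult Z.S) (L.gt a) (pw K Z.S L.gt j b)) l \<in> SP (Suc j)"
        unfolding Z.A.sm_nth L.gt_nth unfolding Z.S_simps by (intro TT.subspace_sum[OF SP_subspace])
    qed
  next
    show "0 \<in> ?A" using TT.subspace_0[OF SP_subspace] by simp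
  next
    fix x y assume "x \<in> ?A" "y \<in> ?A"
    then show "x + y \<in> ?A" using TT.subspace_add[OF SP_subspace] by simp
  qed simp
  then show ?case unfolding pw.simps cv_def by blast
qed

end

subsection \<open>Two maps out of symmetric bialgebras\<close>

text \<open>The situation of the composition of two morphisms: \<open>f\<close> and \<open>g\<close> vanish to order \<open>n - 1\<close> on words of length \<open>n\<close>.\<close>

locale composite_symmetric = composite U D W f + X: symalg U1 D1
  for U :: "('k::field_char_0, 'u::ab_group_add) gvs" and D and W :: "('k, 'w::ab_group_add) mv" and f
    and U1 :: "('k, 'v::ab_group_add) gvs" and D1 +
  fixes g :: "('k, 'v) tensor \<Rightarrow> ('k, 'u) tensor fps"
  assumes gS_small: "small X.S S g"
    and f_ord: "\<And>us. hom us \<Longrightarrow> vanish (length us - 1) (f (mon U us))"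
    and g_ord: "\<And>xs. X.hom xs \<Longrightarrow> vanish (length xs - 1) (g (mon U1 xs))"
begin

sublocale H: composite_source U D W f X.S g by unfold_locales (rule gS_small)
sublocale XZ: sympair U1 D1 Z.S ..

lemma gt_order: 
  assumes h: "X.hom xs" shows "vanish (length xs - 1) (H.L.gt (mon U1 xs))"
  unfolding vanish_def
proof (intro allI impI)
  fix i assume "i < length xs - 1"
  then have "fps_nth (g (mon U1 xs)) i = 0" using g_ord[OF h] unfolding vanish_def by blast
  then show "fps_nth (H.L.gt (mon U1 xs)) i = 0"
    unfolding H.L.gt_nth using Z.mon_zero[of "[]" "[]"] by (simp only: append_Nil)
qed

text \<open>In a product of \<open>j\<close> factors the letters are distributed to \<open>j\<close> subwords of lengths \<open>n\<^sub>i\<close>, and \<open>\<Sum> (n\<^sub>i - 1) = n - j\<close>.  An empty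
  subword only adds to the order, as its truncated difference is \<open>0\<close> instead of \<open>-1\<close>.\<close>

lemma pw_order: "X.hom xs \<Longrightarrow> vanish (length xs - j) (pw X.S Z.S H.L.gt j (mon U1 xs))"
proof (induction j arbitrary: xs)
  case 0
  show ?case
  proof (cases xs)
    case Nil
    then show ?thesis by (simp only: list.size diff_0_eq_0 vanish_0)
  next
    case (Cons x ys)
    have ys: "X.hom ys" using 0[unfolded Cons X.hom_Cons] by blast
    have "mon U1 xs = X.lm x (mon U1 ys)" unfolding Cons sym_mult_mon append_Cons append_Nil ..
    then have "pw X.S Z.S H.L.gt 0 (mon U1 xs) = 0"
      using XZ.ce_lm[OF X.mon_carr[OF X.hom_lists[OF ys]]] by (simp only: pw.simps)
    then show ?thesis by (simp only: vanish_0)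
  qed
next
  case (Suc j)
  let ?A = "{y :: ('k, ('k, 'u) tensor) tensor fps. vanish (length xs - Suc j) y}"
  note l = H.L.gt_lin and p = H.L.KS.lin_pw[OF H.L.gt_lin]
  have c: "mon U1 (nths xs I) \<in> carr X.S" for I by (rule X.mon_carr[OF X.hom_lists[OF X.hom_nths[OF Suc.prems]]])
  have "Sw X.S (\<lambda>a b. ser_mult (mult Z.S) (H.L.gt a) (pw X.S Z.S H.L.gt j b)) (mon U1 xs) \<in> ?A"
  proof (rule XZ.Sw_mon_mem[OF Suc.prems H.L.KS.sm_bilin[OF l p]])
    fix I assume I: "I \<subseteq> {..<length xs}"
    let ?P = "nths xs I" and ?Q = "nths xs (- I)"
    have ln: "length ?P + length ?Q = length xs"
      using card_mono[OF finite_lessThan I] X.length_nths_compl[OF I] by simp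
    have "vanish ((length ?P - 1) + (length ?Q - j)) (ser_mult (mult Z.S) (H.L.gt (mon U1 ?P)) (pw X.S Z.S H.L.gt j (mon U1 ?Q)))"
      by (rule Z.A.vanish_sm[OF gt_order[OF X.hom_nths[OF Suc.prems]] Suc.IH[OF X.hom_nths[OF Suc.prems]] lin_mem[OF l c] lin_mem[OF p c]])
    moreover have "length xs - Suc j \<le> (length ?P - 1) + (length ?Q - j)" using ln by linarith
    ultimately show "ser_mult (mult Z.S) (H.L.gt (mon U1 ?P)) (pw X.S Z.S H.L.gt j (mon U1 ?Q)) \<in> ?A"
      unfolding mem_Collect_eq by (rule vanish_mono)
  qed (simp_all add: vanish_add vanish_neg)
  then show ?case unfolding pw.simps cv_def mem_Collect_eq .
qed

text \<open>The component of \<open>exp(\<iota>g)\<close> with \<open>j\<close> factors contributes order \<open>n - j\<close>, and \<open>\<kappa>\<close> contributes order \<open>j - 1\<close> on it.\<close>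

lemma E_order:
  assumes h: "X.hom xs" shows "vanish (length xs - 1) (H.L.E cumulant (H.L.GG (mon U1 xs)))"
  unfolding vanish_def
proof (intro allI impI)
  fix N assume N: "N < length xs - 1"
  note k = smallD(1)[OF cumulant_small]
  have c: "mon U1 xs \<in> carr X.S" by (rule X.mon_carr[OF X.hom_lists[OF h]])
  have z: "fps_nth (cumulant (fps_nth (H.L.GG (mon U1 xs)) i)) (N - i) = 0" if i: "i \<le> N" for i
  proof -
    obtain M where e: "\<And>p. fps_nth (ev X.S Z.S p H.L.gt (mon U1 xs)) i = 
        (\<Sum>n<M. scl Z.S (fps_nth p n) (fps_nth (pw X.S Z.S H.L.gt n (mon U1 xs)) i))"
      by (rule H.L.KS.ev_nth_ex1[OF H.L.gt_small c, of i]) (rule that)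
    let ?t = "\<lambda>n. fps_nth (pw X.S Z.S H.L.gt n (mon U1 xs)) i"
    have t: "?t n \<in> SP n" for n by (rule H.pw_SP[OF c])
    have tc: "?t n \<in> carr Z.S" for n by (rule subsetD[OF SP_carr t])
    have "vanish (length xs - 1 - i) (cumulant (?t n))" for n
    proof (cases "i < length xs - n")
      case True
      then have "?t n = 0" using pw_order[OF h, of n] unfolding vanish_def by blast
      then show ?thesis using Z.Q.P.lin_0[OF k] by (simp only: vanish_0)
    next
      case False
      then have le: "length xs - 1 - i \<le> n - 1" by linarith
      have "vanish (n - 1) (cumulant (?t n))" by (rule cumulant_SP[OF _ t]) (rule f_ord)
      then show ?thesis by (rule vanish_mono[OF _ le])
    qed
    then have v: "vanish (length xs - 1 - i) (cumulant (scl Z.S r (?t n)))" for r n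
      unfolding lin_scl[OF k tc] by (rule W.vanish_k_act)
    have "cumulant (fps_nth (H.L.GG (mon U1 xs)) i) = (\<Sum>n<M. cumulant (scl Z.S (fps_nth (fps_exp 1) n) (?t n)))"
      unfolding e by (rule Z.Q.P.lin_sum_arg[OF k Z.G.carr_scl[OF tc]])
    then have "vanish (length xs - 1 - i) (cumulant (fps_nth (H.L.GG (mon U1 xs)) i))"
      using vanish_sum[OF v] by (simp only:)
    then show ?thesis unfolding vanish_def using N i by simp
  qed
  show "fps_nth (H.L.E cumulant (H.L.GG (mon U1 xs))) N = 0"
    unfolding Z.Q.P.ser_ext_nth[OF lin_mem[OF H.L.GG_lin c]] by (rule sum.neutral) (use z in simp)
qed

lemma log_order:
  assumes h: "X.hom xs"
  shows "vanish (length xs - 1) (ev X.S W (fps_ln 1) (\<lambda>c. ser_ext (carr S) F (ev X.S S (fps_exp 1) g c) - ce X.S W c) (mon U1 xs))"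
  unfolding H.log_compose[OF X.mon_carr[OF X.hom_lists[OF h]]] by (rule E_order[OF h])

end

section \<open>The category of \<open>IBL\<^sub>\<infinity>\<close>-algebras\<close>

lemma IBL_symalg: "IBL_algebra U D \<Longrightarrow> symalg U"
  unfolding IBL_algebra_def symalg_def gvec_def by blast

lemma IBL_mv_algebra:
  assumes "IBL_algebra U D" shows "mv_algebra (sym_mv U D)"
proof -
  interpret symalg U D by (rule IBL_symalg[OF assms])
  have D: "R_linear S S D" "has_degree S S 1 D" "\<forall>v\<in>ser (carr S). D (D v) = 0" "D (fps_const (unit S)) = 0"
    using assms unfolding IBL_algebra_def Let_def by blast+
  have c: "continuous_on (ser (carr S)) D" by (rule I.Q.P.R_linear_continuous[OF D(1)])
  have u: "coprod S (unit S) = tens (scl S) [unit S, unit S]" "counit S (unit S) = 1"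
    using sym_coprod_mon[of "[]"] eps_mon[of "[]"] by simp_all
  have m: "\<forall>x\<in>carr S. \<forall>y\<in>carr S. counit S (mult S x y) = counit S x * counit S y" using eps_mult by simp
  have B: "BV S = D" by simp
  show ?thesis unfolding mv_algebra_def B
    by (intro conjI S_alg S_cog u m S_conil D c)
qed

context sympair
begin

lemma order_sym_pow:
  assumes "lin S W \<phi>" "\<And>xs. hom xs \<Longrightarrow> length xs = n \<Longrightarrow> vanish m (\<phi> (mon U xs))" "x \<in> sym_pow U n"
  shows "vanish m (\<phi> x)"
proof -
  have "module.subspace dscl {x \<in> carr S. vanish m (\<phi> x)}"
  proof (rule TT.subspaceI)
    show "0 \<in> {x \<in> carr S. vanish m (\<phi> x)}"
      unfolding mem_Collect_eq Q.P.lin_0[OF assms(1)] using G.carr_zero by (intro conjI vanish_0)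
    show "x + y \<in> {x \<in> carr S. vanish m (\<phi> x)}" if "x \<in> {x \<in> carr S. vanish m (\<phi> x)}" "y \<in> {x \<in> carr S. vanish m (\<phi> x)}" for x y
      using that G.carr_add vanish_add lin_add[OF assms(1)] by auto
    show "dscl c x \<in> {x \<in> carr S. vanish m (\<phi> x)}" if "x \<in> {x \<in> carr S. vanish m (\<phi> x)}" for c x
    proof -
      have x: "x \<in> carr S" "vanish m (\<phi> x)" using that by auto
      show ?thesis unfolding mem_Collect_eq lin_scl[OF assms(1) x(1), unfolded S_simps]
        by (rule conjI[OF G.carr_scl[OF x(1), unfolded S_simps] W.vanish_k_act[OF x(2)]])
    qed
  qed
  moreover have "{mon U ys | ys. hom ys \<and> length ys = n} \<subseteq> {x \<in> carr S. vanish m (\<phi> x)}"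
    using assms(2) mon_carr[OF hom_lists] by blast
  ultimately have "sym_pow U n \<subseteq> {x \<in> carr S. vanish m (\<phi> x)}"
    unfolding sym_pow_hom by (intro TT.span_minimal)
  then show ?thesis using assms(3) by blast
qed

end

text \<open>The coefficient \<open>f\<^bsup>(k)\<^esup>\<close> takes \<open>x\<close> to the coefficient of \<open>\<hbar>\<^bsup>k-1\<^esup>\<close> in \<open>f(x)\<close>.  The condition \<open>f\<^bsup>(1)\<^esup>(1) = 0\<close> is the one that
  defines \<open>Lin\<^sup>0\<close>.\<close>

lemma IBL_mor_iff:
  assumes "symalg U1" "symalg U2"
  shows "f \<in> IBL_mor U1 D1 U2 D2 \<longleftrightarrow> f \<in> Lin0_R (sym_mv U1 D1) (sym_mv U2 D2) \<and>
    (\<forall>v\<in>ser (carr (sym_mv U1 D1)). D2 (mv_exp (sym_mv U1 D1) (sym_mv U2 D2) f v) = mv_exp (sym_mv U1 D1) (sym_mv U2 D2) f (D1 v)) \<and>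
    (\<forall>n. \<forall>x\<in>sym_pow U1 n. vanish (n - 1) (f (fps_const x)))"
    (is "_ \<longleftrightarrow> ?L \<and> ?E \<and> ?O")
proof -
  interpret X: symalg U1 D1 by fact
  interpret Y: symalg U2 D2 by fact
  interpret P: cpair X.S Y.S ..
  show ?thesis
  proof
    assume "f \<in> IBL_mor U1 D1 U2 D2"
    then obtain fk where f: "R_linear X.S Y.S f" "has_degree X.S Y.S 0 f" and h: "hbar_expansion X.S Y.S f fk"
      and u: "fk 1 (unit X.S) = 0" and e: ?E and k: "\<forall>k\<ge>1. module.span dscl (\<Union>n\<in>{k<..}. sym_pow U1 n) \<subseteq> {s. fk k s = 0}"
      unfolding IBL_mor_def Let_def mem_Collect_eq by (elim conjE exE)
    have nth: "fps_nth (f (fps_const x)) n = fk (Suc n) x" if x: "x \<in> carr X.S" for x n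
    proof -
      have z: "fk (Suc i) 0 = 0" for i
      proof -
        have "linear_map_on (scl X.S) (scl Y.S) (carr X.S) (fk (Suc i))" using h unfolding hbar_expansion_def by simp
        from linear_map_on_add[OF this X.G.carr_zero X.G.carr_zero] show ?thesis by simp
      qed
      have "fps_nth (f (fps_const x)) n = (\<Sum>i\<le>n. fk (Suc i) (fps_nth (fps_const x) (n - i)))"
        using h P.P.const_carr[OF x] unfolding hbar_expansion_def by blast
      also have "\<dots> = (\<Sum>i\<le>n. if i = n then fk (Suc n) x else 0)"
        by (rule sum.cong) (auto simp: z)
      finally show ?thesis by simp
    qed
    have uc: "unit X.S \<in> carr X.S" by (rule X.E.unit_carr)
    have L: ?L using f nth[OF uc, of 0] u unfolding Lin0_R_def P.Lin_R_iff by simp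
    have O: ?O unfolding vanish_def
    proof (intro allI ballI impI)
      fix n x i assume x: "x \<in> sym_pow U1 n" and i: "i < n - 1"
      have "x \<in> module.span dscl (\<Union>n\<in>{Suc i<..}. sym_pow U1 n)"
        by (rule TT.span_base) (use x i in auto)
      then have "fk (Suc i) x = 0" using k by auto
      then show "fps_nth (f (fps_const x)) i = 0" unfolding nth[OF X.sym_pow_carr[OF x]] .
    qed
    show "?L \<and> ?E \<and> ?O" using L e O by (intro conjI)
  next
    assume "?L \<and> ?E \<and> ?O"
    note a = this
    note L = conjunct1[OF a] and e = conjunct1[OF conjunct2[OF a]] and O = conjunct2[OF conjunct2[OF a]]
    have f: "R_linear X.S Y.S f" "has_degree X.S Y.S 0 f" and u: "fps_nth (f (fps_const (unit X.S))) 0 = 0"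
      using L unfolding Lin0_R_def P.Lin_R_iff by auto
    note l = P.P.R_linear_lin[OF f(1)]
    define fk where "fk = (\<lambda>k x. fps_nth (f (fps_const x)) (k - 1))"
    have h: "hbar_expansion X.S Y.S f fk"
      unfolding hbar_expansion_def
    proof (intro conjI allI impI ballI)
      fix k show "fk k \<in> carr X.S \<rightarrow> carr Y.S" unfolding fk_def using ser_nth[OF lin_mem[OF l]] by auto
      show "linear_map_on (scl X.S) (scl Y.S) (carr X.S) (fk k)"
        unfolding linear_map_on_def fk_def
        using lin_add[OF l] lin_scl_nth[OF Y.G.gvec_axioms l] by auto
    next
      fix v n assume v: "v \<in> ser (carr X.S)"
      have "fps_nth (f v) n = fps_nth (ser_ext (carr X.S) (\<lambda>x. f (fps_const x)) v) n"
        using P.P.R_linear_eq_ser_ext[OF f(1)] by (rule arg_cong)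
      also have "\<dots> = (\<Sum>i\<le>n. fps_nth (f (fps_const (fps_nth v i))) (n - i))" by (rule P.P.ser_ext_nth[OF v])
      also have "\<dots> = (\<Sum>i\<le>n. fps_nth (f (fps_const (fps_nth v (n - i)))) i)"
        by (rule sum.reindex_bij_witness[of _ "\<lambda>i. n - i" "\<lambda>i. n - i"]) auto
      finally show "fps_nth (f v) n = (\<Sum>i\<le>n. fk (Suc i) (fps_nth v (n - i)))" unfolding fk_def by simp
    qed
    have k: "module.span dscl (\<Union>n\<in>{k<..}. sym_pow U1 n) \<subseteq> {s. fk k s = 0}" if "k \<ge> 1" for k
    proof -
      let ?B = "{x \<in> carr X.S. fk k x = 0}"
      have "module.subspace dscl ?B"
      proof (rule TT.subspaceI)
        show "0 \<in> ?B" unfolding fk_def mem_Collect_eq P.P.lin_0[OF l] using X.G.carr_zero by simp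
        show "x + y \<in> ?B" if "x \<in> ?B" "y \<in> ?B" for x y
          using that X.G.carr_add lin_add[OF l, of x y] unfolding fk_def by auto
        show "dscl c x \<in> ?B" if "x \<in> ?B" for c x
          using that X.G.carr_scl[of x c] lin_scl_nth[OF Y.G.gvec_axioms l, of x c] TT.scale_zero_right unfolding fk_def by auto
      qed
      moreover have "(\<Union>n\<in>{k<..}. sym_pow U1 n) \<subseteq> ?B"
      proof
        fix x assume "x \<in> (\<Union>n\<in>{k<..}. sym_pow U1 n)"
        then obtain n where n: "k < n" "x \<in> sym_pow U1 n" by blast
        have "vanish (n - 1) (f (fps_const x))" using O n(2) by blast
        then have "fk k x = 0" unfolding fk_def vanish_def using n(1) that by simp
        then show "x \<in> ?B" using X.sym_pow_carr[OF n(2)] by blast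
      qed
      ultimately have "module.span dscl (\<Union>n\<in>{k<..}. sym_pow U1 n) \<subseteq> ?B" by (intro TT.span_minimal)
      then show ?thesis by blast
    qed
    have u1: "fk 1 (unit X.S) = 0" unfolding fk_def using u by simp
    show "f \<in> IBL_mor U1 D1 U2 D2"
      unfolding IBL_mor_def Let_def mem_Collect_eq
      by (intro conjI f exI[of _ fk] h u1 e allI impI k)
  qed
qed

text \<open>The unit of \<open>S(U)\<close> determines which forms are graded symmetric and hence all monomials; the homogeneous parts determine
  which vectors belong to \<open>U\<close>.  So nothing that the definition of \<open>S\<^sup>n(U)\<close> refers to depends on the presentation.\<close>

lemma sym_mv_sym_pow:
  assumes "symalg U" "symalg U'" and e: "sym_mv U D = sym_mv U' D'"
  shows "sym_pow U n \<subseteq> sym_pow U' n"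
proof -
  interpret X: symalg U D by fact
  interpret Y: symalg U' D' by fact
  have eu: "mon U [] = mon U' []" using arg_cong[OF e, of unit] by simp
  have eg: "sym_gr U = sym_gr U'" using arg_cong[OF e, of gr] by simp
  let ?e = "\<lambda>xs. if xs = [] then 1 else 0 :: 'a"
  \<comment> \<open>The unit is evaluation at the empty word, cut off outside the graded symmetric forms.  So it detects whether a form
    not vanishing on the empty word is graded symmetric; adding the counit form reaches the other forms.\<close>
  have nz: "gsym_form U \<phi> \<longleftrightarrow> gsym_form U' \<phi>" if "\<phi> [] \<noteq> 0" for \<phi>
    using fun_cong[OF eu, of \<phi>] that unfolding mon_def by (simp split: if_splits)
  have gf: "gsym_form U \<phi> \<longleftrightarrow> gsym_form U' \<phi>" for \<phi>
  proof (cases "\<phi> [] = 0")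
    case True
    have *: "gsym_form V \<phi> \<longleftrightarrow> gsym_form V (\<lambda>xs. 1 * \<phi> xs + ?e xs)" if "symalg V" for V :: "('a, 'b) gvs"
    proof -
      interpret V: symalg V "\<lambda>x. x" by (rule that)
      show ?thesis
      proof
        assume "gsym_form V \<phi>"
        then show "gsym_form V (\<lambda>xs. 1 * \<phi> xs + ?e xs)" by (rule gsym_form_lincomb[OF _ V.gsym_eps])
      next
        assume "gsym_form V (\<lambda>xs. 1 * \<phi> xs + ?e xs)"
        from gsym_form_lincomb[OF V.gsym_eps this, of "-1"] show "gsym_form V \<phi>" by simp
      qed
    qed
    show ?thesis unfolding *[OF assms(1)] *[OF assms(2)] by (rule nz) (simp add: True)
  qed (rule nz)
  have em: "mon U xs = mon U' xs" for xs unfolding mon_def gf ..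
  \<comment> \<open>a functional that vanishes on \<open>U'\<close> but not at \<open>u\<close> is a form on words of length one, and separates \<open>u\<close> from \<open>S(U')\<close>\<close>
  have gr: "u \<in> carr U'" if u: "u \<in> gr U i" for u i
  proof (rule ccontr)
    assume nu: "u \<notin> carr U'"
    obtain p where p: "Vector_Spaces.linear (scl U') (scl U') p" "range p \<subseteq> carr U'" "\<forall>x\<in>carr U'. p x = x"
      using subspace_projection[OF Y.vs.vector_space_axioms Y.carr_subspace] by (elim exE conjE)
    have "u - p u \<noteq> 0" using p(2) nu by auto
    from separating_functional[OF Y.vs.vector_space_axioms this]
    obtain l where l: "Vector_Spaces.linear (scl U') (*) l" "l (u - p u) = 1" by (elim exE conjE)
    interpret p: Vector_Spaces.linear "scl U'" "scl U'" p by (rule p(1))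
    interpret l: Vector_Spaces.linear "scl U'" "(*)" l by (rule l(1))
    define q where "q x = l (x - p x)" for x
    have q: "Vector_Spaces.linear (scl U') (*) q"
      unfolding Vector_Spaces.linear_iff q_def
      by (intro conjI allI Y.vs.vector_space_axioms vector_space_field)
        (simp_all only: p.add p.scale l.diff l.add l.scale algebra_simps)
    define \<phi> where "\<phi> xs = (if length xs = 1 then q (hd xs) else 0)" for xs
    have "Vector_Spaces.linear (scl U') (*) (\<lambda>x. \<phi> (xs @ x # ys))" for xs ys
    proof (cases "xs = [] \<and> ys = []")
      case True
      then show ?thesis using q by (simp add: \<phi>_def)
    next
      case False
      then have "\<phi> (xs @ x # ys) = 0" for x by (auto simp: \<phi>_def)
      then show ?thesis using Y.vs.vector_space_axioms vector_space_field by (simp add: Vector_Spaces.linear_iff)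
    qed
    then have gs: "gsym_form U' \<phi>" unfolding gsym_form_def multilinear_form_def by (simp add: \<phi>_def)
    have z: "s \<phi> = 0" if "s \<in> carr Y.S" for s
      using that
    proof (induction rule: Y.carr_S_induct)
      case base show ?case by (simp add: zero_fun_apply)
    next
      case (step c xs y)
      have "\<phi> xs = 0"
      proof (cases "length xs = 1")
        case True
        then obtain x where xs: "xs = [x]" by (auto simp: length_Suc_conv)
        then have "x \<in> carr U'" using Y.hom_lists[OF step(1)] by simp
        then show ?thesis using p(3) by (simp add: xs \<phi>_def q_def l.zero)
      qed (simp add: \<phi>_def)
      then show ?case using step(3) by (simp add: plus_fun_apply dscl_def mon_def)
    qed
    have "mon U' [u] \<in> gr Y.S i" using X.mon1_gr[OF u] unfolding em eg by simp
    from z[OF Y.G.gr_carr[OF this]] show False using gs l(2) by (simp add: mon_def \<phi>_def q_def)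
  qed
  have "{mon U ys | ys. X.hom ys \<and> length ys = n} \<subseteq> {mon U' xs | xs. xs \<in> lists (carr U') \<and> length xs = n}"
    unfolding X.hom_def em using gr by (auto simp: in_lists_conv_set) blast
  then show ?thesis unfolding X.sym_pow_hom sym_pow_def[of U'] by (rule TT.span_mono)
qed

lemma IBL_id:
  assumes "IBL_algebra U D" shows "MV_id (sym_mv U D) \<in> IBL_mor U D U D"
proof -
  have s: "symalg U" by (rule IBL_symalg[OF assms])
  interpret symalg U D by (rule s)
  have BV: "BV S = D" by simp
  have m: "MV_id S \<in> MV_mor S S" by (rule MV_id_mor[OF IBL_mv_algebra[OF assms]])
  have e: "MV_id S = ser_ext (carr S) log_id"
    unfolding MV_id_def by (rule I.Q.mv_log_ser_ext[OF glike_const]) (rule restrict_apply', rule I.Q.P.const_carr)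
  note l = smallD(1)[OF small_log_id]
  have "vanish (n - 1) (MV_id S (fps_const x))" if x: "x \<in> sym_pow U n" for n x
    unfolding e I.Q.P.ser_ext_const[OF l sym_pow_carr[OF x]]
  proof (rule I.order_sym_pow[OF l _ x])
    fix xs assume h: "hom xs" "length xs = n"
    show "vanish (n - 1) (log_id (mon U xs))"
      unfolding log_id_mon[OF h(1)] h(2) by (cases "n = 1") (simp_all only: if_True if_False diff_self_eq_0 vanish_0)
  qed
  then show ?thesis unfolding IBL_mor_iff[OF s s] using m[unfolded MV_mor_iff BV] by blast
qed

lemma IBL_comp:
  assumes "IBL_algebra U1 D1" "IBL_algebra U2 D2" "IBL_algebra U3 D3"
    and g: "g \<in> IBL_mor U1 D1 U2 D2" and f: "f \<in> IBL_mor U2 D2 U3 D3"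
  shows "MV_comp (sym_mv U1 D1) (sym_mv U2 D2) (sym_mv U3 D3) f g \<in> IBL_mor U1 D1 U3 D3"
proof -
  note s = IBL_symalg[OF assms(1)] IBL_symalg[OF assms(2)] IBL_symalg[OF assms(3)]
  note mv = IBL_mv_algebra[OF assms(1)] IBL_mv_algebra[OF assms(2)] IBL_mv_algebra[OF assms(3)]
  interpret X: symalg U1 D1 by (rule s)
  interpret Y: symalg U2 D2 by (rule s)
  interpret Z: symalg U3 D3 by (rule s)
  have BV: "BV X.S = D1" "BV Y.S = D2" "BV Z.S = D3" by simp_all
  have g0: "g \<in> Lin0_R X.S Y.S" and gm: "g \<in> MV_mor X.S Y.S" and go: "\<forall>n. \<forall>x\<in>sym_pow U1 n. vanish (n - 1) (g (fps_const x))"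
    using g[unfolded IBL_mor_iff[OF s(1,2)]] unfolding MV_mor_iff BV by blast+
  have f0: "f \<in> Lin0_R Y.S Z.S" and fm: "f \<in> MV_mor Y.S Z.S" and fo: "\<forall>n. \<forall>x\<in>sym_pow U2 n. vanish (n - 1) (f (fps_const x))"
    using f[unfolded IBL_mor_iff[OF s(2,3)]] unfolding MV_mor_iff BV by blast+
  interpret XY: cpair X.S Y.S ..
  interpret YZ: cpair Y.S Z.S ..
  interpret XZ: sympair U1 D1 Z.S ..
  let ?f = "\<lambda>x. f (fps_const x)" and ?g = "\<lambda>x. g (fps_const x)"
  note fs = YZ.Lin0_small(1)[OF f0] and gs = XY.Lin0_small(1)[OF g0]
  interpret T: composite_symmetric U2 D2 Z.S ?f U1 D1 ?g
  proof unfold_locales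
    show "small Y.S Z.S ?f" "small X.S Y.S ?g" by (rule fs gs)+
    show "vanish (length us - 1) (?f (mon U2 us))" if "Y.hom us" for us using fo Y.mon_sym_pow[OF that refl] by blast
    show "vanish (length us - 1) (?g (mon U1 us))" if "X.hom us" for us using go X.mon_sym_pow[OF that refl] by blast
  qed
  let ?h = "compose (ser (carr X.S)) (mv_exp Y.S Z.S f) (mv_exp X.S Y.S g)"
  have GL: "?h \<in> GL X.S Z.S" 
    by (rule GL_compose[OF XY.cpair_axioms YZ.cpair_axioms XZ.Q.cpair_axioms YZ.exp_GL[OF f0] XY.exp_GL[OF g0]])
  note gl = XZ.Q.GL_glike[OF GL]
  have h: "?h (fps_const x) = ser_ext (carr Y.S) (ev Y.S Z.S (fps_exp 1) ?f) (ev X.S Y.S (fps_exp 1) ?g x)" if x: "x \<in> carr X.S" for x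
  proof -
    have "?h (fps_const x) = mv_exp Y.S Z.S f (mv_exp X.S Y.S g (fps_const x))"
      by (rule compose_eq[OF XY.P.const_carr[OF x]])
    also have "mv_exp X.S Y.S g (fps_const x) = ev X.S Y.S (fps_exp 1) ?g x"
      unfolding XY.mv_exp_ser_ext[where f = g, OF gs refl] by (rule XY.P.ser_ext_const[OF XY.lin_ev[OF gs] x])
    finally show ?thesis unfolding YZ.mv_exp_ser_ext[where f = f, OF fs refl] .
  qed
  note ll = smallD(1)[OF XZ.Q.small_lg[OF gl]]
  have "vanish (n - 1) (MV_comp X.S Y.S Z.S f g (fps_const x))" if x: "x \<in> sym_pow U1 n" for n x
    unfolding MV_comp_def XZ.Q.mv_log_ser_ext[where h = ?h, OF gl refl] XZ.Q.P.ser_ext_const[OF ll X.sym_pow_carr[OF x]]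
  proof (rule XZ.order_sym_pow[OF ll _ x])
    fix xs assume xs: "X.hom xs" "length xs = n"
    have "XZ.Q.lg (\<lambda>x. ?h (fps_const x)) (mon U1 xs) = 
        ev X.S Z.S (fps_ln 1) (\<lambda>c. ser_ext (carr Y.S) (ev Y.S Z.S (fps_exp 1) ?f) (ev X.S Y.S (fps_exp 1) ?g c) - ce X.S Z.S c) (mon U1 xs)"
      by (rule XZ.Q.ev_cong[OF X.mon_carr[OF X.hom_lists[OF xs(1)]]]) (simp only: h)
    then show "vanish (n - 1) (XZ.Q.lg (\<lambda>x. ?h (fps_const x)) (mon U1 xs))"
      using T.log_order[OF xs(1)] unfolding xs(2) by (simp only:)
  qed
  moreover have "MV_comp X.S Y.S Z.S f g \<in> MV_mor X.S Z.S" by (rule MV_comp_mor[OF mv gm fm])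
  ultimately show ?thesis unfolding IBL_mor_iff[OF s(1,3)] unfolding MV_mor_iff BV by blast
qed

lemma IBL_mor_cong:
  assumes "IBL_algebra U D" "IBL_algebra U' D'" "IBL_algebra V E" "sym_mv U D = sym_mv U' D'" "f \<in> IBL_mor U D V E"
  shows "f \<in> IBL_mor U' D' V E"
proof -
  note s = IBL_symalg[OF assms(1)] IBL_symalg[OF assms(2)] IBL_symalg[OF assms(3)]
  have "D = D'" using arg_cong[OF assms(4), of BV] by (simp add: sym_mv_def)
  moreover have "sym_pow U' n \<subseteq> sym_pow U n" for n by (rule sym_mv_sym_pow[OF s(2,1) assms(4)[symmetric]])
  ultimately show ?thesis
    using assms(5) unfolding IBL_mor_iff[OF s(1,3)] IBL_mor_iff[OF s(2,3)] assms(4) by blast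
qed

theorem corollary33:
  shows "subcategory
    (IBL_cat :: (('k::field_char_0, ('k, 'u::ab_group_add) tensor) mv,
                 ('k, 'u) tensor fps \<Rightarrow> ('k, 'u) tensor fps) category)
    MV_cat"
  unfolding subcategory_def
proof (intro conjI ballI)
  let ?I = "IBL_cat :: (('k, ('k, 'u) tensor) mv, ('k, 'u) tensor fps \<Rightarrow> ('k, 'u) tensor fps) category"
  show "is_category (MV_cat :: (('k, ('k, 'u) tensor) mv, ('k, 'u) tensor fps \<Rightarrow> ('k, 'u) tensor fps) category)"
    by (rule MV_category)
  show "Obj ?I \<subseteq> Obj MV_cat"
    unfolding IBL_cat_def MV_cat_def category.simps using IBL_mv_algebra by blast
  fix X assume "X \<in> Obj ?I"
  then obtain U D where X: "X = sym_mv U D" "IBL_algebra U D" unfolding IBL_cat_def category.simps by blast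
  show "Idn ?I X = Idn MV_cat X" unfolding IBL_cat_def MV_cat_def category.simps ..
  show "Idn ?I X \<in> Hom ?I X X" unfolding IBL_cat_def category.simps mem_Collect_eq
    using X IBL_id[OF X(2)] by blast
  fix Y assume "Y \<in> Obj ?I"
  show "Hom ?I X Y \<subseteq> Hom MV_cat X Y"
  proof
    fix f assume "f \<in> Hom ?I X Y"
    then obtain U' D' U'' D'' where i: "IBL_algebra U' D'" "IBL_algebra U'' D''" 
      and e: "X = sym_mv U' D'" "Y = sym_mv U'' D''" and f: "f \<in> IBL_mor U' D' U'' D''"
      unfolding IBL_cat_def category.simps by blast
    have "BV X = D'" "BV Y = D''" unfolding e by (simp_all add: sym_mv_def)
    then show "f \<in> Hom MV_cat X Y"
      using f[unfolded IBL_mor_iff[OF IBL_symalg[OF i(1)] IBL_symalg[OF i(2)]], folded e]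
      unfolding MV_cat_def category.simps MV_mor_iff by blast
  qed
  fix Z assume "Z \<in> Obj ?I"
  fix g f assume g: "g \<in> Hom ?I X Y" and f: "f \<in> Hom ?I Y Z"
  show "Cmp ?I X Y Z f g = Cmp MV_cat X Y Z f g" unfolding IBL_cat_def MV_cat_def category.simps ..
  obtain U1 D1 U2 D2 where g: "IBL_algebra U1 D1" "IBL_algebra U2 D2" "X = sym_mv U1 D1" "Y = sym_mv U2 D2" "g \<in> IBL_mor U1 D1 U2 D2"
    using g unfolding IBL_cat_def category.simps by blast
  obtain U2' D2' U3 D3 where f: "IBL_algebra U2' D2'" "IBL_algebra U3 D3" "Y = sym_mv U2' D2'" "Z = sym_mv U3 D3" "f \<in> IBL_mor U2' D2' U3 D3"
    using f unfolding IBL_cat_def category.simps by blast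
  have "f \<in> IBL_mor U2 D2 U3 D3"
    by (rule IBL_mor_cong[OF f(1) g(2) f(2) _ f(5)]) (rule trans[OF f(3)[symmetric] g(4)])
  from IBL_comp[OF g(1,2) f(2) g(5) this] show "Cmp ?I X Y Z f g \<in> Hom ?I X Z"
    unfolding IBL_cat_def category.simps mem_Collect_eq g(3,4) f(4)[symmetric] using g(1) f(2,4) by blast
qed

end
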